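(* Let $Q$ be a finite quiver without oriented cycles on $k$ vertices, $\alpha \in \mathbb{N}^k$ a dimension vector and $\theta \in \mathbb{Z}^k$. Let $\xi \in M^{ss}_{\alpha}(Q,\theta)$ be a point corresponding to the representation $$V_{\xi} = W_1^{\oplus m_1} \oplus \cdots \oplus W_l^{\oplus m_l},$$ where $W_1,\ldots,W_l$ are pairwise non-isomorphic $\theta$-stable representations of $Q$, $W_i$ has dimension vector $\beta_i$, and $m_i \geq 1$ (so that $\alpha = m_1\beta_1 + \cdots + m_l \beta_l$). Let $Q'$ be the quiver on $l$ vertices $w_1,\ldots,w_l$ having exactly $\delta_{ij} - \chi_Q(\beta_i,\beta_j)$ arrows from $w_i$ to $w_j$ for all $i,j$, and let $\alpha' = (m_1,\ldots,m_l)$. Then $\alpha$ is the dimension vector of a $\theta$-stable representation of $Q$ if and only if $\alpha'$ is the dimension vector of a simple representation of $Q'$.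
   Context: All representations are finite dimensional over $\mathbb{C}$. A quiver $Q$ is a finite directed graph on vertices $v_1,\ldots,v_k$ (loops and multiple arrows allowed). Its Euler form is the bilinear form on $\mathbb{Z}^k$ with $\chi_Q(\alpha,\beta) = \sum_{i,j} a_i \chi_{ij} b_j$, where $\chi_{ij} = \delta_{ij} - \#\{\text{arrows from } v_i \text{ to } v_j\}$. For $\alpha = (a_1,\ldots,a_k) \in \mathbb{N}^k$, $rep_{\alpha}\,Q = \bigoplus_{a : v_i \to v_j} M_{a_j \times a_i}(\mathbb{C})$ is the affine space of $\alpha$-dimensional representations, on which $GL(\alpha) = GL_{a_1} \times \cdots \times GL_{a_k}$ acts by base change. For $\theta = (t_1,\ldots,t_k)$ and a representation $W$ of dimension vector $(b_1,\ldots,b_k)$ put $\theta(W) = \sum_i t_i b_i$. A representation $V$ is $\theta$-semistable if $\theta(V) = 0$ and $\theta(W) \geq 0$ for every subrepresentation $W \subset V$; a nonzero $\theta$-semistable $V$ is $\theta$-stable if the only subrepresentations $W \subset V$ with $\theta(W) = 0$ are $0$ and $V$. Let $SI(Q,n\theta)$ be the space of $f \in \mathbb{C}[rep_{\alpha}\,Q]$ with $f(g.V) = \left(\prod_i \det(g_i)^{n t_i}\right) f(V)$ for all $g = (g_1,\ldots,g_k) \in GL(\alpha)$ and all $V$. For $Q$ without oriented cycles, $M^{ss}_{\alpha}(Q,\theta) = \mathrm{Proj}\left(\bigoplus_{n \geq 0} SI(Q,n\theta)\right)$ is the moduli space of $\theta$-semistable $\alpha$-dimensional representations. Its points correspond bijectively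 to isomorphism classes of $\alpha$-dimensional direct sums of $\theta$-stable representations. *)

theory Defs
  imports
    "Graph_Theory.Arc_Walk"
    "Jordan_Normal_Form.VS_Connect"
    "Jordan_Normal_Form.Gauss_Jordan_Elimination"
begin

text \<open>
  A finite quiver is a \<open>fin_digraph\<close> (loops and multiple arrows allowed). Dimension vectors are
  functions on vertices, of which only the values on \<open>verts Q\<close> matter. A representation assigns
  to every arrow \<open>e\<close> a matrix of size \<open>\<alpha> (head e) \<times> \<alpha> (tail e)\<close>, acting on column vectors.
\<close>

definition arrow_count :: "('v, 'e) pre_digraph \<Rightarrow> 'v \<Rightarrow> 'v \<Rightarrow> nat" where
  "arrow_count Q v w = card {e \<in> arcs Q. tail Q e = v \<and> head Q e = w}"

definition euler_form :: "('v, 'e) pre_digraph \<Rightarrow> ('v \<Rightarrow> int) \<Rightarrow> ('v \<Rightarrow> int) \<Rightarrow> int" where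
  "euler_form Q a b =
    (\<Sum>v\<in>verts Q. \<Sum>w\<in>verts Q. a v * ((if v = w then 1 else 0) - int (arrow_count Q v w)) * b w)"

type_synonym 'e rep = "'e \<Rightarrow> complex mat"

definition rep_space :: "('v, 'e) pre_digraph \<Rightarrow> ('v \<Rightarrow> nat) \<Rightarrow> 'e rep set" where
  "rep_space Q \<alpha> = (\<Pi>\<^sub>E e\<in>arcs Q. carrier_mat (\<alpha> (head Q e)) (\<alpha> (tail Q e)))"

definition rep_iso ::
  "('v, 'e) pre_digraph \<Rightarrow> ('v \<Rightarrow> nat) \<Rightarrow> 'e rep \<Rightarrow> ('v \<Rightarrow> nat) \<Rightarrow> 'e rep \<Rightarrow> bool" where
  "rep_iso Q \<alpha> V \<beta> W \<longleftrightarrow>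
    (\<exists>g. (\<forall>v\<in>verts Q. g v \<in> carrier_mat (\<beta> v) (\<alpha> v) \<and> invertible_mat (g v)) \<and>
         (\<forall>e\<in>arcs Q. g (head Q e) * V e = W e * g (tail Q e)))"

text \<open>The direct sum of \<open>m i\<close> copies of \<open>W i\<close> for \<open>i < l\<close>, in block diagonal form.\<close>

definition rep_direct_sum ::
  "('v, 'e) pre_digraph \<Rightarrow> nat \<Rightarrow> (nat \<Rightarrow> nat) \<Rightarrow> (nat \<Rightarrow> 'e rep) \<Rightarrow> 'e rep" where
  "rep_direct_sum Q l m W =
    (\<lambda>e\<in>arcs Q. diag_block_mat (concat (map (\<lambda>i. replicate (m i) (W i e)) [0..<l])))"


section \<open>Subrepresentations, simplicity and stability\<close>

definition subrep ::
  "('v, 'e) pre_digraph \<Rightarrow> ('v \<Rightarrow> nat) \<Rightarrow> 'e rep \<Rightarrow> ('v \<Rightarrow> complex vec set) \<Rightarrow> bool" where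
  "subrep Q \<alpha> V U \<longleftrightarrow>
    (\<forall>v\<in>verts Q. VectorSpace.subspace class_ring (U v) (module_vec TYPE(complex) (\<alpha> v))) \<and>
    (\<forall>e\<in>arcs Q. \<forall>x\<in>U (tail Q e). V e *\<^sub>v x \<in> U (head Q e))"

definition zero_sub :: "('v, 'e) pre_digraph \<Rightarrow> ('v \<Rightarrow> nat) \<Rightarrow> ('v \<Rightarrow> complex vec set) \<Rightarrow> bool" where
  "zero_sub Q \<alpha> U \<longleftrightarrow> (\<forall>v\<in>verts Q. U v = {0\<^sub>v (\<alpha> v)})"

definition full_sub :: "('v, 'e) pre_digraph \<Rightarrow> ('v \<Rightarrow> nat) \<Rightarrow> ('v \<Rightarrow> complex vec set) \<Rightarrow> bool" where
  "full_sub Q \<alpha> U \<longleftrightarrow> (\<forall>v\<in>verts Q. U v = carrier_vec (\<alpha> v))"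

definition sub_dim :: "('v \<Rightarrow> nat) \<Rightarrow> ('v \<Rightarrow> complex vec set) \<Rightarrow> 'v \<Rightarrow> nat" where
  "sub_dim \<alpha> U v =
    vectorspace.dim class_ring ((module_vec TYPE(complex) (\<alpha> v))\<lparr>carrier := U v\<rparr>)"

definition weight :: "('v, 'e) pre_digraph \<Rightarrow> ('v \<Rightarrow> int) \<Rightarrow> ('v \<Rightarrow> nat) \<Rightarrow> int" where
  "weight Q \<theta> \<beta> = (\<Sum>v\<in>verts Q. \<theta> v * int (\<beta> v))"

definition nonzero_dim :: "('v, 'e) pre_digraph \<Rightarrow> ('v \<Rightarrow> nat) \<Rightarrow> bool" where
  "nonzero_dim Q \<alpha> \<longleftrightarrow> (\<exists>v\<in>verts Q. \<alpha> v \<noteq> 0)"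

definition simple_rep :: "('v, 'e) pre_digraph \<Rightarrow> ('v \<Rightarrow> nat) \<Rightarrow> 'e rep \<Rightarrow> bool" where
  "simple_rep Q \<alpha> V \<longleftrightarrow> nonzero_dim Q \<alpha> \<and>
    (\<forall>U. subrep Q \<alpha> V U \<longrightarrow> zero_sub Q \<alpha> U \<or> full_sub Q \<alpha> U)"

definition theta_semistable :: "('v, 'e) pre_digraph \<Rightarrow> ('v \<Rightarrow> int) \<Rightarrow> ('v \<Rightarrow> nat) \<Rightarrow> 'e rep \<Rightarrow> bool" where
  "theta_semistable Q \<theta> \<alpha> V \<longleftrightarrow> weight Q \<theta> \<alpha> = 0 \<and>
    (\<forall>U. subrep Q \<alpha> V U \<longrightarrow> weight Q \<theta> (sub_dim \<alpha> U) \<ge> 0)"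

definition theta_stable :: "('v, 'e) pre_digraph \<Rightarrow> ('v \<Rightarrow> int) \<Rightarrow> ('v \<Rightarrow> nat) \<Rightarrow> 'e rep \<Rightarrow> bool" where
  "theta_stable Q \<theta> \<alpha> V \<longleftrightarrow> nonzero_dim Q \<alpha> \<and> theta_semistable Q \<theta> \<alpha> V \<and>
    (\<forall>U. subrep Q \<alpha> V U \<and> weight Q \<theta> (sub_dim \<alpha> U) = 0 \<longrightarrow> zero_sub Q \<alpha> U \<or> full_sub Q \<alpha> U)"


section \<open>Semi-invariants and the moduli space\<close>

text \<open>
  The coordinate ring of \<open>rep_space Q \<alpha>\<close>. Its elements are functions on the whole type, but they
  only read matrix entries whose indices are in range, so each of them is determined by its
  restriction to \<open>rep_space Q \<alpha>\<close>.
\<close>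

inductive_set coord_ring :: "('v, 'e) pre_digraph \<Rightarrow> ('v \<Rightarrow> nat) \<Rightarrow> ('e rep \<Rightarrow> complex) set"
  for Q :: "('v, 'e) pre_digraph" and \<alpha> :: "'v \<Rightarrow> nat" where
  const: "(\<lambda>V. c) \<in> coord_ring Q \<alpha>"
| entry: "\<lbrakk>e \<in> arcs Q; i < \<alpha> (head Q e); j < \<alpha> (tail Q e)\<rbrakk>
            \<Longrightarrow> (\<lambda>V. V e $$ (i, j)) \<in> coord_ring Q \<alpha>"
| add: "\<lbrakk>f \<in> coord_ring Q \<alpha>; g \<in> coord_ring Q \<alpha>\<rbrakk> \<Longrightarrow> (\<lambda>V. f V + g V) \<in> coord_ring Q \<alpha>"
| mult: "\<lbrakk>f \<in> coord_ring Q \<alpha>; g \<in> coord_ring Q \<alpha>\<rbrakk> \<Longrightarrow> (\<lambda>V. f V * g V) \<in> coord_ring Q \<alpha>"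

definition GL :: "('v, 'e) pre_digraph \<Rightarrow> ('v \<Rightarrow> nat) \<Rightarrow> ('v \<Rightarrow> complex mat) set" where
  "GL Q \<alpha> = (\<Pi>\<^sub>E v\<in>verts Q. {A \<in> carrier_mat (\<alpha> v) (\<alpha> v). invertible_mat A})"

definition base_change :: "('v, 'e) pre_digraph \<Rightarrow> ('v \<Rightarrow> complex mat) \<Rightarrow> 'e rep \<Rightarrow> 'e rep" where
  "base_change Q g V =
    (\<lambda>e\<in>arcs Q. g (head Q e) * V e * the (mat_inverse (g (tail Q e))))"

text \<open>\<open>SI Q \<alpha> \<sigma>\<close> is the space of semi-invariants of weight \<open>\<sigma>\<close>.\<close>

definition SI ::
  "('v, 'e) pre_digraph \<Rightarrow> ('v \<Rightarrow> nat) \<Rightarrow> ('v \<Rightarrow> int) \<Rightarrow> ('e rep \<Rightarrow> complex) set" where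
  "SI Q \<alpha> \<sigma> = {f \<in> coord_ring Q \<alpha>. \<forall>g\<in>GL Q \<alpha>. \<forall>V\<in>rep_space Q \<alpha>.
      f (base_change Q g V) = (\<Prod>v\<in>verts Q. det (g v) powi \<sigma> v) * f V}"

abbreviation SI_deg ::
  "('v, 'e) pre_digraph \<Rightarrow> ('v \<Rightarrow> nat) \<Rightarrow> ('v \<Rightarrow> int) \<Rightarrow> nat \<Rightarrow> ('e rep \<Rightarrow> complex) set" where
  "SI_deg Q \<alpha> \<theta> n \<equiv> SI Q \<alpha> (\<lambda>v. int n * \<theta> v)"

text \<open>
  The graded ring \<open>\<Oplus>\<^sub>n SI(Q, n\<theta>)\<close> is handled through its homogeneous components: a homogeneous
  ideal \<open>I\<close> is the family of its graded pieces \<open>I n \<subseteq> SI(Q, n\<theta>)\<close>. Points of \<open>Proj\<close> are the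
  homogeneous prime ideals not containing the irrelevant ideal (for homogeneous ideals,
  primality need only be tested on homogeneous elements).
\<close>

definition proj_points ::
  "('v, 'e) pre_digraph \<Rightarrow> ('v \<Rightarrow> nat) \<Rightarrow> ('v \<Rightarrow> int) \<Rightarrow> (nat \<Rightarrow> ('e rep \<Rightarrow> complex) set) set" where
  "proj_points Q \<alpha> \<theta> = {I.
     (\<forall>n. I n \<subseteq> SI_deg Q \<alpha> \<theta> n \<and> (\<lambda>V. 0) \<in> I n \<and>
          (\<forall>f\<in>I n. \<forall>g\<in>I n. (\<lambda>V. f V + g V) \<in> I n)) \<and>
     (\<forall>m n. \<forall>f\<in>SI_deg Q \<alpha> \<theta> m. \<forall>g\<in>I n. (\<lambda>V. f V * g V) \<in> I (m + n)) \<and>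
     (\<forall>m n. \<forall>f\<in>SI_deg Q \<alpha> \<theta> m. \<forall>g\<in>SI_deg Q \<alpha> \<theta> n.
          (\<lambda>V. f V * g V) \<in> I (m + n) \<longrightarrow> f \<in> I m \<or> g \<in> I n) \<and>
     (\<exists>n>0. I n \<noteq> SI_deg Q \<alpha> \<theta> n)}"

text \<open>
  As usual for varieties over the complex numbers, a point of the moduli space is a closed point
  of \<open>Proj\<close>, i.e. a maximal element of \<open>proj_points\<close>.
\<close>

definition moduli_space ::
  "('v, 'e) pre_digraph \<Rightarrow> ('v \<Rightarrow> nat) \<Rightarrow> ('v \<Rightarrow> int) \<Rightarrow> (nat \<Rightarrow> ('e rep \<Rightarrow> complex) set) set" where
  "moduli_space Q \<alpha> \<theta> =
    {I \<in> proj_points Q \<alpha> \<theta>. \<forall>J\<in>proj_points Q \<alpha> \<theta>. (\<forall>n. I n \<subseteq> J n) \<longrightarrow> J = I}"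

text \<open>The point corresponding to \<open>V\<close>: the homogeneous ideal of semi-invariants vanishing at \<open>V\<close>.\<close>

definition moduli_point ::
  "('v, 'e) pre_digraph \<Rightarrow> ('v \<Rightarrow> nat) \<Rightarrow> ('v \<Rightarrow> int) \<Rightarrow> 'e rep
    \<Rightarrow> nat \<Rightarrow> ('e rep \<Rightarrow> complex) set" where
  "moduli_point Q \<alpha> \<theta> V = (\<lambda>n. {f \<in> SI_deg Q \<alpha> \<theta> n. f V = 0})"

end

theory Submission
  imports Defs "HOL-Analysis.Continuum_Not_Denumerable" "Jordan_Normal_Form.Spectral_Radius"
    "HOL-Computational_Algebra.Fundamental_Theorem_Algebra"
begin

text \<open>
  Write \<open>V0\<close> for the direct sum of the \<open>W i\<close> with multiplicities \<open>m i\<close>. By Schur's lemma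
  \<open>Hom (W i, W j)\<close> has dimension \<open>1\<close> for \<open>i = j\<close> and \<open>0\<close> otherwise, and the Euler form computes
  \<open>dim Hom - dim Ext\<close>; so the arrows from \<open>i\<close> to \<open>j\<close> in \<open>Q'\<close> can be used to label a basis of
  \<open>Ext (W i, W j)\<close>, represented by families of matrices \<open>Z a\<close> (\<open>ext_basis\<close>). A representation \<open>M\<close>
  of \<open>Q'\<close> of dimension vector \<open>m\<close> then gives a deformation \<open>V0 + X(M)\<close> of \<open>V0\<close>, where \<open>X(M)\<close> is
  the sum over the arrows \<open>a\<close> of the tensor products of \<open>M a\<close> and \<open>Z a\<close>. The theorem holds because
  both of its sides are equivalent to the stability of \<open>V0 + X(M)\<close> for some \<open>M\<close>. Three arguments
  establish this.

  If \<open>V0 + X(M)\<close> is stable, then \<open>M\<close> is simple (\<open>deform_stable_imp_simple\<close>): a subrepresentation of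
  \<open>M\<close> induces a subrepresentation of \<open>V0 + X(M)\<close>, and its weight is zero because it is built from
  copies of the \<open>W i\<close>.

  If \<open>M\<close> is simple, then \<open>V0 + \<tau> X(M)\<close> is stable for some small \<open>\<tau>\<close> (\<open>simple_imp_deform_stable\<close>).
  Otherwise destabilising subrepresentations exist for a sequence of \<open>\<tau>\<close> tending to \<open>0\<close>, and since
  Grassmannians are compact (\<open>not_stable_limit\<close>) they accumulate at a proper nonzero
  subrepresentation \<open>P\<close> of \<open>V0\<close> of weight at most \<open>0\<close>. As \<open>V0\<close> is polystable, the weight is \<open>0\<close>
  and \<open>P\<close> is the image of an idempotent endomorphism (\<open>polystable_subs\<close>), so by Schur's lemma it
  comes from subspaces \<open>F i\<close> of the multiplicity spaces (\<open>endomorphism_bl\<close>). The first order term in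
  \<open>\<tau>\<close> of the condition of being a subrepresentation says that the component of \<open>X(M)\<close> from \<open>P\<close> to
  its complement is a limit of coboundaries. Linear functionals vanishing on coboundaries
  and dual to the \<open>Z a\<close> turn this into the statement that \<open>F\<close> is a subrepresentation of \<open>M\<close>,
  against the simplicity of \<open>M\<close>.

  If \<open>S\<close> is a stable representation, then \<open>V0 + X(M)\<close> is stable for some \<open>M\<close>
  (\<open>stable_imp_deform_stable\<close>). Consider the line \<open>V0 + t Y\<close> through \<open>V0\<close> and \<open>S = V0 + Y\<close>. For small
  \<open>t\<close> its points are isomorphic to representations \<open>V0 + X(M)\<close> (\<open>local_slice\<close>); this takes the place
  of Luna's slice theorem and is proved by solving a quadratic fixed point equation. For \<open>t\<close> close
  to \<open>1\<close> the points are stable, by compactness again. That a general point of the line inherits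
  both properties is seen without algebraic geometry: for \<open>t0\<close> near \<open>0\<close> and \<open>t1\<close> near \<open>1\<close> outside
  a countable set there is a field embedding into the complex numbers, defined on a subfield
  that contains all matrix entries involved, which fixes the entries of \<open>V0\<close>, of \<open>Y\<close> and of
  the finitely many \<open>X(M)\<close> whose combinations occur in \<open>local_slice\<close>, and sends \<open>t0\<close> to \<open>t1\<close>
  (\<open>generic_transfer\<close>). Applied to the isomorphism at \<open>t0\<close> it gives one at
  \<open>t1\<close>.

  Linear algebra is carried out in one ring, the finitary \<open>\<nat> \<times> \<nat>\<close> matrices: spaces and subspaces
  are idempotents, dimensions are traces, and matrices of any two sizes can be multiplied. The
  last sections translate between this language and the one of the theorem.
\<close>


section \<open>The ring of finitary complex matrices\<close>

text \<open>
  A common home for matrices of all sizes. An \<open>n \<times> m\<close> matrix is an \<open>A\<close> with \<open>idm n * A = A\<close> and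
  \<open>A * idm m = A\<close>, where \<open>idm n\<close> is the unit matrix of size \<open>n\<close>; this avoids dimension types and
  partial operations, and equations between products become equations in an associative ring.
\<close>

typedef fmat = "{f :: nat \<Rightarrow> nat \<Rightarrow> complex. \<exists>n. \<forall>i j. n \<le> i \<or> n \<le> j \<longrightarrow> f i j = 0}"
  morphisms ent Abs_fmat
  by (rule exI[of _ "\<lambda>i j. 0"]) auto

setup_lifting type_definition_fmat

lemma fmat_eqI: "(\<And>i j. ent A i j = ent B i j) \<Longrightarrow> A = B"
  by (metis ent_inject ext)

lemma ent_bound: obtains n where "\<And>i j. n \<le> i \<or> n \<le> j \<Longrightarrow> ent A i j = 0"
  using ent[of A] by auto

lemma ent_bound2:
  obtains n where "\<And>i j. n \<le> i \<or> n \<le> j \<Longrightarrow> ent A i j = 0"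
    "\<And>i j. n \<le> i \<or> n \<le> j \<Longrightarrow> ent B i j = 0"
proof -
  obtain a where a: "\<And>i j. a \<le> i \<or> a \<le> j \<Longrightarrow> ent A i j = 0" using ent_bound[of A] by metis
  obtain b where b: "\<And>i j. b \<le> i \<or> b \<le> j \<Longrightarrow> ent B i j = 0" using ent_bound[of B] by metis
  show ?thesis by (rule that[of "max a b"]) (auto simp: a b)
qed

lift_definition mat_fun :: "nat \<Rightarrow> nat \<Rightarrow> (nat \<Rightarrow> nat \<Rightarrow> complex) \<Rightarrow> fmat" is
  "\<lambda>n m f i j. if i < n \<and> j < m then f i j else 0"
  subgoal for n m f by (rule exI[of _ "max n m"]) auto
  done

lemma ent_mat_fun: "ent (mat_fun n m f) i j = (if i < n \<and> j < m then f i j else 0)"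
  by transfer simp

instantiation fmat :: ab_group_add
begin
lift_definition zero_fmat :: fmat is "\<lambda>i j. 0" by auto
lift_definition plus_fmat :: "fmat \<Rightarrow> fmat \<Rightarrow> fmat" is "\<lambda>f g i j. f i j + g i j"
  subgoal for f g
    apply (elim exE) subgoal for a b by (rule exI[of _ "max a b"]) auto done
  done
lift_definition uminus_fmat :: "fmat \<Rightarrow> fmat" is "\<lambda>f i j. - f i j" by auto
lift_definition minus_fmat :: "fmat \<Rightarrow> fmat \<Rightarrow> fmat" is "\<lambda>f g i j. f i j - g i j"
  subgoal for f g
    apply (elim exE) subgoal for a b by (rule exI[of _ "max a b"]) auto done
  done
instance
  by standard (transfer; auto simp: fun_eq_iff algebra_simps)+
end

lemma ent_zero [simp]: "ent 0 i j = 0" by transfer simp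
lemma ent_add [simp]: "ent (A + B) i j = ent A i j + ent B i j" by transfer simp
lemma ent_minus [simp]: "ent (- A) i j = - ent A i j" by transfer simp
lemma ent_diff [simp]: "ent (A - B) i j = ent A i j - ent B i j" by transfer simp

lemma ent_sum: "ent (sum f S) i j = (\<Sum>x\<in>S. ent (f x) i j)"
  by (induct S rule: infinite_finite_induct) auto

instantiation fmat :: ring
begin
lift_definition times_fmat :: "fmat \<Rightarrow> fmat \<Rightarrow> fmat" is
  "\<lambda>f g i j. \<Sum>k\<in>{k. f i k \<noteq> 0}. f i k * g k j"
  subgoal for f g
    apply (elim exE) subgoal for a b by (rule exI[of _ "max a b"]) (auto intro!: sum.neutral) done
  done

lemma ent_times_raw: "ent (A * B) i j = (\<Sum>k\<in>{k. ent A i k \<noteq> 0}. ent A i k * ent B k j)"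
  by transfer simp

text \<open>
  The product only involves finitely many indices; any finite set that contains those at which both
  factors are nonzero may be used, in particular the known size of a factor.
\<close>

lemma ent_times:
  assumes "finite K" "\<And>k. k \<notin> K \<Longrightarrow> ent A i k = 0 \<or> ent B k j = 0"
  shows "ent (A * B) i j = (\<Sum>k\<in>K. ent A i k * ent B k j)"
proof -
  obtain n where n: "\<And>i j. n \<le> i \<or> n \<le> j \<Longrightarrow> ent A i j = 0" using ent_bound[of A] by blast
  have fin: "finite {k. ent A i k \<noteq> 0}"
    by (rule finite_subset[of _ "{..<n}"]) (use n not_less in auto)
  have "ent (A * B) i j = (\<Sum>k\<in>{k. ent A i k \<noteq> 0} \<union> K. ent A i k * ent B k j)"
    unfolding ent_times_raw using fin assms(1) by (intro sum.mono_neutral_left) auto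
  also have "\<dots> = (\<Sum>k\<in>K. ent A i k * ent B k j)"
    using fin assms by (intro sum.mono_neutral_right) auto
  finally show ?thesis .
qed

instance
proof
  fix a b c :: fmat
  obtain n where n: "\<And>i j. n \<le> i \<or> n \<le> j \<Longrightarrow> ent a i j = 0"
     "\<And>i j. n \<le> i \<or> n \<le> j \<Longrightarrow> ent b i j = 0" using ent_bound2[of a b] by blast
  obtain m where m: "\<And>i j. m \<le> i \<or> m \<le> j \<Longrightarrow> ent c i j = 0" using ent_bound[of c] by blast
  define N where "N = max n m"
  have a: "ent a i j = 0" if "N \<le> i \<or> N \<le> j" for i j using that n by (auto simp: N_def)
  have b: "ent b i j = 0" if "N \<le> i \<or> N \<le> j" for i j using that n by (auto simp: N_def)
  have c: "ent c i j = 0" if "N \<le> i \<or> N \<le> j" for i j using that m by (auto simp: N_def)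
  have T: "ent (x * y) i j = (\<Sum>k<N. ent x i k * ent y k j)"
    if "\<And>k. N \<le> k \<Longrightarrow> ent x i k = 0 \<or> ent y k j = 0" for x y i j
    by (rule ent_times) (use that in \<open>auto simp: not_less\<close>)
  have ab: "ent (a * b) i j = (\<Sum>k<N. ent a i k * ent b k j)" for i j by (rule T) (simp add: a)
  have bc: "ent (b * c) i j = (\<Sum>k<N. ent b i k * ent c k j)" for i j by (rule T) (simp add: b)
  show "a * b * c = a * (b * c)"
  proof (rule fmat_eqI)
    fix i j
    have "ent (a * b * c) i j = (\<Sum>k<N. ent (a*b) i k * ent c k j)" by (rule T) (simp add: c)
    also have "\<dots> = (\<Sum>k<N. \<Sum>l<N. ent a i l * ent b l k * ent c k j)"
      by (simp add: ab sum_distrib_right)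
    also have "\<dots> = (\<Sum>l<N. \<Sum>k<N. ent a i l * ent b l k * ent c k j)" by (rule sum.swap)
    also have "\<dots> = (\<Sum>l<N. ent a i l * ent (b * c) l j)"
      by (simp add: bc sum_distrib_left mult.assoc)
    also have "\<dots> = ent (a * (b * c)) i j" by (rule T[symmetric]) (simp add: a)
    finally show "ent (a * b * c) i j = ent (a * (b * c)) i j" .
  qed
  show "(a + b) * c = a * c + b * c"
  proof (rule fmat_eqI)
    fix i j
    have "ent ((a+b) * c) i j = (\<Sum>k<N. ent (a+b) i k * ent c k j)" by (rule T) (simp add: c)
    moreover have "ent (a * c) i j = (\<Sum>k<N. ent a i k * ent c k j)" by (rule T) (simp add: c)
    moreover have "ent (b * c) i j = (\<Sum>k<N. ent b i k * ent c k j)" by (rule T) (simp add: c)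
    ultimately show "ent ((a + b) * c) i j = ent (a * c + b * c) i j"
      by (simp add: algebra_simps sum.distrib)
  qed
  show "a * (b + c) = a * b + a * c"
  proof (rule fmat_eqI)
    fix i j
    have "ent (a * (b+c)) i j = (\<Sum>k<N. ent a i k * ent (b+c) k j)" by (rule T) (simp add: a)
    moreover have "ent (a * c) i j = (\<Sum>k<N. ent a i k * ent c k j)" by (rule T) (simp add: c)
    ultimately show "ent (a * (b + c)) i j = ent (a * b + a * c) i j"
      by (simp add: ab algebra_simps sum.distrib)
  qed
qed
end

lift_definition csc :: "complex \<Rightarrow> fmat \<Rightarrow> fmat" (infixr \<open>*\<^sub>C\<close> 75) is "\<lambda>c f i j. c * f i j" by auto

lemma ent_csc [simp]: "ent (c *\<^sub>C A) i j = c * ent A i j" by transfer simp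

lemma csc_add_right: "c *\<^sub>C (A + B) = c *\<^sub>C A + c *\<^sub>C B" by (rule fmat_eqI) (simp add: algebra_simps)
lemma csc_add_left: "(c + d) *\<^sub>C A = c *\<^sub>C A + d *\<^sub>C A" by (rule fmat_eqI) (simp add: algebra_simps)
lemma csc_diff_right: "c *\<^sub>C (A - B) = c *\<^sub>C A - c *\<^sub>C B" by (rule fmat_eqI) (simp add: algebra_simps)
lemma csc_diff_left: "(c - d) *\<^sub>C A = c *\<^sub>C A - d *\<^sub>C A" by (rule fmat_eqI) (simp add: algebra_simps)
lemma csc_csc [simp]: "c *\<^sub>C d *\<^sub>C A = (c * d) *\<^sub>C A" by (rule fmat_eqI) simp
lemma csc_one [simp]: "1 *\<^sub>C A = A" by (rule fmat_eqI) simp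
lemma csc_zero_left [simp]: "0 *\<^sub>C A = 0" by (rule fmat_eqI) simp
lemma csc_zero_right [simp]: "c *\<^sub>C 0 = 0" by (rule fmat_eqI) simp
lemma csc_minus_left [simp]: "(- c) *\<^sub>C A = - (c *\<^sub>C A)" by (rule fmat_eqI) simp
lemma csc_eq_0_iff: "c *\<^sub>C A = 0 \<longleftrightarrow> c = 0 \<or> A = 0"
proof
  assume h: "c *\<^sub>C A = 0"
  show "c = 0 \<or> A = 0"
  proof (cases "c = 0")
    case False
    have "A = inverse c *\<^sub>C c *\<^sub>C A" using False by simp
    thus ?thesis using h by (metis csc_zero_right)
  qed auto
qed auto

lemma csc_times_left [simp]: "(c *\<^sub>C A) * B = c *\<^sub>C (A * B)"
proof (rule fmat_eqI)
  fix i j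
  obtain n where n: "\<And>i j. n \<le> i \<or> n \<le> j \<Longrightarrow> ent A i j = 0" using ent_bound[of A] by blast
  have "ent ((c *\<^sub>C A) * B) i j = (\<Sum>k<n. c * ent A i k * ent B k j)"
    by (subst ent_times[where K = "{..<n}"]) (auto simp: n not_less)
  moreover have "ent (A * B) i j = (\<Sum>k<n. ent A i k * ent B k j)"
    by (subst ent_times[where K = "{..<n}"]) (auto simp: n not_less)
  ultimately show "ent ((c *\<^sub>C A) * B) i j = ent (c *\<^sub>C (A * B)) i j"
    by (simp add: sum_distrib_left mult.assoc)
qed

lemma csc_times_right [simp]: "A * (c *\<^sub>C B) = c *\<^sub>C (A * B)"
proof (rule fmat_eqI)
  fix i j
  obtain n where n: "\<And>i j. n \<le> i \<or> n \<le> j \<Longrightarrow> ent A i j = 0" using ent_bound[of A] by blast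
  have "ent (A * (c *\<^sub>C B)) i j = (\<Sum>k<n. c * (ent A i k * ent B k j))"
    by (subst ent_times[where K = "{..<n}"]) (auto simp: n not_less mult.left_commute)
  moreover have "ent (A * B) i j = (\<Sum>k<n. ent A i k * ent B k j)"
    by (subst ent_times[where K = "{..<n}"]) (auto simp: n not_less)
  ultimately show "ent (A * (c *\<^sub>C B)) i j = ent (c *\<^sub>C (A * B)) i j"
    by (simp add: sum_distrib_left mult.left_commute)
qed

lemma csc_sum_right: "c *\<^sub>C sum f S = (\<Sum>x\<in>S. c *\<^sub>C f x)"
  by (induct S rule: infinite_finite_induct) (auto simp: csc_add_right)
lemma csc_sum_left: "sum f S *\<^sub>C A = (\<Sum>x\<in>S. f x *\<^sub>C A)"
  by (induct S rule: infinite_finite_induct) (auto simp: csc_add_left)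

subsection \<open>The entrywise norm\<close>

instantiation fmat :: real_algebra
begin
definition scaleR_fmat :: "real \<Rightarrow> fmat \<Rightarrow> fmat" where "scaleR_fmat r A = complex_of_real r *\<^sub>C A"
instance
  by standard (simp_all add: scaleR_fmat_def csc_add_right csc_add_left)
end

instantiation fmat :: real_normed_algebra
begin

definition norm_fmat :: "fmat \<Rightarrow> real" where
  "norm_fmat A = (\<Sum>(i,j)\<in>{(i,j). ent A i j \<noteq> 0}. cmod (ent A i j))"

definition dist_fmat :: "fmat \<Rightarrow> fmat \<Rightarrow> real" where "dist_fmat A B = norm (A - B)"
definition sgn_fmat :: "fmat \<Rightarrow> fmat" where "sgn_fmat A = A /\<^sub>R norm A"
definition uniformity_fmat :: "(fmat \<times> fmat) filter" where
  "uniformity_fmat = (INF e\<in>{0 <..}. principal {(x, y). dist x y < e})"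
definition open_fmat :: "fmat set \<Rightarrow> bool" where
  "open_fmat U = (\<forall>x\<in>U. eventually (\<lambda>(x', y). x' = x \<longrightarrow> y \<in> U) uniformity)"

lemma norm_fmat_bound:
  assumes "\<And>i j. n \<le> i \<or> m \<le> j \<Longrightarrow> ent A i j = 0"
  shows "norm A = (\<Sum>i<n. \<Sum>j<m. cmod (ent A i j))"
proof -
  have "norm A = (\<Sum>(i,j)\<in>{..<n}\<times>{..<m}. cmod (ent A i j))"
    unfolding norm_fmat_def
  proof (rule sum.mono_neutral_left)
    show "{(i, j). ent A i j \<noteq> 0} \<subseteq> {..<n} \<times> {..<m}"
      using assms by (auto simp: not_less[symmetric])
  qed auto
  thus ?thesis by (simp add: sum.cartesian_product)
qed

instance
proof
  fix r :: real and x y z :: fmat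
  show "dist x y = norm (x - y)" by (rule dist_fmat_def)
  show "sgn x = x /\<^sub>R norm x" by (rule sgn_fmat_def)
  show "uniformity = (INF e\<in>{0 <..}. principal {(x, y :: fmat). dist x y < e})"
    by (rule uniformity_fmat_def)
  show "open U \<longleftrightarrow> (\<forall>x\<in>U. eventually (\<lambda>(x', y). x' = x \<longrightarrow> y \<in> U) uniformity)" for U :: "fmat set"
    by (rule open_fmat_def)
  obtain n where x: "\<And>i j. n \<le> i \<or> n \<le> j \<Longrightarrow> ent x i j = 0"
     and y: "\<And>i j. n \<le> i \<or> n \<le> j \<Longrightarrow> ent y i j = 0" using ent_bound2[of x y] by blast
  have nx: "norm x = (\<Sum>i<n. \<Sum>j<n. cmod (ent x i j))" by (rule norm_fmat_bound) (rule x)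
  have ny: "norm y = (\<Sum>i<n. \<Sum>j<n. cmod (ent y i j))" by (rule norm_fmat_bound) (rule y)
  show "norm (r *\<^sub>R x) = \<bar>r\<bar> * norm x"
    by (subst norm_fmat_bound[of n n]) (auto simp: x nx scaleR_fmat_def norm_mult sum_distrib_left)
  show "norm (x + y) \<le> norm x + norm y"
  proof -
    have "norm (x + y) = (\<Sum>i<n. \<Sum>j<n. cmod (ent x i j + ent y i j))"
      by (subst norm_fmat_bound[of n n]) (auto simp: x y)
    also have "\<dots> \<le> (\<Sum>i<n. \<Sum>j<n. cmod (ent x i j) + cmod (ent y i j))"
      by (intro sum_mono norm_triangle_ineq)
    finally show ?thesis by (simp add: nx ny sum.distrib)
  qed
  show "norm x = 0 \<longleftrightarrow> x = 0"
  proof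
    assume "norm x = 0"
    hence "\<forall>i<n. \<forall>j<n. cmod (ent x i j) = 0"
      unfolding nx by (simp add: sum_nonneg_eq_0_iff sum_nonneg)
    thus "x = 0" using x by (intro fmat_eqI) (metis ent_zero not_less norm_eq_zero)
  qed (simp add: norm_fmat_def)
  have xy: "ent (x * y) i j = (\<Sum>k<n. ent x i k * ent y k j)" for i j
    by (rule ent_times) (use x in \<open>auto simp: not_less\<close>)
  have "norm (x * y) = (\<Sum>i<n. \<Sum>j<n. cmod (ent (x * y) i j))"
    by (rule norm_fmat_bound) (auto simp: xy x y)
  also have "\<dots> \<le> (\<Sum>i<n. \<Sum>j<n. \<Sum>k<n. cmod (ent x i k) * cmod (ent y k j))"
    unfolding xy by (intro sum_mono order_trans[OF norm_sum]) (auto simp: norm_mult intro!: sum_mono)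
  also have "\<dots> = (\<Sum>i<n. \<Sum>k<n. cmod (ent x i k) * (\<Sum>j<n. cmod (ent y k j)))"
    by (subst sum.swap) (simp add: sum_distrib_left)
  also have "\<dots> \<le> (\<Sum>i<n. \<Sum>k<n. cmod (ent x i k) * norm y)"
  proof (intro sum_mono mult_left_mono)
    fix i k assume "k \<in> {..<n}"
    thus "(\<Sum>j<n. cmod (ent y k j)) \<le> norm y"
      unfolding ny by (intro member_le_sum[of k "{..<n}" "\<lambda>k. \<Sum>j<n. cmod (ent y k j)"]) (auto intro: sum_nonneg)
  qed auto
  also have "\<dots> = norm x * norm y" by (simp add: nx sum_distrib_right)
  finally show "norm (x * y) \<le> norm x * norm y" .
qed
end

lemma norm_csc: "norm (c *\<^sub>C A) = cmod c * norm A"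
proof -
  obtain n where x: "\<And>i j. n \<le> i \<or> n \<le> j \<Longrightarrow> ent A i j = 0" using ent_bound[of A] by blast
  show ?thesis
    by (subst (1 2) norm_fmat_bound[of n n]) (auto simp: x norm_mult sum_distrib_left)
qed

subsection \<open>Trace, adjoint, units\<close>

definition trc :: "fmat \<Rightarrow> complex" where "trc A = (\<Sum>i\<in>{i. ent A i i \<noteq> 0}. ent A i i)"

lemma trc_eq:
  assumes "\<And>i. n \<le> i \<Longrightarrow> ent A i i = 0"
  shows "trc A = (\<Sum>i<n. ent A i i)"
  unfolding trc_def
proof (rule sum.mono_neutral_left)
  show "{i. ent A i i \<noteq> 0} \<subseteq> {..<n}" using assms by (auto simp: not_less[symmetric])
qed auto

lemma trc_zero [simp]: "trc 0 = 0" by (simp add: trc_def)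

lemma trc_add: "trc (A + B) = trc A + trc B"
proof -
  obtain n where "\<And>i j. n \<le> i \<or> n \<le> j \<Longrightarrow> ent A i j = 0" "\<And>i j. n \<le> i \<or> n \<le> j \<Longrightarrow> ent B i j = 0"
    using ent_bound2[of A B] by blast
  thus ?thesis by (simp add: trc_eq[of n] sum.distrib)
qed

lemma trc_csc: "trc (c *\<^sub>C A) = c * trc A"
proof -
  obtain n where "\<And>i j. n \<le> i \<or> n \<le> j \<Longrightarrow> ent A i j = 0" using ent_bound[of A] by blast
  thus ?thesis by (simp add: trc_eq[of n] sum_distrib_left)
qed

lemma trc_minus: "trc (- A) = - trc A"
  using trc_csc[of "-1" A] by simp

lemma trc_diff: "trc (A - B) = trc A - trc B"
  using trc_add[of A "- B"] by (simp add: trc_minus)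

lemma trc_sum: "trc (sum f S) = (\<Sum>x\<in>S. trc (f x))"
  by (induct S rule: infinite_finite_induct) (auto simp: trc_add)

lemma trc_commute: "trc (A * B) = trc (B * A)"
proof -
  obtain n where n: "\<And>i j. n \<le> i \<or> n \<le> j \<Longrightarrow> ent A i j = 0" "\<And>i j. n \<le> i \<or> n \<le> j \<Longrightarrow> ent B i j = 0"
    using ent_bound2[of A B] by blast
  have AB: "ent (A * B) i j = (\<Sum>k<n. ent A i k * ent B k j)" for i j
    by (rule ent_times) (use n in \<open>auto simp: not_less\<close>)
  have BA: "ent (B * A) i j = (\<Sum>k<n. ent B i k * ent A k j)" for i j
    by (rule ent_times) (use n in \<open>auto simp: not_less\<close>)
  have "trc (A * B) = (\<Sum>i<n. \<Sum>k<n. ent A i k * ent B k i)"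
    by (subst trc_eq[of n]) (auto simp: AB n)
  also have "\<dots> = (\<Sum>k<n. \<Sum>i<n. ent A i k * ent B k i)" by (rule sum.swap)
  also have "\<dots> = trc (B * A)"
    by (subst trc_eq[of n]) (auto simp: BA n mult.commute)
  finally show ?thesis .
qed

lemma norm_trc_le: "cmod (trc A) \<le> norm A"
proof -
  obtain n where x: "\<And>i j. n \<le> i \<or> n \<le> j \<Longrightarrow> ent A i j = 0" using ent_bound[of A] by blast
  have "cmod (trc A) \<le> (\<Sum>i<n. cmod (ent A i i))"
    using x by (subst trc_eq[of n]) (auto intro: norm_sum)
  also have "\<dots> \<le> (\<Sum>i<n. \<Sum>j<n. cmod (ent A i j))"
    by (intro sum_mono member_le_sum[of _ "{..<n}" "\<lambda>j. cmod (ent A _ j)"]) auto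
  also have "\<dots> = norm A" by (rule norm_fmat_bound[symmetric]) (rule x)
  finally show ?thesis .
qed

lemma bounded_linear_trc: "bounded_linear trc"
  by (rule bounded_linear_intro[of _ 1])
     (auto simp: trc_add scaleR_fmat_def trc_csc scaleR_conv_of_real norm_trc_le)

lemmas tendsto_trc [tendsto_intros] = bounded_linear.tendsto[OF bounded_linear_trc]

lemma tendsto_csc [tendsto_intros]:
  assumes "(f \<longlongrightarrow> a) F" "(g \<longlongrightarrow> B) F"
  shows "((\<lambda>x. f x *\<^sub>C g x) \<longlongrightarrow> a *\<^sub>C B) F"
proof -
  have "bounded_bilinear csc"
    by standard (auto simp: csc_add_left csc_add_right scaleR_fmat_def scaleR_conv_of_real mult.commute norm_csc
        intro!: exI[of _ 1])
  thus ?thesis using assms by (rule bounded_bilinear.tendsto)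
qed

lift_definition adj :: "fmat \<Rightarrow> fmat" is "\<lambda>f i j. cnj (f j i)" by auto

lemma ent_adj [simp]: "ent (adj A) i j = cnj (ent A j i)" by transfer simp

lemma adj_adj [simp]: "adj (adj A) = A" by (rule fmat_eqI) simp
lemma adj_diff: "adj (A - B) = adj A - adj B" by (rule fmat_eqI) simp
lemma adj_times: "adj (A * B) = adj B * adj A"
proof (rule fmat_eqI)
  fix i j
  obtain n where n: "\<And>i j. n \<le> i \<or> n \<le> j \<Longrightarrow> ent A i j = 0" "\<And>i j. n \<le> i \<or> n \<le> j \<Longrightarrow> ent B i j = 0"
    using ent_bound2[of A B] by blast
  have "ent (A * B) j i = (\<Sum>k<n. ent A j k * ent B k i)"
    by (rule ent_times) (use n in \<open>auto simp: not_less\<close>)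
  moreover have "ent (adj B * adj A) i j = (\<Sum>k<n. ent (adj B) i k * ent (adj A) k j)"
    by (rule ent_times) (use n in \<open>auto simp: not_less\<close>)
  ultimately show "ent (adj (A * B)) i j = ent (adj B * adj A) i j" by (simp add: mult.commute)
qed

lemma trc_adj_times_self:
  assumes "\<And>i j. n \<le> i \<or> m \<le> j \<Longrightarrow> ent A i j = 0"
  shows "trc (adj A * A) = of_real (\<Sum>i<n. \<Sum>j<m. (cmod (ent A i j))\<^sup>2)"
proof -
  have E: "ent (adj A * A) i j = (\<Sum>k<n. cnj (ent A k i) * ent A k j)" for i j
    by (subst ent_times[where K="{..<n}"]) (use assms in \<open>auto simp: not_less\<close>)
  have "trc (adj A * A) = (\<Sum>j<m. \<Sum>k<n. cnj (ent A k j) * ent A k j)"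
    by (subst trc_eq[of m]) (auto simp: E assms)
  also have "\<dots> = (\<Sum>k<n. \<Sum>j<m. cnj (ent A k j) * ent A k j)" by (rule sum.swap)
  also have "\<dots> = of_real (\<Sum>i<n. \<Sum>j<m. (cmod (ent A i j))\<^sup>2)"
    by (simp add: complex_norm_square[unfolded of_real_power] mult.commute)
  finally show ?thesis .
qed

text \<open>
  The trace form of the adjoint is positive definite; this is what makes orthogonal projections
  available in \<open>hermitian_idempotent\<close>.
\<close>

lemma adj_times_self_eq_0: assumes "adj A * A = 0" shows "A = 0"
proof -
  obtain n where x: "\<And>i j. n \<le> i \<or> n \<le> j \<Longrightarrow> ent A i j = 0" using ent_bound[of A] by blast
  have "of_real (\<Sum>i<n. \<Sum>j<n. (cmod (ent A i j))\<^sup>2) = (0::complex)"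
    using trc_adj_times_self[of n n A] assms x by simp
  hence "(\<Sum>i<n. \<Sum>j<n. (cmod (ent A i j))\<^sup>2) = 0" using of_real_eq_0_iff by blast
  hence "\<forall>i<n. \<forall>j<n. ent A i j = 0" by (simp add: sum_nonneg_eq_0_iff sum_nonneg)
  thus ?thesis using x by (intro fmat_eqI) (metis ent_zero not_less)
qed

definition idm :: "nat \<Rightarrow> fmat" where "idm n = mat_fun n n (\<lambda>i j. if i = j then 1 else 0)"
definition unit_at :: "nat \<Rightarrow> nat \<Rightarrow> fmat" where
  "unit_at i j = mat_fun (Suc i) (Suc j) (\<lambda>x y. if x = i \<and> y = j then 1 else 0)"

lemma ent_idm: "ent (idm n) i j = (if i = j \<and> i < n then 1 else 0)"
  by (auto simp: idm_def ent_mat_fun)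
lemma ent_unit_at: "ent (unit_at a b) i j = (if i = a \<and> j = b then 1 else 0)"
  by (auto simp: unit_at_def ent_mat_fun)

lemma ent_idm_times: "ent (idm n * A) i j = (if i < n then ent A i j else 0)"
  by (subst ent_times[where K="{i}"]) (auto simp: ent_idm)
lemma ent_times_idm: "ent (A * idm n) i j = (if j < n then ent A i j else 0)"
  by (subst ent_times[where K="{j}"]) (auto simp: ent_idm)
lemma ent_unit_times: "ent (unit_at a b * A) i j = (if i = a then ent A b j else 0)"
  by (subst ent_times[where K="{b}"]) (auto simp: ent_unit_at)
lemma ent_times_unit: "ent (A * unit_at a b) i j = (if j = b then ent A i a else 0)"
  by (subst ent_times[where K="{a}"]) (auto simp: ent_unit_at)

lemma idm_idm [simp]: "idm n * idm n = idm n"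
  by (rule fmat_eqI) (simp add: ent_idm_times ent_idm)
lemma adj_idm [simp]: "adj (idm n) = idm n"
  by (rule fmat_eqI) (simp add: ent_idm)
lemma trc_idm [simp]: "trc (idm n) = of_nat n"
  by (subst trc_eq[of n]) (auto simp: ent_idm)
lemma idm_0 [simp]: "idm 0 = 0" by (rule fmat_eqI) (simp add: ent_idm)
lemma idm_eq_0_iff [simp]: "idm n = 0 \<longleftrightarrow> n = 0"
  by (metis trc_idm trc_zero of_nat_eq_0_iff idm_0)
lemma idm_Suc: "idm (Suc n) = idm n + unit_at n n"
  by (rule fmat_eqI) (auto simp: ent_idm ent_unit_at)

lemma unit_unit: "unit_at a b * unit_at c d = (if b = c then unit_at a d else 0)"
  by (rule fmat_eqI) (auto simp: ent_unit_times ent_unit_at)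

lemma unit_times_unit: "unit_at a b * A * unit_at c d = ent A b c *\<^sub>C unit_at a d"
  by (rule fmat_eqI) (auto simp: ent_unit_times ent_times_unit ent_unit_at)

lemma idm_times_iff: "idm n * A = A \<longleftrightarrow> (\<forall>i j. n \<le> i \<longrightarrow> ent A i j = 0)"
proof
  assume h: "idm n * A = A"
  show "\<forall>i j. n \<le> i \<longrightarrow> ent A i j = 0" by (subst h[symmetric]) (simp add: ent_idm_times)
qed (auto intro!: fmat_eqI simp: ent_idm_times)
lemma times_idm_iff: "A * idm n = A \<longleftrightarrow> (\<forall>i j. n \<le> j \<longrightarrow> ent A i j = 0)"
proof
  assume h: "A * idm n = A"
  show "\<forall>i j. n \<le> j \<longrightarrow> ent A i j = 0" by (subst h[symmetric]) (simp add: ent_times_idm)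
qed (auto intro!: fmat_eqI simp: ent_times_idm)


section \<open>Rank factorisation and idempotents\<close>

lemma times_right: "X = Y \<Longrightarrow> X * D = Y * (D::fmat)" by simp

text \<open>
  Wedderburn's rank reduction: if \<open>a = ent A x y\<close> is nonzero, then subtracting from \<open>A\<close> the rank one
  matrix \<open>A * unit_at y x * A\<close>, divided by \<open>a\<close>, clears row \<open>x\<close> and column \<open>y\<close> and creates no new
  nonzero row. A factorisation of the remainder through a space of dimension \<open>c\<close> is extended by one
  coordinate.
\<close>

lemma rank_factorization:
  fixes A :: fmat
  shows "\<exists>c Z Z' L L'. A = Z * Z' \<and> L * Z = idm c \<and> Z' * L' = idm c \<and> Z * idm c = Z \<and> idm c * Z' = Z'"
proof (induct "card {i. \<exists>j. ent A i j \<noteq> 0}" arbitrary: A rule: less_induct)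
  case less
  obtain n where n: "\<And>i j. n \<le> i \<or> n \<le> j \<Longrightarrow> ent A i j = 0" using ent_bound[of A] by blast
  have fin: "finite {i. \<exists>j. ent A i j \<noteq> 0}"
    by (rule finite_subset[of _ "{..<n}"]) (use n in \<open>auto simp: not_less[symmetric]\<close>)
  show ?case
  proof (cases "A = 0")
    case True
    thus ?thesis by (intro exI[of _ "0::nat"] exI[of _ "0::fmat"]) auto
  next
    case False
    then obtain x y where xy: "ent A x y \<noteq> 0" using fmat_eqI[of A 0] by auto
    define a where "a = ent A x y"
    have a: "a \<noteq> 0" using xy by (simp add: a_def)
    define A' where "A' = A - inverse a *\<^sub>C (A * unit_at y x * A)"
    have entA': "ent A' i j = ent A i j - inverse a * ent A i y * ent A x j" for i j
    proof -
      have "ent (A * unit_at y x * A) i j = ent (A * unit_at y x) i x * ent A x j"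
        by (subst ent_times[where K="{x}"]) (auto simp: ent_times_unit)
      thus ?thesis by (simp add: A'_def ent_times_unit)
    qed
    have row: "ent A' x j = 0" for j using a by (simp add: entA' a_def[symmetric])
    have col: "ent A' i y = 0" for i using a by (simp add: entA' a_def[symmetric])
    have "{i. \<exists>j. ent A' i j \<noteq> 0} \<subset> {i. \<exists>j. ent A i j \<noteq> 0}"
    proof (rule psubsetI)
      show "{i. \<exists>j. ent A' i j \<noteq> 0} \<subseteq> {i. \<exists>j. ent A i j \<noteq> 0}"
      proof clarify
        fix i j assume "ent A' i j \<noteq> 0"
        thus "\<exists>j. ent A i j \<noteq> 0" unfolding entA' by (metis diff_zero mult_zero_left mult_zero_right)
      qed
      have "x \<in> {i. \<exists>j. ent A i j \<noteq> 0}" "x \<notin> {i. \<exists>j. ent A' i j \<noteq> 0}" using xy row by auto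
      thus "{i. \<exists>j. ent A' i j \<noteq> 0} \<noteq> {i. \<exists>j. ent A i j \<noteq> 0}" by blast
    qed
    hence "card {i. \<exists>j. ent A' i j \<noteq> 0} < card {i. \<exists>j. ent A i j \<noteq> 0}" by (rule psubset_card_mono[OF fin])
    from less[OF this] obtain c Z1 Z1' L1 L1' where ih: "A' = Z1 * Z1'" "L1 * Z1 = idm c" "Z1' * L1' = idm c"
      "Z1 * idm c = Z1" "idm c * Z1' = Z1'" by blast
    have Z1: "Z1 = A' * L1'" and Z1': "Z1' = L1 * A'"
      by (simp_all add: ih(1) mult.assoc ih(3,4)) (simp_all add: mult.assoc[symmetric] ih(2,5))
    have z1: "Z1 * unit_at c k = 0" for k
    proof -
      have "idm c * unit_at c k = 0" by (rule fmat_eqI) (auto simp: ent_idm_times ent_unit_at)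
      hence "Z1 * idm c * unit_at c k = 0" by (simp add: mult.assoc)
      thus ?thesis by (simp add: ih(4))
    qed
    have z2: "unit_at k c * Z1' = 0" for k
    proof -
      have "unit_at k c * idm c = 0" by (rule fmat_eqI) (auto simp: ent_times_idm ent_unit_at)
      hence "unit_at k c * (idm c * Z1') = 0" by (simp add: mult.assoc[symmetric])
      thus ?thesis by (simp add: ih(5))
    qed
    have z3: "unit_at k x * Z1 = 0" for k
    proof -
      have "unit_at k x * A' = 0" by (rule fmat_eqI) (auto simp: ent_unit_times row)
      thus ?thesis unfolding Z1 by (simp add: mult.assoc[symmetric])
    qed
    have z4: "Z1' * unit_at y k = 0" for k
    proof -
      have "A' * unit_at y k = 0" by (rule fmat_eqI) (auto simp: ent_times_unit col)
      thus ?thesis unfolding Z1' by (simp add: mult.assoc)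
    qed
    have ua: "unit_at k x * (A * unit_at y j) = a *\<^sub>C unit_at k j" for k j
      using unit_times_unit[of k x A y j] by (simp add: a_def mult.assoc)
    define Z where "Z = Z1 + A * unit_at y c"
    define Z' where "Z' = Z1' + inverse a *\<^sub>C (unit_at c x * A)"
    define L where "L = L1 - inverse a *\<^sub>C (L1 * (A * unit_at y x)) + inverse a *\<^sub>C unit_at c x"
    define L' where "L' = L1' - inverse a *\<^sub>C (unit_at y x * (A * L1')) + unit_at y c"
    have "Z * Z' = A"
    proof -
      have "unit_at y c * (unit_at c x * A) = unit_at y x * A" by (simp add: mult.assoc[symmetric] unit_unit)
      moreover have "Z1 * (unit_at c x * A) = 0" by (simp add: mult.assoc[symmetric] z1)
      ultimately show ?thesis
        by (simp add: Z_def Z'_def algebra_simps z2 ih(1)[symmetric])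
           (simp add: A'_def mult.assoc)
    qed
    moreover have "L * Z = idm (Suc c)"
    proof -
      have e1: "L1 * (A * unit_at y x) * Z1 = 0" by (simp add: mult.assoc z3)
      have e2: "L1 * (A * unit_at y x) * (A * unit_at y c) = a *\<^sub>C (L1 * (A * unit_at y c))"
        by (simp add: mult.assoc ua)
      show ?thesis using a
        by (simp add: L_def Z_def distrib_left distrib_right left_diff_distrib ih(2) e1 e2 z3 ua idm_Suc
           del: mult_minus_left)
    qed
    moreover have "Z' * L' = idm (Suc c)"
    proof -
      have e1: "Z1' * (unit_at y x * (A * L1')) = 0" by (simp add: mult.assoc[symmetric] z4)
      have e2: "unit_at c x * A * (unit_at y x * (A * L1')) = a *\<^sub>C (unit_at c x * (A * L1'))"
        using times_right[OF ua[of c x], of "A * L1'"] by (simp add: mult.assoc)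
      have e3: "unit_at c x * A * unit_at y c = a *\<^sub>C unit_at c c" by (simp add: ua mult.assoc)
      have e4: "unit_at c x * A * L1' = unit_at c x * (A * L1')" by (rule mult.assoc)
      show ?thesis using a
        by (simp add: L'_def Z'_def distrib_left distrib_right right_diff_distrib ih(3) e1 e2 e3 e4 z4 idm_Suc)
    qed
    moreover have "Z * idm (Suc c) = Z"
    proof -
      have "A * unit_at y c * idm c = 0"
        by (rule fmat_eqI) (auto simp: ent_times_idm ent_times_unit)
      thus ?thesis by (simp add: Z_def idm_Suc distrib_left distrib_right ih(4) z1 mult.assoc unit_unit)
    qed
    moreover have "idm (Suc c) * Z' = Z'"
    proof -
      have "idm c * (unit_at c x * A) = 0"
        by (rule fmat_eqI) (auto simp: ent_idm_times ent_unit_times)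
      thus ?thesis
        by (simp add: Z'_def idm_Suc distrib_left distrib_right ih(5) z2 mult.assoc[symmetric] unit_unit)
    qed
    ultimately show ?thesis by blast
  qed
qed

lemma von_neumann_regular:
  fixes A :: fmat
  obtains B where "A * B * A = A" "B * A * B = B"
proof -
  obtain c Z Z' L L' where f: "A = Z * Z'" "L * Z = idm c" "Z' * L' = idm c" "Z * idm c = Z" "idm c * Z' = Z'"
    using rank_factorization[of A] by blast
  define C where "C = L' * L"
  have "A * C * A = Z * (Z' * L') * (L * Z) * Z'" by (simp add: f(1) C_def mult.assoc)
  also have "\<dots> = A" unfolding f(2,3) by (simp add: f(1,4))
  finally have 1: "A * C * A = A" .
  show ?thesis
    by (rule that[of "C * A * C"])
       (simp_all add: mult.assoc 1[unfolded mult.assoc] times_right[OF 1, unfolded mult.assoc])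
qed

text \<open>
  An idempotent is the projection onto a space of dimension \<open>c\<close>: the columns of \<open>Z\<close> are a basis of its
  image and the rows of \<open>Z'\<close> are the dual coordinates. The trace therefore counts dimensions, which is
  how ranks enter all later arguments.
\<close>

lemma idempotent_split:
  assumes "P * P = P"
  obtains c Z Z' where "P = Z * Z'" "Z' * Z = idm c" "Z * idm c = Z" "idm c * Z' = Z'" "trc P = of_nat c"
proof -
  obtain c Z Z' L L' where f: "P = Z * Z'" "L * Z = idm c" "Z' * L' = idm c" "Z * idm c = Z" "idm c * Z' = Z'"
    using rank_factorization[of P] by blast
  have "L * (P * P) * L' = L * P * L'" by (simp add: assms)
  hence "(L * Z) * (Z' * Z) * (Z' * L') = (L * Z) * (Z' * L')" by (simp add: f(1) mult.assoc)
  hence "idm c * (Z' * Z) * idm c = idm c" by (simp add: f(2,3))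
  hence ZZ: "Z' * Z = idm c" by (simp add: mult.assoc f(4)) (simp add: mult.assoc[symmetric] f(5))
  have "trc P = trc (Z' * Z)" by (simp add: f(1) trc_commute)
  thus ?thesis using that f ZZ by simp
qed

lemma trc_idempotent_eq_0:
  assumes "P * P = P" "trc P = 0" shows "P = 0"
proof -
  obtain c Z Z' where "P = Z * Z'" "Z' * Z = idm c" "Z * idm c = Z" "idm c * Z' = Z'" "trc P = of_nat c"
    by (rule idempotent_split[OF assms(1)])
  hence "c = 0" using assms(2) by simp
  hence "Z = 0" using \<open>Z * idm c = Z\<close> by simp
  thus ?thesis using \<open>P = Z * Z'\<close> by simp
qed

lemma trc_idempotent_nat:
  assumes "P * P = P" obtains c where "trc P = of_nat c"
  using assms that by (rule idempotent_split)

text \<open>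
  The two equations say that \<open>P\<close> and \<open>P'\<close> have the same image.
\<close>

lemma trc_same_image: "P * P' = P' \<Longrightarrow> P' * P = P \<Longrightarrow> trc P = trc P'"
  by (metis trc_commute)

lemma idempotent_le_same_trc:
  assumes "P * P = P" "N * N = N" "N * P = P" "P * N = P" "trc P = trc N"
  shows "P = N"
proof -
  have "(N - P) * (N - P) = N - P" by (simp add: algebra_simps assms)
  moreover have "trc (N - P) = 0" by (simp add: trc_diff assms)
  ultimately have "N - P = 0" by (rule trc_idempotent_eq_0)
  thus ?thesis by simp
qed

text \<open>
  The orthogonal projection onto the image of \<open>P\<close> is \<open>P * C * adj P\<close> for a generalised inverse \<open>C\<close> of
  \<open>adj P * P\<close>; by positivity \<open>adj P\<close> can be cancelled on the left. Unlike arbitrary idempotents, orthogonal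
  projections have bounded entries, so they can replace the points of a Grassmannian in
  compactness arguments.
\<close>

lemma hermitian_idempotent:
  assumes "P * P = P"
  obtains H where "H * H = H" "adj H = H" "P * H = H" "H * P = P"
    "\<And>N. adj N = N \<Longrightarrow> N * P = P \<Longrightarrow> N * H = H \<and> H * N = H"
proof -
  obtain C where C: "adj P * P * C * (adj P * P) = adj P * P" by (rule von_neumann_regular)
  \<comment> \<open>Positivity: \<open>adj P\<close> is injective on the image of \<open>P\<close>.\<close>
  have star: "P * X = P * Y" if "adj P * (P * X) = adj P * (P * Y)" for X Y
  proof -
    have "adj (P * X - P * Y) * (P * X - P * Y) = (adj X - adj Y) * (adj P * (P * X) - adj P * (P * Y))"
      by (simp add: adj_diff adj_times algebra_simps)
    hence "adj (P * X - P * Y) * (P * X - P * Y) = 0" using that by simp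
    from adj_times_self_eq_0[OF this] show ?thesis by simp
  qed
  define H where "H = P * C * adj P"
  have HP: "H * P = P"
  proof -
    have "P * (C * adj P * P) = P * P"
      by (rule star) (use C assms in \<open>simp add: mult.assoc\<close>)
    thus ?thesis by (simp add: H_def mult.assoc assms)
  qed
  have PH: "P * H = H" by (simp add: H_def mult.assoc[symmetric] assms)
  have HH: "H * H = H" using times_right[OF HP, of "C * adj P"] by (simp add: H_def mult.assoc)
  have aH: "adj H = P * adj C * adj P" by (simp add: H_def adj_times mult.assoc)
  have "adj P * P * adj C * (adj P * P) = adj P * P"
    using arg_cong[OF C, of adj] by (simp add: adj_times mult.assoc)
  hence "P * (adj C * adj P * P) = P * P"
    by (intro star) (use assms in \<open>simp add: mult.assoc\<close>)
  hence aHP: "adj H * P = P" by (simp add: aH mult.assoc assms)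
  have aHH: "adj H * H = H" using times_right[OF aHP, of H] by (simp add: mult.assoc PH)
  have "adj H * H = adj H" using arg_cong[OF aHH, of adj] by (simp add: adj_times)
  hence H: "adj H = H" using aHH by simp
  show ?thesis
  proof (rule that[OF HH H PH HP])
    fix N assume N: "adj N = N" "N * P = P"
    have 1: "N * H = H" using times_right[OF N(2), of H] by (simp add: mult.assoc PH)
    moreover have "H * N = H" using arg_cong[OF 1, of adj] by (simp add: adj_times H N)
    ultimately show "N * H = H \<and> H * N = H" ..
  qed
qed

text \<open>
  The sum of the squared absolute values of the entries is \<open>trc (adj H * H) = trc H\<close>, the rank of \<open>H\<close>.
\<close>

lemma hermitian_idempotent_ent_le:
  assumes "H * H = H" "adj H = H" "idm n * H = H" "H * idm n = H"
  shows "cmod (ent H i j) \<le> real n + 1"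
proof (cases "i < n \<and> j < n")
  case True
  have H: "ent H i j = 0" if "n \<le> i \<or> n \<le> j" for i j using that assms(3,4)
    by (auto simp: idm_times_iff times_idm_iff)
  have t: "trc H = of_real (\<Sum>i<n. \<Sum>j<n. (cmod (ent H i j))\<^sup>2)"
    using trc_adj_times_self[of n n H] H assms(1,2) by simp
  have "(idm n - H) * (idm n - H) = idm n - H" by (simp add: algebra_simps assms)
  then obtain d where d: "trc (idm n - H) = of_nat d" by (rule trc_idempotent_nat)
  obtain c where c: "trc H = of_nat c" by (rule trc_idempotent_nat[OF assms(1)])
  have "of_nat c + of_nat d = (of_nat n :: complex)" using c d by (simp add: trc_diff algebra_simps)
  hence "c + d = n" by (metis of_nat_add of_nat_eq_iff)
  hence cn: "c \<le> n" by simp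
  have "complex_of_real (\<Sum>i<n. \<Sum>j<n. (cmod (ent H i j))\<^sup>2) = complex_of_real (real c)"
    using t c by simp
  hence "(\<Sum>i<n. \<Sum>j<n. (cmod (ent H i j))\<^sup>2) = real c" by (simp only: of_real_eq_iff)
  moreover have "(cmod (ent H i j))\<^sup>2 \<le> (\<Sum>j<n. (cmod (ent H i j))\<^sup>2)"
    by (rule member_le_sum[of j "{..<n}" "\<lambda>j. (cmod (ent H i j))\<^sup>2"]) (use True in auto)
  moreover have "\<dots> \<le> (\<Sum>i<n. \<Sum>j<n. (cmod (ent H i j))\<^sup>2)"
    by (rule member_le_sum[of i "{..<n}" "\<lambda>i. \<Sum>j<n. (cmod (ent H i j))\<^sup>2"]) (use True in \<open>auto intro: sum_nonneg\<close>)
  ultimately have "(cmod (ent H i j))\<^sup>2 \<le> real n" using cn by linarith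
  also have "\<dots> \<le> (real n + 1)\<^sup>2" by (simp add: power2_eq_square algebra_simps)
  finally show ?thesis by (rule power2_le_imp_le) simp
next
  case False
  hence "ent H i j = 0" using assms(3,4) by (auto simp: idm_times_iff times_idm_iff not_less)
  thus ?thesis by simp
qed

text \<open>
  If \<open>B\<close> is a generalised inverse of \<open>A\<close> inside the corner ring of \<open>N\<close>, then
  \<open>N - B * A = (N - A) * (N - B * A)\<close>, and \<open>norm (N - A) < 1\<close> forces both sides to vanish. No
  completeness of the ring is involved.
\<close>

lemma corner_inverse:
  fixes N :: fmat
  assumes N: "N * N = N" and A: "N * A = A" "A * N = A" and d: "norm (N - A) < 1"
  obtains B where "N * B = B" "B * N = B" "A * B = N" "B * A = N"
proof -
  obtain C where C: "A * C * A = A" "C * A * C = C" by (rule von_neumann_regular)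
  define B where "B = N * C * N"
  have AB: "A * B * A = A"
    by (simp add: B_def mult.assoc A C(1)[unfolded mult.assoc] times_right[OF A(2), unfolded mult.assoc])
  have NB: "N * B = B" "B * N = B"
    by (simp_all add: B_def mult.assoc N times_right[OF N, unfolded mult.assoc])
  have "N - B * A = (N - A) * (N - B * A)"
    using AB times_right[OF NB(1), of A] by (simp add: right_diff_distrib left_diff_distrib mult.assoc A N)
  hence "norm (N - B * A) \<le> norm (N - A) * norm (N - B * A)" by (metis norm_mult_ineq)
  hence "(1 - norm (N - A)) * norm (N - B * A) \<le> 0" by (simp add: algebra_simps)
  hence "norm (N - B * A) \<le> 0" using d by (simp add: mult_le_0_iff)
  hence BA: "B * A = N" by simp
  have "A * B = N"
  proof (rule idempotent_le_same_trc)
    show "A * B * (A * B) = A * B" using times_right[OF AB, of B] by (simp add: mult.assoc)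
    show "trc (A * B) = trc N" by (simp add: BA trc_commute[of A])
    show "N * (A * B) = A * B" using times_right[OF A(1), of B] by (simp add: mult.assoc)
    show "A * B * N = A * B" by (simp add: mult.assoc NB)
  qed (rule N)
  thus ?thesis using that NB BA by blast
qed

lemma corner_inverse_tendsto:
  fixes A :: "nat \<Rightarrow> fmat"
  assumes N: "N * N = N" and A: "\<And>k. N * A k = A k" "\<And>k. A k * N = A k" and lim: "A \<longlonglongrightarrow> N"
  obtains B where "\<forall>\<^sub>F k in sequentially. N * B k = B k \<and> B k * N = B k \<and> A k * B k = N \<and> B k * A k = N" "B \<longlonglongrightarrow> N"
proof -
  have lim0: "(\<lambda>k. norm (N - A k)) \<longlonglongrightarrow> 0"
    using tendsto_norm[OF tendsto_diff[OF tendsto_const lim], of N] by simp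
  have ev: "\<forall>\<^sub>F k in sequentially. norm (N - A k) < 1/2"
    using order_tendstoD(2)[OF lim0, of "1/2"] by simp
  define B where "B k = (SOME B. N * B = B \<and> B * N = B \<and> A k * B = N \<and> B * A k = N)" for k
  have B: "N * B k = B k \<and> B k * N = B k \<and> A k * B k = N \<and> B k * A k = N" if "norm (N - A k) < 1/2" for k
  proof -
    have "norm (N - A k) < 1" using that by simp
    then obtain B' where "N * B' = B' \<and> B' * N = B' \<and> A k * B' = N \<and> B' * A k = N"
      using corner_inverse[OF N A, of k] by metis
    thus ?thesis unfolding B_def by (rule someI)
  qed
  have bd: "norm (B k - N) \<le> norm (N - A k) * (2 * norm N)" if h: "norm (N - A k) < 1/2" for k
  proof -
    have e: "B k - N = (N - A k) * B k" using B[OF h] by (simp add: left_diff_distrib)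
    have "norm (B k) \<le> norm N + norm (B k - N)" using norm_triangle_ineq[of N "B k - N"] by simp
    also have "norm (B k - N) \<le> norm (N - A k) * norm (B k)" unfolding e by (rule norm_mult_ineq)
    also have "\<dots> \<le> 1/2 * norm (B k)" using h by (intro mult_right_mono) auto
    finally have "norm (B k) \<le> 2 * norm N" by simp
    hence "norm (N - A k) * norm (B k) \<le> norm (N - A k) * (2 * norm N)" by (intro mult_left_mono) auto
    thus ?thesis unfolding e using norm_mult_ineq[of "N - A k" "B k"] by linarith
  qed
  have "(\<lambda>k. B k - N) \<longlonglongrightarrow> 0"
  proof (rule tendsto_0_le[OF lim0, where K = "2 * norm N"])
    show "\<forall>\<^sub>F k in sequentially. norm (B k - N) \<le> norm (norm (N - A k)) * (2 * norm N)"
      using ev by eventually_elim (use bd in simp)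
  qed
  hence "B \<longlonglongrightarrow> N" by (simp add: LIM_zero_iff)
  moreover have "\<forall>\<^sub>F k in sequentially. N * B k = B k \<and> B k * N = B k \<and> A k * B k = N \<and> B k * A k = N"
    using ev by eventually_elim (rule B)
  ultimately show ?thesis using that by blast
qed


section \<open>Representations by finitary matrices and Schur's lemma\<close>

text \<open>
  The idempotent \<open>N v\<close> stands for the vector space at the vertex \<open>v\<close>. Arbitrary idempotents are
  allowed, so that a subrepresentation of a representation is again a representation.
\<close>

definition fm_rep :: "('v,'e) pre_digraph \<Rightarrow> ('v \<Rightarrow> fmat) \<Rightarrow> ('e \<Rightarrow> fmat) \<Rightarrow> bool" where
  "fm_rep Q N V \<longleftrightarrow> (\<forall>v\<in>verts Q. N v * N v = N v) \<and>
     (\<forall>e\<in>arcs Q. N (head Q e) * V e = V e \<and> V e * N (tail Q e) = V e)"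

text \<open>
  A subrepresentation is described by a projection \<open>P v\<close> onto its space at each vertex. The projection
  is not determined by the subspace; stability does not depend on the choice, since the weight
  only involves the traces.
\<close>

definition fm_sub :: "('v,'e) pre_digraph \<Rightarrow> ('v \<Rightarrow> fmat) \<Rightarrow> ('e \<Rightarrow> fmat) \<Rightarrow> ('v \<Rightarrow> fmat) \<Rightarrow> bool" where
  "fm_sub Q N V P \<longleftrightarrow> (\<forall>v\<in>verts Q. P v * P v = P v \<and> N v * P v = P v \<and> P v * N v = P v) \<and>
     (\<forall>e\<in>arcs Q. P (head Q e) * (V e * P (tail Q e)) = V e * P (tail Q e))"

definition fm_weight :: "('v,'e) pre_digraph \<Rightarrow> ('v \<Rightarrow> int) \<Rightarrow> ('v \<Rightarrow> fmat) \<Rightarrow> real" where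
  "fm_weight Q \<theta> N = (\<Sum>v\<in>verts Q. of_int (\<theta> v) * Re (trc (N v)))"

text \<open>
  With \<open>\<theta> = 0\<close> all weights vanish and this is simplicity, so that both sides of the final equivalence
  are instances of one notion.
\<close>

definition fm_stable :: "('v,'e) pre_digraph \<Rightarrow> ('v \<Rightarrow> int) \<Rightarrow> ('v \<Rightarrow> fmat) \<Rightarrow> ('e \<Rightarrow> fmat) \<Rightarrow> bool" where
  "fm_stable Q \<theta> N V \<longleftrightarrow> (\<exists>v\<in>verts Q. N v \<noteq> 0) \<and> fm_weight Q \<theta> N = 0 \<and>
     (\<forall>P. fm_sub Q N V P \<longrightarrow>
        (\<forall>v\<in>verts Q. P v = 0) \<or> (\<forall>v\<in>verts Q. P v = N v) \<or> 0 < fm_weight Q \<theta> P)"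

definition fm_hom :: "('v,'e) pre_digraph \<Rightarrow> ('v \<Rightarrow> fmat) \<Rightarrow> ('e \<Rightarrow> fmat) \<Rightarrow> ('v \<Rightarrow> fmat) \<Rightarrow> ('e \<Rightarrow> fmat)
    \<Rightarrow> ('v \<Rightarrow> fmat) \<Rightarrow> bool" where
  "fm_hom Q N V N' V' f \<longleftrightarrow> (\<forall>v\<in>verts Q. N' v * f v = f v \<and> f v * N v = f v) \<and>
     (\<forall>e\<in>arcs Q. f (head Q e) * V e = V' e * f (tail Q e))"

lemma fm_weight_cong: "(\<And>v. v \<in> verts Q \<Longrightarrow> trc (P v) = trc (P' v)) \<Longrightarrow> fm_weight Q \<theta> P = fm_weight Q \<theta> P'"
  by (simp add: fm_weight_def)

lemma fm_weight_add:
  "(\<And>v. v \<in> verts Q \<Longrightarrow> trc (P v) = trc (A v) + trc (B v)) \<Longrightarrow>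
    fm_weight Q \<theta> P = fm_weight Q \<theta> A + fm_weight Q \<theta> B"
  by (simp add: fm_weight_def algebra_simps sum.distrib)

lemma fm_weight_0: "(\<And>v. v \<in> verts Q \<Longrightarrow> P v = 0) \<Longrightarrow> fm_weight Q \<theta> P = 0"
  by (simp add: fm_weight_def)

lemma fm_stable_sub_cases:
  assumes "fm_stable Q \<theta> N V" "fm_sub Q N V P"
  shows "0 \<le> fm_weight Q \<theta> P"
    "fm_weight Q \<theta> P = 0 \<Longrightarrow> (\<forall>v\<in>verts Q. P v = 0) \<or> (\<forall>v\<in>verts Q. P v = N v)"
proof -
  have c: "(\<forall>v\<in>verts Q. P v = 0) \<or> (\<forall>v\<in>verts Q. P v = N v) \<or> 0 < fm_weight Q \<theta> P"
    using assms by (simp add: fm_stable_def)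
  have "(\<forall>v\<in>verts Q. P v = N v) \<Longrightarrow> fm_weight Q \<theta> P = 0"
    using assms(1) fm_weight_cong[of Q P N \<theta>] by (simp add: fm_stable_def)
  moreover have "(\<forall>v\<in>verts Q. P v = 0) \<Longrightarrow> fm_weight Q \<theta> P = 0" by (rule fm_weight_0) simp
  ultimately show "0 \<le> fm_weight Q \<theta> P" using c by linarith
  show "fm_weight Q \<theta> P = 0 \<Longrightarrow> (\<forall>v\<in>verts Q. P v = 0) \<or> (\<forall>v\<in>verts Q. P v = N v)"
    using c by auto
qed

lemma wf_ends: "wf_digraph Q \<Longrightarrow> e \<in> arcs Q \<Longrightarrow> head Q e \<in> verts Q"
  "wf_digraph Q \<Longrightarrow> e \<in> arcs Q \<Longrightarrow> tail Q e \<in> verts Q"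
  by (auto simp: wf_digraph.head_in_verts wf_digraph.tail_in_verts)

lemma fm_hom_comp:
  assumes "fm_hom Q N1 V1 N2 V2 f" "fm_hom Q N2 V2 N3 V3 g"
  shows "fm_hom Q N1 V1 N3 V3 (\<lambda>v. g v * f v)"
  unfolding fm_hom_def
proof (intro conjI ballI)
  fix v assume v: "v \<in> verts Q"
  show "N3 v * (g v * f v) = g v * f v" using assms(2) v by (simp add: fm_hom_def mult.assoc[symmetric])
  show "g v * f v * N1 v = g v * f v" using assms(1) v by (simp add: fm_hom_def mult.assoc)
next
  fix e assume e: "e \<in> arcs Q"
  have f: "f (head Q e) * V1 e = V2 e * f (tail Q e)" and g: "g (head Q e) * V2 e = V3 e * g (tail Q e)"
    using assms e by (auto simp: fm_hom_def)
  show "g (head Q e) * f (head Q e) * V1 e = V3 e * (g (tail Q e) * f (tail Q e))"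
    using times_right[OF g, of "f (tail Q e)"] by (simp add: mult.assoc f)
qed

text \<open>
  Projections onto the kernel and onto the image of a homomorphism, from a generalised inverse \<open>B\<close>:
  \<open>N - B f\<close> and \<open>f B\<close>. As \<open>trc (f B) = trc (B f)\<close>, the weights add up.
\<close>

lemma hom_kernel_image:
  assumes wf: "wf_digraph Q" and V: "fm_rep Q N V" and V': "fm_rep Q N' V'" and f: "fm_hom Q N V N' V' f"
  obtains K R B where "fm_sub Q N V K" "fm_sub Q N' V' R"
    "\<forall>v\<in>verts Q. f v * K v = 0 \<and> R v * f v = f v \<and> B v * f v = N v - K v \<and> f v * B v = R v \<and>
      N v * B v = B v \<and> B v * N' v = B v"
    "fm_weight Q \<theta> N = fm_weight Q \<theta> K + fm_weight Q \<theta> R"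
proof -
  define C where "C v = (SOME B. f v * B * f v = f v)" for v
  have C: "f v * C v * f v = f v" for v
  proof -
    obtain B where "f v * B * f v = f v" by (rule von_neumann_regular)
    thus ?thesis unfolding C_def by (rule someI)
  qed
  define B where "B v = N v * C v * N' v" for v
  have N: "N v * N v = N v" "N' v * N' v = N' v" if "v \<in> verts Q" for v
    using V V' that by (auto simp: fm_rep_def)
  have fN: "N' v * f v = f v" "f v * N v = f v" if "v \<in> verts Q" for v
    using f that by (auto simp: fm_hom_def)
  have fB: "f v * (B v * f v) = f v" if "v \<in> verts Q" for v
    by (simp add: B_def mult.assoc fN[OF that] times_right[OF fN(2)[OF that], unfolded mult.assoc]
        C[unfolded mult.assoc])
  have NB: "N v * B v = B v" "B v * N' v = B v" if "v \<in> verts Q" for v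
    by (simp_all add: B_def mult.assoc N[OF that] times_right[OF N(1)[OF that], unfolded mult.assoc])
  note fB' = times_right[OF fB, unfolded mult.assoc]
  note NB' = times_right[OF NB(1), unfolded mult.assoc] times_right[OF NB(2), unfolded mult.assoc]
  note fN' = times_right[OF fN(1), unfolded mult.assoc] times_right[OF fN(2), unfolded mult.assoc]
  define K where "K v = N v - B v * f v" for v
  define R where "R v = f v * B v" for v
  have NV: "N (head Q e) * V e = V e" "V e * N (tail Q e) = V e"
    "N' (head Q e) * V' e = V' e" "V' e * N' (tail Q e) = V' e" if "e \<in> arcs Q" for e
    using V V' that by (auto simp: fm_rep_def)
  note NV' = times_right[OF NV(1), unfolded mult.assoc] times_right[OF NV(2), unfolded mult.assoc]
    times_right[OF NV(3), unfolded mult.assoc] times_right[OF NV(4), unfolded mult.assoc]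
  have eq: "f (head Q e) * V e = V' e * f (tail Q e)" if "e \<in> arcs Q" for e
    using f that by (auto simp: fm_hom_def)
  note eq' = times_right[OF eq, unfolded mult.assoc]
  note ends = wf_ends[OF wf]
  have fK: "f v * K v = 0" if "v \<in> verts Q" for v
    using that by (simp add: K_def right_diff_distrib fN fB)
  have subK: "fm_sub Q N V K"
    unfolding fm_sub_def
  proof (intro conjI ballI)
    fix v assume v: "v \<in> verts Q"
    show "K v * K v = K v"
      by (simp add: K_def algebra_simps mult.assoc v N fN fB fB' NB NB' fN')
    show "N v * K v = K v" "K v * N v = K v"
      by (simp_all add: K_def algebra_simps mult.assoc v N fN fB fB' NB NB' fN')
  next
    fix e assume e: "e \<in> arcs Q"
    have "f (head Q e) * (V e * K (tail Q e)) = 0"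
      by (simp add: eq'[OF e] fK[OF ends(2)[OF e]])
    thus "K (head Q e) * (V e * K (tail Q e)) = V e * K (tail Q e)"
      by (simp add: K_def[of "head Q e"] left_diff_distrib mult.assoc NV' e)
  qed
  have subR: "fm_sub Q N' V' R"
    unfolding fm_sub_def
  proof (intro conjI ballI)
    fix v assume v: "v \<in> verts Q"
    show "R v * R v = R v" "N' v * R v = R v" "R v * N' v = R v"
      by (simp_all add: R_def mult.assoc v N fN fB fB' NB NB' fN')
  next
    fix e assume e: "e \<in> arcs Q"
    have "V' e * R (tail Q e) = f (head Q e) * (V e * B (tail Q e))"
      by (simp add: R_def eq'[OF e])
    thus "R (head Q e) * (V' e * R (tail Q e)) = V' e * R (tail Q e)"
      by (simp add: R_def[of "head Q e"] mult.assoc fB'[OF ends(1)[OF e]])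
  qed
  have tr: "trc (N v) = trc (K v) + trc (R v)" for v
    by (simp add: K_def R_def trc_diff trc_commute[of "f v"])
  show ?thesis
    by (rule that[OF subK subR, of B])
       (use fK fB NB fm_weight_add[of Q N K R \<theta>] tr in \<open>simp_all add: R_def K_def mult.assoc\<close>)
qed

text \<open>
  Schur's lemma: the kernel and the image of a homomorphism between stable representations both
  have nonnegative weight, and the weights add up to zero.
\<close>

lemma schur_iso:
  assumes wf: "wf_digraph Q" and V: "fm_rep Q N V" and V': "fm_rep Q N' V'" and f: "fm_hom Q N V N' V' f"
    and st: "fm_stable Q \<theta> N V" "fm_stable Q \<theta> N' V'" and nz: "\<exists>v\<in>verts Q. f v \<noteq> 0"
  obtains g where "fm_hom Q N' V' N V g" "\<forall>v\<in>verts Q. g v * f v = N v \<and> f v * g v = N' v"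
proof -
  obtain K R B where KR0: "fm_sub Q N V K" "fm_sub Q N' V' R"
    "\<forall>v\<in>verts Q. f v * K v = 0 \<and> R v * f v = f v \<and> B v * f v = N v - K v \<and> f v * B v = R v \<and>
      N v * B v = B v \<and> B v * N' v = B v"
    "fm_weight Q \<theta> N = fm_weight Q \<theta> K + fm_weight Q \<theta> R"
    by (rule hom_kernel_image[OF wf V V' f, of \<theta>])
  have KR1: "f v * K v = 0" "R v * f v = f v" "B v * f v = N v - K v" "f v * B v = R v"
      "N v * B v = B v" "B v * N' v = B v" if "v \<in> verts Q" for v using KR0(3) that by auto
  note KR = KR0(1,2) KR1 KR0(4)
  have fN: "N' v * f v = f v" "f v * N v = f v" if "v \<in> verts Q" for v
    using f that by (auto simp: fm_hom_def)
  have "fm_weight Q \<theta> N = 0" using st by (simp add: fm_stable_def)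
  hence w: "fm_weight Q \<theta> K = 0" "fm_weight Q \<theta> R = 0"
    using KR(9) fm_stable_sub_cases(1)[OF st(1) KR(1)] fm_stable_sub_cases(1)[OF st(2) KR(2)] by linarith+
  have K: "\<forall>v\<in>verts Q. K v = 0"
    using fm_stable_sub_cases(2)[OF st(1) KR(1) w(1)] nz KR(3) fN(2) by metis
  have R: "\<forall>v\<in>verts Q. R v = N' v"
    using fm_stable_sub_cases(2)[OF st(2) KR(2) w(2)] nz KR(4) by (metis mult_zero_left)
  have 1: "B v * f v = N v" "f v * B v = N' v" if "v \<in> verts Q" for v using KR K R that by auto
  have "fm_hom Q N' V' N V B"
    unfolding fm_hom_def
  proof (intro conjI ballI)
    fix e assume e: "e \<in> arcs Q"
    note h = wf_ends(1)[OF wf e] and t = wf_ends(2)[OF wf e]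
    have "B (head Q e) * V' e = B (head Q e) * ((V' e * f (tail Q e)) * B (tail Q e))"
      using V' e 1(2)[OF t] by (simp add: fm_rep_def mult.assoc)
    also have "\<dots> = B (head Q e) * f (head Q e) * V e * B (tail Q e)"
      using f e by (simp add: fm_hom_def mult.assoc)
    also have "\<dots> = V e * B (tail Q e)" using V e 1(1)[OF h] by (simp add: fm_rep_def)
    finally show "B (head Q e) * V' e = V e * B (tail Q e)" .
  qed (use KR in auto)
  thus ?thesis using that 1 by blast
qed

lemma eigenvector_exists:
  assumes "n \<noteq> 0" "idm n * F = F" "F * idm n = F"
  obtains c X where "X \<noteq> 0" "idm n * X = X" "F * X = c *\<^sub>C X"
proof -
  define A where "A = mat n n (\<lambda>(i,j). ent F i j)"
  have A: "A \<in> carrier_mat n n" by (simp add: A_def)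
  obtain c where "c \<in> spectrum A" using spectrum_non_empty[OF A] assms(1) by auto
  then obtain x where x: "x \<in> carrier_vec n" "x \<noteq> 0\<^sub>v n" "A *\<^sub>v x = c \<cdot>\<^sub>v x"
    using A by (auto simp: spectrum_def eigenvalue_def eigenvector_def)
  define X where "X = mat_fun n 1 (\<lambda>i j. x $ i)"
  have F: "ent F i j = 0" if "n \<le> i \<or> n \<le> j" for i j
    using that assms(2,3) by (auto simp: idm_times_iff times_idm_iff)
  have "F * X = c *\<^sub>C X"
  proof (rule fmat_eqI)
    fix i j
    have E: "ent (F * X) i j = (\<Sum>k<n. ent F i k * ent X k j)"
      by (rule ent_times) (auto simp: F not_less)
    show "ent (F * X) i j = ent (c *\<^sub>C X) i j"
    proof (cases "i < n \<and> j = 0")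
      case True
      have "(A *\<^sub>v x) $ i = (c \<cdot>\<^sub>v x) $ i" by (simp add: x)
      hence "(\<Sum>k<n. ent F i k * x $ k) = c * x $ i"
        using True x(1) by (simp add: A_def scalar_prod_def lessThan_atLeast0)
      thus ?thesis using True unfolding E by (simp add: X_def ent_mat_fun)
    qed (unfold E, auto simp: X_def ent_mat_fun F)
  qed
  moreover have "X \<noteq> 0"
  proof
    assume "X = 0"
    hence "ent X i 0 = 0" for i by simp
    moreover have "ent X i 0 = x $ i" if "i < n" for i using that by (simp add: X_def ent_mat_fun)
    ultimately have "x = 0\<^sub>v n" using x(1) by (intro eq_vecI) auto
    thus False using x(2) by simp
  qed
  moreover have "idm n * X = X" by (simp add: idm_times_iff X_def ent_mat_fun)
  ultimately show ?thesis using that by blast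
qed

text \<open>
  Subtracting an eigenvalue of \<open>f w\<close> at some vertex \<open>w\<close> yields an endomorphism that is not
  injective, hence zero by \<open>schur_iso\<close>.
\<close>

lemma schur_scalar:
  assumes wf: "wf_digraph Q" and V: "fm_rep Q (\<lambda>v. idm (\<beta> v)) V" and st: "fm_stable Q \<theta> (\<lambda>v. idm (\<beta> v)) V"
    and f: "fm_hom Q (\<lambda>v. idm (\<beta> v)) V (\<lambda>v. idm (\<beta> v)) V f"
  obtains c where "\<forall>v\<in>verts Q. f v = c *\<^sub>C idm (\<beta> v)"
proof -
  obtain w where w: "w \<in> verts Q" "\<beta> w \<noteq> 0" using st by (auto simp: fm_stable_def)
  have fN: "idm (\<beta> v) * f v = f v" "f v * idm (\<beta> v) = f v" if "v \<in> verts Q" for v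
    using f that by (auto simp: fm_hom_def)
  obtain c X where X: "X \<noteq> 0" "idm (\<beta> w) * X = X" "f w * X = c *\<^sub>C X"
    by (rule eigenvector_exists[OF w(2) fN[OF w(1)]])
  define f' where "f' v = f v - c *\<^sub>C idm (\<beta> v)" for v
  have f': "fm_hom Q (\<lambda>v. idm (\<beta> v)) V (\<lambda>v. idm (\<beta> v)) V f'"
    using f V by (auto simp: fm_hom_def fm_rep_def f'_def algebra_simps)
  have "\<forall>v\<in>verts Q. f' v = 0"
  proof (rule ccontr)
    assume "\<not> (\<forall>v\<in>verts Q. f' v = 0)"
    hence "\<exists>v\<in>verts Q. f' v \<noteq> 0" by blast
    then obtain g where "fm_hom Q (\<lambda>v. idm (\<beta> v)) V (\<lambda>v. idm (\<beta> v)) V g"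
      "\<forall>v\<in>verts Q. g v * f' v = idm (\<beta> v) \<and> f' v * g v = idm (\<beta> v)"
      by (rule schur_iso[OF wf V V f' st st])
    hence g: "g v * f' v = idm (\<beta> v)" if "v \<in> verts Q" for v using that by blast
    have "X = g w * (f' w * X)" using g[OF w(1)] X(2) by (simp add: mult.assoc[symmetric])
    also have "f' w * X = 0" by (simp add: f'_def left_diff_distrib X)
    finally show False using X(1) by simp
  qed
  thus ?thesis using that[of c] by (simp add: f'_def)
qed


section \<open>Subrepresentations of a direct sum of stable representations\<close>

text \<open>
  The maps \<open>s p\<close> and \<open>s' p\<close> are the inclusions and projections of a direct sum of stable representations,
  and the set \<open>A\<close> consists of the summands that may be needed to contain the subrepresentation \<open>P\<close>. The
  induction on \<open>A\<close> splits \<open>P\<close> by its projection to one summand \<open>W p\<close> into the kernel \<open>K\<close>, which lies in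
  the remaining summands, and the image \<open>R\<close>, a subrepresentation of \<open>W p\<close>. Both have nonnegative weight.
  In the case of weight zero \<open>K\<close> is the image of an idempotent endomorphism \<open>E1\<close>, and \<open>R\<close> is zero or all
  of \<open>W p\<close>.
\<close>

lemma polystable_subs:
  assumes wf: "wf_digraph Q"
    and V: "fm_rep Q N V"
    and W: "\<And>p. p \<in> J \<Longrightarrow> fm_rep Q (M p) (W p)" "\<And>p. p \<in> J \<Longrightarrow> fm_stable Q \<theta> (M p) (W p)"
    and s: "\<And>p. p \<in> J \<Longrightarrow> fm_hom Q (M p) (W p) N V (s p)"
    and s': "\<And>p. p \<in> J \<Longrightarrow> fm_hom Q N V (M p) (W p) (s' p)"
  shows "finite A \<Longrightarrow> A \<subseteq> J \<Longrightarrow> fm_sub Q N V P \<Longrightarrow> (\<forall>v\<in>verts Q. (\<Sum>p\<in>A. s p v * s' p v) * P v = P v) \<Longrightarrow>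
    0 \<le> fm_weight Q \<theta> P \<and> (fm_weight Q \<theta> P = 0 \<longrightarrow>
      (\<exists>E. fm_hom Q N V N V E \<and> (\<forall>v\<in>verts Q. E v * E v = E v \<and> E v * P v = P v \<and> P v * E v = E v)))"
proof (induct A arbitrary: P rule: finite_induct)
  case empty
  hence P0: "\<forall>v\<in>verts Q. P v = 0" by simp
  have "fm_hom Q N V N V (\<lambda>v. 0)" by (simp add: fm_hom_def)
  thus ?case using P0 fm_weight_0[of Q P \<theta>] by (auto intro!: exI[of _ "\<lambda>v. 0"])
next
  case (insert p A)
  have p: "p \<in> J" using insert by simp
  note ends = wf_ends[OF wf]
  have P: "P v * P v = P v" "N v * P v = P v" "P v * N v = P v" if "v \<in> verts Q" for v
    using insert.prems(2) that by (auto simp: fm_sub_def)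
  have PV: "P (head Q e) * (V e * P (tail Q e)) = V e * P (tail Q e)" if "e \<in> arcs Q" for e
    using insert.prems(2) that by (auto simp: fm_sub_def)
  note P' = P[THEN times_right, unfolded mult.assoc] and PV' = PV[THEN times_right, unfolded mult.assoc]
  have s'N: "M p v * s' p v = s' p v" "s' p v * N v = s' p v" if "v \<in> verts Q" for v
    using s'[OF p] that by (auto simp: fm_hom_def)
  note s'N' = s'N[THEN times_right, unfolded mult.assoc]
  have s'V: "s' p (head Q e) * V e = W p e * s' p (tail Q e)" if "e \<in> arcs Q" for e
    using s'[OF p] that by (auto simp: fm_hom_def)
  note s'V' = s'V[THEN times_right, unfolded mult.assoc]
  have WM: "M p (head Q e) * W p e = W p e" "W p e * M p (tail Q e) = W p e" if "e \<in> arcs Q" for e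
    using W(1)[OF p] that by (auto simp: fm_rep_def)
  have NV: "N (head Q e) * V e = V e" "V e * N (tail Q e) = V e" if "e \<in> arcs Q" for e
    using V that by (auto simp: fm_rep_def)
  define V' where "V' e = V e * P (tail Q e)" for e
  define f where "f v = s' p v * P v" for v
  have repP: "fm_rep Q P V'"
    unfolding fm_rep_def V'_def using P PV ends by (auto simp: mult.assoc)
  have homf: "fm_hom Q P V' (M p) (W p) f"
    unfolding fm_hom_def
  proof (intro conjI ballI)
    fix v assume v: "v \<in> verts Q"
    show "M p v * f v = f v" "f v * P v = f v" using v by (simp_all add: f_def s'N' P mult.assoc)
  next
    fix e assume e: "e \<in> arcs Q"
    show "f (head Q e) * V' e = W p e * f (tail Q e)"
      using e by (simp add: f_def V'_def mult.assoc PV s'V')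
  qed
  obtain K R B where KR: "fm_sub Q P V' K" "fm_sub Q (M p) (W p) R"
    and KR0: "\<forall>v\<in>verts Q. f v * K v = 0 \<and> R v * f v = f v \<and> B v * f v = P v - K v \<and> f v * B v = R v \<and>
      P v * B v = B v \<and> B v * M p v = B v"
    and wKR: "fm_weight Q \<theta> P = fm_weight Q \<theta> K + fm_weight Q \<theta> R"
    by (rule hom_kernel_image[OF wf repP W(1)[OF p] homf, of \<theta>])
  have KR': "f v * K v = 0" "R v * f v = f v" "B v * f v = P v - K v" "f v * B v = R v"
      "P v * B v = B v" "B v * M p v = B v" if "v \<in> verts Q" for v using KR0 that by auto
  have K: "K v * K v = K v" "P v * K v = K v" "K v * P v = K v" if "v \<in> verts Q" for v
    using KR(1) that by (auto simp: fm_sub_def)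
  note K' = K[THEN times_right, unfolded mult.assoc]
  have s'K: "s' p v * K v = 0" if "v \<in> verts Q" for v
    using KR'(1)[OF that] by (simp add: f_def mult.assoc K that)
  have subK: "fm_sub Q N V K"
    unfolding fm_sub_def
  proof (intro conjI ballI)
    fix v assume v: "v \<in> verts Q"
    show "K v * K v = K v" by (rule K(1)[OF v])
    show "N v * K v = K v" using P'(2)[OF v, of "K v"] by (simp add: K v)
    show "K v * N v = K v" using K(3)[OF v] P(3)[OF v] by (metis mult.assoc)
  next
    fix e assume e: "e \<in> arcs Q"
    show "K (head Q e) * (V e * K (tail Q e)) = V e * K (tail Q e)"
      using KR(1) e by (simp add: fm_sub_def V'_def mult.assoc K ends)
  qed
  have "(\<Sum>p\<in>A. s p v * s' p v) * K v = K v" if v: "v \<in> verts Q" for v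
  proof -
    have "(\<Sum>p\<in>insert p A. s p v * s' p v) * P v * K v = P v * K v" using insert.prems(3) v by simp
    hence "(\<Sum>p\<in>insert p A. s p v * s' p v) * K v = K v" by (simp add: mult.assoc K v)
    thus ?thesis using insert.hyps by (simp add: distrib_right mult.assoc s'K v)
  qed
  with insert.hyps(3)[OF _ subK] insert.prems(1)
  have ih: "0 \<le> fm_weight Q \<theta> K" "fm_weight Q \<theta> K = 0 \<Longrightarrow>
      (\<exists>E. fm_hom Q N V N V E \<and> (\<forall>v\<in>verts Q. E v * E v = E v \<and> E v * K v = K v \<and> K v * E v = E v))"
    by auto
  have wR: "0 \<le> fm_weight Q \<theta> R" by (rule fm_stable_sub_cases(1)[OF W(2)[OF p] KR(2)])
  show ?case
  proof (intro conjI impI)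
    show "0 \<le> fm_weight Q \<theta> P" using wKR ih(1) wR by linarith
  next
    assume "fm_weight Q \<theta> P = 0"
    hence w0: "fm_weight Q \<theta> K = 0" "fm_weight Q \<theta> R = 0" using wKR ih(1) wR by linarith+
    obtain E1 where E1: "fm_hom Q N V N V E1"
      and E1': "\<And>v. v \<in> verts Q \<Longrightarrow> E1 v * E1 v = E1 v" "\<And>v. v \<in> verts Q \<Longrightarrow> E1 v * K v = K v"
        "\<And>v. v \<in> verts Q \<Longrightarrow> K v * E1 v = E1 v"
      using ih(2)[OF w0(1)] by blast
    note E1'' = E1'[THEN times_right, unfolded mult.assoc]
    show "\<exists>E. fm_hom Q N V N V E \<and> (\<forall>v\<in>verts Q. E v * E v = E v \<and> E v * P v = P v \<and> P v * E v = E v)"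
      using fm_stable_sub_cases(2)[OF W(2)[OF p] KR(2) w0(2)]
    proof
      assume "\<forall>v\<in>verts Q. R v = 0"
      hence "f v = 0" if "v \<in> verts Q" for v using KR'(2)[OF that] that by simp
      hence "P v = K v" if "v \<in> verts Q" for v using KR'(3)[OF that] that by simp
      thus ?thesis using E1 E1' by (intro exI[of _ E1]) simp
    next
      assume R: "\<forall>v\<in>verts Q. R v = M p v"
      have s'E1: "s' p v * E1 v = 0" if "v \<in> verts Q" for v
        using s'K[OF that, THEN times_right, of "E1 v"] by (simp add: mult.assoc E1' that)
      have s'B: "s' p v * B v = M p v" if "v \<in> verts Q" for v
        using KR'(4)[OF that] R that by (simp add: f_def mult.assoc KR')
      have BsP: "B v * (s' p v * P v) = P v - K v" if "v \<in> verts Q" for v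
        using KR'(3)[OF that] by (simp add: f_def)
      note s'E1' = s'E1[THEN times_right, unfolded mult.assoc]
      note s'B' = s'B[THEN times_right, unfolded mult.assoc]
      note BsP' = BsP[THEN times_right, unfolded mult.assoc]
      have E1N: "N v * E1 v = E1 v" "E1 v * N v = E1 v" if "v \<in> verts Q" for v
        using E1 that by (auto simp: fm_hom_def)
      note E1N' = E1N[THEN times_right, unfolded mult.assoc]
      have E1V: "E1 (head Q e) * V e = V e * E1 (tail Q e)" if "e \<in> arcs Q" for e
        using E1 that by (auto simp: fm_hom_def)
      note E1V' = E1V[THEN times_right, unfolded mult.assoc]
      have PE1: "P v * E1 v = E1 v" if v: "v \<in> verts Q" for v
        using K'(2)[OF v, of "E1 v"] by (simp add: E1' v)
      have NB: "N v * B v = B v" if v: "v \<in> verts Q" for v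
        using P'(2)[OF v, of "B v"] by (simp add: KR' v)
      \<comment> \<open>The section \<open>B\<close> of the projection \<open>P \<rightarrow> W p\<close> need not be a homomorphism, but its defect takes
        values in \<open>K\<close>, and \<open>N - E1\<close> kills \<open>K\<close>; so \<open>r\<close> is a homomorphism.\<close>
      define r where "r v = B v - E1 v * B v" for v
      define E where "E v = E1 v + r v * s' p v" for v
      have E1r: "E1 v * r v = 0" if v: "v \<in> verts Q" for v
        by (simp add: r_def right_diff_distrib E1''(1)[OF v])
      have s'r: "s' p v * r v = M p v" if v: "v \<in> verts Q" for v
        by (simp add: r_def right_diff_distrib s'B s'E1' v)
      have rV: "V e * r (tail Q e) = r (head Q e) * W p e" if e: "e \<in> arcs Q" for e
      proof -
        note h = ends(1)[OF e] and t = ends(2)[OF e]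
        define D where "D = V e * B (tail Q e) - B (head Q e) * W p e"
        have "P (head Q e) * (V e * B (tail Q e)) = V e * B (tail Q e)"
          using PV'[OF e, of "B (tail Q e)"] by (simp add: KR' t)
        hence PD: "P (head Q e) * D = D"
          by (simp add: D_def right_diff_distrib KR'(5)[OF h, THEN times_right, unfolded mult.assoc])
        have s'D: "s' p (head Q e) * D = 0"
          by (simp add: D_def right_diff_distrib s'V' e s'B' h s'B t WM)
        have "K (head Q e) * D = P (head Q e) * D - (P (head Q e) - K (head Q e)) * D"
          by (simp add: left_diff_distrib)
        also have "\<dots> = D" using PD s'D by (simp add: BsP[OF h, symmetric] mult.assoc)
        finally have KD: "K (head Q e) * D = D" .
        have "E1 (head Q e) * D = D" using E1''(2)[OF h, of D] by (simp add: KD)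
        thus ?thesis using E1V'[OF e, of "B (tail Q e)"]
          by (simp add: r_def D_def algebra_simps)
      qed
      have "fm_hom Q N V N V E"
        unfolding fm_hom_def
      proof (intro conjI ballI)
        fix v assume v: "v \<in> verts Q"
        have "N v * r v = r v" using v by (simp add: r_def right_diff_distrib NB E1N')
        thus "N v * E v = E v"
          using v by (simp add: E_def distrib_left E1N) (simp add: mult.assoc[symmetric])
        show "E v * N v = E v" using v by (simp add: E_def distrib_right mult.assoc E1N s'N)
      next
        fix e assume e: "e \<in> arcs Q"
        show "E (head Q e) * V e = V e * E (tail Q e)"
          using rV[OF e, THEN times_right, of "s' p (tail Q e)"]
          by (simp add: E_def distrib_left distrib_right mult.assoc E1V s'V e)
      qed
      moreover have "E v * E v = E v \<and> E v * P v = P v \<and> P v * E v = E v" if v: "v \<in> verts Q" for v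
      proof (intro conjI)
        have rs: "E1 v * (r v * X) = 0" "s' p v * (r v * X) = M p v * X" for X
          using E1r[OF v, THEN times_right, of X] s'r[OF v, THEN times_right, of X] by (simp_all add: mult.assoc)
        show "E v * E v = E v"
          by (simp add: E_def distrib_left distrib_right mult.assoc E1' s'E1 rs s'N v)
        show "E v * P v = P v"
          by (simp add: E_def r_def algebra_simps BsP v E1')
        have "P v * r v = r v" using v PE1[OF v, THEN times_right, of "B v"]
          by (simp add: r_def right_diff_distrib KR' mult.assoc)
        thus "P v * E v = E v"
          using v by (simp add: E_def distrib_left PE1) (simp add: mult.assoc[symmetric])
      qed
      ultimately show ?thesis by blast
    qed
  qed
qed


section \<open>Compactness\<close>

lemma bounded_family_subseq:
  fixes f :: "nat \<Rightarrow> 'k \<Rightarrow> complex"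
  assumes "finite K" "\<And>k n. k \<in> K \<Longrightarrow> cmod (f n k) \<le> b"
  shows "\<exists>r. strict_mono r \<and> (\<forall>k\<in>K. convergent (\<lambda>n. f (r n) k))"
  using assms
proof (induct K rule: finite_induct)
  case empty
  show ?case by (rule exI[of _ id]) (simp add: strict_mono_def)
next
  case (insert k K)
  then obtain r where r: "strict_mono r" "\<And>j. j \<in> K \<Longrightarrow> convergent (\<lambda>n. f (r n) j)" by auto
  have real_sub: "\<exists>s. strict_mono s \<and> convergent (\<lambda>n. g (s n))" if "\<And>n. \<bar>g n\<bar> \<le> b" for g :: "nat \<Rightarrow> real"
  proof -
    obtain s where s: "strict_mono s" "monoseq (\<lambda>n. g (s n))" using seq_monosub[of g] by (auto simp: strict_mono_def)
    have "Bseq (\<lambda>n. g (s n))" by (rule BseqI'[of _ b]) (simp add: that)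
    thus ?thesis using s Bseq_monoseq_convergent by blast
  qed
  have bk: "cmod (f (r n) k) \<le> b" for n using insert.prems by simp
  obtain s1 where s1: "strict_mono s1" "convergent (\<lambda>n. Re (f (r (s1 n)) k))"
    using real_sub[of "\<lambda>n. Re (f (r n) k)"] bk abs_Re_le_cmod order_trans by blast
  obtain s2 where s2: "strict_mono s2" "convergent (\<lambda>n. Im (f (r (s1 (s2 n))) k))"
    using real_sub[of "\<lambda>n. Im (f (r (s1 n)) k)"] bk abs_Im_le_cmod order_trans by blast
  define q where "q = r \<circ> s1 \<circ> s2"
  have q: "strict_mono q" unfolding q_def by (intro strict_mono_o r s1 s2)
  obtain a where a: "(\<lambda>n. Re (f (r (s1 n)) k)) \<longlonglongrightarrow> a" using s1(2) by (auto simp: convergent_def)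
  obtain c where c: "(\<lambda>n. Im (f (r (s1 (s2 n))) k)) \<longlonglongrightarrow> c" using s2(2) by (auto simp: convergent_def)
  have "(\<lambda>n. Re (f (q n) k)) \<longlonglongrightarrow> a" using LIMSEQ_subseq_LIMSEQ[OF a s2(1)] by (simp add: q_def o_def)
  moreover have "(\<lambda>n. Im (f (q n) k)) \<longlonglongrightarrow> c" using c by (simp add: q_def)
  ultimately have "(\<lambda>n. f (q n) k) \<longlonglongrightarrow> Complex a c" by (simp add: tendsto_complex_iff)
  hence "convergent (\<lambda>n. f (q n) k)" by (auto simp: convergent_def)
  moreover have "convergent (\<lambda>n. f (q n) j)" if j: "j \<in> K" for j
    using convergent_subseq_convergent[OF r(2)[OF j] strict_mono_o[OF s1(1) s2(1)]] by (simp add: q_def o_def)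
  ultimately show ?case using q by auto
qed

lemma tendsto_fmatI:
  fixes A :: "nat \<Rightarrow> fmat"
  assumes A: "\<And>k. idm n * A k = A k" "\<And>k. A k * idm m = A k"
    and lim: "\<And>i j. i < n \<Longrightarrow> j < m \<Longrightarrow> (\<lambda>k. ent (A k) i j) \<longlonglongrightarrow> L i j"
  shows "A \<longlonglongrightarrow> mat_fun n m L"
proof -
  have A0: "ent (A k) i j = 0" if "n \<le> i \<or> m \<le> j" for k i j
    using that A[of k] by (auto simp: idm_times_iff times_idm_iff)
  have "(\<lambda>k. \<Sum>i<n. \<Sum>j<m. cmod (ent (A k) i j - L i j)) \<longlonglongrightarrow> (\<Sum>i<n. \<Sum>j<m. cmod (L i j - L i j))"
    by (intro tendsto_sum tendsto_norm tendsto_diff lim tendsto_const) auto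
  hence "(\<lambda>k. \<Sum>i<n. \<Sum>j<m. cmod (ent (A k) i j - L i j)) \<longlonglongrightarrow> 0" by simp
  moreover have "(\<Sum>i<n. \<Sum>j<m. cmod (ent (A k) i j - L i j)) = norm (A k - mat_fun n m L)" for k
    by (subst norm_fmat_bound[of n m]) (auto simp: ent_mat_fun A0)
  ultimately have "(\<lambda>k. norm (A k - mat_fun n m L)) \<longlonglongrightarrow> 0" by simp
  hence "(\<lambda>k. A k - mat_fun n m L) \<longlonglongrightarrow> 0" by (rule tendsto_norm_zero_cancel)
  thus ?thesis by (simp add: LIM_zero_iff)
qed

lemma idempotent_trc_ge_1:
  assumes "P * P = P" "P \<noteq> 0" shows "1 \<le> Re (trc P)"
proof -
  obtain c where c: "trc P = of_nat c" by (rule trc_idempotent_nat[OF assms(1)])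
  have "c \<noteq> 0" using trc_idempotent_eq_0[OF assms(1)] assms(2) c by auto
  thus ?thesis using c by simp
qed

lemma idempotent_trc_ge_0: "P * P = P \<Longrightarrow> 0 \<le> Re (trc P)"
  using idempotent_trc_ge_1[of P] by (cases "P = 0") auto

text \<open>
  Replacing destabilising projections by orthogonal ones (same image, hence same weight) makes their
  entries bounded, and a subsequence converges. The limit is neither zero nor everything because the
  trace of a nonzero idempotent is at least \<open>1\<close>.
\<close>

lemma not_stable_limit:
  fixes Vn :: "nat \<Rightarrow> 'e \<Rightarrow> fmat"
  assumes Q: "fin_digraph Q"
    and lim: "\<And>e. e \<in> arcs Q \<Longrightarrow> (\<lambda>n. Vn n e) \<longlonglongrightarrow> V e"
    and N: "\<exists>v\<in>verts Q. \<alpha> v \<noteq> 0" "fm_weight Q \<theta> (\<lambda>v. idm (\<alpha> v)) = 0"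
    and ns: "\<And>n. \<not> fm_stable Q \<theta> (\<lambda>v. idm (\<alpha> v)) (Vn n)"
  obtains r P Pn where "strict_mono r" "\<forall>n. fm_sub Q (\<lambda>v. idm (\<alpha> v)) (Vn (r n)) (Pn n)"
    "\<forall>v\<in>verts Q. (\<lambda>n. Pn n v) \<longlonglongrightarrow> P v" "fm_sub Q (\<lambda>v. idm (\<alpha> v)) V P" "fm_weight Q \<theta> P \<le> 0"
    "\<exists>v\<in>verts Q. P v \<noteq> 0" "\<exists>v\<in>verts Q. P v \<noteq> idm (\<alpha> v)"
proof -
  interpret fin_digraph Q by (rule Q)
  define N where "N v = idm (\<alpha> v)" for v
  have wf: "wf_digraph Q" by unfold_locales
  note ends = wf_ends[OF wf]
  have fin: "finite (verts Q)" by simp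
  have "\<exists>P. fm_sub Q N (Vn n) P \<and> fm_weight Q \<theta> P \<le> 0 \<and> (\<exists>v\<in>verts Q. P v \<noteq> 0) \<and>
      (\<exists>v\<in>verts Q. P v \<noteq> N v) \<and> (\<forall>v\<in>verts Q. adj (P v) = P v)" for n
  proof -
    obtain P where P: "fm_sub Q N (Vn n) P" "\<exists>v\<in>verts Q. P v \<noteq> 0" "\<exists>v\<in>verts Q. P v \<noteq> N v"
      "\<not> 0 < fm_weight Q \<theta> P"
      using ns[of n] N unfolding fm_stable_def N_def by auto
    have PP: "P v * P v = P v" "N v * P v = P v" "P v * N v = P v" if "v \<in> verts Q" for v
      using P(1) that by (auto simp: fm_sub_def)
    have "\<forall>v. \<exists>H. v \<in> verts Q \<longrightarrow> H * H = H \<and> adj H = H \<and> P v * H = H \<and> H * P v = P v \<and> N v * H = H \<and> H * N v = H"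
    proof
      fix v
      show "\<exists>H. v \<in> verts Q \<longrightarrow> H * H = H \<and> adj H = H \<and> P v * H = H \<and> H * P v = P v \<and> N v * H = H \<and> H * N v = H"
      proof (cases "v \<in> verts Q")
        case True
        obtain H where H: "H * H = H" "adj H = H" "P v * H = H" "H * P v = P v"
            "\<And>N. adj N = N \<Longrightarrow> N * P v = P v \<Longrightarrow> N * H = H \<and> H * N = H"
          using hermitian_idempotent[OF PP(1)[OF True]] by blast
        thus ?thesis using PP(2)[OF True] by (intro exI[of _ H]) (simp add: N_def)
      qed auto
    qed
    then obtain H where "\<forall>v. v \<in> verts Q \<longrightarrow> H v * H v = H v \<and> adj (H v) = H v \<and> P v * H v = H v \<and> H v * P v = P v \<and> N v * H v = H v \<and> H v * N v = H v"
      by metis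
    hence H: "H v * H v = H v" "adj (H v) = H v" "P v * H v = H v" "H v * P v = P v" "N v * H v = H v"
       "H v * N v = H v" if "v \<in> verts Q" for v using that by auto
    have "fm_sub Q N (Vn n) H"
      unfolding fm_sub_def
    proof (intro conjI ballI)
      fix e assume e: "e \<in> arcs Q"
      note h = ends(1)[OF e] and t = ends(2)[OF e]
      have "P (head Q e) * (Vn n e * P (tail Q e)) * H (tail Q e) = Vn n e * P (tail Q e) * H (tail Q e)"
        using P(1) e by (simp add: fm_sub_def)
      hence "P (head Q e) * (Vn n e * H (tail Q e)) = Vn n e * H (tail Q e)" by (simp add: mult.assoc H t)
      thus "H (head Q e) * (Vn n e * H (tail Q e)) = Vn n e * H (tail Q e)"
        using H(4)[OF h, THEN times_right, of "Vn n e * H (tail Q e)"] by (simp add: mult.assoc)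
    qed (use H in auto)
    moreover have "fm_weight Q \<theta> H = fm_weight Q \<theta> P"
      by (rule fm_weight_cong) (metis H(3,4) trc_commute)
    moreover have "\<exists>v\<in>verts Q. H v \<noteq> 0" using P(2) H(4) by (metis mult_zero_left)
    moreover have "\<exists>v\<in>verts Q. H v \<noteq> N v"
    proof -
      obtain v where v: "v \<in> verts Q" "P v \<noteq> N v" using P(3) by blast
      have "H v = N v \<Longrightarrow> P v = N v" using H(3)[OF v(1)] PP(3)[OF v(1)] by simp
      thus ?thesis using v by blast
    qed
    ultimately show ?thesis using P(4) H(2) by (intro exI[of _ H]) auto
  qed
  then obtain P0 where "\<forall>n. fm_sub Q N (Vn n) (P0 n) \<and> fm_weight Q \<theta> (P0 n) \<le> 0 \<and> (\<exists>v\<in>verts Q. P0 n v \<noteq> 0) \<and>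
      (\<exists>v\<in>verts Q. P0 n v \<noteq> N v) \<and> (\<forall>v\<in>verts Q. adj (P0 n v) = P0 n v)" by metis
  hence P0: "fm_sub Q N (Vn n) (P0 n)" "fm_weight Q \<theta> (P0 n) \<le> 0" "\<exists>v\<in>verts Q. P0 n v \<noteq> 0"
      "\<exists>v\<in>verts Q. P0 n v \<noteq> N v" "\<forall>v\<in>verts Q. adj (P0 n v) = P0 n v" for n by blast+
  have P0': "P0 n v * P0 n v = P0 n v" "N v * P0 n v = P0 n v" "P0 n v * N v = P0 n v" if "v \<in> verts Q" for v n
    using P0(1)[of n] that by (auto simp: fm_sub_def)
  define K where "K = (SIGMA v:verts Q. {..<\<alpha> v} \<times> {..<\<alpha> v})"
  define f where "f n k = (case k of (v, i, j) \<Rightarrow> ent (P0 n v) i j)" for n k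
  have "cmod (f n k) \<le> (\<Sum>v\<in>verts Q. real (\<alpha> v) + 1)" if kK: "k \<in> K" for k n
  proof -
    obtain v i j where k: "k = (v, i, j)" "v \<in> verts Q" using kK by (auto simp: K_def)
    have "cmod (ent (P0 n v) i j) \<le> real (\<alpha> v) + 1"
      by (rule hermitian_idempotent_ent_le) (use P0' P0(5) k in \<open>auto simp: N_def\<close>)
    also have "\<dots> \<le> (\<Sum>v\<in>verts Q. real (\<alpha> v) + 1)"
      by (rule member_le_sum[of v "verts Q" "\<lambda>v. real (\<alpha> v) + 1"]) (use k fin in auto)
    finally show ?thesis by (simp add: f_def k)
  qed
  moreover have "finite K" by (auto simp: K_def intro: fin)
  ultimately obtain r where r: "strict_mono r" "\<And>k. k \<in> K \<Longrightarrow> convergent (\<lambda>n. f (r n) k)"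
    using bounded_family_subseq[of K f] by blast
  define Pn where "Pn n = P0 (r n)" for n
  define P where "P v = mat_fun (\<alpha> v) (\<alpha> v) (\<lambda>i j. lim (\<lambda>n. ent (P0 (r n) v) i j))" for v
  have PnP: "(\<lambda>n. Pn n v) \<longlonglongrightarrow> P v" if v: "v \<in> verts Q" for v
    unfolding P_def
  proof (rule tendsto_fmatI)
    fix i j assume "i < \<alpha> v" "j < \<alpha> v"
    hence "(v, i, j) \<in> K" using v by (simp add: K_def)
    from r(2)[OF this] show "(\<lambda>k. ent (Pn k v) i j) \<longlonglongrightarrow> lim (\<lambda>n. ent (P0 (r n) v) i j)"
      by (simp add: f_def Pn_def convergent_LIMSEQ_iff)
  qed (use P0'[OF v] in \<open>auto simp: Pn_def N_def\<close>)
  have Vlim: "(\<lambda>n. Vn (r n) e) \<longlonglongrightarrow> V e" if "e \<in> arcs Q" for e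
    using LIMSEQ_subseq_LIMSEQ[OF lim[OF that] r(1)] by (simp add: o_def)
  have subP: "fm_sub Q N V P"
    unfolding fm_sub_def
  proof (intro conjI ballI)
    fix v assume v: "v \<in> verts Q"
    have "(\<lambda>n. Pn n v * Pn n v) \<longlonglongrightarrow> P v * P v" by (intro tendsto_intros PnP v)
    thus "P v * P v = P v" using PnP[OF v] LIMSEQ_unique by (auto simp: Pn_def P0' v)
    have "(\<lambda>n. N v * Pn n v) \<longlonglongrightarrow> N v * P v" by (intro tendsto_intros PnP v)
    thus "N v * P v = P v" using PnP[OF v] LIMSEQ_unique by (auto simp: Pn_def P0' v)
    have "(\<lambda>n. Pn n v * N v) \<longlonglongrightarrow> P v * N v" by (intro tendsto_intros PnP v)
    thus "P v * N v = P v" using PnP[OF v] LIMSEQ_unique by (auto simp: Pn_def P0' v)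
  next
    fix e assume e: "e \<in> arcs Q"
    have a: "(\<lambda>n. Pn n (head Q e) * (Vn (r n) e * Pn n (tail Q e))) \<longlonglongrightarrow> P (head Q e) * (V e * P (tail Q e))"
      and b: "(\<lambda>n. Vn (r n) e * Pn n (tail Q e)) \<longlonglongrightarrow> V e * P (tail Q e)"
      by (intro tendsto_intros PnP ends Vlim e)+
    have "Pn n (head Q e) * (Vn (r n) e * Pn n (tail Q e)) = Vn (r n) e * Pn n (tail Q e)" for n
      using P0(1)[of "r n"] e by (simp add: fm_sub_def Pn_def)
    thus "P (head Q e) * (V e * P (tail Q e)) = V e * P (tail Q e)"
      using a b LIMSEQ_unique by simp
  qed
  have tlim: "(\<lambda>n. Re (trc (Pn n v))) \<longlonglongrightarrow> Re (trc (P v))" if "v \<in> verts Q" for v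
    by (intro tendsto_intros PnP that)
  have wlim: "(\<lambda>n. fm_weight Q \<theta> (Pn n)) \<longlonglongrightarrow> fm_weight Q \<theta> P"
    unfolding fm_weight_def by (intro tendsto_intros PnP)
  have w: "fm_weight Q \<theta> P \<le> 0"
    by (rule LIMSEQ_le_const2[OF wlim]) (use P0(2) in \<open>auto simp: Pn_def\<close>)
  have ge1: "1 \<le> (\<Sum>v\<in>verts Q. Re (trc (F v)))" if F: "\<And>v. v \<in> verts Q \<Longrightarrow> F v * F v = F v" "\<exists>v\<in>verts Q. F v \<noteq> 0" for F
  proof -
    obtain v where v: "v \<in> verts Q" "F v \<noteq> 0" using F(2) by blast
    have "1 \<le> Re (trc (F v))" by (rule idempotent_trc_ge_1[OF F(1)[OF v(1)] v(2)])
    also have "\<dots> \<le> (\<Sum>v\<in>verts Q. Re (trc (F v)))"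
      by (rule member_le_sum[of v "verts Q" "\<lambda>v. Re (trc (F v))"]) (use v fin F(1) idempotent_trc_ge_0 in auto)
    finally show ?thesis .
  qed
  have "1 \<le> (\<Sum>v\<in>verts Q. Re (trc (P v)))"
  proof (rule LIMSEQ_le_const)
    show "(\<lambda>n. \<Sum>v\<in>verts Q. Re (trc (Pn n v))) \<longlonglongrightarrow> (\<Sum>v\<in>verts Q. Re (trc (P v)))"
      by (intro tendsto_sum tlim)
    show "\<exists>N. \<forall>n\<ge>N. 1 \<le> (\<Sum>v\<in>verts Q. Re (trc (Pn n v)))"
      using ge1 P0' P0(3) unfolding Pn_def by simp
  qed
  hence nz: "\<exists>v\<in>verts Q. P v \<noteq> 0" by (rule contrapos_pp) simp
  have "1 \<le> (\<Sum>v\<in>verts Q. Re (trc (N v - P v)))"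
  proof (rule LIMSEQ_le_const)
    show "(\<lambda>n. \<Sum>v\<in>verts Q. Re (trc (N v - Pn n v))) \<longlonglongrightarrow> (\<Sum>v\<in>verts Q. Re (trc (N v - P v)))"
      by (intro tendsto_intros PnP)
    have "1 \<le> (\<Sum>v\<in>verts Q. Re (trc (N v - P0 (r n) v)))" for n
    proof (rule ge1)
      fix v assume v: "v \<in> verts Q"
      have "N v * N v = N v" by (simp add: N_def)
      thus "(N v - P0 (r n) v) * (N v - P0 (r n) v) = N v - P0 (r n) v"
        using P0'[OF v, of "r n"] by (simp add: algebra_simps)
    qed (use P0(4)[of "r n"] in \<open>metis right_minus_eq\<close>)
    thus "\<exists>n0. \<forall>n\<ge>n0. 1 \<le> (\<Sum>v\<in>verts Q. Re (trc (N v - Pn n v)))" by (simp add: Pn_def)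
  qed
  hence nf: "\<exists>v\<in>verts Q. P v \<noteq> N v"
    by (rule contrapos_pp) simp
  have "\<forall>n. fm_sub Q N (Vn (r n)) (Pn n)" using P0(1) by (simp add: Pn_def)
  thus ?thesis using that[OF r(1), of Pn P] PnP subP w nz nf unfolding N_def by blast
qed


section \<open>A quadratic fixed point equation with a small parameter\<close>

text \<open>
  For small \<open>t\<close> the right hand side maps the polydisc of radius \<open>R\<close> to itself and contracts by \<open>1/2\<close>
  there; both \<open>\<delta>\<close> and \<open>R\<close> are independent of \<open>t\<close>.
\<close>

lemma quadratic_fixed_point:
  fixes c :: "'k \<Rightarrow> complex"
  assumes K: "finite K"
  shows "\<exists>\<delta>>0. \<exists>R. \<forall>t. cmod t < \<delta> \<longrightarrow> (\<exists>z. \<forall>k\<in>K. cmod (z k) \<le> R \<and>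
     z k = c k + t * ((\<Sum>j\<in>K. B k j * z j) + (\<Sum>j\<in>K. \<Sum>l\<in>K. C k j l * z j * z l)))"
proof -
  define b where "b = (\<Sum>k\<in>K. (\<Sum>j\<in>K. cmod (B k j)) + (\<Sum>j\<in>K. \<Sum>l\<in>K. cmod (C k j l)))"
  define R where "R = (\<Sum>k\<in>K. cmod (c k)) + 1"
  define q where "q z k = (\<Sum>j\<in>K. B k j * z j) + (\<Sum>j\<in>K. \<Sum>l\<in>K. C k j l * z j * z l)" for z k
  \<comment> \<open>Large enough for both estimates: \<open>\<bar>t\<bar> Y \<le> 1/2\<close> bounds the perturbation \<open>t q\<close> on the polydisc
    by \<open>1\<close> and its Lipschitz constant by \<open>1/2\<close>.\<close>
  define Y where "Y = b * R + b * R * R + b + 2 * b * R + 1"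
  define \<delta> where "\<delta> = inverse (2 * Y)"
  have b0: "0 \<le> b" by (simp add: b_def sum_nonneg)
  have R1: "1 \<le> R" by (simp add: R_def sum_nonneg)
  have Y0: "0 < Y" unfolding Y_def using b0 R1 by (simp add: add_nonneg_pos)
  have d0: "0 < \<delta>" unfolding \<delta>_def using Y0 by simp
  have bk1: "(\<Sum>j\<in>K. cmod (B k j)) + (\<Sum>j\<in>K. \<Sum>l\<in>K. cmod (C k j l)) \<le> b" if "k \<in> K" for k
    unfolding b_def by (rule member_le_sum[of k K "\<lambda>k. (\<Sum>j\<in>K. cmod (B k j)) + (\<Sum>j\<in>K. \<Sum>l\<in>K. cmod (C k j l))"])
      (use that K in \<open>auto intro!: add_nonneg_nonneg sum_nonneg\<close>)
  have bk2: "(\<Sum>j\<in>K. cmod (B k j)) \<le> b" "(\<Sum>j\<in>K. \<Sum>l\<in>K. cmod (C k j l)) \<le> b" if "k \<in> K" for k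
  proof -
    have "0 \<le> (\<Sum>j\<in>K. cmod (B k j))" "0 \<le> (\<Sum>j\<in>K. \<Sum>l\<in>K. cmod (C k j l))" by (auto intro!: sum_nonneg)
    thus "(\<Sum>j\<in>K. cmod (B k j)) \<le> b" "(\<Sum>j\<in>K. \<Sum>l\<in>K. cmod (C k j l)) \<le> b"
      using bk1[OF that] by linarith+
  qed
  have ck: "cmod (c k) \<le> R - 1" if "k \<in> K" for k
    unfolding R_def using member_le_sum[of k K "\<lambda>k. cmod (c k)"] that K by simp
  have q_bd: "cmod (q z k) \<le> b * (R + R * R)" if "k \<in> K" "\<And>j. j \<in> K \<Longrightarrow> cmod (z j) \<le> R" for z k
  proof -
    have "cmod (q z k) \<le> (\<Sum>j\<in>K. cmod (B k j) * R) + (\<Sum>j\<in>K. \<Sum>l\<in>K. cmod (C k j l) * (R * R))"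
      unfolding q_def using R1 that(2)
      by (intro order_trans[OF norm_triangle_ineq] add_mono order_trans[OF norm_sum] sum_mono)
         (auto simp: norm_mult mult.assoc intro!: mult_left_mono mult_mono)
    also have "\<dots> = (\<Sum>j\<in>K. cmod (B k j)) * R + (\<Sum>j\<in>K. \<Sum>l\<in>K. cmod (C k j l)) * (R * R)"
      by (simp add: sum_distrib_right)
    also have "\<dots> \<le> b * R + b * (R * R)"
      using bk2[OF that(1)] R1 by (intro add_mono mult_right_mono) auto
    finally show ?thesis by (simp add: distrib_left)
  qed
  have q_lip: "cmod (q z k - q w k) \<le> b * (1 + 2 * R) * D"
    if "k \<in> K" "\<And>j. j \<in> K \<Longrightarrow> cmod (z j) \<le> R" "\<And>j. j \<in> K \<Longrightarrow> cmod (w j) \<le> R"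
      "\<And>j. j \<in> K \<Longrightarrow> cmod (z j - w j) \<le> D" "0 \<le> D" for z w k D
  proof -
    have e: "q z k - q w k = (\<Sum>j\<in>K. B k j * (z j - w j)) +
        (\<Sum>j\<in>K. \<Sum>l\<in>K. C k j l * (z j * (z l - w l) + (z j - w j) * w l))"
      unfolding q_def by (simp add: sum_subtractf sum.distrib algebra_simps)
    have zw: "cmod (z j * (z l - w l) + (z j - w j) * w l) \<le> 2 * R * D" if "j \<in> K" "l \<in> K" for j l
    proof -
      have "cmod (z j * (z l - w l) + (z j - w j) * w l) \<le> cmod (z j) * cmod (z l - w l) + cmod (z j - w j) * cmod (w l)"
        by (metis norm_mult norm_triangle_ineq)
      also have "\<dots> \<le> R * D + D * R"
        using that \<open>\<And>j. j \<in> K \<Longrightarrow> cmod (z j) \<le> R\<close> \<open>\<And>j. j \<in> K \<Longrightarrow> cmod (w j) \<le> R\<close>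
          \<open>\<And>j. j \<in> K \<Longrightarrow> cmod (z j - w j) \<le> D\<close> R1 \<open>0 \<le> D\<close> by (intro add_mono mult_mono) auto
      finally show ?thesis by (simp add: algebra_simps)
    qed
    have "cmod (q z k - q w k) \<le> (\<Sum>j\<in>K. cmod (B k j) * D) + (\<Sum>j\<in>K. \<Sum>l\<in>K. cmod (C k j l) * (2 * R * D))"
      unfolding e using that(4) zw
      by (intro order_trans[OF norm_triangle_ineq] add_mono order_trans[OF norm_sum] sum_mono)
         (auto simp: norm_mult intro!: mult_left_mono)
    also have "\<dots> = (\<Sum>j\<in>K. cmod (B k j)) * D + (\<Sum>j\<in>K. \<Sum>l\<in>K. cmod (C k j l)) * (2 * R * D)"
      by (simp add: sum_distrib_right)
    also have "\<dots> \<le> b * D + b * (2 * R * D)"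
      using bk2[OF that(1)] R1 that(5) by (intro add_mono mult_right_mono) auto
    finally show ?thesis by (simp add: algebra_simps)
  qed
  have main: "\<exists>z. \<forall>k\<in>K. cmod (z k) \<le> R \<and> z k = c k + t * q z k" if t: "cmod t < \<delta>" for t
  proof -
    have "cmod t * Y \<le> \<delta> * Y" using t Y0 by (intro mult_right_mono) auto
    also have "\<dots> = 1/2" using Y0 by (simp add: \<delta>_def)
    finally have td: "cmod t * Y \<le> 1/2" .
    have nn: "0 \<le> cmod t * (b * R)" "0 \<le> cmod t * (b * R * R)" "0 \<le> cmod t * b" "0 \<le> cmod t"
      using b0 R1 by auto
    have t1: "cmod t * (b * (R + R * R)) \<le> 1" and t2: "cmod t * (b * (1 + 2 * R)) \<le> 1/2"
    proof -
      have e: "cmod t * Y = cmod t * (b * R) + cmod t * (b * R * R) + cmod t * b + 2 * (cmod t * (b * R)) + cmod t"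
        "cmod t * (b * (R + R * R)) = cmod t * (b * R) + cmod t * (b * R * R)"
        "cmod t * (b * (1 + 2 * R)) = cmod t * b + 2 * (cmod t * (b * R))"
        by (simp_all add: Y_def algebra_simps)
      show "cmod t * (b * (R + R * R)) \<le> 1" using td nn unfolding e by linarith
      show "cmod t * (b * (1 + 2 * R)) \<le> 1/2" using td nn unfolding e by linarith
    qed
    define Z where "Z n = ((\<lambda>z k. c k + t * q z k) ^^ n) (\<lambda>k. 0)" for n
    have Z0: "Z 0 = (\<lambda>k. 0)" and ZS: "Z (Suc n) k = c k + t * q (Z n) k" for n k by (simp_all add: Z_def)
    have ZR: "\<forall>k\<in>K. cmod (Z n k) \<le> R" for n
    proof (induct n)
      case 0 thus ?case using R1 by (simp add: Z0)
    next
      case (Suc n)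
      show ?case
      proof
        fix k assume k: "k \<in> K"
        have "cmod (Z (Suc n) k) \<le> cmod (c k) + cmod t * cmod (q (Z n) k)"
          unfolding ZS by (metis norm_mult norm_triangle_ineq)
        also have "\<dots> \<le> (R - 1) + cmod t * (b * (R + R * R))"
          using Suc k by (intro add_mono ck mult_left_mono q_bd) auto
        finally show "cmod (Z (Suc n) k) \<le> R" using t1 by simp
      qed
    qed
    have Zd: "\<forall>k\<in>K. cmod (Z (Suc n) k - Z n k) \<le> R * (1/2)^n" for n
    proof (induct n)
      case 0 thus ?case using ZR[of 1] by (simp add: Z0)
    next
      case (Suc n)
      show ?case
      proof
        fix k assume k: "k \<in> K"
        have "Z (Suc (Suc n)) k - Z (Suc n) k = t * (q (Z (Suc n)) k - q (Z n) k)"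
          by (simp only: ZS) (simp add: algebra_simps)
        hence "cmod (Z (Suc (Suc n)) k - Z (Suc n) k) = cmod t * cmod (q (Z (Suc n)) k - q (Z n) k)"
          by (simp add: norm_mult)
        also have "\<dots> \<le> cmod t * (b * (1 + 2 * R) * (R * (1/2)^n))"
          using Suc k ZR[of "Suc n"] ZR[of n] R1 by (intro mult_left_mono q_lip) auto
        also have "\<dots> = (cmod t * (b * (1 + 2 * R))) * (R * (1/2)^n)" by simp
        also have "\<dots> \<le> 1/2 * (R * (1/2)^n)" using t2 R1 by (intro mult_right_mono) auto
        finally show "cmod (Z (Suc (Suc n)) k - Z (Suc n) k) \<le> R * (1/2)^Suc n" by simp
      qed
    qed
    have conv: "convergent (\<lambda>n. Z n k)" if k: "k \<in> K" for k
    proof -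
      have "summable (\<lambda>n. R * (1/2)^n)" by (intro summable_mult summable_geometric) simp
      hence "summable (\<lambda>n. Z (Suc n) k - Z n k)"
        by (rule summable_comparison_test') (use Zd k in auto)
      hence "convergent (\<lambda>n. \<Sum>i<n. Z (Suc i) k - Z i k)" by (simp add: summable_iff_convergent)
      thus ?thesis unfolding sum_lessThan_telescope[of "\<lambda>n. Z n k"] by (simp add: Z0)
    qed
    define z where "z k = lim (\<lambda>n. Z n k)" for k
    have z: "(\<lambda>n. Z n k) \<longlonglongrightarrow> z k" if "k \<in> K" for k
      using conv[OF that] by (simp add: z_def convergent_LIMSEQ_iff)
    show ?thesis
    proof (intro exI ballI conjI)
      fix k assume k: "k \<in> K"
      show "cmod (z k) \<le> R"
        by (rule LIMSEQ_le_const2[OF tendsto_norm[OF z[OF k]]]) (use ZR k in auto)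
      have "(\<lambda>n. c k + t * q (Z n) k) \<longlonglongrightarrow> c k + t * q z k"
        unfolding q_def by (intro tendsto_intros z)
      moreover have "(\<lambda>n. Z (Suc n) k) \<longlonglongrightarrow> z k" using z[OF k] by (rule LIMSEQ_Suc)
      ultimately show "z k = c k + t * q z k" unfolding ZS using LIMSEQ_unique by blast
    qed
  qed
  thus ?thesis using d0 unfolding q_def by blast
qed


section \<open>Embeddings of countable subfields of the complex numbers\<close>

definition subfld :: "complex set \<Rightarrow> bool" where
  "subfld F \<longleftrightarrow> 0 \<in> F \<and> 1 \<in> F \<and> (\<forall>x\<in>F. \<forall>y\<in>F. x + y \<in> F \<and> x - y \<in> F \<and> x * y \<in> F) \<and> (\<forall>x\<in>F. inverse x \<in> F)"

definition fhom :: "complex set \<Rightarrow> (complex \<Rightarrow> complex) \<Rightarrow> bool" where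
  "fhom F h \<longleftrightarrow> h 1 = 1 \<and> (\<forall>x\<in>F. \<forall>y\<in>F. h (x + y) = h x + h y \<and> h (x * y) = h x * h y)"

definition poly_over :: "complex set \<Rightarrow> complex poly \<Rightarrow> bool" where
  "poly_over F p \<longleftrightarrow> (\<forall>i. coeff p i \<in> F)"

lemma subfldD:
  assumes "subfld F" shows "0 \<in> F" "1 \<in> F" "x \<in> F \<Longrightarrow> y \<in> F \<Longrightarrow> x + y \<in> F" "x \<in> F \<Longrightarrow> y \<in> F \<Longrightarrow> x - y \<in> F"
    "x \<in> F \<Longrightarrow> y \<in> F \<Longrightarrow> x * y \<in> F" "x \<in> F \<Longrightarrow> inverse x \<in> F" "x \<in> F \<Longrightarrow> y \<in> F \<Longrightarrow> x / y \<in> F"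
  using assms unfolding subfld_def divide_inverse by blast+

lemma subfld_sum: "subfld F \<Longrightarrow> (\<And>x. x \<in> A \<Longrightarrow> f x \<in> F) \<Longrightarrow> sum f A \<in> F"
  by (induct A rule: infinite_finite_induct) (auto intro: subfldD)

lemma fhomD:
  assumes "fhom F h" "subfld F"
  shows "h 1 = 1" "h 0 = 0" "x \<in> F \<Longrightarrow> y \<in> F \<Longrightarrow> h (x + y) = h x + h y" "x \<in> F \<Longrightarrow> y \<in> F \<Longrightarrow> h (x * y) = h x * h y"
    "x \<in> F \<Longrightarrow> y \<in> F \<Longrightarrow> h (x - y) = h x - h y" "x \<in> F \<Longrightarrow> h x = 0 \<longleftrightarrow> x = 0"
proof -
  show 1: "h 1 = 1" and add: "\<And>x y. x \<in> F \<Longrightarrow> y \<in> F \<Longrightarrow> h (x + y) = h x + h y"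
    and mult: "\<And>x y. x \<in> F \<Longrightarrow> y \<in> F \<Longrightarrow> h (x * y) = h x * h y"
    using assms by (auto simp: fhom_def)
  have "h (0 + 0) = h 0 + h 0" by (rule add) (use assms(2) subfldD in auto)
  thus 0: "h 0 = 0" by simp
  show "h (x - y) = h x - h y" if "x \<in> F" "y \<in> F" for x y
    using add[of "x - y" y] subfldD(4)[OF assms(2) that] that by simp
  show "h x = 0 \<longleftrightarrow> x = 0" if "x \<in> F" for x
    using mult[of x "inverse x"] subfldD(6)[OF assms(2) that] that 0 1 by (cases "x = 0") auto
qed

lemma fhom_sum:
  assumes "fhom F h" "subfld F" "\<And>x. x \<in> A \<Longrightarrow> f x \<in> F"
  shows "h (sum f A) = (\<Sum>x\<in>A. h (f x))"
  using assms(3)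
  by (induct A rule: infinite_finite_induct) (auto simp: fhomD[OF assms(1,2)] subfld_sum[OF assms(2)])

context
  fixes F h assumes F: "subfld F" and h: "fhom F h"
begin

lemma coeff_map_h: "coeff (map_poly h p) i = h (coeff p i)"
  by (simp add: coeff_map_poly fhomD(2)[OF h F])

lemma poly_over_add: "poly_over F p \<Longrightarrow> poly_over F q \<Longrightarrow> poly_over F (p + q)"
  and poly_over_diff: "poly_over F p \<Longrightarrow> poly_over F q \<Longrightarrow> poly_over F (p - q)"
  and poly_over_0: "poly_over F 0" and poly_over_1: "poly_over F 1"
  and poly_over_const: "c \<in> F \<Longrightarrow> poly_over F [:c:]"
  and poly_over_X: "poly_over F [:0, 1:]"
  and poly_over_monom: "c \<in> F \<Longrightarrow> poly_over F (monom c n)"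
  by (auto simp: poly_over_def subfldD[OF F] coeff_pCons split: nat.splits)

lemma poly_over_mult: "poly_over F p \<Longrightarrow> poly_over F q \<Longrightarrow> poly_over F (p * q)"
  by (auto simp: poly_over_def coeff_mult intro!: subfld_sum[OF F] subfldD[OF F])

lemma map_h_add: "poly_over F p \<Longrightarrow> poly_over F q \<Longrightarrow> map_poly h (p + q) = map_poly h p + map_poly h q"
  by (rule poly_eqI) (simp add: coeff_map_h poly_over_def fhomD[OF h F])
lemma map_h_mult: "poly_over F p \<Longrightarrow> poly_over F q \<Longrightarrow> map_poly h (p * q) = map_poly h p * map_poly h q"
  by (rule poly_eqI)
     (simp add: coeff_map_h coeff_mult poly_over_def fhomD[OF h F] fhom_sum[OF h F] subfldD[OF F])
lemma map_h_const: "map_poly h [:c:] = [:h c:]"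
  by (rule poly_eqI) (simp add: coeff_map_h coeff_pCons fhomD[OF h F] split: nat.splits)
lemma map_h_X: "map_poly h [:0, 1:] = [:0, 1:]"
  by (rule poly_eqI) (simp add: coeff_map_h coeff_pCons fhomD[OF h F] split: nat.splits)
lemma map_h_1: "map_poly h 1 = 1"
  by (rule poly_eqI) (simp add: coeff_map_h fhomD[OF h F])
lemma map_h_eq_0: "poly_over F p \<Longrightarrow> map_poly h p = 0 \<longleftrightarrow> p = 0"
  by (simp add: poly_eq_iff coeff_map_h poly_over_def fhomD[OF h F])

lemma poly_over_div:
  assumes m: "poly_over F m" "m \<noteq> 0"
  shows "poly_over F p \<Longrightarrow> \<exists>s r. poly_over F s \<and> poly_over F r \<and> p = m * s + r \<and> (r = 0 \<or> degree r < degree m)"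
proof (induct "degree p" arbitrary: p rule: less_induct)
  case less
  show ?case
  proof (cases "p = 0 \<or> degree p < degree m")
    case True
    thus ?thesis using less.prems poly_over_0 by (intro exI[of _ 0] exI[of _ p]) auto
  next
    case False
    define c where "c = lead_coeff p / lead_coeff m"
    define d where "d = degree p - degree m"
    define p1 where "p1 = p - m * monom c d"
    have c: "c \<in> F" using less.prems m by (auto simp: c_def poly_over_def subfldD[OF F])
    have p1: "poly_over F p1" unfolding p1_def
      by (intro poly_over_diff poly_over_mult poly_over_monom less.prems m c)
    have "degree (m * monom c d) \<le> degree p"
      using False degree_mult_le[of m "monom c d"] degree_monom_le[of c d] unfolding d_def by linarith
    hence dp: "degree p1 \<le> degree p" unfolding p1_def by (intro degree_diff_le) auto
    have "coeff (m * monom c d) (degree p) = lead_coeff p"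
      using False m(2) by (simp add: mult.commute[of m] coeff_monom_mult d_def c_def)
    hence "coeff p1 (degree p) = 0" by (simp add: p1_def)
    hence "p1 = 0 \<or> degree p1 < degree p" using dp eq_zero_or_degree_less by blast
    hence "\<exists>s r. poly_over F s \<and> poly_over F r \<and> p1 = m * s + r \<and> (r = 0 \<or> degree r < degree m)"
    proof
      assume "p1 = 0" thus ?thesis using poly_over_0 by (intro exI[of _ 0]) auto
    next
      assume "degree p1 < degree p" thus ?thesis by (rule less.hyps) (rule p1)
    qed
    then obtain s r where sr: "poly_over F s" "poly_over F r" "p1 = m * s + r" "r = 0 \<or> degree r < degree m" by blast
    have "p = m * (s + monom c d) + r" using sr(3) by (simp add: p1_def algebra_simps)
    thus ?thesis using sr poly_over_add[OF sr(1) poly_over_monom[OF c, of d]] by blast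
  qed
qed

text \<open>
  The condition for extending \<open>h\<close> to \<open>F(u)\<close> by \<open>u \<mapsto> u'\<close>: a polynomial over \<open>F\<close> vanishes at \<open>u\<close> iff its
  image under \<open>h\<close> vanishes at \<open>u'\<close>. It covers algebraic and transcendental \<open>u\<close> alike.
\<close>

definition conj_over :: "complex \<Rightarrow> complex \<Rightarrow> bool" where
  "conj_over u u' \<longleftrightarrow> (\<forall>p. poly_over F p \<longrightarrow> (poly p u = 0 \<longleftrightarrow> poly (map_poly h p) u' = 0))"

text \<open>
  Take for \<open>u'\<close> a root of the image of the minimal polynomial \<open>m\<close> of \<open>u\<close>. The polynomial \<open>g\<close> of
  least degree whose image vanishes at \<open>u'\<close> divides every other such polynomial, in particular \<open>m\<close>;
  as \<open>m\<close> has least degree among the polynomials vanishing at \<open>u\<close>, it is \<open>g\<close> and not the cofactor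
  that vanishes at \<open>u\<close>.
\<close>

lemma conj_over_algebraic:
  assumes "\<exists>p. poly_over F p \<and> p \<noteq> 0 \<and> poly p u = 0"
  obtains u' where "conj_over u u'"
proof -
  have ex_min: "\<exists>m. P m \<and> (\<forall>p. P p \<longrightarrow> degree m \<le> degree p)" if "P p0" for P and p0 :: "complex poly"
    using that ex_has_least_nat[of P p0 degree] by blast
  obtain m where m: "poly_over F m" "m \<noteq> 0" "poly m u = 0"
    and mmin: "\<And>p. poly_over F p \<Longrightarrow> p \<noteq> 0 \<Longrightarrow> poly p u = 0 \<Longrightarrow> degree m \<le> degree p"
    using assms ex_min[of "\<lambda>p. poly_over F p \<and> p \<noteq> 0 \<and> poly p u = 0"] by blast
  have const: "degree p \<noteq> 0" if p: "p \<noteq> 0" "poly p x = 0" for p and x :: complex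
    using p by (metis degree_eq_zeroE mult_zero_right poly_pCons add.right_neutral poly_0 pCons_0_0)
  have degh: "degree (map_poly h p) = degree p" if p: "poly_over F p" for p
    by (rule degree_map_poly) (use p fhomD(6)[OF h F] in \<open>auto simp: poly_over_def\<close>)
  have "\<not> constant (poly (map_poly h m))"
    using const[OF m(2,3)] degh[OF m(1)] by (simp add: constant_degree)
  then obtain u' where u': "poly (map_poly h m) u' = 0" using fundamental_theorem_of_algebra by blast
  have fwd: "poly (map_poly h p) u' = 0" if p: "poly_over F p" "poly p u = 0" for p
  proof -
    obtain s r where sr: "poly_over F s" "poly_over F r" "p = m * s + r" "r = 0 \<or> degree r < degree m"
      using poly_over_div[OF m(1,2) p(1)] by blast
    have "poly r u = 0" using p(2) sr(3) m(3) by simp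
    hence "r = 0" using mmin[of r] sr by fastforce
    thus ?thesis using sr u' by (simp add: map_h_mult[OF m(1) sr(1)])
  qed
  obtain g where g: "poly_over F g" "g \<noteq> 0" "poly (map_poly h g) u' = 0"
    and gmin: "\<And>p. poly_over F p \<Longrightarrow> p \<noteq> 0 \<Longrightarrow> poly (map_poly h p) u' = 0 \<Longrightarrow> degree g \<le> degree p"
    using m u' ex_min[of "\<lambda>p. poly_over F p \<and> p \<noteq> 0 \<and> poly (map_poly h p) u' = 0"] by blast
  have gdiv: "\<exists>s. poly_over F s \<and> p = g * s" if p: "poly_over F p" "poly (map_poly h p) u' = 0" for p
  proof -
    obtain s r where sr: "poly_over F s" "poly_over F r" "p = g * s + r" "r = 0 \<or> degree r < degree g"
      using poly_over_div[OF g(1,2) p(1)] by blast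
    have "map_poly h p = map_poly h g * map_poly h s + map_poly h r"
      using sr by (simp add: map_h_add map_h_mult poly_over_mult g)
    hence "poly (map_poly h r) u' = 0" using p(2) g(3) by simp
    hence "r = 0" using gmin[of r] sr by fastforce
    thus ?thesis using sr by auto
  qed
  obtain s where s: "poly_over F s" "m = g * s" using gdiv[OF m(1) u'] by blast
  have "poly g u = 0"
  proof (rule ccontr)
    assume "poly g u \<noteq> 0"
    hence "poly s u = 0" using m(3) s by simp
    moreover have "s \<noteq> 0" using m(2) s by auto
    ultimately have "degree m \<le> degree s" using mmin s by blast
    moreover have "degree m = degree g + degree s" unfolding s(2) by (rule degree_mult_eq) (use g \<open>s \<noteq> 0\<close> in auto)
    ultimately have "degree g = 0" by simp
    moreover have "map_poly h g \<noteq> 0" using g map_h_eq_0 by blast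
    ultimately show False using const[of "map_poly h g" u'] g(3) degh[OF g(1)] by simp
  qed
  hence "poly p u = 0" if "poly_over F p" "poly (map_poly h p) u' = 0" for p
    using gdiv[OF that] by auto
  thus ?thesis using fwd that[of u'] unfolding conj_over_def by blast
qed

lemma conj_over_transcendental:
  assumes "\<And>p. poly_over F p \<Longrightarrow> p \<noteq> 0 \<Longrightarrow> poly p u \<noteq> 0"
    "\<And>p. poly_over F p \<Longrightarrow> p \<noteq> 0 \<Longrightarrow> poly (map_poly h p) u' \<noteq> 0"
  shows "conj_over u u'"
  unfolding conj_over_def using assms map_h_eq_0 by (metis poly_0)

lemma countable_poly_over: assumes "countable F" shows "countable {p. poly_over F p}"
proof -
  have "coeffs ` {p. poly_over F p} \<subseteq> lists F"
    by (auto simp: poly_over_def in_set_conv_nth nth_coeffs_coeff length_coeffs_degree split: if_splits)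
  moreover have "countable (lists F)" using assms by (rule countable_lists)
  ultimately have "countable (coeffs ` {p. poly_over F p})" by (rule countable_subset)
  thus ?thesis by (rule countable_image_inj_on) (auto simp: inj_on_def coeffs_eq_iff)
qed

lemma countable_roots:
  assumes "countable F" shows "countable {x. \<exists>p. poly_over F p \<and> p \<noteq> 0 \<and> poly (map_poly h p) x = 0}"
proof -
  have "{x. \<exists>p. poly_over F p \<and> p \<noteq> 0 \<and> poly (map_poly h p) x = 0} =
      (\<Union>p\<in>{p. poly_over F p \<and> p \<noteq> 0}. {x. poly (map_poly h p) x = 0})" by auto
  moreover have "countable \<dots>"
  proof (rule countable_UN)
    show "countable {p. poly_over F p \<and> p \<noteq> 0}"
      by (rule countable_subset[OF _ countable_poly_over[OF assms]]) auto
    fix p assume "p \<in> {p. poly_over F p \<and> p \<noteq> 0}"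
    hence "map_poly h p \<noteq> 0" using map_h_eq_0 by simp
    thus "countable {x. poly (map_poly h p) x = 0}" by (intro countable_finite poly_roots_finite)
  qed
  ultimately show ?thesis by simp
qed

text \<open>
  For transcendental \<open>u\<close> any \<open>u'\<close> that is transcendental over the image of \<open>F\<close> will do, and one exists
  because \<open>F\<close> is countable.
\<close>

lemma conj_over_exists: assumes "countable F" obtains u' where "conj_over u u'"
proof (cases "\<exists>p. poly_over F p \<and> p \<noteq> 0 \<and> poly p u = 0")
  case True
  thus ?thesis using conj_over_algebraic that by blast
next
  case False
  define S where "S = {x. \<exists>p. poly_over F p \<and> p \<noteq> 0 \<and> poly (map_poly h p) x = 0}"
  have "S \<noteq> UNIV" using countable_roots[OF assms] uncountable_UNIV_complex unfolding S_def by metis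
  then obtain u' where "u' \<notin> S" by auto
  hence "conj_over u u'" using False by (intro conj_over_transcendental) (auto simp: S_def)
  thus ?thesis by (rule that)
qed

text \<open>
  The elements of \<open>F' = F(u)\<close> are fractions of values of polynomials at \<open>u\<close>; \<open>conj_over\<close> makes the image of
  such a fraction independent of its representation.
\<close>

lemma fhom_extend:
  assumes cF: "countable F" and cj: "conj_over u u'"
  obtains F' h' where "subfld F'" "countable F'" "fhom F' h'" "F \<subseteq> F'" "u \<in> F'" "\<forall>x\<in>F. h' x = h x" "h' u = u'"
proof -
  define frac where "frac x p q \<longleftrightarrow> poly_over F p \<and> poly_over F q \<and> poly q u \<noteq> 0 \<and> x = poly p u / poly q u" for x p q
  define F' where "F' = {x. \<exists>p q. frac x p q}"
  define val where "val p q = poly (map_poly h p) u' / poly (map_poly h q) u'" for p q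
  define h' where "h' x = (SOME y. \<exists>p q. frac x p q \<and> y = val p q)" for x
  have nz: "poly (map_poly h q) u' \<noteq> 0" if "poly_over F q" "poly q u \<noteq> 0" for q
    using cj that by (auto simp: conj_over_def)
  have val_eq: "val p q = val p1 q1" if a: "frac x p q" and b: "frac x p1 q1" for x p q p1 q1
  proof -
    have "poly (p * q1 - p1 * q) u = 0" using a b by (auto simp: frac_def field_simps)
    moreover have o: "poly_over F (p * q1)" "poly_over F (p1 * q)"
      using a b by (auto simp: frac_def intro: poly_over_mult)
    ultimately have "poly (map_poly h (p * q1 - p1 * q)) u' = 0"
      using cj poly_over_diff[OF o] unfolding conj_over_def by blast
    moreover have "map_poly h (p * q1) = map_poly h (p * q1 - p1 * q) + map_poly h (p1 * q)"
      using map_h_add[OF poly_over_diff[OF o] o(2)] by simp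
    ultimately have "poly (map_poly h (p * q1)) u' = poly (map_poly h (p1 * q)) u'" by simp
    hence "poly (map_poly h p) u' * poly (map_poly h q1) u' = poly (map_poly h p1) u' * poly (map_poly h q) u'"
      using a b by (simp add: frac_def map_h_mult)
    thus ?thesis using nz a b by (auto simp: val_def frac_def field_simps)
  qed
  have h': "h' x = val p q" if fr: "frac x p q" for x p q
  proof -
    have "\<exists>p q. frac x p q \<and> h' x = val p q"
      unfolding h'_def by (rule someI[of _ "val p q"]) (use fr in blast)
    thus ?thesis using val_eq fr by metis
  qed
  have fadd: "frac (x + y) (p * q1 + p1 * q) (q * q1)" and fdiff: "frac (x - y) (p * q1 - p1 * q) (q * q1)"
    and fmult: "frac (x * y) (p * p1) (q * q1)"
    if "frac x p q" "frac y p1 q1" for x y p q p1 q1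
    using that by (auto simp: frac_def intro!: poly_over_add poly_over_diff poly_over_mult simp: field_simps)
  have fc: "frac c [:c:] 1" if "c \<in> F" for c using that by (simp add: frac_def poly_over_const poly_over_1)
  have fu: "frac u [:0, 1:] 1" by (simp add: frac_def poly_over_1 poly_over_X)
  have finv: "\<exists>p' q'. frac (inverse x) p' q'" if "frac x p q" for x p q
  proof (cases "poly p u = 0")
    case True
    hence "x = 0" using that by (simp add: frac_def)
    thus ?thesis using fc[OF subfldD(1)[OF F]] by auto
  next
    case False
    thus ?thesis using that by (intro exI[of _ q] exI[of _ p]) (auto simp: frac_def)
  qed
  have "subfld F'"
    unfolding subfld_def
  proof (intro conjI ballI)
    show "0 \<in> F'" "1 \<in> F'" using fc subfldD[OF F] by (auto simp: F'_def)
    fix x y assume "x \<in> F'" "y \<in> F'"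
    thus "x + y \<in> F'" "x - y \<in> F'" "x * y \<in> F'" using fadd fdiff fmult unfolding F'_def by blast+
  next
    fix x assume "x \<in> F'" thus "inverse x \<in> F'" using finv by (auto simp: F'_def)
  qed
  moreover have "countable F'"
  proof -
    have "F' \<subseteq> (\<lambda>(p, q). poly p u / poly q u) ` ({p. poly_over F p} \<times> {p. poly_over F p})"
      by (auto simp: F'_def frac_def)
    thus ?thesis using countable_poly_over[OF cF] by (meson countable_SIGMA countable_image countable_subset)
  qed
  moreover have "fhom F' h'"
    unfolding fhom_def
  proof (intro conjI ballI)
    show "h' 1 = 1" using h'[OF fc[OF subfldD(2)[OF F]]]
      by (simp add: val_def map_h_const map_h_1 fhomD[OF h F])
    fix x y assume "x \<in> F'" "y \<in> F'"
    then obtain p q p1 q1 where f: "frac x p q" "frac y p1 q1" by (auto simp: F'_def)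
    have o: "poly_over F p" "poly_over F q" "poly_over F p1" "poly_over F q1"
      "poly (map_poly h q) u' \<noteq> 0" "poly (map_poly h q1) u' \<noteq> 0"
      using f nz by (auto simp: frac_def)
    show "h' (x + y) = h' x + h' y"
      unfolding h'[OF fadd[OF f]] h'[OF f(1)] h'[OF f(2)]
      using o by (simp add: val_def map_h_add map_h_mult poly_over_mult field_simps)
    show "h' (x * y) = h' x * h' y"
      unfolding h'[OF fmult[OF f]] h'[OF f(1)] h'[OF f(2)]
      using o by (simp add: val_def map_h_mult)
  qed
  moreover have "F \<subseteq> F'" "u \<in> F'" using fc fu by (auto simp: F'_def)
  moreover have "\<forall>x\<in>F. h' x = h x" using h'[OF fc] by (simp add: val_def map_h_const map_h_1)
  moreover have "h' u = u'" using h'[OF fu] by (simp add: val_def map_h_X map_h_1)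
  ultimately show ?thesis using that by blast
qed

end

lemma fhom_extend_finite:
  assumes "finite A" "subfld F" "countable F" "fhom F h"
  shows "\<exists>F' h'. subfld F' \<and> countable F' \<and> fhom F' h' \<and> F \<subseteq> F' \<and> A \<subseteq> F' \<and> (\<forall>x\<in>F. h' x = h x)"
  using assms(1)
proof (induct A rule: finite_induct)
  case empty
  thus ?case using assms by blast
next
  case (insert u A)
  then obtain F1 h1 where F1: "subfld F1" "countable F1" "fhom F1 h1" "F \<subseteq> F1" "A \<subseteq> F1" "\<forall>x\<in>F. h1 x = h x" by blast
  obtain u' where u': "conj_over F1 h1 u u'" by (rule conj_over_exists[OF F1(1,3,2)])
  obtain F' h' where F': "subfld F'" "countable F'" "fhom F' h'" "F1 \<subseteq> F'" "u \<in> F'" "\<forall>x\<in>F1. h' x = h1 x" "h' u = u'"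
    by (rule fhom_extend[OF F1(1,3,2) u'])
  show ?case using F1 F' by (intro exI[of _ F'] exI[of _ h']) (auto simp: subset_iff)
qed

lemma countable_subfld_containing:
  assumes "finite A" obtains F where "subfld F" "countable F" "A \<subseteq> F"
proof -
  have "subfld \<rat>" by (auto simp: subfld_def)
  moreover have "countable (\<rat> :: complex set)" by (simp add: Rats_def)
  moreover have "fhom \<rat> id" by (simp add: fhom_def)
  ultimately show ?thesis using fhom_extend_finite[OF assms] that by blast
qed

text \<open>
  Let \<open>F\<close> be a countable field containing \<open>A\<close> and \<open>Bad\<close> the set of numbers algebraic over \<open>F\<close>. If \<open>t0\<close> and
  \<open>t1\<close> are transcendental over \<open>F\<close>, then \<open>t0 \<mapsto> t1\<close> defines an embedding of \<open>F(t0)\<close> over \<open>F\<close>, which extends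
  to any finite set \<open>B\<close> of further numbers. The set \<open>B\<close> may depend on \<open>t0\<close> and \<open>t1\<close>; only \<open>A\<close> has to be
  known in advance.
\<close>

lemma generic_transfer:
  assumes "finite A"
  obtains Bad where "countable Bad"
    "\<forall>t0 t1 B. t0 \<notin> Bad \<longrightarrow> t1 \<notin> Bad \<longrightarrow> finite B \<longrightarrow>
      (\<exists>F h. subfld F \<and> fhom F h \<and> A \<subseteq> F \<and> B \<subseteq> F \<and> t0 \<in> F \<and> (\<forall>x\<in>A. h x = x) \<and> h t0 = t1)"
proof -
  obtain F where F: "subfld F" "countable F" "A \<subseteq> F" by (rule countable_subfld_containing[OF assms])
  have id: "fhom F id" by (simp add: fhom_def)
  define Bad where "Bad = {x. \<exists>p. poly_over F p \<and> p \<noteq> 0 \<and> poly p x = 0}"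
  have "countable Bad" using countable_roots[OF F(1) id F(2)] by (simp add: Bad_def map_poly_id)
  moreover have "\<exists>F' h. subfld F' \<and> fhom F' h \<and> A \<subseteq> F' \<and> B \<subseteq> F' \<and> t0 \<in> F' \<and> (\<forall>x\<in>A. h x = x) \<and> h t0 = t1"
    if t: "t0 \<notin> Bad" "t1 \<notin> Bad" "finite B" for t0 t1 B
  proof -
    have cj: "conj_over F id t0 t1"
      by (rule conj_over_transcendental[OF F(1) id]) (use t in \<open>auto simp: Bad_def map_poly_id\<close>)
    obtain F1 h1 where F1: "subfld F1" "countable F1" "fhom F1 h1" "F \<subseteq> F1" "t0 \<in> F1" "\<forall>x\<in>F. h1 x = id x" "h1 t0 = t1"
      by (rule fhom_extend[OF F(1) id F(2) cj])
    obtain F2 h2 where F2: "subfld F2" "countable F2" "fhom F2 h2" "F1 \<subseteq> F2" "B \<subseteq> F2" "\<forall>x\<in>F1. h2 x = h1 x"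
      using fhom_extend_finite[OF t(3) F1(1,2,3)] by blast
    show ?thesis using F F1 F2 by (intro exI[of _ F2] exI[of _ h2]) (auto simp: subset_iff)
  qed
  ultimately show ?thesis using that by blast
qed


section \<open>A basis of the extension space of two representations\<close>

text \<open>
  Linear algebra for the matrix \<open>d\<close> of a linear map whose kernel has dimension \<open>\<kappa>\<close>: the \<open>c\<close> vectors \<open>z k\<close>
  span a complement of the image, and the functionals \<open>\<zeta> k\<close> are dual to them and vanish on the image. A
  generalised inverse \<open>C\<close> of the map \<open>D\<close> yields projections \<open>K = 1 - C D\<close> onto the kernel and
  \<open>P = 1 - D C\<close> onto a complement of the image, \<open>trc (D C) = trc (C D)\<close> gives the dimension formula,
  and \<open>idempotent_split\<close> applied to \<open>P\<close> gives the \<open>z\<close> and \<open>\<zeta>\<close>. The hypothesis on the kernel spells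
  out the dimensions \<open>0\<close> and \<open>1\<close>, the values that Schur's lemma allows.
\<close>

lemma cokernel_basis:
  fixes d :: "'a \<Rightarrow> 'b \<Rightarrow> complex"
  assumes A: "finite A" and B: "finite B"
    and ker: "(\<kappa> = 0 \<and> (\<forall>x. (\<forall>a\<in>A. (\<Sum>b\<in>B. d a b * x b) = 0) \<longrightarrow> (\<forall>b\<in>B. x b = 0))) \<or>
      (\<kappa> = 1 \<and> (\<exists>w. (\<exists>b\<in>B. w b \<noteq> 0) \<and> (\<forall>a\<in>A. (\<Sum>b\<in>B. d a b * w b) = 0) \<and>
        (\<forall>x. (\<forall>a\<in>A. (\<Sum>b\<in>B. d a b * x b) = 0) \<longrightarrow> (\<exists>c. \<forall>b\<in>B. x b = c * w b))))"
  obtains c z \<zeta> where "c + card B = card A + \<kappa>"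
    "\<forall>k<c. \<forall>b\<in>B. (\<Sum>a\<in>A. \<zeta> k a * d a b) = 0"
    "\<forall>k<c. \<forall>j<c. (\<Sum>a\<in>A. \<zeta> k a * z j a) = (if k = j then 1 else 0)"
    "\<forall>y. \<exists>x t. \<forall>a\<in>A. y a = (\<Sum>b\<in>B. d a b * x b) + (\<Sum>k<c. t k * z k a)"
proof -
  define n m where "n = card A" and "m = card B"
  obtain f where f: "bij_betw f A {..<n}" using ex_bij_betw_finite_nat[OF A] by (auto simp: n_def atLeast0LessThan)
  obtain g where g: "bij_betw g B {..<m}" using ex_bij_betw_finite_nat[OF B] by (auto simp: m_def atLeast0LessThan)
  define fi gi where "fi = inv_into A f" and "gi = inv_into B g"
  have fa: "f a < n" "fi (f a) = a" if "a \<in> A" for a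
    using f that by (auto simp: fi_def bij_betw_def)
  have gb: "g b < m" "gi (g b) = b" if "b \<in> B" for b
    using g that by (auto simp: gi_def bij_betw_def)
  have fi: "fi i \<in> A" "f (fi i) = i" if "i < n" for i
    using f that unfolding fi_def bij_betw_def by (metis lessThan_iff inv_into_into, metis lessThan_iff f_inv_into_f)
  have gi: "gi i \<in> B" "g (gi i) = i" if "i < m" for i
    using g that unfolding gi_def bij_betw_def by (metis lessThan_iff inv_into_into, metis lessThan_iff f_inv_into_f)
  have sumA: "(\<Sum>i<n. F i) = (\<Sum>a\<in>A. F (f a))" for F :: "nat \<Rightarrow> complex"
    by (rule sum.reindex_bij_betw[OF f, symmetric])
  have sumB: "(\<Sum>i<m. F i) = (\<Sum>b\<in>B. F (g b))" for F :: "nat \<Rightarrow> complex"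
    by (rule sum.reindex_bij_betw[OF g, symmetric])
  define D where "D = mat_fun n m (\<lambda>i j. d (fi i) (gi j))"
  have entD: "ent D (f a) (g b) = d a b" if "a \<in> A" "b \<in> B" for a b
    using fa gb that by (simp add: D_def ent_mat_fun)
  have D: "idm n * D = D" "D * idm m = D" by (simp_all add: idm_times_iff times_idm_iff D_def ent_mat_fun)
  have Dmul: "ent (D * X) (f a) j = (\<Sum>b\<in>B. d a b * ent X (g b) j)" if "a \<in> A" for a j X
  proof -
    have "ent (D * X) (f a) j = (\<Sum>k<m. ent D (f a) k * ent X k j)"
      by (rule ent_times) (auto simp: D_def ent_mat_fun)
    thus ?thesis unfolding sumB by (simp add: entD that)
  qed
  obtain C where C: "D * C * D = D" "C * D * C = C" by (rule von_neumann_regular)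
  define C' where "C' = idm m * C * idm n"
  have C': "idm m * C' = C'" "C' * idm n = C'"
    by (simp_all add: C'_def mult.assoc times_right[OF idm_idm, unfolded mult.assoc])
  have DCD: "D * (C' * D) = D"
    by (simp add: C'_def mult.assoc D times_right[OF D(2), unfolded mult.assoc] C(1)[unfolded mult.assoc])
  note DCD' = times_right[OF DCD, unfolded mult.assoc]
  note C'' = times_right[OF C'(1), unfolded mult.assoc] times_right[OF C'(2), unfolded mult.assoc]
    and D'' = times_right[OF D(1), unfolded mult.assoc] times_right[OF D(2), unfolded mult.assoc]
  define K where "K = idm m - C' * D"
  define P where "P = idm n - D * C'"
  have KK: "K * K = K" by (simp add: K_def algebra_simps mult.assoc D C' C'' D'' DCD DCD')
  have DK: "D * K = 0" by (simp add: K_def right_diff_distrib D DCD)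
  have PP: "P * P = P" by (simp add: P_def algebra_simps mult.assoc D C' C'' D'' DCD DCD')
  have PD: "P * D = 0" by (simp add: P_def left_diff_distrib mult.assoc D DCD)
  obtain c Z Z' where Z: "P = Z * Z'" "Z' * Z = idm c" "Z * idm c = Z" "idm c * Z' = Z'" "trc P = of_nat c"
    by (rule idempotent_split[OF PP])
  have Kcol: "(\<Sum>b\<in>B. d a b * ent K (g b) j) = 0" if "a \<in> A" for a j
    using Dmul[OF that, of K j] by (simp add: DK)
  have Ksup: "ent K i j = 0" if "m \<le> i \<or> m \<le> j" for i j
  proof -
    have "idm m * K = K" "K * idm m = K" by (simp_all add: K_def algebra_simps mult.assoc C' C'' D)
    thus ?thesis using that by (auto simp: idm_times_iff times_idm_iff)
  qed
  \<comment> \<open>In the case \<open>\<kappa> = 1\<close> the projection \<open>K\<close> has rank one: \<open>K = W * R\<close> and \<open>trc K = trc (R * W) = 1\<close>.\<close>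
  have trK: "trc K = of_nat \<kappa>"
    using ker
  proof
    assume k: "\<kappa> = 0 \<and> (\<forall>x. (\<forall>a\<in>A. (\<Sum>b\<in>B. d a b * x b) = 0) \<longrightarrow> (\<forall>b\<in>B. x b = 0))"
    have "K = 0"
    proof (rule fmat_eqI)
      fix i j
      have "\<forall>b\<in>B. ent K (g b) j = 0"
        using conjunct2[OF k, THEN spec, of "\<lambda>b. ent K (g b) j"] Kcol by simp
      hence "i < m \<Longrightarrow> ent K i j = 0" using gi by metis
      thus "ent K i j = ent 0 i j" using Ksup[of i j] by (cases "i < m") auto
    qed
    thus ?thesis using k by simp
  next
    assume k: "\<kappa> = 1 \<and> (\<exists>w. (\<exists>b\<in>B. w b \<noteq> 0) \<and> (\<forall>a\<in>A. (\<Sum>b\<in>B. d a b * w b) = 0) \<and>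
        (\<forall>x. (\<forall>a\<in>A. (\<Sum>b\<in>B. d a b * x b) = 0) \<longrightarrow> (\<exists>c. \<forall>b\<in>B. x b = c * w b)))"
    then obtain w where w: "\<exists>b\<in>B. w b \<noteq> 0" "\<forall>a\<in>A. (\<Sum>b\<in>B. d a b * w b) = 0"
      "\<And>x. \<forall>a\<in>A. (\<Sum>b\<in>B. d a b * x b) = 0 \<Longrightarrow> \<exists>c. \<forall>b\<in>B. x b = c * w b" by blast
    have "\<forall>j. \<exists>r. \<forall>b\<in>B. ent K (g b) j = r * w b"
      using w(3)[of "\<lambda>b. ent K (g b) _"] Kcol by simp
    then obtain r where r: "\<And>j b. b \<in> B \<Longrightarrow> ent K (g b) j = r j * w b" by metis
    define W where "W = mat_fun m 1 (\<lambda>i j. w (gi i))"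
    define R where "R = mat_fun 1 m (\<lambda>i j. r j)"
    have KWR: "K = W * R"
    proof (rule fmat_eqI)
      fix i j
      have "ent (W * R) i j = (\<Sum>k\<in>{0}. ent W i k * ent R k j)"
        by (rule ent_times) (auto simp: W_def R_def ent_mat_fun)
      moreover have "ent K i j = r j * w (gi i)" if "i < m" using r[OF gi(1)[OF that], of j] gi(2)[OF that] by simp
      ultimately show "ent K i j = ent (W * R) i j" using Ksup[of i j]
        by (auto simp: W_def R_def ent_mat_fun not_less)
    qed
    have "D * W = 0"
    proof (rule fmat_eqI)
      fix i j
      show "ent (D * W) i j = ent 0 i j"
      proof (cases "i < n \<and> j = 0")
        case True
        have "ent (D * W) (f (fi i)) j = (\<Sum>b\<in>B. d (fi i) b * ent W (g b) j)" by (rule Dmul) (use fi True in auto)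
        also have "\<dots> = (\<Sum>b\<in>B. d (fi i) b * w b)" using True gb by (intro sum.cong) (auto simp: W_def ent_mat_fun)
        finally show ?thesis using w(2) fi True by simp
      next
        case False
        have "ent (D * W) i j = (\<Sum>k<m. ent D i k * ent W k j)"
          by (rule ent_times) (auto simp: D_def ent_mat_fun)
        thus ?thesis using False by (auto simp: D_def W_def ent_mat_fun intro!: sum.neutral)
      qed
    qed
    moreover have "idm m * W = W" by (simp add: idm_times_iff W_def ent_mat_fun)
    ultimately have "K * W = W" by (simp add: K_def left_diff_distrib mult.assoc)
    hence WRW: "W * (R * W) = W" by (simp add: KWR mult.assoc)
    obtain b where b: "b \<in> B" "w b \<noteq> 0" using w(1) by blast
    define \<rho> where "\<rho> = ent (R * W) 0 0"
    have "ent (W * (R * W)) (g b) 0 = (\<Sum>k\<in>{0}. ent W (g b) k * ent (R * W) k 0)"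
      by (rule ent_times) (auto simp: W_def ent_mat_fun)
    hence "w b * \<rho> = w b" using gb[OF b(1)] by (simp add: WRW \<rho>_def) (simp add: W_def ent_mat_fun)
    hence \<rho>: "\<rho> = 1" using b(2) by simp
    have sup: "ent (R * W) i i = 0" if "1 \<le> i" for i
    proof -
      have "idm 1 * R = R" by (simp add: idm_times_iff R_def ent_mat_fun)
      hence "idm 1 * (R * W) = R * W" by (metis mult.assoc)
      thus ?thesis using that by (simp add: idm_times_iff)
    qed
    have "trc (R * W) = 1" using sup \<rho> by (subst trc_eq[of 1]) (auto simp: \<rho>_def)
    thus ?thesis using k trc_commute[of W R] by (simp add: KWR)
  qed
  have "trc P - trc K = of_nat n - of_nat m" by (simp add: P_def K_def trc_diff trc_commute[of D])
  hence "of_nat c + of_nat m = (of_nat n + of_nat \<kappa> :: complex)" using Z(5) trK by (simp add: algebra_simps)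
  hence "c + m = n + \<kappa>" by (metis of_nat_add of_nat_eq_iff)
  moreover have "\<forall>k<c. \<forall>b\<in>B. (\<Sum>a\<in>A. ent Z' k (f a) * d a b) = 0"
  proof (intro allI impI ballI)
    fix k b assume "k < c" and b: "b \<in> B"
    have "Z' * D = Z' * Z * Z' * D" by (simp add: Z)
    also have "\<dots> = Z' * (P * D)" by (simp add: Z(1) mult.assoc)
    finally have "Z' * D = 0" by (simp add: PD)
    moreover have "ent (Z' * D) k (g b) = (\<Sum>i<n. ent Z' k i * ent D i (g b))"
      by (rule ent_times) (auto simp: D_def ent_mat_fun)
    ultimately show "(\<Sum>a\<in>A. ent Z' k (f a) * d a b) = 0" unfolding sumA using b by (simp add: entD)
  qed
  moreover have "\<forall>k<c. \<forall>j<c. (\<Sum>a\<in>A. ent Z' k (f a) * ent Z (f a) j) = (if k = j then 1 else 0)"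
  proof (intro allI impI)
    fix k j assume "k < c" "j < c"
    have "Z = P * Z" by (simp add: Z mult.assoc)
    hence "idm n * Z = Z" by (simp add: P_def left_diff_distrib right_diff_distrib mult.assoc D'') (metis D(1) mult.assoc idm_idm right_diff_distrib)
    hence "ent (Z' * Z) k j = (\<Sum>i<n. ent Z' k i * ent Z i j)"
      by (intro ent_times) (auto simp: idm_times_iff)
    thus "(\<Sum>a\<in>A. ent Z' k (f a) * ent Z (f a) j) = (if k = j then 1 else 0)"
      using \<open>k < c\<close> unfolding sumA by (simp add: Z(2) ent_idm)
  qed
  moreover have "\<forall>y. \<exists>x t. \<forall>a\<in>A. y a = (\<Sum>b\<in>B. d a b * x b) + (\<Sum>k<c. t k * ent Z (f a) k)"
  proof
    fix y :: "'a \<Rightarrow> complex"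
    define Y where "Y = mat_fun n 1 (\<lambda>i j. y (fi i))"
    have "idm n * Y = Y" by (simp add: idm_times_iff Y_def ent_mat_fun)
    hence "Y = D * (C' * Y) + Z * (Z' * Y)"
      by (simp add: mult.assoc[symmetric] Z(1)[symmetric]) (simp add: P_def left_diff_distrib)
    have "y a = (\<Sum>b\<in>B. d a b * ent (C' * Y) (g b) 0) + (\<Sum>k<c. ent (Z' * Y) k 0 * ent Z (f a) k)" if a: "a \<in> A" for a
    proof -
      have "y a = ent Y (f a) 0" using fa[OF a] by (simp add: Y_def ent_mat_fun)
      also have "\<dots> = ent (D * (C' * Y)) (f a) 0 + ent (Z * (Z' * Y)) (f a) 0"
        using \<open>Y = D * (C' * Y) + Z * (Z' * Y)\<close> by (metis ent_add)
      also have "ent (Z * (Z' * Y)) (f a) 0 = (\<Sum>k<c. ent Z (f a) k * ent (Z' * Y) k 0)"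
        by (rule ent_times) (use Z(3) in \<open>auto simp: times_idm_iff\<close>)
      finally show ?thesis by (simp add: Dmul[OF a] mult.commute)
    qed
    thus "\<exists>x t. \<forall>a\<in>A. y a = (\<Sum>b\<in>B. d a b * x b) + (\<Sum>k<c. t k * ent Z (f a) k)"
      by (intro exI[of _ "\<lambda>b. ent (C' * Y) (g b) 0"] exI[of _ "\<lambda>k. ent (Z' * Y) k 0"] ballI)
  qed
  ultimately show ?thesis using that[of c "\<lambda>k a. ent Z' k (f a)" "\<lambda>k a. ent Z (f a) k"] by (simp add: n_def m_def)
qed

lemma euler_form_eq:
  assumes "fin_digraph Q"
  shows "euler_form Q (\<lambda>v. int (\<beta> v)) (\<lambda>v. int (\<beta>' v)) =
    (\<Sum>v\<in>verts Q. int (\<beta> v * \<beta>' v)) - (\<Sum>e\<in>arcs Q. int (\<beta> (tail Q e) * \<beta>' (head Q e)))"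
proof -
  interpret fin_digraph Q by (rule assms)
  have fin: "finite (verts Q)" "finite (arcs Q)" by simp_all
  have "(\<Sum>v\<in>verts Q. \<Sum>w\<in>verts Q. int (\<beta> v) * int (arrow_count Q v w) * int (\<beta>' w)) =
     (\<Sum>v\<in>verts Q. \<Sum>w\<in>verts Q. \<Sum>e\<in>{e\<in>arcs Q. tail Q e = v \<and> head Q e = w}. int (\<beta> (tail Q e) * \<beta>' (head Q e)))"
    by (intro sum.cong refl) (simp add: arrow_count_def)
  also have "\<dots> = (\<Sum>v\<in>verts Q. \<Sum>e\<in>{e\<in>arcs Q. tail Q e = v}. int (\<beta> (tail Q e) * \<beta>' (head Q e)))"
  proof (rule sum.cong[OF refl])
    fix v
    have "(\<Sum>w\<in>verts Q. \<Sum>e\<in>{e\<in>{e\<in>arcs Q. tail Q e = v}. head Q e = w}. int (\<beta> (tail Q e) * \<beta>' (head Q e))) =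
      (\<Sum>e\<in>{e\<in>arcs Q. tail Q e = v}. int (\<beta> (tail Q e) * \<beta>' (head Q e)))"
      by (rule sum.group) (use fin in auto)
    moreover have "{e\<in>{e\<in>arcs Q. tail Q e = v}. head Q e = w} = {e\<in>arcs Q. tail Q e = v \<and> head Q e = w}" for w by auto
    ultimately show "(\<Sum>w\<in>verts Q. \<Sum>e\<in>{e\<in>arcs Q. tail Q e = v \<and> head Q e = w}. int (\<beta> (tail Q e) * \<beta>' (head Q e))) =
      (\<Sum>e\<in>{e\<in>arcs Q. tail Q e = v}. int (\<beta> (tail Q e) * \<beta>' (head Q e)))" by simp
  qed
  also have "\<dots> = (\<Sum>e\<in>arcs Q. int (\<beta> (tail Q e) * \<beta>' (head Q e)))"
    by (rule sum.group) (use fin in auto)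
  finally have 1: "(\<Sum>v\<in>verts Q. \<Sum>w\<in>verts Q. int (\<beta> v) * int (arrow_count Q v w) * int (\<beta>' w)) =
    (\<Sum>e\<in>arcs Q. int (\<beta> (tail Q e) * \<beta>' (head Q e)))" .
  have "(\<Sum>v\<in>verts Q. \<Sum>w\<in>verts Q. int (\<beta> v) * (if v = w then 1 else 0) * int (\<beta>' w)) =
    (\<Sum>v\<in>verts Q. int (\<beta> v * \<beta>' v))"
    using fin by (intro sum.cong refl) (simp add: if_distrib if_distribR sum.delta cong: if_cong)
  thus ?thesis unfolding euler_form_def 1[symmetric]
    by (simp add: right_diff_distrib left_diff_distrib sum_subtractf)
qed

definition corner_fam :: "'v set \<Rightarrow> ('v \<Rightarrow> nat) \<Rightarrow> ('v \<Rightarrow> nat) \<Rightarrow> ('v \<Rightarrow> fmat) \<Rightarrow> bool" where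
  "corner_fam S m n h \<longleftrightarrow> (\<forall>v\<in>S. idm (m v) * h v = h v \<and> h v * idm (n v) = h v)"

text \<open>
  The map \<open>h \<mapsto> h W - W' h\<close> from families of matrices over the vertices to families over the arrows has
  kernel \<open>Hom (W, W')\<close> and cokernel \<open>Ext (W, W')\<close>, and the dimensions of its domain and codomain differ by the
  Euler form. The proof writes the map in coordinates and applies \<open>cokernel_basis\<close>: \<open>Z\<close> represents
  a basis of \<open>Ext\<close> and \<open>\<zeta>\<close> is the dual basis, paired by the trace form.
\<close>

lemma ext_basis:
  fixes Q :: "('v, 'e) pre_digraph"
  assumes Q: "fin_digraph Q"
    and W: "fm_rep Q (\<lambda>v. idm (\<beta> v)) W" and W': "fm_rep Q (\<lambda>v. idm (\<beta>' v)) W'"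
    and hom: "(\<kappa> = 0 \<and> (\<forall>h. fm_hom Q (\<lambda>v. idm (\<beta> v)) W (\<lambda>v. idm (\<beta>' v)) W' h \<longrightarrow> (\<forall>v\<in>verts Q. h v = 0))) \<or>
      (\<kappa> = 1 \<and> (\<exists>h0. fm_hom Q (\<lambda>v. idm (\<beta> v)) W (\<lambda>v. idm (\<beta>' v)) W' h0 \<and> (\<exists>v\<in>verts Q. h0 v \<noteq> 0) \<and>
        (\<forall>h. fm_hom Q (\<lambda>v. idm (\<beta> v)) W (\<lambda>v. idm (\<beta>' v)) W' h \<longrightarrow> (\<exists>c. \<forall>v\<in>verts Q. h v = c *\<^sub>C h0 v))))"
  obtains c Z \<zeta> where "int c = int \<kappa> - euler_form Q (\<lambda>v. int (\<beta> v)) (\<lambda>v. int (\<beta>' v))"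
    "\<forall>k<c. corner_fam (arcs Q) (\<lambda>e. \<beta>' (head Q e)) (\<lambda>e. \<beta> (tail Q e)) (Z k)"
    "\<forall>h. corner_fam (verts Q) \<beta>' \<beta> h \<longrightarrow>
       (\<forall>k<c. (\<Sum>e\<in>arcs Q. trc (\<zeta> k e * (h (head Q e) * W e - W' e * h (tail Q e)))) = 0)"
    "\<forall>k<c. \<forall>j<c. (\<Sum>e\<in>arcs Q. trc (\<zeta> k e * Z j e)) = (if k = j then 1 else 0)"
    "\<forall>Y. corner_fam (arcs Q) (\<lambda>e. \<beta>' (head Q e)) (\<lambda>e. \<beta> (tail Q e)) Y \<longrightarrow>
       (\<exists>h t. corner_fam (verts Q) \<beta>' \<beta> h \<and>
         (\<forall>e\<in>arcs Q. Y e = h (head Q e) * W e - W' e * h (tail Q e) + (\<Sum>k<c. t k *\<^sub>C Z k e)))"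
proof -
  interpret fin_digraph Q by (rule Q)
  have wf: "wf_digraph Q" by unfold_locales
  have fin: "finite (verts Q)" "finite (arcs Q)" by simp_all
  define A where "A = (SIGMA e:arcs Q. {..<\<beta>' (head Q e)} \<times> {..<\<beta> (tail Q e)})"
  define B where "B = (SIGMA v:verts Q. {..<\<beta>' v} \<times> {..<\<beta> v})"
  have fA: "finite A" and fB: "finite B" using fin by (auto simp: A_def B_def)
  have cA: "card A = (\<Sum>e\<in>arcs Q. \<beta>' (head Q e) * \<beta> (tail Q e))"
    and cB: "card B = (\<Sum>v\<in>verts Q. \<beta>' v * \<beta> v)"
    using fin by (simp_all add: A_def B_def card_SigmaI card_cartesian_product)
  define d where "d a b = (case a of (e, x, y) \<Rightarrow> case b of (v, x', y') \<Rightarrow>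
     (if v = head Q e \<and> x' = x then ent (W e) y' y else 0) - (if v = tail Q e \<and> y' = y then ent (W' e) x x' else 0))" for a b
  define fam where "fam x v = mat_fun (\<beta>' v) (\<beta> v) (\<lambda>i j. x (v, i, j))" for x :: "'v \<times> nat \<times> nat \<Rightarrow> complex" and v
  have fam: "corner_fam (verts Q) \<beta>' \<beta> (fam x)" for x
    by (simp add: corner_fam_def fam_def idm_times_iff times_idm_iff ent_mat_fun)
  have Wz: "idm (\<beta> (head Q e)) * W e = W e" "W e * idm (\<beta> (tail Q e)) = W e"
    "idm (\<beta>' (head Q e)) * W' e = W' e" "W' e * idm (\<beta>' (tail Q e)) = W' e" if "e \<in> arcs Q" for e
    using W W' that by (auto simp: fm_rep_def)
  have sumB: "(\<Sum>b\<in>B. F b) = (\<Sum>v\<in>verts Q. \<Sum>i<\<beta>' v. \<Sum>j<\<beta> v. F (v, i, j))" for F :: "_ \<Rightarrow> complex"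
  proof -
    have "(\<Sum>v\<in>verts Q. \<Sum>i<\<beta>' v. \<Sum>j<\<beta> v. F (v, i, j)) = (\<Sum>v\<in>verts Q. \<Sum>x\<in>{..<\<beta>' v}\<times>{..<\<beta> v}. F (v, x))"
      by (simp add: sum.cartesian_product split_def)
    also have "\<dots> = (\<Sum>b\<in>B. F b)" unfolding B_def by (simp add: sum.Sigma split_def)
    finally show ?thesis by simp
  qed
  have sumA: "(\<Sum>a\<in>A. F a) = (\<Sum>e\<in>arcs Q. \<Sum>i<\<beta>' (head Q e). \<Sum>j<\<beta> (tail Q e). F (e, i, j))" for F :: "_ \<Rightarrow> complex"
  proof -
    have "(\<Sum>e\<in>arcs Q. \<Sum>i<\<beta>' (head Q e). \<Sum>j<\<beta> (tail Q e). F (e, i, j)) =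
        (\<Sum>e\<in>arcs Q. \<Sum>x\<in>{..<\<beta>' (head Q e)}\<times>{..<\<beta> (tail Q e)}. F (e, x))"
      by (simp add: sum.cartesian_product split_def)
    also have "\<dots> = (\<Sum>a\<in>A. F a)" unfolding A_def by (simp add: sum.Sigma split_def)
    finally show ?thesis by simp
  qed
  have pull: "(\<Sum>j\<in>S. if P then F j else 0) = (if P then \<Sum>j\<in>S. F j else 0)"
    for S :: "nat set" and P and F :: "nat \<Rightarrow> complex" by simp
  have ent_hW: "ent (h (head Q e) * W e - W' e * h (tail Q e)) x y =
      (\<Sum>j<\<beta> (head Q e). ent (h (head Q e)) x j * ent (W e) j y) - (\<Sum>i<\<beta>' (tail Q e). ent (W' e) x i * ent (h (tail Q e)) i y)"
    if "e \<in> arcs Q" for h e x y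
  proof -
    have "ent (h (head Q e) * W e) x y = (\<Sum>j<\<beta> (head Q e). ent (h (head Q e)) x j * ent (W e) j y)"
      by (rule ent_times) (use Wz[OF that] in \<open>auto simp: idm_times_iff times_idm_iff\<close>)
    moreover have "ent (W' e * h (tail Q e)) x y = (\<Sum>i<\<beta>' (tail Q e). ent (W' e) x i * ent (h (tail Q e)) i y)"
      by (rule ent_times) (use Wz[OF that] in \<open>auto simp: idm_times_iff times_idm_iff\<close>)
    ultimately show ?thesis by simp
  qed
  have dsum: "(\<Sum>b\<in>B. d (e, i, j) b * x b) = ent (fam x (head Q e) * W e - W' e * fam x (tail Q e)) i j"
    if a: "(e, i, j) \<in> A" for e i j x
  proof -
    have e: "e \<in> arcs Q" "i < \<beta>' (head Q e)" "j < \<beta> (tail Q e)" using a by (auto simp: A_def)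
    note ht = wf_ends[OF wf e(1)]
    have "(\<Sum>b\<in>B. d (e, i, j) b * x b) =
      (\<Sum>v\<in>verts Q. \<Sum>i'<\<beta>' v. \<Sum>j'<\<beta> v. if v = head Q e then (if i' = i then ent (W e) j' j * x (v, i', j') else 0) else 0) -
      (\<Sum>v\<in>verts Q. \<Sum>i'<\<beta>' v. \<Sum>j'<\<beta> v. if v = tail Q e then (if j' = j then ent (W' e) i i' * x (v, i', j') else 0) else 0)"
      unfolding sumB sum_subtractf[symmetric] by (intro sum.cong refl) (auto simp: d_def algebra_simps)
    also have "(\<Sum>v\<in>verts Q. \<Sum>i'<\<beta>' v. \<Sum>j'<\<beta> v. if v = head Q e then (if i' = i then ent (W e) j' j * x (v, i', j') else 0) else 0)
      = (\<Sum>v\<in>verts Q. if v = head Q e then (\<Sum>i'<\<beta>' v. if i' = i then (\<Sum>j'<\<beta> v. ent (W e) j' j * x (v, i', j')) else 0) else 0)"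
      by (simp only: pull)
    also have "\<dots> = (\<Sum>j'<\<beta> (head Q e). ent (W e) j' j * x (head Q e, i, j'))"
      using e ht fin by (simp add: sum.delta)
    also have "(\<Sum>v\<in>verts Q. \<Sum>i'<\<beta>' v. \<Sum>j'<\<beta> v. if v = tail Q e then (if j' = j then ent (W' e) i i' * x (v, i', j') else 0) else 0)
      = (\<Sum>v\<in>verts Q. if v = tail Q e then (\<Sum>i'<\<beta>' v. \<Sum>j'<\<beta> v. if j' = j then ent (W' e) i i' * x (v, i', j') else 0) else 0)"
      by (simp only: pull)
    also have "\<dots> = (\<Sum>i'<\<beta>' (tail Q e). ent (W' e) i i' * x (tail Q e, i', j))"
      using e ht fin by (simp add: sum.delta)
    finally have eq: "(\<Sum>b\<in>B. d (e, i, j) b * x b) =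
      (\<Sum>j'<\<beta> (head Q e). ent (W e) j' j * x (head Q e, i, j')) - (\<Sum>i'<\<beta>' (tail Q e). ent (W' e) i i' * x (tail Q e, i', j))" .
    show ?thesis unfolding eq ent_hW[OF e(1)] using e by (simp add: fam_def ent_mat_fun mult.commute)
  qed
  have famd: "corner_fam (arcs Q) (\<lambda>e. \<beta>' (head Q e)) (\<lambda>e. \<beta> (tail Q e)) (\<lambda>e. h (head Q e) * W e - W' e * h (tail Q e))"
    if "corner_fam (verts Q) \<beta>' \<beta> h" for h
    unfolding corner_fam_def
  proof
    fix e assume e: "e \<in> arcs Q"
    note ht = wf_ends[OF wf e]
    have h: "idm (\<beta>' v) * h v = h v" "h v * idm (\<beta> v) = h v" if "v \<in> verts Q" for v
      using \<open>corner_fam (verts Q) \<beta>' \<beta> h\<close> that by (auto simp: corner_fam_def)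
    show "idm (\<beta>' (head Q e)) * (h (head Q e) * W e - W' e * h (tail Q e)) = h (head Q e) * W e - W' e * h (tail Q e) \<and>
      (h (head Q e) * W e - W' e * h (tail Q e)) * idm (\<beta> (tail Q e)) = h (head Q e) * W e - W' e * h (tail Q e)"
      by (simp add: left_diff_distrib right_diff_distrib mult.assoc Wz[OF e] h ht
          times_right[OF h(1)[OF ht(1)], unfolded mult.assoc] times_right[OF Wz(3)[OF e], unfolded mult.assoc])
  qed
  have eq0: "Y e = Y' e" if "corner_fam (arcs Q) (\<lambda>e. \<beta>' (head Q e)) (\<lambda>e. \<beta> (tail Q e)) Y"
     "corner_fam (arcs Q) (\<lambda>e. \<beta>' (head Q e)) (\<lambda>e. \<beta> (tail Q e)) Y'" "e \<in> arcs Q"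
     "\<And>i j. (e, i, j) \<in> A \<Longrightarrow> ent (Y e) i j = ent (Y' e) i j" for Y Y' e
  proof (rule fmat_eqI)
    fix i j
    show "ent (Y e) i j = ent (Y' e) i j"
      using that(1,2,3) that(4)[of i j]
      by (cases "i < \<beta>' (head Q e) \<and> j < \<beta> (tail Q e)")
         (auto simp: corner_fam_def idm_times_iff times_idm_iff A_def not_less)
  qed
  have homfam: "fm_hom Q (\<lambda>v. idm (\<beta> v)) W (\<lambda>v. idm (\<beta>' v)) W' (fam x)"
    if "\<forall>a\<in>A. (\<Sum>b\<in>B. d a b * x b) = 0" for x
    unfolding fm_hom_def
  proof (intro conjI ballI)
    fix e assume e: "e \<in> arcs Q"
    have "fam x (head Q e) * W e - W' e * fam x (tail Q e) = 0"
      by (rule eq0[of "\<lambda>e. fam x (head Q e) * W e - W' e * fam x (tail Q e)" "\<lambda>e. 0"])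
         (use famd[OF fam] e dsum that in \<open>auto simp: corner_fam_def\<close>)
    thus "fam x (head Q e) * W e = W' e * fam x (tail Q e)" by simp
  qed (use fam[of x] in \<open>auto simp: corner_fam_def\<close>)
  define coo where "coo h b = (case b of (v, i, j) \<Rightarrow> ent (h v) i j)" for h :: "'v \<Rightarrow> fmat" and b
  have famcoo: "fam (coo h) v = h v" if "corner_fam (verts Q) \<beta>' \<beta> h" "v \<in> verts Q" for h v
  proof (rule fmat_eqI)
    fix i j
    show "ent (fam (coo h) v) i j = ent (h v) i j"
      using that by (auto simp: fam_def ent_mat_fun coo_def corner_fam_def idm_times_iff times_idm_iff not_less)
  qed
  have ent_fam: "ent (fam x v) i j = x (v, i, j)" if "(v, i, j) \<in> B" for x v i j
    using that by (simp add: fam_def ent_mat_fun B_def)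
  have dcoo: "(\<Sum>b\<in>B. d (e, i, j) b * coo h b) = ent (h (head Q e) * W e - W' e * h (tail Q e)) i j"
    if "corner_fam (verts Q) \<beta>' \<beta> h" "(e, i, j) \<in> A" for h e i j
    using dsum[OF that(2), of "coo h"] famcoo[OF that(1)] that(2) wf_ends[OF wf] by (simp add: A_def)
  have ker: "(\<kappa> = 0 \<and> (\<forall>x. (\<forall>a\<in>A. (\<Sum>b\<in>B. d a b * x b) = 0) \<longrightarrow> (\<forall>b\<in>B. x b = 0))) \<or>
      (\<kappa> = 1 \<and> (\<exists>w. (\<exists>b\<in>B. w b \<noteq> 0) \<and> (\<forall>a\<in>A. (\<Sum>b\<in>B. d a b * w b) = 0) \<and>
        (\<forall>x. (\<forall>a\<in>A. (\<Sum>b\<in>B. d a b * x b) = 0) \<longrightarrow> (\<exists>c. \<forall>b\<in>B. x b = c * w b))))"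
    using hom
  proof (elim disjE conjE)
    assume k: "\<kappa> = 0" "\<forall>h. fm_hom Q (\<lambda>v. idm (\<beta> v)) W (\<lambda>v. idm (\<beta>' v)) W' h \<longrightarrow> (\<forall>v\<in>verts Q. h v = 0)"
    have "x b = 0" if x: "\<forall>a\<in>A. (\<Sum>b\<in>B. d a b * x b) = 0" and b: "b \<in> B" for x b
    proof -
      obtain v i j where vij: "b = (v, i, j)" "v \<in> verts Q" using b by (auto simp: B_def)
      have "fam x v = 0" using k homfam[OF x] vij by blast
      thus ?thesis using ent_fam[of v i j x] b vij by simp
    qed
    thus ?thesis using k by blast
  next
    assume k: "\<kappa> = 1" "\<exists>h0. fm_hom Q (\<lambda>v. idm (\<beta> v)) W (\<lambda>v. idm (\<beta>' v)) W' h0 \<and> (\<exists>v\<in>verts Q. h0 v \<noteq> 0) \<and>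
        (\<forall>h. fm_hom Q (\<lambda>v. idm (\<beta> v)) W (\<lambda>v. idm (\<beta>' v)) W' h \<longrightarrow> (\<exists>c. \<forall>v\<in>verts Q. h v = c *\<^sub>C h0 v))"
    then obtain h0 where h0: "fm_hom Q (\<lambda>v. idm (\<beta> v)) W (\<lambda>v. idm (\<beta>' v)) W' h0" "\<exists>v\<in>verts Q. h0 v \<noteq> 0"
      "\<And>h. fm_hom Q (\<lambda>v. idm (\<beta> v)) W (\<lambda>v. idm (\<beta>' v)) W' h \<Longrightarrow> \<exists>c. \<forall>v\<in>verts Q. h v = c *\<^sub>C h0 v" by blast
    have c0: "corner_fam (verts Q) \<beta>' \<beta> h0" using h0(1) by (auto simp: corner_fam_def fm_hom_def)
    obtain v where v: "v \<in> verts Q" "h0 v \<noteq> 0" using h0(2) by blast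
    have "\<exists>b\<in>B. coo h0 b \<noteq> 0"
    proof (rule ccontr)
      assume "\<not> (\<exists>b\<in>B. coo h0 b \<noteq> 0)"
      hence "fam (coo h0) v = 0" using v by (intro fmat_eqI) (auto simp: fam_def ent_mat_fun B_def)
      thus False using famcoo[OF c0 v(1)] v(2) by simp
    qed
    moreover have "(\<Sum>b\<in>B. d a b * coo h0 b) = 0" if a: "a \<in> A" for a
    proof -
      obtain e i j where eij: "a = (e, i, j)" "e \<in> arcs Q" using a by (auto simp: A_def)
      show ?thesis using dcoo[OF c0, of e i j] h0(1) a eij by (simp add: fm_hom_def)
    qed
    moreover have "\<exists>c. \<forall>b\<in>B. x b = c * coo h0 b" if x: "\<forall>a\<in>A. (\<Sum>b\<in>B. d a b * x b) = 0" for x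
    proof -
      obtain c where c: "\<forall>v\<in>verts Q. fam x v = c *\<^sub>C h0 v" using h0(3)[OF homfam[OF x]] by blast
      have "x b = c * coo h0 b" if b: "b \<in> B" for b
      proof -
        obtain v i j where vij: "b = (v, i, j)" "v \<in> verts Q" using b by (auto simp: B_def)
        thus ?thesis using ent_fam[of v i j x] c b by (simp add: coo_def)
      qed
      thus ?thesis by blast
    qed
    ultimately show ?thesis using k(1) by blast
  qed
  obtain c z \<zeta> where c: "c + card B = card A + \<kappa>"
    "\<forall>k<c. \<forall>b\<in>B. (\<Sum>a\<in>A. \<zeta> k a * d a b) = 0"
    "\<forall>k<c. \<forall>j<c. (\<Sum>a\<in>A. \<zeta> k a * z j a) = (if k = j then 1 else 0)"
    "\<forall>y. \<exists>x t. \<forall>a\<in>A. y a = (\<Sum>b\<in>B. d a b * x b) + (\<Sum>k<c. t k * z k a)"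
    by (rule cokernel_basis[OF fA fB ker])
  define Z where "Z k e = mat_fun (\<beta>' (head Q e)) (\<beta> (tail Q e)) (\<lambda>i j. z k (e, i, j))" for k e
  define \<zeta>' where "\<zeta>' k e = mat_fun (\<beta> (tail Q e)) (\<beta>' (head Q e)) (\<lambda>j i. \<zeta> k (e, i, j))" for k e
  have trz: "trc (\<zeta>' k e * Y) = (\<Sum>i<\<beta>' (head Q e). \<Sum>j<\<beta> (tail Q e). \<zeta> k (e, i, j) * ent Y i j)" for k e Y
  proof -
    have E: "ent (\<zeta>' k e * Y) x y = (\<Sum>i<\<beta>' (head Q e). ent (\<zeta>' k e) x i * ent Y i y)" for x y
      by (rule ent_times) (auto simp: \<zeta>'_def ent_mat_fun)
    have "trc (\<zeta>' k e * Y) = (\<Sum>j<\<beta> (tail Q e). \<Sum>i<\<beta>' (head Q e). \<zeta> k (e, i, j) * ent Y i j)"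
      by (subst trc_eq[of "\<beta> (tail Q e)"], simp_all only: E) (auto simp: \<zeta>'_def ent_mat_fun)
    also have "\<dots> = (\<Sum>i<\<beta>' (head Q e). \<Sum>j<\<beta> (tail Q e). \<zeta> k (e, i, j) * ent Y i j)" by (rule sum.swap)
    finally show ?thesis .
  qed
  have "int c = int \<kappa> - euler_form Q (\<lambda>v. int (\<beta> v)) (\<lambda>v. int (\<beta>' v))"
  proof -
    have "int c + int (card B) = int (card A) + int \<kappa>" using c(1) by (metis of_nat_add)
    thus ?thesis unfolding euler_form_eq[OF Q] cA cB by (simp add: mult.commute)
  qed
  moreover have "\<forall>k<c. corner_fam (arcs Q) (\<lambda>e. \<beta>' (head Q e)) (\<lambda>e. \<beta> (tail Q e)) (Z k)"
    by (simp add: corner_fam_def Z_def idm_times_iff times_idm_iff ent_mat_fun)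
  moreover have "\<forall>h. corner_fam (verts Q) \<beta>' \<beta> h \<longrightarrow>
       (\<forall>k<c. (\<Sum>e\<in>arcs Q. trc (\<zeta>' k e * (h (head Q e) * W e - W' e * h (tail Q e)))) = 0)"
  proof (intro allI impI)
    fix h k assume h: "corner_fam (verts Q) \<beta>' \<beta> h" and k: "k < c"
    have "(\<Sum>e\<in>arcs Q. trc (\<zeta>' k e * (h (head Q e) * W e - W' e * h (tail Q e)))) =
      (\<Sum>e\<in>arcs Q. \<Sum>i<\<beta>' (head Q e). \<Sum>j<\<beta> (tail Q e). \<zeta> k (e, i, j) * (\<Sum>b\<in>B. d (e, i, j) b * coo h b))"
      unfolding trz by (intro sum.cong refl) (use dcoo[OF h] in \<open>simp add: A_def\<close>)
    also have "\<dots> = (\<Sum>a\<in>A. \<zeta> k a * (\<Sum>b\<in>B. d a b * coo h b))" unfolding sumA by simp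
    also have "\<dots> = (\<Sum>b\<in>B. (\<Sum>a\<in>A. \<zeta> k a * d a b) * coo h b)"
      by (simp add: sum_distrib_left sum_distrib_right mult.assoc) (rule sum.swap)
    also have "\<dots> = 0" using c(2) k by simp
    finally show "(\<Sum>e\<in>arcs Q. trc (\<zeta>' k e * (h (head Q e) * W e - W' e * h (tail Q e)))) = 0" .
  qed
  moreover have "\<forall>k<c. \<forall>j<c. (\<Sum>e\<in>arcs Q. trc (\<zeta>' k e * Z j e)) = (if k = j then 1 else 0)"
  proof (intro allI impI)
    fix k j assume kj: "k < c" "j < c"
    have "(\<Sum>e\<in>arcs Q. trc (\<zeta>' k e * Z j e)) = (\<Sum>a\<in>A. \<zeta> k a * z j a)"
      unfolding trz sumA by (intro sum.cong refl) (simp add: Z_def ent_mat_fun)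
    thus "(\<Sum>e\<in>arcs Q. trc (\<zeta>' k e * Z j e)) = (if k = j then 1 else 0)" using c(3) kj by simp
  qed
  moreover have "\<forall>Y. corner_fam (arcs Q) (\<lambda>e. \<beta>' (head Q e)) (\<lambda>e. \<beta> (tail Q e)) Y \<longrightarrow>
       (\<exists>h t. corner_fam (verts Q) \<beta>' \<beta> h \<and>
         (\<forall>e\<in>arcs Q. Y e = h (head Q e) * W e - W' e * h (tail Q e) + (\<Sum>k<c. t k *\<^sub>C Z k e)))"
  proof (intro allI impI)
    fix Y assume Y: "corner_fam (arcs Q) (\<lambda>e. \<beta>' (head Q e)) (\<lambda>e. \<beta> (tail Q e)) Y"
    obtain x t where xt: "\<forall>a\<in>A. (case a of (e, i, j) \<Rightarrow> ent (Y e) i j) = (\<Sum>b\<in>B. d a b * x b) + (\<Sum>k<c. t k * z k a)"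
      using c(4) by metis
    have "Y e = fam x (head Q e) * W e - W' e * fam x (tail Q e) + (\<Sum>k<c. t k *\<^sub>C Z k e)" if e: "e \<in> arcs Q" for e
    proof (rule eq0[OF Y _ e, of "\<lambda>e. fam x (head Q e) * W e - W' e * fam x (tail Q e) + (\<Sum>k<c. t k *\<^sub>C Z k e)"])
      have "corner_fam (arcs Q) (\<lambda>e. \<beta>' (head Q e)) (\<lambda>e. \<beta> (tail Q e)) (\<lambda>e. \<Sum>k<c. t k *\<^sub>C Z k e)"
        by (auto simp: corner_fam_def idm_times_iff times_idm_iff ent_sum Z_def ent_mat_fun intro!: sum.neutral)
      thus "corner_fam (arcs Q) (\<lambda>e. \<beta>' (head Q e)) (\<lambda>e. \<beta> (tail Q e))
          (\<lambda>e. fam x (head Q e) * W e - W' e * fam x (tail Q e) + (\<Sum>k<c. t k *\<^sub>C Z k e))"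
        using famd[OF fam[of x]] unfolding corner_fam_def by (simp add: distrib_left distrib_right)
      fix i j assume a: "(e, i, j) \<in> A"
      have "ent (Y e) i j = ent (fam x (head Q e) * W e - W' e * fam x (tail Q e)) i j + (\<Sum>k<c. t k * z k (e, i, j))"
        using bspec[OF xt a] dsum[OF a, of x] by simp
      thus "ent (Y e) i j = ent (fam x (head Q e) * W e - W' e * fam x (tail Q e) + (\<Sum>k<c. t k *\<^sub>C Z k e)) i j"
        using a by (simp add: ent_sum Z_def ent_mat_fun A_def)
    qed
    thus "\<exists>h t. corner_fam (verts Q) \<beta>' \<beta> h \<and>
         (\<forall>e\<in>arcs Q. Y e = h (head Q e) * W e - W' e * h (tail Q e) + (\<Sum>k<c. t k *\<^sub>C Z k e))"
      using fam by blast
  qed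
  ultimately show ?thesis by (rule that)
qed


section \<open>The local quiver\<close>

text \<open>
  Here \<open>s (i, k)\<close> and \<open>s' (i, k)\<close> are the inclusion of and the projection to the \<open>k\<close>-th copy of \<open>W i\<close> in the
  direct sum of all copies. The arrows \<open>a\<close> of \<open>Q'\<close> label a basis \<open>Z a\<close> of the spaces \<open>Ext (W i, W j)\<close>, with
  dual functionals \<open>\<zeta> a\<close> as in \<open>ext_basis\<close>.
\<close>

locale local_quiver =
  fixes Q :: "('v, 'e) pre_digraph" and \<theta> :: "'v \<Rightarrow> int" and \<alpha> :: "'v \<Rightarrow> nat"
    and l :: nat and m :: "nat \<Rightarrow> nat" and \<beta> :: "nat \<Rightarrow> 'v \<Rightarrow> nat" and W :: "nat \<Rightarrow> 'e \<Rightarrow> fmat"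
    and Q' :: "(nat, 'f) pre_digraph" and Z \<zeta> :: "'f \<Rightarrow> 'e \<Rightarrow> fmat"
    and s s' :: "nat \<times> nat \<Rightarrow> 'v \<Rightarrow> fmat"
  assumes Q: "fin_digraph Q" and Q': "fin_digraph Q'" and vQ': "verts Q' = {..<l}"
    and W: "i < l \<Longrightarrow> fm_rep Q (\<lambda>v. idm (\<beta> i v)) (W i)"
    and stW: "i < l \<Longrightarrow> fm_stable Q \<theta> (\<lambda>v. idm (\<beta> i v)) (W i)"
    and homW: "i < l \<Longrightarrow> j < l \<Longrightarrow> i \<noteq> j \<Longrightarrow>
      fm_hom Q (\<lambda>v. idm (\<beta> i v)) (W i) (\<lambda>v. idm (\<beta> j v)) (W j) f \<Longrightarrow> v \<in> verts Q \<Longrightarrow> f v = 0"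
    and Z: "a \<in> arcs Q' \<Longrightarrow> corner_fam (arcs Q) (\<lambda>e. \<beta> (head Q' a) (head Q e)) (\<lambda>e. \<beta> (tail Q' a) (tail Q e)) (Z a)"
    and \<zeta>: "a \<in> arcs Q' \<Longrightarrow> corner_fam (verts Q) (\<beta> (head Q' a)) (\<beta> (tail Q' a)) h \<Longrightarrow>
      (\<Sum>e\<in>arcs Q. trc (\<zeta> a e * (h (head Q e) * W (tail Q' a) e - W (head Q' a) e * h (tail Q e)))) = 0"
    and \<zeta>Z: "a \<in> arcs Q' \<Longrightarrow> b \<in> arcs Q' \<Longrightarrow> head Q' a = head Q' b \<Longrightarrow> tail Q' a = tail Q' b \<Longrightarrow>
      (\<Sum>e\<in>arcs Q. trc (\<zeta> a e * Z b e)) = (if a = b then 1 else 0)"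
    and span: "i < l \<Longrightarrow> j < l \<Longrightarrow> corner_fam (arcs Q) (\<lambda>e. \<beta> j (head Q e)) (\<lambda>e. \<beta> i (tail Q e)) Y \<Longrightarrow>
      \<exists>h t. corner_fam (verts Q) (\<beta> j) (\<beta> i) h \<and>
        (\<forall>e\<in>arcs Q. Y e = h (head Q e) * W i e - W j e * h (tail Q e) +
          (\<Sum>a\<in>{a\<in>arcs Q'. tail Q' a = i \<and> head Q' a = j}. t a *\<^sub>C Z a e))"
    and s: "i < l \<Longrightarrow> k < m i \<Longrightarrow> v \<in> verts Q \<Longrightarrow>
      idm (\<alpha> v) * s (i, k) v = s (i, k) v \<and> s (i, k) v * idm (\<beta> i v) = s (i, k) v"
    and s': "i < l \<Longrightarrow> k < m i \<Longrightarrow> v \<in> verts Q \<Longrightarrow>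
      idm (\<beta> i v) * s' (i, k) v = s' (i, k) v \<and> s' (i, k) v * idm (\<alpha> v) = s' (i, k) v"
    and s's: "i < l \<Longrightarrow> k < m i \<Longrightarrow> j < l \<Longrightarrow> k' < m j \<Longrightarrow> v \<in> verts Q \<Longrightarrow>
      s' (i, k) v * s (j, k') v = (if i = j \<and> k = k' then idm (\<beta> i v) else 0)"
    and ss': "v \<in> verts Q \<Longrightarrow> (\<Sum>i<l. \<Sum>k<m i. s (i, k) v * s' (i, k) v) = idm (\<alpha> v)"
begin

lemma wf: "wf_digraph Q" and wf': "wf_digraph Q'"
  using Q Q' by (simp_all add: fin_digraph_def)

lemma fins: "finite (verts Q)" "finite (arcs Q)" "finite (arcs Q')"
  using Q Q' by (simp_all add: fin_digraph_def fin_digraph_axioms_def)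

lemmas ends = wf_ends[OF wf]

lemma ends': "a \<in> arcs Q' \<Longrightarrow> head Q' a < l" "a \<in> arcs Q' \<Longrightarrow> tail Q' a < l"
  using wf_ends[OF wf'] vQ' by auto

lemma Wz: "i < l \<Longrightarrow> e \<in> arcs Q \<Longrightarrow> idm (\<beta> i (head Q e)) * W i e = W i e"
  "i < l \<Longrightarrow> e \<in> arcs Q \<Longrightarrow> W i e * idm (\<beta> i (tail Q e)) = W i e"
  using W[of i] by (auto simp: fm_rep_def)

lemma Zz: "a \<in> arcs Q' \<Longrightarrow> e \<in> arcs Q \<Longrightarrow> idm (\<beta> (head Q' a) (head Q e)) * Z a e = Z a e"
  "a \<in> arcs Q' \<Longrightarrow> e \<in> arcs Q \<Longrightarrow> Z a e * idm (\<beta> (tail Q' a) (tail Q e)) = Z a e"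
  using Z[of a] by (auto simp: corner_fam_def)

text \<open>
  With respect to the decomposition of the direct sum into copies of the \<open>W i\<close>, this is the block
  matrix whose block from the \<open>k\<close>-th copy of \<open>W i\<close> to the \<open>k'\<close>-th copy of \<open>W j\<close> is \<open>ent \<mu> k' k\<close> times \<open>X\<close>,
  that is \<open>\<mu> \<otimes> X\<close>. The vertices \<open>v\<close> and \<open>w\<close> are the target and the source of \<open>X\<close>.
\<close>

definition tens :: "nat \<Rightarrow> nat \<Rightarrow> 'v \<Rightarrow> 'v \<Rightarrow> fmat \<Rightarrow> fmat \<Rightarrow> fmat" where
  "tens j i v w \<mu> X = (\<Sum>k'<m j. \<Sum>k<m i. ent \<mu> k' k *\<^sub>C (s (j, k') v * (X * s' (i, k) w)))"

lemma tens_sum_left: "tens j i v w (sum \<mu> S) X = (\<Sum>x\<in>S. tens j i v w (\<mu> x) X)"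
  by (induct S rule: infinite_finite_induct)
     (auto simp: tens_def csc_add_left sum.distrib)
lemma tens_diff_left: "tens j i v w (\<mu> - \<nu>) X = tens j i v w \<mu> X - tens j i v w \<nu> X"
  by (simp add: tens_def csc_diff_left sum_subtractf)
lemma tens_csc_left: "tens j i v w (c *\<^sub>C \<mu>) X = c *\<^sub>C tens j i v w \<mu> X"
  by (simp add: tens_def csc_sum_right mult.assoc)
lemma tens_0_left [simp]: "tens j i v w 0 X = 0"
  by (simp add: tens_def)

lemma tens_mult:
  assumes "j < l" "i < l" "i' < l" "k < l" "w \<in> verts Q" "X * idm (\<beta> i w) = X" "\<mu> * idm (m i) = \<mu>"
  shows "tens j i v w \<mu> X * tens i' k w u \<nu> Y = (if i = i' then tens j k v u (\<mu> * \<nu>) (X * Y) else 0)"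
proof -
  have mid: "s' (i, b) w * (s (i', c) w * E) = (if i = i' \<and> b = c then idm (\<beta> i w) * E else 0)"
    if "b < m i" "c < m i'" for b c E
    using s's[of i b i' c w, THEN times_right, of E] assms that by (simp add: mult.assoc)
  have XE: "X * (idm (\<beta> i w) * E) = X * E" for E
    using times_right[OF assms(6), of E] by (simp add: mult.assoc)
  hence XE': "X * (idm (\<beta> i' w) * E) = X * E" if "i = i'" for E using that by simp
  have "tens j i v w \<mu> X * tens i' k w u \<nu> Y =
    (\<Sum>a<m j. \<Sum>b<m i. \<Sum>c<m i'. \<Sum>d<m k.
      (ent \<mu> a b * ent \<nu> c d) *\<^sub>C (s (j, a) v * (X * (s' (i, b) w * (s (i', c) w * (Y * s' (k, d) u))))))"
    unfolding tens_def sum_distrib_right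
    by (simp add: sum_distrib_left mult.assoc csc_sum_right mult.commute[of "ent \<nu> x y" "ent \<mu> z w" for x y z w])
  also have "\<dots> = (\<Sum>a<m j. \<Sum>b<m i. \<Sum>c<m i'. \<Sum>d<m k.
      (if i = i' \<and> b = c then (ent \<mu> a b * ent \<nu> c d) *\<^sub>C (s (j, a) v * (X * (Y * s' (k, d) u))) else 0))"
    by (intro sum.cong refl) (auto simp: mid XE')
  also have "\<dots> = (if i = i' then tens j k v u (\<mu> * \<nu>) (X * Y) else 0)"
  proof (cases "i = i'")
    case True
    have "(\<Sum>b<m i. \<Sum>c<m i'. \<Sum>d<m k.
      (if i = i' \<and> b = c then (ent \<mu> a b * ent \<nu> c d) *\<^sub>C (s (j, a) v * (X * (Y * s' (k, d) u))) else 0)) =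
      (\<Sum>d<m k. ent (\<mu> * \<nu>) a d *\<^sub>C (s (j, a) v * (X * (Y * s' (k, d) u))))" for a
    proof -
      have E: "ent (\<mu> * \<nu>) a d = (\<Sum>b<m i. ent \<mu> a b * ent \<nu> b d)" for d
        by (rule ent_times) (use assms(7) in \<open>auto simp: times_idm_iff\<close>)
      have "(\<Sum>b<m i. \<Sum>c<m i'. \<Sum>d<m k.
        (if i = i' \<and> b = c then (ent \<mu> a b * ent \<nu> c d) *\<^sub>C (s (j, a) v * (X * (Y * s' (k, d) u))) else 0)) =
        (\<Sum>b<m i. \<Sum>c<m i. if b = c then (\<Sum>d<m k. (ent \<mu> a b * ent \<nu> c d) *\<^sub>C (s (j, a) v * (X * (Y * s' (k, d) u)))) else 0)"
        unfolding True[symmetric] by (intro sum.cong refl) auto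
      also have "\<dots> = (\<Sum>b<m i. \<Sum>d<m k. (ent \<mu> a b * ent \<nu> b d) *\<^sub>C (s (j, a) v * (X * (Y * s' (k, d) u))))"
        by (rule sum.cong[OF refl]) simp
      also have "\<dots> = (\<Sum>d<m k. \<Sum>b<m i. (ent \<mu> a b * ent \<nu> b d) *\<^sub>C (s (j, a) v * (X * (Y * s' (k, d) u))))"
        by (rule sum.swap)
      finally show ?thesis by (simp add: E csc_sum_left)
    qed
    thus ?thesis using True by (simp add: tens_def mult.assoc)
  qed simp
  finally show ?thesis .
qed

lemma tens_corner:
  assumes "j < l" "i < l" "v \<in> verts Q" "w \<in> verts Q"
  shows "idm (\<alpha> v) * tens j i v w \<mu> X = tens j i v w \<mu> X" "tens j i v w \<mu> X * idm (\<alpha> w) = tens j i v w \<mu> X"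
proof -
  have "idm (\<alpha> v) * (s (j, k) v * E) = s (j, k) v * E" if "k < m j" for k E
    using conjunct1[OF s[of j k v], THEN times_right, of E] assms that by (simp add: mult.assoc)
  thus "idm (\<alpha> v) * tens j i v w \<mu> X = tens j i v w \<mu> X"
    by (simp add: tens_def sum_distrib_left)
  show "tens j i v w \<mu> X * idm (\<alpha> w) = tens j i v w \<mu> X"
    unfolding tens_def sum_distrib_right
    by (intro sum.cong refl) (simp add: mult.assoc conjunct2[OF s'] assms)
qed

lemma tens_block:
  assumes "j < l" "i < l" "j0 < l" "i0 < l" "k' < m j" "k < m i" "v \<in> verts Q" "w \<in> verts Q"
    "idm (\<beta> j0 v) * X = X" "X * idm (\<beta> i0 w) = X"
  shows "s' (j, k') v * (tens j0 i0 v w \<mu> X * s (i, k) w) = (if j = j0 \<and> i = i0 then ent \<mu> k' k *\<^sub>C X else 0)"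
proof -
  have mid: "s' (j, k') v * (s (j0, b) v * E) = (if j = j0 \<and> k' = b then idm (\<beta> j v) * E else 0)" if "b < m j0" for b E
    using s's[of j k' j0 b v, THEN times_right, of E] assms that by (simp add: mult.assoc)
  have "s' (j, k') v * (tens j0 i0 v w \<mu> X * s (i, k) w) =
    (\<Sum>b<m j0. \<Sum>c<m i0. ent \<mu> b c *\<^sub>C (s' (j, k') v * (s (j0, b) v * (X * (s' (i0, c) w * s (i, k) w)))))"
    unfolding tens_def by (simp add: sum_distrib_left sum_distrib_right mult.assoc)
  also have "\<dots> = (\<Sum>b<m j0. \<Sum>c<m i0. if b = k' \<and> c = k \<and> j = j0 \<and> i = i0 then ent \<mu> k' k *\<^sub>C X else 0)"
    by (intro sum.cong refl) (use assms in \<open>auto simp: mid s's\<close>)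
  also have "\<dots> = (\<Sum>b<m j0. if b = k' then (\<Sum>c<m i0. if c = k then (if j = j0 \<and> i = i0 then ent \<mu> k' k *\<^sub>C X else 0) else 0) else 0)"
    by (intro sum.cong refl) (auto intro!: sum.neutral)
  also have "\<dots> = (if j = j0 \<and> i = i0 then ent \<mu> k' k *\<^sub>C X else 0)"
    using assms by (cases "j = j0 \<and> i = i0") auto
  finally show ?thesis .
qed

lemma trc_tens:
  assumes "i < l" "v \<in> verts Q" "idm (m i) * F = F"
  shows "trc (tens i i v v F (idm (\<beta> i v))) = trc F * of_nat (\<beta> i v)"
proof -
  have "trc (s (i, k') v * (idm (\<beta> i v) * s' (i, k) v)) = (if k = k' then of_nat (\<beta> i v) else 0)"
    if "k < m i" "k' < m i" for k k'
  proof -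
    have "trc (s (i, k') v * (idm (\<beta> i v) * s' (i, k) v)) = trc (s' (i, k) v * s (i, k') v)"
      using conjunct1[OF s'[OF assms(1) that(1) assms(2)]] by (simp add: trc_commute)
    thus ?thesis using s's[of i k i k' v] that assms by simp
  qed
  hence "trc (tens i i v v F (idm (\<beta> i v))) = (\<Sum>k'<m i. \<Sum>k<m i. if k = k' then ent F k' k * of_nat (\<beta> i v) else 0)"
    unfolding tens_def trc_sum trc_csc by (intro sum.cong refl) auto
  also have "\<dots> = (\<Sum>k<m i. ent F k k) * of_nat (\<beta> i v)"
    by (simp add: sum_distrib_right)
  also have "(\<Sum>k<m i. ent F k k) = trc F"
    by (rule trc_eq[symmetric]) (use assms(3) in \<open>simp add: idm_times_iff\<close>)
  finally show ?thesis .
qed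

text \<open>
  The polystable representation \<open>V0\<close>, the perturbation \<open>XM M\<close> given by a representation \<open>M\<close> of the
  local quiver, and the transformation \<open>bl F\<close> with blocks \<open>F i \<otimes> 1\<close> induced by endomorphisms \<open>F i\<close>
  of the multiplicity spaces. The map \<open>M \<mapsto> XM M\<close> is equivariant: \<open>bl\<close> acts on \<open>XM M\<close> through the
  action of \<open>F\<close> on \<open>M\<close> (\<open>XM_bl\<close>, \<open>bl_XM\<close>), and \<open>bl F\<close> commutes with \<open>V0\<close>.
\<close>

definition V0 :: "'e \<Rightarrow> fmat" where
  "V0 e = (\<Sum>i<l. tens i i (head Q e) (tail Q e) (idm (m i)) (W i e))"

definition XM :: "('f \<Rightarrow> fmat) \<Rightarrow> 'e \<Rightarrow> fmat" where
  "XM M e = (\<Sum>a\<in>arcs Q'. tens (head Q' a) (tail Q' a) (head Q e) (tail Q e) (M a) (Z a e))"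

definition bl :: "(nat \<Rightarrow> fmat) \<Rightarrow> 'v \<Rightarrow> fmat" where
  "bl F v = (\<Sum>i<l. tens i i v v (F i) (idm (\<beta> i v)))"

definition scalF :: "(nat \<Rightarrow> fmat) \<Rightarrow> bool" where
  "scalF F \<longleftrightarrow> (\<forall>i<l. idm (m i) * F i = F i \<and> F i * idm (m i) = F i)"

definition repM :: "('f \<Rightarrow> fmat) \<Rightarrow> bool" where
  "repM M \<longleftrightarrow> (\<forall>a\<in>arcs Q'. idm (m (head Q' a)) * M a = M a \<and> M a * idm (m (tail Q' a)) = M a)"

abbreviation "N \<equiv> \<lambda>v. idm (\<alpha> v)"

lemma repM_iff: "repM M \<longleftrightarrow> fm_rep Q' (\<lambda>i. idm (m i)) M"
  by (simp add: repM_def fm_rep_def)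

lemma bl_corner: "v \<in> verts Q \<Longrightarrow> idm (\<alpha> v) * bl F v = bl F v" "v \<in> verts Q \<Longrightarrow> bl F v * idm (\<alpha> v) = bl F v"
  by (simp_all add: bl_def sum_distrib_left sum_distrib_right tens_corner)

lemma V0_corner: "e \<in> arcs Q \<Longrightarrow> N (head Q e) * V0 e = V0 e" "e \<in> arcs Q \<Longrightarrow> V0 e * N (tail Q e) = V0 e"
  by (simp_all add: V0_def sum_distrib_left sum_distrib_right tens_corner ends)

lemma XM_corner: "e \<in> arcs Q \<Longrightarrow> N (head Q e) * XM M e = XM M e" "e \<in> arcs Q \<Longrightarrow> XM M e * N (tail Q e) = XM M e"
  by (simp_all add: XM_def sum_distrib_left sum_distrib_right tens_corner ends ends')

lemma rep_deform: "fm_rep Q N (\<lambda>e. V0 e + XM M e)" "fm_rep Q N V0"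
  by (simp_all add: fm_rep_def distrib_left distrib_right V0_corner XM_corner)

lemma bl_id: "v \<in> verts Q \<Longrightarrow> bl (\<lambda>i. idm (m i)) v = idm (\<alpha> v)"
proof -
  assume v: "v \<in> verts Q"
  have "tens i i v v (idm (m i)) (idm (\<beta> i v)) = (\<Sum>k<m i. s (i, k) v * s' (i, k) v)" if i: "i < l" for i
  proof -
    have "tens i i v v (idm (m i)) (idm (\<beta> i v)) = (\<Sum>k'<m i. \<Sum>k<m i. if k = k' then s (i, k) v * s' (i, k) v else 0)"
      unfolding tens_def
      by (intro sum.cong refl) (use conjunct1[OF s'[OF i _ v]] in \<open>auto simp: ent_idm\<close>)
    thus ?thesis by simp
  qed
  thus ?thesis using ss'[OF v] by (simp add: bl_def)
qed

lemma V0_alt: "e \<in> arcs Q \<Longrightarrow> V0 e = (\<Sum>i<l. \<Sum>k<m i. s (i, k) (head Q e) * (W i e * s' (i, k) (tail Q e)))"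
proof -
  assume e: "e \<in> arcs Q"
  have "tens i i v w (idm (m i)) X = (\<Sum>k'<m i. \<Sum>k<m i. if k = k' then s (i, k) v * (X * s' (i, k) w) else 0)" for i v w X
    unfolding tens_def by (intro sum.cong refl) (auto simp: ent_idm)
  thus ?thesis by (simp add: V0_def)
qed

lemma bl_mult: "v \<in> verts Q \<Longrightarrow> scalF F \<Longrightarrow> bl F v * bl G v = bl (\<lambda>i. F i * G i) v"
proof -
  assume v: "v \<in> verts Q" and F: "scalF F"
  have "bl F v * bl G v = (\<Sum>i<l. \<Sum>i'<l. tens i i v v (F i) (idm (\<beta> i v)) * tens i' i' v v (G i') (idm (\<beta> i' v)))"
    unfolding bl_def sum_distrib_right by (simp add: sum_distrib_left)
  also have "\<dots> = (\<Sum>i<l. \<Sum>i'<l. if i = i' then tens i i v v (F i * G i) (idm (\<beta> i v)) else 0)"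
    by (intro sum.cong refl) (use v F in \<open>auto simp: tens_mult scalF_def\<close>)
  finally show ?thesis by (simp add: bl_def)
qed

lemma V0_bl: "e \<in> arcs Q \<Longrightarrow> V0 e * bl F (tail Q e) = (\<Sum>i<l. tens i i (head Q e) (tail Q e) (idm (m i) * F i) (W i e))"
proof -
  assume e: "e \<in> arcs Q"
  have "V0 e * bl F (tail Q e) = (\<Sum>i<l. \<Sum>i'<l. tens i i (head Q e) (tail Q e) (idm (m i)) (W i e) *
      tens i' i' (tail Q e) (tail Q e) (F i') (idm (\<beta> i' (tail Q e))))"
    unfolding V0_def bl_def sum_distrib_right by (simp add: sum_distrib_left)
  also have "\<dots> = (\<Sum>i<l. \<Sum>i'<l. if i = i' then tens i i (head Q e) (tail Q e) (idm (m i) * F i) (W i e) else 0)"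
    by (intro sum.cong refl) (use e in \<open>auto simp: tens_mult Wz ends\<close>)
  finally show ?thesis by simp
qed

lemma bl_V0: "e \<in> arcs Q \<Longrightarrow> scalF F \<Longrightarrow> bl F (head Q e) * V0 e = (\<Sum>i<l. tens i i (head Q e) (tail Q e) (F i) (W i e))"
proof -
  assume e: "e \<in> arcs Q" and F: "scalF F"
  have "bl F (head Q e) * V0 e = (\<Sum>i<l. \<Sum>i'<l. tens i i (head Q e) (head Q e) (F i) (idm (\<beta> i (head Q e))) *
      tens i' i' (head Q e) (tail Q e) (idm (m i')) (W i' e))"
    unfolding V0_def bl_def sum_distrib_right by (simp add: sum_distrib_left)
  also have "\<dots> = (\<Sum>i<l. \<Sum>i'<l. if i = i' then tens i i (head Q e) (tail Q e) (F i) (W i e) else 0)"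
    by (intro sum.cong refl) (use e F in \<open>auto simp: tens_mult Wz ends scalF_def\<close>)
  finally show ?thesis by simp
qed

lemma XM_bl: "e \<in> arcs Q \<Longrightarrow> repM M \<Longrightarrow> XM M e * bl F (tail Q e) = XM (\<lambda>a. M a * F (tail Q' a)) e"
proof -
  assume e: "e \<in> arcs Q" and M: "repM M"
  have "XM M e * bl F (tail Q e) = (\<Sum>a\<in>arcs Q'. \<Sum>i<l. tens (head Q' a) (tail Q' a) (head Q e) (tail Q e) (M a) (Z a e) *
      tens i i (tail Q e) (tail Q e) (F i) (idm (\<beta> i (tail Q e))))"
    unfolding XM_def bl_def sum_distrib_right by (simp add: sum_distrib_left)
  also have "\<dots> = (\<Sum>a\<in>arcs Q'. \<Sum>i<l. if i = tail Q' a then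
      tens (head Q' a) (tail Q' a) (head Q e) (tail Q e) (M a * F (tail Q' a)) (Z a e) else 0)"
    by (intro sum.cong refl) (use e M in \<open>auto simp: tens_mult Zz ends ends' repM_def\<close>)
  finally show ?thesis using ends' by (simp add: XM_def)
qed

lemma bl_XM: "e \<in> arcs Q \<Longrightarrow> scalF F \<Longrightarrow> bl F (head Q e) * XM M e = XM (\<lambda>a. F (head Q' a) * M a) e"
proof -
  assume e: "e \<in> arcs Q" and F: "scalF F"
  have "bl F (head Q e) * XM M e = (\<Sum>a\<in>arcs Q'. \<Sum>i<l. tens i i (head Q e) (head Q e) (F i) (idm (\<beta> i (head Q e))) *
      tens (head Q' a) (tail Q' a) (head Q e) (tail Q e) (M a) (Z a e))"
    unfolding XM_def bl_def sum_distrib_left by (simp add: sum_distrib_right)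
  also have "\<dots> = (\<Sum>a\<in>arcs Q'. \<Sum>i<l. if i = head Q' a then
      tens (head Q' a) (tail Q' a) (head Q e) (tail Q e) (F (head Q' a) * M a) (Z a e) else 0)"
    by (intro sum.cong refl) (use e F in \<open>auto simp: tens_mult Zz ends ends' scalF_def\<close>)
  finally show ?thesis using ends' by (simp add: XM_def)
qed

lemma bl_block:
  assumes "j < l" "i < l" "k' < m j" "k < m i" "v \<in> verts Q"
  shows "s' (j, k') v * (bl F v * s (i, k) v) = (if j = i then ent (F i) k' k *\<^sub>C idm (\<beta> i v) else 0)"
proof -
  have "s' (j, k') v * (bl F v * s (i, k) v) = (\<Sum>i0<l. s' (j, k') v * (tens i0 i0 v v (F i0) (idm (\<beta> i0 v)) * s (i, k) v))"
    by (simp add: bl_def sum_distrib_left sum_distrib_right)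
  also have "\<dots> = (\<Sum>i0<l. if i0 = i then (if j = i then ent (F i) k' k *\<^sub>C idm (\<beta> i v) else 0) else 0)"
    by (intro sum.cong refl) (use assms in \<open>auto simp: tens_block\<close>)
  finally show ?thesis using assms by simp
qed

lemma W_nonzero: assumes "i < l" obtains v where "v \<in> verts Q" "\<beta> i v \<noteq> 0"
  using stW[OF assms] by (auto simp: fm_stable_def)

lemma bl_inj:
  assumes "scalF F" "scalF G" "\<And>v. v \<in> verts Q \<Longrightarrow> bl F v = bl G v" "i < l"
  shows "F i = G i"
proof (rule fmat_eqI)
  fix x y
  obtain v where v: "v \<in> verts Q" "\<beta> i v \<noteq> 0" by (rule W_nonzero[OF assms(4)])
  show "ent (F i) x y = ent (G i) x y"
  proof (cases "x < m i \<and> y < m i")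
    case True
    hence "ent (F i) x y *\<^sub>C idm (\<beta> i v) = ent (G i) x y *\<^sub>C idm (\<beta> i v)"
      using bl_block[of i i x y v F] bl_block[of i i x y v G] assms v by simp
    hence "(ent (F i) x y - ent (G i) x y) *\<^sub>C idm (\<beta> i v) = 0" by (simp add: csc_diff_left)
    thus ?thesis using v by (simp add: csc_eq_0_iff)
  next
    case False
    have "ent (F i) x y = 0" "ent (G i) x y = 0"
      using assms False by (auto simp: scalF_def idm_times_iff times_idm_iff not_less)
    thus ?thesis by simp
  qed
qed

lemma fm_weight_bl:
  assumes "scalF F" shows "fm_weight Q \<theta> (bl F) = 0"
proof -
  have "fm_weight Q \<theta> (bl F) = (\<Sum>v\<in>verts Q. of_int (\<theta> v) * (\<Sum>i<l. Re (trc (F i)) * real (\<beta> i v)))"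
    unfolding fm_weight_def
    by (intro sum.cong refl) (use assms in \<open>simp add: bl_def trc_sum trc_tens scalF_def\<close>)
  also have "\<dots> = (\<Sum>v\<in>verts Q. \<Sum>i<l. Re (trc (F i)) * (of_int (\<theta> v) * real (\<beta> i v)))"
    by (simp add: sum_distrib_left algebra_simps)
  also have "\<dots> = (\<Sum>i<l. Re (trc (F i)) * (\<Sum>v\<in>verts Q. of_int (\<theta> v) * real (\<beta> i v)))"
    unfolding sum_distrib_left by (rule sum.swap)
  also have "\<dots> = 0"
  proof (rule sum.neutral, rule ballI)
    fix i assume "i \<in> {..<l}"
    hence "fm_weight Q \<theta> (\<lambda>v. idm (\<beta> i v)) = 0" using stW[of i] by (simp add: fm_stable_def)
    thus "Re (trc (F i)) * (\<Sum>v\<in>verts Q. of_int (\<theta> v) * real (\<beta> i v)) = 0" by (simp add: fm_weight_def)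
  qed
  finally show ?thesis .
qed

lemma fm_weight_N: "fm_weight Q \<theta> N = 0"
proof -
  have "scalF (\<lambda>i. idm (m i))" by (simp add: scalF_def)
  from fm_weight_bl[OF this] show ?thesis using fm_weight_cong[of Q "bl (\<lambda>i. idm (m i))" N \<theta>] bl_id by simp
qed

text \<open>
  A subrepresentation \<open>F\<close> of \<open>M\<close> induces the subrepresentation \<open>bl F\<close> of the deformation. Its weight
  is zero because the \<open>W i\<close> have weight zero.
\<close>

theorem deform_stable_imp_simple:
  assumes M: "repM M" and st: "fm_stable Q \<theta> N (\<lambda>e. V0 e + XM M e)"
  shows "fm_stable Q' (\<lambda>_. 0) (\<lambda>i. idm (m i)) M"
  unfolding fm_stable_def
proof (intro conjI allI impI)
  obtain v where v: "v \<in> verts Q" "idm (\<alpha> v) \<noteq> 0" using st by (auto simp: fm_stable_def)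
  show "\<exists>i\<in>verts Q'. idm (m i) \<noteq> 0"
  proof (rule ccontr)
    assume "\<not> (\<exists>i\<in>verts Q'. idm (m i) \<noteq> 0)"
    hence "m i = 0" if "i < l" for i using that vQ' by auto
    hence "idm (\<alpha> v) = 0" using ss'[OF v(1)] by simp
    thus False using v by simp
  qed
  show "fm_weight Q' (\<lambda>_. 0) (\<lambda>i. idm (m i)) = 0" by (simp add: fm_weight_def)
next
  fix F assume F: "fm_sub Q' (\<lambda>i. idm (m i)) M F"
  have sF: "scalF F" using F vQ' by (auto simp: fm_sub_def scalF_def)
  have FF: "F i * F i = F i" if "i < l" for i using F vQ' that by (auto simp: fm_sub_def)
  have "fm_sub Q N (\<lambda>e. V0 e + XM M e) (bl F)"
    unfolding fm_sub_def
  proof (intro conjI ballI)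
    fix v assume v: "v \<in> verts Q"
    show "bl F v * bl F v = bl F v" using FF by (simp add: bl_mult v sF) (simp add: bl_def)
    show "N v * bl F v = bl F v" "bl F v * N v = bl F v" using bl_corner v by auto
  next
    fix e assume e: "e \<in> arcs Q"
    have 1: "(V0 e + XM M e) * bl F (tail Q e) = V0 e * bl F (tail Q e) + XM (\<lambda>a. M a * F (tail Q' a)) e"
      by (simp add: distrib_right XM_bl e M)
    have 2: "bl F (head Q e) * (V0 e * bl F (tail Q e)) = V0 e * bl F (tail Q e)"
    proof -
      have "bl F (head Q e) * (V0 e * bl F (tail Q e)) = (bl F (head Q e) * V0 e) * bl F (tail Q e)" by (simp add: mult.assoc)
      also have "bl F (head Q e) * V0 e = V0 e * bl F (tail Q e)"
        using sF by (simp add: bl_V0 V0_bl e scalF_def)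
      finally show ?thesis
        using bl_mult[OF ends(2)[OF e] sF, of F] FF by (simp add: mult.assoc) (simp add: bl_def)
    qed
    have 3: "bl F (head Q e) * XM (\<lambda>a. M a * F (tail Q' a)) e = XM (\<lambda>a. M a * F (tail Q' a)) e"
      unfolding bl_XM[OF e sF] using F unfolding XM_def fm_sub_def by (intro sum.cong refl) simp
    show "bl F (head Q e) * ((V0 e + XM M e) * bl F (tail Q e)) = (V0 e + XM M e) * bl F (tail Q e)"
      by (simp add: 1 distrib_left 2 3)
  qed
  hence "(\<forall>v\<in>verts Q. bl F v = 0) \<or> (\<forall>v\<in>verts Q. bl F v = N v)"
    using st fm_weight_bl[OF sF] unfolding fm_stable_def by auto
  thus "(\<forall>i\<in>verts Q'. F i = 0) \<or> (\<forall>i\<in>verts Q'. F i = idm (m i)) \<or> 0 < fm_weight Q' (\<lambda>_. 0) F"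
  proof
    assume "\<forall>v\<in>verts Q. bl F v = 0"
    hence "bl F v = bl (\<lambda>_. 0) v" if "v \<in> verts Q" for v using that by (simp add: bl_def[of "\<lambda>_. 0"])
    moreover have "scalF (\<lambda>_. 0)" by (simp add: scalF_def)
    ultimately have "F i = 0" if "i < l" for i using bl_inj[OF sF _ _ that] by simp
    thus ?thesis using vQ' by auto
  next
    assume "\<forall>v\<in>verts Q. bl F v = N v"
    hence "bl F v = bl (\<lambda>i. idm (m i)) v" if "v \<in> verts Q" for v using that by (simp add: bl_id)
    moreover have "scalF (\<lambda>i. idm (m i))" by (simp add: scalF_def)
    ultimately have "F i = idm (m i)" if "i < l" for i using bl_inj[OF sF _ _ that] by simp
    thus ?thesis using vQ' by auto
  qed
qed

lemma hom_V0_s: "i < l \<Longrightarrow> k < m i \<Longrightarrow> fm_hom Q (\<lambda>v. idm (\<beta> i v)) (W i) N V0 (s (i, k))"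
  unfolding fm_hom_def
proof (intro conjI ballI)
  fix e assume i: "i < l" "k < m i" and e: "e \<in> arcs Q"
  note tl = ends(2)[OF e]
  have "V0 e * s (i, k) (tail Q e) = (\<Sum>j<l. \<Sum>k'<m j. s (j, k') (head Q e) * (W j e * (s' (j, k') (tail Q e) * s (i, k) (tail Q e))))"
    by (simp add: V0_alt[OF e] sum_distrib_right mult.assoc)
  also have "\<dots> = (\<Sum>j<l. \<Sum>k'<m j. if j = i \<and> k' = k then s (i, k) (head Q e) * W i e else 0)"
    by (intro sum.cong refl) (use i tl Wz(2)[OF i(1) e] in \<open>auto simp: s's\<close>)
  also have "\<dots> = (\<Sum>j<l. if j = i then (\<Sum>k'<m j. if k' = k then s (i, k) (head Q e) * W i e else 0) else 0)"
    by (rule sum.cong[OF refl]) auto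
  finally show "s (i, k) (head Q e) * W i e = V0 e * s (i, k) (tail Q e)" using i by simp
qed (use s in auto)

lemma hom_V0_s': "i < l \<Longrightarrow> k < m i \<Longrightarrow> fm_hom Q N V0 (\<lambda>v. idm (\<beta> i v)) (W i) (s' (i, k))"
  unfolding fm_hom_def
proof (intro conjI ballI)
  fix e assume i: "i < l" "k < m i" and e: "e \<in> arcs Q"
  note hd = ends(1)[OF e]
  have "s' (i, k) (head Q e) * V0 e = (\<Sum>j<l. \<Sum>k'<m j. s' (i, k) (head Q e) * s (j, k') (head Q e) * (W j e * s' (j, k') (tail Q e)))"
    by (simp add: V0_alt[OF e] sum_distrib_left mult.assoc)
  also have "\<dots> = (\<Sum>j<l. \<Sum>k'<m j. if j = i \<and> k' = k then W i e * s' (i, k) (tail Q e) else 0)"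
    by (intro sum.cong refl)
       (use i hd Wz(1)[OF i(1) e, THEN times_right, unfolded mult.assoc] in \<open>auto simp: s's\<close>)
  also have "\<dots> = (\<Sum>j<l. if j = i then (\<Sum>k'<m j. if k' = k then W i e * s' (i, k) (tail Q e) else 0) else 0)"
    by (rule sum.cong[OF refl]) auto
  finally show "s' (i, k) (head Q e) * V0 e = W i e * s' (i, k) (tail Q e)" using i by simp
qed (use s' in auto)

text \<open>
  At \<open>V0\<close> the tangent space of the representation space is spanned by the tangent directions of the
  orbit and of the family \<open>V0 + XM M\<close>. The assertion is \<open>span\<close>, applied to all blocks of \<open>Y\<close> separately.
\<close>

theorem slice_surjective:
  assumes Y: "corner_fam (arcs Q) (\<lambda>e. \<alpha> (head Q e)) (\<lambda>e. \<alpha> (tail Q e)) Y"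
  obtains h M where "corner_fam (verts Q) \<alpha> \<alpha> h" "repM M"
    "\<forall>e\<in>arcs Q. Y e = h (head Q e) * V0 e - V0 e * h (tail Q e) + XM M e"
proof -
  define Yb where "Yb j k' i k e = s' (j, k') (head Q e) * (Y e * s (i, k) (tail Q e))" for j k' i k e
  have Yb: "corner_fam (arcs Q) (\<lambda>e. \<beta> j (head Q e)) (\<lambda>e. \<beta> i (tail Q e)) (Yb j k' i k)"
    if "j < l" "k' < m j" "i < l" "k < m i" for j k' i k
    unfolding corner_fam_def Yb_def
    using conjunct1[OF s'[OF that(1,2) ends(1)], THEN times_right, unfolded mult.assoc]
      conjunct2[OF s[OF that(3,4) ends(2)]] by (simp add: mult.assoc)
  define good where "good j k' i k h t \<longleftrightarrow> corner_fam (verts Q) (\<beta> j) (\<beta> i) h \<and>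
        (\<forall>e\<in>arcs Q. Yb j k' i k e = h (head Q e) * W i e - W j e * h (tail Q e) +
          (\<Sum>a\<in>{a\<in>arcs Q'. tail Q' a = i \<and> head Q' a = j}. t a *\<^sub>C Z a e))" for j k' i k h t
  have "\<forall>j k' i k. \<exists>h t. j < l \<and> k' < m j \<and> i < l \<and> k < m i \<longrightarrow> good j k' i k h t"
    using span[OF _ _ Yb] unfolding good_def by blast
  then obtain h t where "\<And>j k' i k. j < l \<and> k' < m j \<and> i < l \<and> k < m i \<longrightarrow> good j k' i k (h j k' i k) (t j k' i k)"
    by metis
  hence ht: "corner_fam (verts Q) (\<beta> j) (\<beta> i) (h j k' i k) \<and>
        (\<forall>e\<in>arcs Q. Yb j k' i k e = h j k' i k (head Q e) * W i e - W j e * h j k' i k (tail Q e) +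
          (\<Sum>a\<in>{a\<in>arcs Q'. tail Q' a = i \<and> head Q' a = j}. t j k' i k a *\<^sub>C Z a e))"
    if "j < l" "k' < m j" "i < l" "k < m i" for j k' i k
    using that unfolding good_def by blast
  define H where "H v = (\<Sum>j<l. \<Sum>k'<m j. \<Sum>i<l. \<Sum>k<m i. s (j, k') v * (h j k' i k v * s' (i, k) v))" for v
  define M where "M a = mat_fun (m (head Q' a)) (m (tail Q' a)) (\<lambda>k' k. t (head Q' a) k' (tail Q' a) k a)" for a
  have H: "corner_fam (verts Q) \<alpha> \<alpha> H"
    unfolding corner_fam_def
  proof (intro ballI conjI)
    fix v assume v: "v \<in> verts Q"
    have "idm (\<alpha> v) * (s (j, k) v * E) = s (j, k) v * E" if "j < l" "k < m j" for j k E
      using conjunct1[OF s[of j k v], THEN times_right, of E] that v by (simp add: mult.assoc)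
    thus "idm (\<alpha> v) * H v = H v" by (simp add: H_def sum_distrib_left)
    show "H v * idm (\<alpha> v) = H v"
      unfolding H_def sum_distrib_right
      by (intro sum.cong refl) (simp add: mult.assoc conjunct2[OF s'] v)
  qed
  have M: "repM M" by (simp add: repM_def M_def idm_times_iff times_idm_iff ent_mat_fun)
  have "Y e = H (head Q e) * V0 e - V0 e * H (tail Q e) + XM M e" if e: "e \<in> arcs Q" for e
  proof -
    note hd = ends(1)[OF e] and tl = ends(2)[OF e]
    define S where "S G = (\<Sum>j<l. \<Sum>k'<m j. \<Sum>i<l. \<Sum>k<m i. s (j, k') (head Q e) * (G j k' i k * s' (i, k) (tail Q e)))"
      for G :: "nat \<Rightarrow> nat \<Rightarrow> nat \<Rightarrow> nat \<Rightarrow> fmat"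
    have "Y e = idm (\<alpha> (head Q e)) * (Y e * idm (\<alpha> (tail Q e)))" using Y e by (simp add: corner_fam_def)
    also have "\<dots> = S (\<lambda>j k' i k. Yb j k' i k e)"
      unfolding ss'[OF hd, symmetric] ss'[OF tl, symmetric] S_def Yb_def sum_distrib_right
      by (simp add: sum_distrib_left mult.assoc)
    also have "\<dots> = S (\<lambda>j k' i k. h j k' i k (head Q e) * W i e - W j e * h j k' i k (tail Q e) +
          (\<Sum>a\<in>{a\<in>arcs Q'. tail Q' a = i \<and> head Q' a = j}. t j k' i k a *\<^sub>C Z a e))"
      unfolding S_def by (intro sum.cong refl) (use ht e in auto)
    also have "\<dots> = S (\<lambda>j k' i k. h j k' i k (head Q e) * W i e) - S (\<lambda>j k' i k. W j e * h j k' i k (tail Q e)) +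
       S (\<lambda>j k' i k. \<Sum>a\<in>{a\<in>arcs Q'. tail Q' a = i \<and> head Q' a = j}. t j k' i k a *\<^sub>C Z a e)"
      unfolding S_def by (simp add: distrib_left distrib_right left_diff_distrib right_diff_distrib sum.distrib sum_subtractf)
    also have "S (\<lambda>j k' i k. h j k' i k (head Q e) * W i e) = H (head Q e) * V0 e"
    proof -
      have sV: "s' (i, k) (head Q e) * V0 e = W i e * s' (i, k) (tail Q e)" if "i < l" "k < m i" for i k
        using hom_V0_s'[OF that] e by (simp add: fm_hom_def)
      show ?thesis unfolding S_def H_def sum_distrib_right
        by (intro sum.cong refl) (simp add: mult.assoc sV)
    qed
    also have "S (\<lambda>j k' i k. W j e * h j k' i k (tail Q e)) = V0 e * H (tail Q e)"
    proof -
      have Vs: "V0 e * (s (j, k) (tail Q e) * E) = s (j, k) (head Q e) * (W j e * E)" if "j < l" "k < m j" for j k E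
      proof -
        have "V0 e * s (j, k) (tail Q e) = s (j, k) (head Q e) * W j e"
          using hom_V0_s[OF that] e by (simp add: fm_hom_def)
        from times_right[OF this, of E] show ?thesis by (simp add: mult.assoc)
      qed
      show ?thesis unfolding S_def H_def sum_distrib_left
        by (intro sum.cong refl) (simp add: mult.assoc Vs)
    qed
    also have "S (\<lambda>j k' i k. \<Sum>a\<in>{a\<in>arcs Q'. tail Q' a = i \<and> head Q' a = j}. t j k' i k a *\<^sub>C Z a e) = XM M e"
    proof -
      have "XM M e = (\<Sum>j<l. \<Sum>i<l. \<Sum>a\<in>{a\<in>arcs Q'. tail Q' a = i \<and> head Q' a = j}. tens j i (head Q e) (tail Q e) (M a) (Z a e))"
      proof -
        have "XM M e = (\<Sum>j<l. \<Sum>a\<in>{a\<in>arcs Q'. head Q' a = j}. tens (head Q' a) (tail Q' a) (head Q e) (tail Q e) (M a) (Z a e))"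
          unfolding XM_def by (rule sum.group[symmetric]) (use fins ends' in auto)
        also have "\<dots> = (\<Sum>j<l. \<Sum>i<l. \<Sum>a\<in>{a\<in>{a\<in>arcs Q'. head Q' a = j}. tail Q' a = i}. tens (head Q' a) (tail Q' a) (head Q e) (tail Q e) (M a) (Z a e))"
          by (rule sum.cong[OF refl], rule sum.group[symmetric]) (use fins ends' in auto)
        also have "\<dots> = (\<Sum>j<l. \<Sum>i<l. \<Sum>a\<in>{a\<in>arcs Q'. tail Q' a = i \<and> head Q' a = j}. tens j i (head Q e) (tail Q e) (M a) (Z a e))"
          by (intro sum.cong refl) auto
        finally show ?thesis .
      qed
      also have "\<dots> = (\<Sum>j<l. \<Sum>i<l. \<Sum>k'<m j. \<Sum>k<m i. \<Sum>a\<in>{a\<in>arcs Q'. tail Q' a = i \<and> head Q' a = j}.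
          t j k' i k a *\<^sub>C (s (j, k') (head Q e) * (Z a e * s' (i, k) (tail Q e))))"
      proof (intro sum.cong refl)
        fix j i
        have "(\<Sum>a\<in>{a\<in>arcs Q'. tail Q' a = i \<and> head Q' a = j}. tens j i (head Q e) (tail Q e) (M a) (Z a e)) =
          (\<Sum>a\<in>{a\<in>arcs Q'. tail Q' a = i \<and> head Q' a = j}. \<Sum>k'<m j. \<Sum>k<m i. t j k' i k a *\<^sub>C (s (j, k') (head Q e) * (Z a e * s' (i, k) (tail Q e))))"
          unfolding tens_def by (intro sum.cong refl) (auto simp: M_def ent_mat_fun)
        also have "\<dots> = (\<Sum>k'<m j. \<Sum>a\<in>{a\<in>arcs Q'. tail Q' a = i \<and> head Q' a = j}. \<Sum>k<m i. t j k' i k a *\<^sub>C (s (j, k') (head Q e) * (Z a e * s' (i, k) (tail Q e))))"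
          by (rule sum.swap)
        also have "\<dots> = (\<Sum>k'<m j. \<Sum>k<m i. \<Sum>a\<in>{a\<in>arcs Q'. tail Q' a = i \<and> head Q' a = j}. t j k' i k a *\<^sub>C (s (j, k') (head Q e) * (Z a e * s' (i, k) (tail Q e))))"
          by (rule sum.cong[OF refl], rule sum.swap)
        finally show "(\<Sum>a\<in>{a\<in>arcs Q'. tail Q' a = i \<and> head Q' a = j}. tens j i (head Q e) (tail Q e) (M a) (Z a e)) =
          (\<Sum>k'<m j. \<Sum>k<m i. \<Sum>a\<in>{a\<in>arcs Q'. tail Q' a = i \<and> head Q' a = j}. t j k' i k a *\<^sub>C (s (j, k') (head Q e) * (Z a e * s' (i, k) (tail Q e))))" .
      qed
      also have "\<dots> = (\<Sum>j<l. \<Sum>k'<m j. \<Sum>i<l. \<Sum>k<m i. \<Sum>a\<in>{a\<in>arcs Q'. tail Q' a = i \<and> head Q' a = j}.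
          t j k' i k a *\<^sub>C (s (j, k') (head Q e) * (Z a e * s' (i, k) (tail Q e))))"
        by (rule sum.cong[OF refl], rule sum.swap)
      finally show ?thesis by (simp add: S_def sum_distrib_left sum_distrib_right)
    qed
    finally show ?thesis .
  qed
  thus ?thesis using that H M by blast
qed

end


section \<open>Simple representations of the local quiver deform to stable ones\<close>

context local_quiver
begin

text \<open>
  Schur's lemma, applied to all blocks of \<open>E\<close>.
\<close>

lemma endomorphism_bl:
  assumes E: "fm_hom Q N V0 N V0 E"
  obtains F where "scalF F" "\<forall>v\<in>verts Q. E v = bl F v"
proof -
  have blk: "fm_hom Q (\<lambda>v. idm (\<beta> i v)) (W i) (\<lambda>v. idm (\<beta> j v)) (W j) (\<lambda>v. s' (j, k') v * (E v * s (i, k) v))"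
    if "i < l" "k < m i" "j < l" "k' < m j" for i k j k'
    using fm_hom_comp[OF fm_hom_comp[OF hom_V0_s[OF that(1,2)] E] hom_V0_s'[OF that(3,4)]] .
  have "\<forall>i k' k. \<exists>c. i < l \<and> k < m i \<and> k' < m i \<longrightarrow> (\<forall>v\<in>verts Q. s' (i, k') v * (E v * s (i, k) v) = c *\<^sub>C idm (\<beta> i v))"
  proof (intro allI)
    fix i k' k
    show "\<exists>c. i < l \<and> k < m i \<and> k' < m i \<longrightarrow> (\<forall>v\<in>verts Q. s' (i, k') v * (E v * s (i, k) v) = c *\<^sub>C idm (\<beta> i v))"
    proof (cases "i < l \<and> k < m i \<and> k' < m i")
      case True
      hence I: "i < l" "k < m i" "k' < m i" by auto
      obtain c where "\<forall>v\<in>verts Q. s' (i, k') v * (E v * s (i, k) v) = c *\<^sub>C idm (\<beta> i v)"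
        by (rule schur_scalar[OF wf W[OF I(1)] stW[OF I(1)] blk[OF I(1,2) I(1,3)]])
      thus ?thesis by blast
    qed auto
  qed
  then obtain c where c: "\<And>i k' k. i < l \<and> k < m i \<and> k' < m i \<longrightarrow>
      (\<forall>v\<in>verts Q. s' (i, k') v * (E v * s (i, k) v) = c i k' k *\<^sub>C idm (\<beta> i v))" by metis
  define F where "F i = mat_fun (m i) (m i) (c i)" for i
  have F: "scalF F" by (simp add: scalF_def F_def idm_times_iff times_idm_iff ent_mat_fun)
  have "E v = bl F v" if v: "v \<in> verts Q" for v
  proof -
    have "E v = idm (\<alpha> v) * (E v * idm (\<alpha> v))" using E v by (simp add: fm_hom_def)
    also have "\<dots> = (\<Sum>j<l. \<Sum>k'<m j. \<Sum>i<l. \<Sum>k<m i. s (j, k') v * ((s' (j, k') v * (E v * s (i, k) v)) * s' (i, k) v))"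
      unfolding ss'[OF v, symmetric] sum_distrib_right by (simp add: sum_distrib_left mult.assoc)
    also have "\<dots> = (\<Sum>j<l. \<Sum>k'<m j. \<Sum>i<l. if i = j then (\<Sum>k<m j. c j k' k *\<^sub>C (s (j, k') v * (idm (\<beta> j v) * s' (j, k) v))) else 0)"
    proof (intro sum.cong refl)
      fix j k' i assume j: "j \<in> {..<l}" and k': "k' \<in> {..<m j}" and i: "i \<in> {..<l}"
      show "(\<Sum>k<m i. s (j, k') v * ((s' (j, k') v * (E v * s (i, k) v)) * s' (i, k) v)) =
        (if i = j then (\<Sum>k<m j. c j k' k *\<^sub>C (s (j, k') v * (idm (\<beta> j v) * s' (j, k) v))) else 0)"
      proof (cases "i = j")
        case True
        thus ?thesis using c[of j _ k'] j k' v by (auto intro!: sum.cong)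
      next
        case False
        have "s' (j, k') v * (E v * s (i, k) v) = 0" if "k < m i" for k
          using homW[OF _ _ False blk] i j k' v that by simp
        thus ?thesis using False by (auto intro!: sum.neutral)
      qed
    qed
    also have "\<dots> = bl F v"
      by (simp add: bl_def tens_def F_def ent_mat_fun)
    finally show ?thesis .
  qed
  thus ?thesis using that F by blast
qed

lemma XM_block:
  assumes "b \<in> arcs Q'" "e \<in> arcs Q" "k' < m (head Q' b)" "k < m (tail Q' b)"
  shows "s' (head Q' b, k') (head Q e) * (XM M e * s (tail Q' b, k) (tail Q e)) =
    (\<Sum>a\<in>{a\<in>arcs Q'. head Q' a = head Q' b \<and> tail Q' a = tail Q' b}. ent (M a) k' k *\<^sub>C Z a e)"
proof -
  have "s' (head Q' b, k') (head Q e) * (XM M e * s (tail Q' b, k) (tail Q e)) =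
    (\<Sum>a\<in>arcs Q'. s' (head Q' b, k') (head Q e) * (tens (head Q' a) (tail Q' a) (head Q e) (tail Q e) (M a) (Z a e) * s (tail Q' b, k) (tail Q e)))"
    by (simp add: XM_def sum_distrib_left sum_distrib_right)
  also have "\<dots> = (\<Sum>a\<in>arcs Q'. if head Q' a = head Q' b \<and> tail Q' a = tail Q' b then ent (M a) k' k *\<^sub>C Z a e else 0)"
    by (intro sum.cong refl) (use assms ends ends' Zz in \<open>auto simp: tens_block\<close>)
  also have "\<dots> = (\<Sum>a\<in>{a\<in>arcs Q'. head Q' a = head Q' b \<and> tail Q' a = tail Q' b}. ent (M a) k' k *\<^sub>C Z a e)"
    using fins by (simp add: sum.inter_filter)
  finally show ?thesis .
qed

lemma XM_csc: "XM (\<lambda>a. c *\<^sub>C M a) e = c *\<^sub>C XM M e"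
  by (simp add: XM_def tens_csc_left csc_sum_right)

text \<open>
  Together with \<open>zeta_coboundary\<close>: applied to a block, the functional \<open>\<zeta> b\<close> reads off a matrix entry
  of \<open>M b\<close> and does not see changes along the orbit of \<open>V0\<close>.
\<close>

lemma zeta_XM:
  assumes b: "b \<in> arcs Q'" and k: "k' < m (head Q' b)" "k < m (tail Q' b)"
  shows "(\<Sum>e\<in>arcs Q. trc (\<zeta> b e * (s' (head Q' b, k') (head Q e) * (XM M e * s (tail Q' b, k) (tail Q e))))) = ent (M b) k' k"
proof -
  let ?A = "{a\<in>arcs Q'. head Q' a = head Q' b \<and> tail Q' a = tail Q' b}"
  have "(\<Sum>e\<in>arcs Q. trc (\<zeta> b e * (s' (head Q' b, k') (head Q e) * (XM M e * s (tail Q' b, k) (tail Q e))))) =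
    (\<Sum>e\<in>arcs Q. \<Sum>a\<in>?A. ent (M a) k' k * trc (\<zeta> b e * Z a e))"
    by (intro sum.cong refl) (simp add: XM_block[OF b _ k] sum_distrib_left trc_sum trc_csc)
  also have "\<dots> = (\<Sum>a\<in>?A. ent (M a) k' k * (\<Sum>e\<in>arcs Q. trc (\<zeta> b e * Z a e)))"
    unfolding sum_distrib_left by (rule sum.swap)
  also have "\<dots> = (\<Sum>a\<in>?A. if b = a then ent (M a) k' k else 0)"
    by (intro sum.cong refl) (use \<zeta>Z b in auto)
  also have "\<dots> = ent (M b) k' k" using b fins by simp
  finally show ?thesis .
qed

lemma zeta_coboundary:
  assumes b: "b \<in> arcs Q'" and k: "k' < m (head Q' b)" "k < m (tail Q' b)"
  shows "(\<Sum>e\<in>arcs Q. trc (\<zeta> b e * (s' (head Q' b, k') (head Q e) * ((H (head Q e) * V0 e - V0 e * H (tail Q e)) * s (tail Q' b, k) (tail Q e))))) = 0"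
proof -
  note hl = ends'(1)[OF b] and tl = ends'(2)[OF b]
  define h where "h v = s' (head Q' b, k') v * (H v * s (tail Q' b, k) v)" for v
  have h: "corner_fam (verts Q) (\<beta> (head Q' b)) (\<beta> (tail Q' b)) h"
    unfolding corner_fam_def h_def
    using conjunct1[OF s'[OF hl k(1)], THEN times_right, unfolded mult.assoc] conjunct2[OF s[OF tl k(2)]]
    by (simp add: mult.assoc)
  have "s' (head Q' b, k') (head Q e) * ((H (head Q e) * V0 e - V0 e * H (tail Q e)) * s (tail Q' b, k) (tail Q e)) =
    h (head Q e) * W (tail Q' b) e - W (head Q' b) e * h (tail Q e)" if e: "e \<in> arcs Q" for e
  proof -
    have 1: "s (tail Q' b, k) (head Q e) * W (tail Q' b) e = V0 e * s (tail Q' b, k) (tail Q e)"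
      and 2: "s' (head Q' b, k') (head Q e) * V0 e = W (head Q' b) e * s' (head Q' b, k') (tail Q e)"
      using hom_V0_s[OF tl k(2)] hom_V0_s'[OF hl k(1)] e by (auto simp: fm_hom_def)
    show ?thesis using times_right[OF 2, of "H (tail Q e) * s (tail Q' b, k) (tail Q e)"]
      by (simp add: h_def left_diff_distrib right_diff_distrib mult.assoc 1)
  qed
  thus ?thesis using \<zeta>[OF b h] by simp
qed

text \<open>
  If \<open>V0 + \<tau> n *\<^sub>C XM M\<close> is unstable along a sequence \<open>\<tau> n\<close> tending to zero, then destabilising
  subrepresentations \<open>Pn\<close> converge to a subrepresentation \<open>P\<close> of \<open>V0\<close> which is the image of some idempotent
  \<open>bl F\<close>. Expanding the condition on \<open>Pn\<close> to first order in \<open>\<tau>\<close> shows that \<open>F\<close> is a subrepresentation of \<open>M\<close>.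
\<close>

theorem simple_imp_deform_stable:
  assumes M: "repM M" and simple: "fm_stable Q' (\<lambda>_. 0) (\<lambda>i. idm (m i)) M"
  obtains M' where "repM M'" "fm_stable Q \<theta> N (\<lambda>e. V0 e + XM M' e)"
proof (rule ccontr)
  assume neg: "\<not> thesis"
  define \<tau> where "\<tau> n = complex_of_real (1 / real (Suc n))" for n
  have ns: "\<not> fm_stable Q \<theta> N (\<lambda>e. V0 e + \<tau> n *\<^sub>C XM M e)" for n
  proof
    assume st: "fm_stable Q \<theta> N (\<lambda>e. V0 e + \<tau> n *\<^sub>C XM M e)"
    have "repM (\<lambda>a. \<tau> n *\<^sub>C M a)" using M by (simp add: repM_def)
    thus False using neg that[of "\<lambda>a. \<tau> n *\<^sub>C M a"] st by (simp add: XM_csc)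
  qed
  have "(\<lambda>n. 1 / real (Suc n)) \<longlonglongrightarrow> 0" using LIMSEQ_inverse_real_of_nat by (simp add: inverse_eq_divide)
  from tendsto_of_real[OF this, where 'a = complex]
  have \<tau>0: "\<tau> \<longlonglongrightarrow> 0" by (simp only: \<tau>_def[abs_def] of_real_0)
  have lim: "(\<lambda>n. V0 e + \<tau> n *\<^sub>C XM M e) \<longlonglongrightarrow> V0 e" for e
  proof -
    have "(\<lambda>n. V0 e + \<tau> n *\<^sub>C XM M e) \<longlonglongrightarrow> V0 e + 0 *\<^sub>C XM M e"
      by (intro tendsto_intros \<tau>0)
    thus ?thesis by simp
  qed
  have \<alpha>nz: "\<exists>v\<in>verts Q. \<alpha> v \<noteq> 0"
  proof -
    obtain i where i: "i < l" "m i \<noteq> 0" using simple vQ' by (auto simp: fm_stable_def)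
    obtain v where v: "v \<in> verts Q" "\<beta> i v \<noteq> 0" by (rule W_nonzero[OF i(1)])
    have "\<alpha> v \<noteq> 0"
    proof
      assume "\<alpha> v = 0"
      hence "s (i, 0) v = 0" using s[OF i(1), of 0 v] i v by simp
      thus False using s's[OF i(1), of 0 i 0 v] i v by simp
    qed
    thus ?thesis using v by blast
  qed
  obtain r P Pn where r: "strict_mono r" and Pn: "\<forall>n. fm_sub Q N (\<lambda>e. V0 e + \<tau> (r n) *\<^sub>C XM M e) (Pn n)"
    and PnP: "\<forall>v\<in>verts Q. (\<lambda>n. Pn n v) \<longlonglongrightarrow> P v" and P: "fm_sub Q N V0 P" "fm_weight Q \<theta> P \<le> 0"
    "\<exists>v\<in>verts Q. P v \<noteq> 0" "\<exists>v\<in>verts Q. P v \<noteq> idm (\<alpha> v)"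
    by (rule not_stable_limit[OF Q lim \<alpha>nz fm_weight_N ns])
  \<comment> \<open>The limit \<open>P\<close> has weight zero and is the image of an idempotent endomorphism \<open>E = bl F\<close> of \<open>V0\<close>.\<close>
  define J where "J = (SIGMA i:{..<l}. {..<m i})"
  have ps: "0 \<le> fm_weight Q \<theta> P \<and> (fm_weight Q \<theta> P = 0 \<longrightarrow>
      (\<exists>E. fm_hom Q N V0 N V0 E \<and> (\<forall>v\<in>verts Q. E v * E v = E v \<and> E v * P v = P v \<and> P v * E v = E v)))"
  proof (rule polystable_subs[where J = J and M = "\<lambda>p v. idm (\<beta> (fst p) v)" and W = "\<lambda>p. W (fst p)" and s = s and s' = s' and A = J])
    show "\<forall>v\<in>verts Q. (\<Sum>p\<in>J. s p v * s' p v) * P v = P v"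
    proof
      fix v assume v: "v \<in> verts Q"
      have "(\<Sum>p\<in>J. s p v * s' p v) = (\<Sum>i<l. \<Sum>k<m i. s (i, k) v * s' (i, k) v)"
        by (simp add: J_def sum.Sigma split_def)
      thus "(\<Sum>p\<in>J. s p v * s' p v) * P v = P v" using P(1) v by (simp add: ss' fm_sub_def)
    qed
  qed (use wf rep_deform(2) W stW hom_V0_s hom_V0_s' P(1) in \<open>auto simp: J_def\<close>)
  then obtain E where E: "fm_hom Q N V0 N V0 E"
    and "\<forall>v\<in>verts Q. E v * E v = E v \<and> E v * P v = P v \<and> P v * E v = E v"
    using P(2) by auto
  hence EE: "E v * E v = E v" and EP: "E v * P v = P v" and PE: "P v * E v = E v" if "v \<in> verts Q" for v
    using that by auto
  have NE: "N v * E v = E v" "E v * N v = E v" if "v \<in> verts Q" for v using E that by (auto simp: fm_hom_def)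
  have EV: "E (head Q e) * V0 e = V0 e * E (tail Q e)" if "e \<in> arcs Q" for e using E that by (auto simp: fm_hom_def)
  obtain F where F: "scalF F" and EF: "\<forall>v\<in>verts Q. E v = bl F v" by (rule endomorphism_bl[OF E])
  have FF: "F i * F i = F i" if i: "i < l" for i
  proof -
    have "scalF (\<lambda>i. F i * F i)"
      unfolding scalF_def
    proof (intro allI impI conjI)
      fix i assume "i < l"
      hence c: "idm (m i) * F i = F i" "F i * idm (m i) = F i" using F by (auto simp: scalF_def)
      show "idm (m i) * (F i * F i) = F i * F i" by (simp add: mult.assoc[symmetric] c)
      show "F i * F i * idm (m i) = F i * F i" by (simp add: mult.assoc c)
    qed
    moreover have "bl (\<lambda>i. F i * F i) v = bl F v" if v: "v \<in> verts Q" for v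
      using bl_mult[OF v F, of F] EE[OF v] EF v by simp
    ultimately show ?thesis using bl_inj[where F = "\<lambda>i. F i * F i" and G = F, OF _ F _ i] by blast
  qed
  have Pn': "Pn n v * Pn n v = Pn n v" "N v * Pn n v = Pn n v" "Pn n v * N v = Pn n v" if "v \<in> verts Q" for n v
  proof -
    have "\<forall>v\<in>verts Q. Pn n v * Pn n v = Pn n v \<and> N v * Pn n v = Pn n v \<and> Pn n v * N v = Pn n v"
      using spec[OF Pn, of n, unfolded fm_sub_def] by (rule conjunct1)
    note c = bspec[OF this that]
    show "Pn n v * Pn n v = Pn n v" by (rule conjunct1[OF c])
    show "N v * Pn n v = Pn n v" by (rule conjunct1[OF conjunct2[OF c]])
    show "Pn n v * N v = Pn n v" by (rule conjunct2[OF conjunct2[OF c]])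
  qed
  \<comment> \<open>\<open>B\<close> inverts, for large indices, the map induced by \<open>Pn n v\<close> on the image of \<open>E v\<close>.\<close>
  define approx where "approx v B \<longleftrightarrow> (\<forall>\<^sub>F n in sequentially. E v * B n = B n \<and> B n * E v = B n \<and>
      E v * Pn n v * E v * B n = E v \<and> B n * (E v * Pn n v * E v) = E v) \<and> B \<longlonglongrightarrow> E v" for v B
  have "\<forall>v. \<exists>B. v \<in> verts Q \<longrightarrow> approx v B"
  proof
    fix v
    show "\<exists>B. v \<in> verts Q \<longrightarrow> approx v B"
    proof (cases "v \<in> verts Q")
      case True
      have "(\<lambda>n. E v * Pn n v * E v) \<longlonglongrightarrow> E v * P v * E v"
        by (intro tendsto_intros) (use PnP True in auto)
      hence l: "(\<lambda>n. E v * Pn n v * E v) \<longlonglongrightarrow> E v" by (simp add: EP PE True)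
      have c: "E v * (E v * Pn n v * E v) = E v * Pn n v * E v" "E v * Pn n v * E v * E v = E v * Pn n v * E v" for n
        by (simp_all add: mult.assoc EE True times_right[OF EE[OF True], unfolded mult.assoc])
      obtain B where "\<forall>\<^sub>F k in sequentially. E v * B k = B k \<and> B k * E v = B k \<and>
          E v * Pn k v * E v * B k = E v \<and> B k * (E v * Pn k v * E v) = E v" "B \<longlonglongrightarrow> E v"
        by (rule corner_inverse_tendsto[OF EE[OF True] c l])
      thus ?thesis unfolding approx_def by blast
    qed auto
  qed
  from choice[OF this] obtain B' where "\<forall>v. v \<in> verts Q \<longrightarrow> approx v (B' v)" by (rule exE)
  hence appr: "approx v (B' v)" if "v \<in> verts Q" for v using that by simp
  have B': "\<forall>\<^sub>F n in sequentially. E v * B' v n = B' v n \<and> B' v n * E v = B' v n \<and>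
      E v * Pn n v * E v * B' v n = E v \<and> B' v n * (E v * Pn n v * E v) = E v" "B' v \<longlonglongrightarrow> E v"
    if "v \<in> verts Q" for v
    using appr[OF that, unfolded approx_def] by (rule conjunct1, rule conjunct2)
  \<comment> \<open>For large \<open>n\<close> this is the projection with the image of \<open>Pn n v\<close> and the kernel of \<open>E v\<close>, so the
    subrepresentation \<open>Pn n\<close> is the graph of \<open>H n\<close>, which maps the image of \<open>E\<close> to its kernel and
    tends to zero.\<close>
  define R where "R n v = Pn n v * B' v n" for n v
  have limR: "(\<lambda>n. R n v) \<longlonglongrightarrow> E v" if v: "v \<in> verts Q" for v
  proof -
    have "(\<lambda>n. R n v) \<longlonglongrightarrow> P v * E v" unfolding R_def by (intro tendsto_mult B'(2)[OF v]) (use PnP v in auto)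
    thus ?thesis by (simp add: PE v)
  qed
  define H where "H n v = R n v - E v" for n v
  have limH: "(\<lambda>n. H n v) \<longlonglongrightarrow> 0" if "v \<in> verts Q" for v
    using tendsto_diff[OF limR[OF that] tendsto_const[of "E v"]] by (simp add: H_def)
  have evR: "\<forall>\<^sub>F n in sequentially. E v * R n v = E v \<and> R n v * E v = R n v \<and> R n v * Pn n v = Pn n v \<and> Pn n v * R n v = R n v"
    if v: "v \<in> verts Q" for v
  proof -
    \<comment> \<open>Traces of idempotents are natural numbers, so the dimensions agree from some point on.\<close>
    have "(\<lambda>n. trc (Pn n v)) \<longlonglongrightarrow> trc (P v)" by (intro tendsto_intros) (use PnP v in auto)
    hence "(\<lambda>n. cmod (trc (Pn n v) - trc (P v))) \<longlonglongrightarrow> 0"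
      using tendsto_norm[OF tendsto_diff[OF _ tendsto_const[of "trc (P v)"]]] by fastforce
    hence "\<forall>\<^sub>F n in sequentially. cmod (trc (Pn n v) - trc (P v)) < 1" by (rule order_tendstoD(2)) simp
    moreover have "\<forall>\<^sub>F n in sequentially. E v * B' v n = B' v n \<and> B' v n * E v = B' v n \<and>
      E v * Pn n v * E v * B' v n = E v \<and> B' v n * (E v * Pn n v * E v) = E v" by (rule B'(1)[OF v])
    ultimately show ?thesis
    proof eventually_elim
      case (elim n)
      obtain c where c: "trc (Pn n v) = of_nat c" by (rule trc_idempotent_nat[OF Pn'(1)[OF v]])
      have "P v * P v = P v" using P(1) v by (auto simp: fm_sub_def)
      then obtain d where d: "trc (P v) = of_nat d" by (rule trc_idempotent_nat)
      have "cmod (of_int (int c - int d)) < 1" using elim c d by simp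
      hence "c = d" by (simp only: norm_of_int)
      hence trP: "trc (Pn n v) = trc (E v)" using c d trc_same_image[OF PE[OF v] EP[OF v]] by simp
      have b: "E v * B' v n = B' v n" "E v * Pn n v * E v * B' v n = E v" using elim by auto
      have ER: "E v * R n v = E v" using b(2) by (simp add: R_def mult.assoc b(1))
      have RE: "R n v * E v = R n v" using elim by (simp add: R_def mult.assoc)
      have PR: "Pn n v * R n v = R n v" using times_right[OF Pn'(1)[OF v]] by (simp add: R_def mult.assoc)
      have RR: "R n v * R n v = R n v"
      proof -
        have "R n v * R n v = R n v * (E v * R n v)" by (simp add: mult.assoc[symmetric] RE)
        also have "\<dots> = R n v" by (simp only: ER RE)
        finally show ?thesis .
      qed
      have trR: "trc (R n v) = trc (E v)" using trc_commute[of "R n v" "E v"] by (simp add: ER RE)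
      define D where "D = Pn n v - R n v * Pn n v"
      have "D * D = D"
        using times_right[OF PR, of "Pn n v"] times_right[OF RR, of "Pn n v"]
        by (simp add: D_def algebra_simps mult.assoc Pn' v)
      moreover have "trc D = 0" by (simp add: D_def trc_diff trc_commute[of "R n v"] PR trR trP)
      ultimately have "D = 0" by (rule trc_idempotent_eq_0)
      thus ?case using ER RE PR by (simp add: D_def)
    qed
  qed
  have "\<forall>\<^sub>F n in sequentially. \<forall>v\<in>verts Q. E v * R n v = E v \<and> R n v * E v = R n v \<and> R n v * Pn n v = Pn n v \<and> Pn n v * R n v = R n v"
    by (rule eventually_ball_finite) (use fins evR in auto)
  \<comment> \<open>The subrepresentation condition for the graph of \<open>H n\<close>: up to the factor \<open>\<tau>\<close> and terms tending
    to zero, the component of \<open>XM M\<close> from the image of \<open>E\<close> to its kernel is a coboundary.\<close>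
  hence evD: "\<forall>\<^sub>F n in sequentially. \<forall>e\<in>arcs Q. H n (head Q e) * V0 e - V0 e * H n (tail Q e) =
      \<tau> (r n) *\<^sub>C ((N (head Q e) - E (head Q e)) * (XM M e * R n (tail Q e)) - H n (head Q e) * (XM M e * R n (tail Q e)))"
  proof eventually_elim
    case (elim n)
    show ?case
    proof
      fix e assume e: "e \<in> arcs Q"
      note h = ends(1)[OF e] and t = ends(2)[OF e]
      define Vn where "Vn = V0 e + \<tau> (r n) *\<^sub>C XM M e"
      have R: "E v * R n v = E v" "R n v * E v = R n v" "R n v * Pn n v = Pn n v" "Pn n v * R n v = R n v"
        if "v \<in> verts Q" for v using elim that by auto
      have PVP: "Pn n (head Q e) * (Vn * Pn n (tail Q e)) = Vn * Pn n (tail Q e)"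
        using Pn e by (simp add: fm_sub_def Vn_def)
      have "Pn n (head Q e) * (Vn * R n (tail Q e)) = Vn * R n (tail Q e)"
        using times_right[OF PVP, of "R n (tail Q e)"] by (simp add: mult.assoc R(4)[OF t])
      hence RV: "R n (head Q e) * (Vn * R n (tail Q e)) = Vn * R n (tail Q e)"
        using times_right[OF R(3)[OF h], of "Vn * R n (tail Q e)"] by (simp add: mult.assoc)
      have EVR: "E (head Q e) * (V0 e * X) = V0 e * (E (tail Q e) * X)" for X
        using times_right[OF EV[OF e], of X] by (simp add: mult.assoc)
      have HE: "H n (head Q e) * E (head Q e) = H n (head Q e)" by (simp add: H_def left_diff_distrib R h EE)
      have HV: "H n (head Q e) * (V0 e * R n (tail Q e)) = H n (head Q e) * V0 e"
      proof -
        have "H n (head Q e) * (V0 e * R n (tail Q e)) = H n (head Q e) * (E (head Q e) * (V0 e * R n (tail Q e)))"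
          using times_right[OF HE, of "V0 e * R n (tail Q e)"] by (simp add: mult.assoc)
        also have "\<dots> = H n (head Q e) * (E (head Q e) * V0 e)" by (simp add: EVR R t EV e)
        also have "\<dots> = H n (head Q e) * V0 e" using times_right[OF HE, of "V0 e"] by (simp add: mult.assoc)
        finally show ?thesis .
      qed
      have "Vn * R n (tail Q e) - E (head Q e) * (Vn * R n (tail Q e)) = H n (head Q e) * (Vn * R n (tail Q e))"
        using RV by (simp add: H_def left_diff_distrib)
      moreover have "Vn * R n (tail Q e) - E (head Q e) * (Vn * R n (tail Q e)) =
        V0 e * H n (tail Q e) + \<tau> (r n) *\<^sub>C ((N (head Q e) - E (head Q e)) * (XM M e * R n (tail Q e)))"
        using times_right[OF XM_corner(1)[OF e], of M "R n (tail Q e)"]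
        by (simp add: Vn_def distrib_left distrib_right EVR R t csc_diff_right left_diff_distrib right_diff_distrib mult.assoc H_def)
      moreover have "H n (head Q e) * (Vn * R n (tail Q e)) =
        H n (head Q e) * V0 e + \<tau> (r n) *\<^sub>C (H n (head Q e) * (XM M e * R n (tail Q e)))"
        by (simp add: Vn_def distrib_left distrib_right HV)
      ultimately show "H n (head Q e) * V0 e - V0 e * H n (tail Q e) =
        \<tau> (r n) *\<^sub>C ((N (head Q e) - E (head Q e)) * (XM M e * R n (tail Q e)) - H n (head Q e) * (XM M e * R n (tail Q e)))"
        by (simp add: csc_diff_right csc_add_right algebra_simps)
    qed
  qed
  \<comment> \<open>\<open>G = 0\<close> expresses that \<open>F\<close> is a subrepresentation of \<open>M\<close>.\<close>
  define G where "G a = (idm (m (head Q' a)) - F (head Q' a)) * (M a * F (tail Q' a))" for a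
  have XG: "(N (head Q e) - E (head Q e)) * (XM M e * E (tail Q e)) = XM G e" if e: "e \<in> arcs Q" for e
  proof -
    have NEbl: "N v - E v = bl (\<lambda>i. idm (m i) - F i) v" if v: "v \<in> verts Q" for v
      using bl_id[OF v] EF v by (simp add: bl_def tens_diff_left sum_subtractf)
    have "scalF (\<lambda>i. idm (m i) - F i)" using F by (simp add: scalF_def algebra_simps)
    moreover have "E (tail Q e) = bl F (tail Q e)" using EF ends(2)[OF e] by simp
    ultimately show ?thesis by (simp add: NEbl[OF ends(1)[OF e]] XM_bl[OF e M] bl_XM[OF e] G_def[abs_def])
  qed
  have G0: "G b = 0" if b: "b \<in> arcs Q'" for b
  proof (rule fmat_eqI)
    fix k' k
    note hl = ends'(1)[OF b] and tl = ends'(2)[OF b]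
    have Fh: "idm (m i) * F i = F i" "F i * idm (m i) = F i" if "i < l" for i using F that by (auto simp: scalF_def)
    have Mb: "idm (m (head Q' b)) * M b = M b" using M b by (simp add: repM_def)
    have Gc: "idm (m (head Q' b)) * G b = G b" "G b * idm (m (tail Q' b)) = G b"
      by (simp_all add: G_def left_diff_distrib right_diff_distrib mult.assoc Fh hl tl
          times_right[OF Fh(1)[OF hl], unfolded mult.assoc] times_right[OF Mb, unfolded mult.assoc])
    show "ent (G b) k' k = ent 0 k' k"
    proof (cases "k' < m (head Q' b) \<and> k < m (tail Q' b)")
      case True
      hence k: "k' < m (head Q' b)" "k < m (tail Q' b)" by auto
      \<comment> \<open>A functional that vanishes on coboundaries and has the value \<open>ent (G b) k' k\<close> on \<open>XM G\<close>.\<close>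
      define z where "z Y = (\<Sum>e\<in>arcs Q. trc (\<zeta> b e * (s' (head Q' b, k') (head Q e) * (Y e * s (tail Q' b, k) (tail Q e)))))" for Y
      define Yn where "Yn n e = (N (head Q e) - E (head Q e)) * (XM M e * R n (tail Q e)) - H n (head Q e) * (XM M e * R n (tail Q e))" for n e
      have "(\<lambda>n. z (Yn n)) \<longlonglongrightarrow> z (\<lambda>e. (N (head Q e) - E (head Q e)) * (XM M e * E (tail Q e)) - 0 * (XM M e * E (tail Q e)))"
        unfolding z_def Yn_def by (intro tendsto_intros limR limH ends)
      hence "(\<lambda>n. z (Yn n)) \<longlonglongrightarrow> z (\<lambda>e. (N (head Q e) - E (head Q e)) * (XM M e * E (tail Q e)))" by simp
      moreover have "z (\<lambda>e. (N (head Q e) - E (head Q e)) * (XM M e * E (tail Q e))) = z (XM G)"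
        unfolding z_def by (intro sum.cong refl) (simp add: XG)
      moreover have "z (XM G) = ent (G b) k' k" unfolding z_def by (rule zeta_XM[OF b k])
      moreover have "\<forall>\<^sub>F n in sequentially. z (Yn n) = 0"
        using evD
      proof eventually_elim
        case (elim n)
        have "z (\<lambda>e. H n (head Q e) * V0 e - V0 e * H n (tail Q e)) = \<tau> (r n) * z (Yn n)"
          unfolding z_def sum_distrib_left
          by (intro sum.cong refl) (use elim in \<open>simp add: Yn_def trc_csc\<close>)
        moreover have "z (\<lambda>e. H n (head Q e) * V0 e - V0 e * H n (tail Q e)) = 0"
          unfolding z_def by (rule zeta_coboundary[OF b k])
        moreover have "\<tau> (r n) \<noteq> 0" by (simp add: \<tau>_def del: of_nat_Suc)
        ultimately show ?case by simp
      qed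
      ultimately have "(\<lambda>n. 0) \<longlonglongrightarrow> ent (G b) k' k" using tendsto_cong[of "\<lambda>n. z (Yn n)" "\<lambda>n. 0"] by simp
      thus ?thesis by (simp add: LIMSEQ_const_iff)
    next
      case False
      thus ?thesis using Gc by (auto simp: idm_times_iff times_idm_iff not_less)
    qed
  qed
  have "fm_sub Q' (\<lambda>i. idm (m i)) M F"
    unfolding fm_sub_def
  proof (intro conjI ballI)
    fix i assume "i \<in> verts Q'"
    thus "F i * F i = F i" "idm (m i) * F i = F i" "F i * idm (m i) = F i" using FF F vQ' by (auto simp: scalF_def)
  next
    fix a assume a: "a \<in> arcs Q'"
    have Ma: "idm (m (head Q' a)) * (M a * X) = M a * X" for X
    proof -
      have "idm (m (head Q' a)) * M a = M a" using M a by (simp add: repM_def)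
      from times_right[OF this, of X] show ?thesis by (simp add: mult.assoc)
    qed
    show "F (head Q' a) * (M a * F (tail Q' a)) = M a * F (tail Q' a)"
      using G0[OF a] by (simp add: G_def left_diff_distrib Ma)
  qed
  hence "(\<forall>i\<in>verts Q'. F i = 0) \<or> (\<forall>i\<in>verts Q'. F i = idm (m i))"
    using simple by (auto simp: fm_stable_def fm_weight_def)
  thus False
  proof
    assume "\<forall>i\<in>verts Q'. F i = 0"
    hence "E v = 0" if "v \<in> verts Q" for v using EF that vQ' by (simp add: bl_def)
    hence "P v = 0" if "v \<in> verts Q" for v using EP[OF that] that by simp
    thus False using P(3) by blast
  next
    assume "\<forall>i\<in>verts Q'. F i = idm (m i)"
    hence "E v = N v" if "v \<in> verts Q" for v using EF that vQ' bl_id[OF that] by (simp add: bl_def)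
    moreover have "P v * N v = P v" if "v \<in> verts Q" for v using P(1) that by (simp add: fm_sub_def)
    ultimately have "P v = N v" if "v \<in> verts Q" for v using PE[OF that] that by simp
    thus False using P(4) by blast
  qed
qed

end


section \<open>Stable representations come from the local quiver\<close>

lemma fm_stable_iso:
  assumes wf: "wf_digraph Q" and V: "fm_rep Q N V" and st: "fm_stable Q \<theta> N V'"
    and g: "fm_hom Q N V N V' g" and N: "\<forall>v\<in>verts Q. N v * g' v = g' v \<and> g' v * N v = g' v"
    and gg': "\<forall>v\<in>verts Q. g v * g' v = N v" "\<forall>v\<in>verts Q. g' v * g v = N v"
  shows "fm_stable Q \<theta> N V"
  unfolding fm_stable_def
proof (intro conjI allI impI)
  show "\<exists>v\<in>verts Q. N v \<noteq> 0" "fm_weight Q \<theta> N = 0" using st by (auto simp: fm_stable_def)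
  fix P assume P: "fm_sub Q N V P"
  have Pv: "P v * P v = P v" "N v * P v = P v" "P v * N v = P v" if "v \<in> verts Q" for v
    using P that by (auto simp: fm_sub_def)
  have gN: "N v * g v = g v" "g v * N v = g v" "N v * g' v = g' v" "g' v * N v = g' v" "g v * g' v = N v" "g' v * g v = N v"
    if "v \<in> verts Q" for v using g N gg' that by (auto simp: fm_hom_def)
  note Pv' = Pv[THEN times_right, unfolded mult.assoc] and gN' = gN[THEN times_right, unfolded mult.assoc]
  define R where "R v = g v * (P v * g' v)" for v
  have R: "fm_sub Q N V' R"
    unfolding fm_sub_def
  proof (intro conjI ballI)
    fix v assume v: "v \<in> verts Q"
    show "R v * R v = R v" "N v * R v = R v" "R v * N v = R v"
      by (simp_all add: R_def mult.assoc gN' Pv' gN Pv v)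
  next
    fix e assume e: "e \<in> arcs Q"
    note h = wf_ends(1)[OF wf e] and t = wf_ends(2)[OF wf e]
    have gV: "g (head Q e) * V e = V' e * g (tail Q e)" using g e by (simp add: fm_hom_def)
    have PVP: "P (head Q e) * (V e * P (tail Q e)) = V e * P (tail Q e)" using P e by (simp add: fm_sub_def)
    have V'R: "V' e * R (tail Q e) = g (head Q e) * (V e * (P (tail Q e) * g' (tail Q e)))"
      using times_right[OF gV, of "P (tail Q e) * g' (tail Q e)"] by (simp add: R_def mult.assoc)
    have NV: "N (head Q e) * (V e * X) = V e * X" for X
    proof -
      have "N (head Q e) * V e = V e" using V e by (simp add: fm_rep_def)
      from times_right[OF this, of X] show ?thesis by (simp add: mult.assoc)
    qed
    show "R (head Q e) * (V' e * R (tail Q e)) = V' e * R (tail Q e)"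
      unfolding V'R using times_right[OF PVP, of "g' (tail Q e)"]
      by (simp add: R_def mult.assoc gN' h NV)
  qed
  have w: "fm_weight Q \<theta> R = fm_weight Q \<theta> P"
  proof (rule fm_weight_cong)
    fix v assume v: "v \<in> verts Q"
    show "trc (R v) = trc (P v)" using trc_commute[of "g v" "P v * g' v"]
      by (simp add: R_def mult.assoc gN Pv v)
  qed
  have Pback: "P v = g' v * (R v * g v)" if v: "v \<in> verts Q" for v
    by (simp add: R_def mult.assoc gN gN' Pv v)
  have "(\<forall>v\<in>verts Q. R v = 0) \<or> (\<forall>v\<in>verts Q. R v = N v) \<or> 0 < fm_weight Q \<theta> R"
    using st R unfolding fm_stable_def by blast
  thus "(\<forall>v\<in>verts Q. P v = 0) \<or> (\<forall>v\<in>verts Q. P v = N v) \<or> 0 < fm_weight Q \<theta> P"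
  proof (elim disjE)
    assume "\<forall>v\<in>verts Q. R v = 0"
    hence "P v = 0" if "v \<in> verts Q" for v using Pback[OF that] that by simp
    thus ?thesis by simp
  next
    assume "\<forall>v\<in>verts Q. R v = N v"
    hence "P v = N v" if "v \<in> verts Q" for v using Pback[OF that] that by (simp add: gN)
    thus ?thesis by simp
  qed (simp add: w)
qed

text \<open>
  The case distinction makes the image finitary for every \<open>h\<close>; field embeddings map \<open>0\<close> to \<open>0\<close> anyway.
\<close>

lift_definition emap :: "(complex \<Rightarrow> complex) \<Rightarrow> fmat \<Rightarrow> fmat" is
  "\<lambda>h f i j. if f i j = 0 then 0 else h (f i j)" by auto

definition ents_in :: "complex set \<Rightarrow> fmat \<Rightarrow> bool" where
  "ents_in F A \<longleftrightarrow> (\<forall>i j. ent A i j \<in> F)"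

definition ents :: "fmat \<Rightarrow> complex set" where "ents A = range (\<lambda>(i, j). ent A i j)"

lemma ents_in_iff: "ents_in F A \<longleftrightarrow> ents A \<subseteq> F"
  by (auto simp: ents_in_def ents_def)

lemma finite_ents: "finite (ents A)"
proof -
  obtain n where n: "\<And>i j. n \<le> i \<or> n \<le> j \<Longrightarrow> ent A i j = 0" using ent_bound[of A] by blast
  have "ents A \<subseteq> insert 0 ((\<lambda>(i, j). ent A i j) ` ({..<n} \<times> {..<n}))"
  proof
    fix x assume "x \<in> ents A"
    then obtain i j where x: "x = ent A i j" by (auto simp: ents_def)
    show "x \<in> insert 0 ((\<lambda>(i, j). ent A i j) ` ({..<n} \<times> {..<n}))"
      using n[of i j] x by (cases "i < n \<and> j < n") auto
  qed
  thus ?thesis by (rule finite_subset) auto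
qed

context
  fixes F h assumes F: "subfld F" and h: "fhom F h"
begin

lemma ent_emap: "ent (emap h A) i j = h (ent A i j)"
  using fhomD(2)[OF h F] by transfer auto

lemma emap_add: "ents_in F A \<Longrightarrow> ents_in F B \<Longrightarrow> emap h (A + B) = emap h A + emap h B"
  by (rule fmat_eqI) (simp add: ent_emap ents_in_def fhomD(3)[OF h F])

lemma emap_times: "ents_in F A \<Longrightarrow> ents_in F B \<Longrightarrow> emap h (A * B) = emap h A * emap h B"
proof (rule fmat_eqI)
  fix i j
  assume A: "ents_in F A" and B: "ents_in F B"
  obtain n where n: "\<And>i j. n \<le> i \<or> n \<le> j \<Longrightarrow> ent A i j = 0" using ent_bound[of A] by blast
  have 1: "ent (A * B) i j = (\<Sum>k<n. ent A i k * ent B k j)"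
    by (rule ent_times) (use n in \<open>auto simp: not_less\<close>)
  have 2: "ent (emap h A * emap h B) i j = (\<Sum>k<n. ent (emap h A) i k * ent (emap h B) k j)"
    by (rule ent_times) (use n fhomD(2)[OF h F] in \<open>auto simp: not_less ent_emap\<close>)
  show "ent (emap h (A * B)) i j = ent (emap h A * emap h B) i j"
    unfolding ent_emap[of "A * B"] 1 2 using A B
    by (subst fhom_sum[OF h F]) (auto simp: ents_in_def ent_emap subfldD[OF F] fhomD(4)[OF h F])
qed

lemma emap_csc: "c \<in> F \<Longrightarrow> ents_in F A \<Longrightarrow> emap h (c *\<^sub>C A) = h c *\<^sub>C emap h A"
  by (rule fmat_eqI) (simp add: ent_emap ents_in_def fhomD(4)[OF h F])

lemma ents_in_csc: "c \<in> F \<Longrightarrow> ents_in F A \<Longrightarrow> ents_in F (c *\<^sub>C A)"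
  by (simp add: ents_in_def subfldD[OF F])

lemma ents_in_add: "ents_in F A \<Longrightarrow> ents_in F B \<Longrightarrow> ents_in F (A + B)"
  by (simp add: ents_in_def subfldD[OF F])

lemma ents_in_sum: "(\<And>x. x \<in> S \<Longrightarrow> ents_in F (f x)) \<Longrightarrow> ents_in F (sum f S)"
  by (auto simp: ents_in_def ent_sum intro!: subfld_sum[OF F])

lemma emap_sum: "(\<And>x. x \<in> S \<Longrightarrow> ents_in F (f x)) \<Longrightarrow> emap h (sum f S) = (\<Sum>x\<in>S. emap h (f x))"
  by (rule fmat_eqI, simp add: ent_emap ent_sum, rule fhom_sum[OF h F]) (auto simp: ents_in_def)

lemma emap_fixed: "(\<And>x. x \<in> ents A \<Longrightarrow> h x = x) \<Longrightarrow> emap h A = A"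
  by (rule fmat_eqI) (auto simp: ent_emap ents_def)

lemma emap_idm: "emap h (idm n) = idm n"
  by (rule fmat_eqI) (simp add: ent_emap ent_idm fhomD(1,2)[OF h F])

end

lemma avoid_countable:
  assumes "countable Bad" "0 < \<epsilon>"
  obtains x :: real where "a < x" "x < a + \<epsilon>" "complex_of_real x \<notin> Bad"
proof -
  have "countable {x. complex_of_real x \<in> Bad}"
  proof (rule countable_image_inj_on)
    show "countable (complex_of_real ` {x. complex_of_real x \<in> Bad})"
      by (rule countable_subset[OF _ assms(1)]) auto
  qed (simp add: inj_on_def)
  hence "\<not> {a<..<a + \<epsilon>} \<subseteq> {x. complex_of_real x \<in> Bad}"
    using uncountable_open_interval[of a "a + \<epsilon>"] assms(2) by (metis countable_subset less_add_same_cancel1)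
  then obtain x where "x \<in> {a<..<a + \<epsilon>}" "complex_of_real x \<notin> Bad" by blast
  thus ?thesis by (intro that[of x]) auto
qed

context local_quiver
begin

lemma XM_sum: "XM (\<lambda>a. \<Sum>\<kappa>\<in>K. z \<kappa> *\<^sub>C M \<kappa> a) e = (\<Sum>\<kappa>\<in>K. z \<kappa> *\<^sub>C XM (M \<kappa>) e)"
proof -
  have "XM (\<lambda>a. \<Sum>\<kappa>\<in>K. z \<kappa> *\<^sub>C M \<kappa> a) e = (\<Sum>a\<in>arcs Q'. \<Sum>\<kappa>\<in>K. z \<kappa> *\<^sub>C tens (head Q' a) (tail Q' a) (head Q e) (tail Q e) (M \<kappa> a) (Z a e))"
    by (simp add: XM_def tens_sum_left tens_csc_left)
  also have "\<dots> = (\<Sum>\<kappa>\<in>K. \<Sum>a\<in>arcs Q'. z \<kappa> *\<^sub>C tens (head Q' a) (tail Q' a) (head Q e) (tail Q e) (M \<kappa> a) (Z a e))"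
    by (rule sum.swap)
  finally show ?thesis by (simp add: XM_def csc_sum_right)
qed

text \<open>
  By \<open>slice_surjective\<close> every family \<open>\<Sum> z U\<close> of matrices, where \<open>U\<close> runs through the elementary
  families, is a coboundary of \<open>h z = \<Sum> z h\<close> plus \<open>X z = \<Sum> z (XM M)\<close>. The condition that \<open>1 + t h z\<close> maps
  \<open>V0 + t (X z)\<close> to \<open>V0 + t Y\<close> is divisible by \<open>t\<close>, and division leaves a quadratic fixed point equation for \<open>z\<close>,
  solved by \<open>quadratic_fixed_point\<close>.
\<close>

lemma local_slice:
  assumes Y: "corner_fam (arcs Q) (\<lambda>e. \<alpha> (head Q e)) (\<lambda>e. \<alpha> (tail Q e)) Y"
  obtains K and M :: "'e \<times> nat \<times> nat \<Rightarrow> 'f \<Rightarrow> fmat" and \<delta> where "finite K" "\<forall>\<kappa>\<in>K. repM (M \<kappa>)" "\<delta> > 0"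
    "\<forall>t. cmod t < \<delta> \<longrightarrow> (\<exists>\<mu> g g'. corner_fam (verts Q) \<alpha> \<alpha> g \<and> corner_fam (verts Q) \<alpha> \<alpha> g' \<and>
      (\<forall>v\<in>verts Q. g v * g' v = N v \<and> g' v * g v = N v) \<and>
      (\<forall>e\<in>arcs Q. g (head Q e) * (V0 e + (\<Sum>\<kappa>\<in>K. \<mu> \<kappa> *\<^sub>C XM (M \<kappa>) e)) = (V0 e + t *\<^sub>C Y e) * g (tail Q e)))"
proof -
  define K where "K = (SIGMA e:arcs Q. {..<\<alpha> (head Q e)} \<times> {..<\<alpha> (tail Q e)})"
  have fK: "finite K" using fins by (auto simp: K_def)
  define U where "U \<kappa> e = (case \<kappa> of (e', x, y) \<Rightarrow> if e = e' then unit_at x y else 0)" for \<kappa> :: "'e \<times> nat \<times> nat" and e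
  have U: "corner_fam (arcs Q) (\<lambda>e. \<alpha> (head Q e)) (\<lambda>e. \<alpha> (tail Q e)) (U \<kappa>)" if "\<kappa> \<in> K" for \<kappa>
    using that by (auto simp: K_def corner_fam_def U_def idm_times_iff times_idm_iff ent_unit_at)
  define good where "good \<kappa> h M \<longleftrightarrow> corner_fam (verts Q) \<alpha> \<alpha> h \<and> repM M \<and>
    (\<forall>e\<in>arcs Q. U \<kappa> e = h (head Q e) * V0 e - V0 e * h (tail Q e) + XM M e)" for \<kappa> h M
  have "\<forall>\<kappa>. \<exists>h M. \<kappa> \<in> K \<longrightarrow> good \<kappa> h M"
    using slice_surjective[OF U] unfolding good_def by metis
  then obtain h M where hM: "\<And>\<kappa>. \<kappa> \<in> K \<Longrightarrow> good \<kappa> (h \<kappa>) (M \<kappa>)" by metis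
  have hc: "corner_fam (verts Q) \<alpha> \<alpha> (h \<kappa>)" and M: "repM (M \<kappa>)"
    and Uh: "\<And>e. e \<in> arcs Q \<Longrightarrow> U \<kappa> e = h \<kappa> (head Q e) * V0 e - V0 e * h \<kappa> (tail Q e) + XM (M \<kappa>) e"
    if "\<kappa> \<in> K" for \<kappa> using hM[OF that] unfolding good_def by blast+
  define c where "c \<kappa> = (case \<kappa> of (e, x, y) \<Rightarrow> ent (Y e) x y)" for \<kappa> :: "'e \<times> nat \<times> nat"
  define B where "B \<kappa> j = (case \<kappa> of (e, x, y) \<Rightarrow> ent (Y e * h j (tail Q e)) x y)" for \<kappa> :: "'e \<times> nat \<times> nat" and j
  define C where "C \<kappa> j k = (case \<kappa> of (e, x, y) \<Rightarrow> - ent (h j (head Q e) * XM (M k) e) x y)" for \<kappa> :: "'e \<times> nat \<times> nat" and j k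
  obtain \<delta>1 R where \<delta>1: "\<delta>1 > 0" and fp: "\<And>t. cmod t < \<delta>1 \<Longrightarrow> \<exists>z. \<forall>\<kappa>\<in>K. cmod (z \<kappa>) \<le> R \<and>
     z \<kappa> = c \<kappa> + t * ((\<Sum>j\<in>K. B \<kappa> j * z j) + (\<Sum>j\<in>K. \<Sum>k\<in>K. C \<kappa> j k * z j * z k))"
    using quadratic_fixed_point[OF fK, of c B C] by blast
  \<comment> \<open>A bound for \<open>h z\<close>, which makes \<open>1 + t h z\<close> invertible for \<open>\<bar>t\<bar> < 1 / b\<close>.\<close>
  define b where "b = (\<Sum>v\<in>verts Q. \<Sum>\<kappa>\<in>K. \<bar>R\<bar> * norm (h \<kappa> v)) + 1"
  have b: "1 \<le> b" by (simp add: b_def sum_nonneg)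
  define \<delta> where "\<delta> = min \<delta>1 (1 / b)"
  have "\<delta> > 0" using \<delta>1 b by (simp add: \<delta>_def)
  have main: "\<exists>\<mu> g g'. corner_fam (verts Q) \<alpha> \<alpha> g \<and> corner_fam (verts Q) \<alpha> \<alpha> g' \<and>
      (\<forall>v\<in>verts Q. g v * g' v = N v \<and> g' v * g v = N v) \<and>
      (\<forall>e\<in>arcs Q. g (head Q e) * (V0 e + (\<Sum>\<kappa>\<in>K. \<mu> \<kappa> *\<^sub>C XM (M \<kappa>) e)) = (V0 e + t *\<^sub>C Y e) * g (tail Q e))"
    if t: "cmod t < \<delta>" for t
  proof -
    have "cmod t < \<delta>1" using t by (simp add: \<delta>_def)
    from fp[OF this] obtain z where zz: "\<forall>\<kappa>\<in>K. cmod (z \<kappa>) \<le> R \<and>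
      z \<kappa> = c \<kappa> + t * ((\<Sum>j\<in>K. B \<kappa> j * z j) + (\<Sum>j\<in>K. \<Sum>k\<in>K. C \<kappa> j k * z j * z k))" by (rule exE)
    have zR: "cmod (z \<kappa>) \<le> R" if "\<kappa> \<in> K" for \<kappa> using bspec[OF zz that] by (rule conjunct1)
    have z: "z \<kappa> = c \<kappa> + t * ((\<Sum>j\<in>K. B \<kappa> j * z j) + (\<Sum>j\<in>K. \<Sum>k\<in>K. C \<kappa> j k * z j * z k))"
      if "\<kappa> \<in> K" for \<kappa> using bspec[OF zz that] by (rule conjunct2)
    define hz where "hz v = (\<Sum>\<kappa>\<in>K. z \<kappa> *\<^sub>C h \<kappa> v)" for v
    define Xz where "Xz e = (\<Sum>\<kappa>\<in>K. z \<kappa> *\<^sub>C XM (M \<kappa>) e)" for e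
    have hzc: "idm (\<alpha> v) * hz v = hz v" "hz v * idm (\<alpha> v) = hz v" if v: "v \<in> verts Q" for v
    proof -
      have "idm (\<alpha> v) * h \<kappa> v = h \<kappa> v" "h \<kappa> v * idm (\<alpha> v) = h \<kappa> v" if "\<kappa> \<in> K" for \<kappa>
        using hc[OF that] v by (simp_all add: corner_fam_def)
      thus "idm (\<alpha> v) * hz v = hz v" "hz v * idm (\<alpha> v) = hz v"
        by (simp_all add: hz_def sum_distrib_left sum_distrib_right)
    qed
    have Xzc: "idm (\<alpha> (head Q e)) * Xz e = Xz e" "Xz e * idm (\<alpha> (tail Q e)) = Xz e" if "e \<in> arcs Q" for e
      using that by (simp_all add: Xz_def sum_distrib_left sum_distrib_right XM_corner)
    have Yc: "idm (\<alpha> (head Q e)) * Y e = Y e" "Y e * idm (\<alpha> (tail Q e)) = Y e" if "e \<in> arcs Q" for e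
      using Y that by (simp_all add: corner_fam_def)
    have eq: "hz (head Q e) * V0 e - V0 e * hz (tail Q e) + Xz e = Y e + t *\<^sub>C (Y e * hz (tail Q e) - hz (head Q e) * Xz e)"
      if e: "e \<in> arcs Q" for e
    proof -
      note hd = ends(1)[OF e] and tl = ends(2)[OF e]
      have "hz (head Q e) * V0 e - V0 e * hz (tail Q e) + Xz e = (\<Sum>\<kappa>\<in>K. z \<kappa> *\<^sub>C U \<kappa> e)"
      proof -
        have "(\<Sum>\<kappa>\<in>K. z \<kappa> *\<^sub>C U \<kappa> e) = (\<Sum>\<kappa>\<in>K. z \<kappa> *\<^sub>C (h \<kappa> (head Q e) * V0 e) - z \<kappa> *\<^sub>C (V0 e * h \<kappa> (tail Q e)) + z \<kappa> *\<^sub>C XM (M \<kappa>) e)"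
          by (intro sum.cong refl) (simp add: Uh e csc_add_right csc_diff_right)
        thus ?thesis by (simp add: hz_def Xz_def sum_distrib_left sum_distrib_right sum.distrib sum_subtractf)
      qed
      also have "\<dots> = Y e + t *\<^sub>C (Y e * hz (tail Q e) - hz (head Q e) * Xz e)"
      proof (rule fmat_eqI)
        fix x y
        have Yh: "Y e * hz (tail Q e) = (\<Sum>j\<in>K. z j *\<^sub>C (Y e * h j (tail Q e)))"
          by (simp add: hz_def sum_distrib_left)
        have hX: "hz (head Q e) * Xz e = (\<Sum>j\<in>K. \<Sum>k\<in>K. (z j * z k) *\<^sub>C (h j (head Q e) * XM (M k) e))"
          unfolding hz_def Xz_def sum_distrib_right by (simp add: sum_distrib_left csc_sum_right mult.commute)
        show "ent (\<Sum>\<kappa>\<in>K. z \<kappa> *\<^sub>C U \<kappa> e) x y = ent (Y e + t *\<^sub>C (Y e * hz (tail Q e) - hz (head Q e) * Xz e)) x y"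
        proof (cases "x < \<alpha> (head Q e) \<and> y < \<alpha> (tail Q e)")
          case True
          hence K: "(e, x, y) \<in> K" using e by (simp add: K_def)
          have "ent (\<Sum>\<kappa>\<in>K. z \<kappa> *\<^sub>C U \<kappa> e) x y = (\<Sum>\<kappa>\<in>K. if \<kappa> = (e, x, y) then z \<kappa> else 0)"
            unfolding ent_sum by (intro sum.cong refl) (auto simp: U_def ent_unit_at split: prod.splits)
          also have "\<dots> = z (e, x, y)" using K fK by simp
          also have "\<dots> = ent (Y e) x y + t * (ent (Y e * hz (tail Q e)) x y - ent (hz (head Q e) * Xz e) x y)"
            unfolding z[OF K] Yh hX ent_sum
            by (simp add: c_def B_def C_def sum_negf mult.commute mult.left_commute mult.assoc)
          finally show ?thesis by simp
        next
          case False
          have "idm (\<alpha> (head Q e)) * (\<Sum>\<kappa>\<in>K. z \<kappa> *\<^sub>C U \<kappa> e) = (\<Sum>\<kappa>\<in>K. z \<kappa> *\<^sub>C U \<kappa> e)"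
            "(\<Sum>\<kappa>\<in>K. z \<kappa> *\<^sub>C U \<kappa> e) * idm (\<alpha> (tail Q e)) = (\<Sum>\<kappa>\<in>K. z \<kappa> *\<^sub>C U \<kappa> e)"
            using U e by (auto simp: corner_fam_def sum_distrib_left sum_distrib_right intro!: sum.cong)
          moreover have "idm (\<alpha> (head Q e)) * (Y e + t *\<^sub>C (Y e * hz (tail Q e) - hz (head Q e) * Xz e)) = Y e + t *\<^sub>C (Y e * hz (tail Q e) - hz (head Q e) * Xz e)"
            by (simp add: distrib_left right_diff_distrib mult.assoc Yc e
                times_right[OF Yc(1)[OF e], unfolded mult.assoc] times_right[OF hzc(1)[OF hd], unfolded mult.assoc])
          moreover have "(Y e + t *\<^sub>C (Y e * hz (tail Q e) - hz (head Q e) * Xz e)) * idm (\<alpha> (tail Q e)) = Y e + t *\<^sub>C (Y e * hz (tail Q e) - hz (head Q e) * Xz e)"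
            by (simp add: distrib_right left_diff_distrib mult.assoc Yc e hzc tl Xzc)
          ultimately show ?thesis using False unfolding idm_times_iff times_idm_iff not_less de_Morgan_conj by metis
        qed
      qed
      finally show ?thesis .
    qed
    define g where "g v = N v + t *\<^sub>C hz v" for v
    have gc: "idm (\<alpha> v) * g v = g v" "g v * idm (\<alpha> v) = g v" if "v \<in> verts Q" for v
      using hzc[OF that] by (simp_all add: g_def distrib_left distrib_right)
    have "\<exists>g'. idm (\<alpha> v) * g' = g' \<and> g' * idm (\<alpha> v) = g' \<and> g v * g' = N v \<and> g' * g v = N v" if v: "v \<in> verts Q" for v
    proof -
      have "norm (hz v) \<le> (\<Sum>\<kappa>\<in>K. \<bar>R\<bar> * norm (h \<kappa> v))"
        unfolding hz_def
      proof (rule order_trans[OF norm_sum], rule sum_mono)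
        fix \<kappa> assume "\<kappa> \<in> K"
        hence "cmod (z \<kappa>) \<le> \<bar>R\<bar>" using zR by fastforce
        thus "norm (z \<kappa> *\<^sub>C h \<kappa> v) \<le> \<bar>R\<bar> * norm (h \<kappa> v)" unfolding norm_csc by (rule mult_right_mono) simp
      qed
      also have "\<dots> \<le> (\<Sum>v\<in>verts Q. \<Sum>\<kappa>\<in>K. \<bar>R\<bar> * norm (h \<kappa> v))"
        by (rule member_le_sum[of v "verts Q" "\<lambda>v. \<Sum>\<kappa>\<in>K. \<bar>R\<bar> * norm (h \<kappa> v)"]) (use v fins in \<open>auto intro: sum_nonneg\<close>)
      finally have hb: "norm (hz v) \<le> b" by (simp add: b_def)
      have "cmod t * norm (hz v) \<le> cmod t * b" using hb by (rule mult_left_mono) simp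
      also have "\<dots> < 1" using t b by (simp add: \<delta>_def field_simps)
      finally have "norm (N v - g v) < 1" by (simp add: g_def norm_csc)
      from corner_inverse[OF idm_idm gc[OF v] this] show ?thesis by metis
    qed
    hence "\<forall>v. \<exists>g'. v \<in> verts Q \<longrightarrow> (idm (\<alpha> v) * g' = g' \<and> g' * idm (\<alpha> v) = g' \<and> g v * g' = N v \<and> g' * g v = N v)" by simp
    from choice[OF this] obtain g' where
      "\<forall>v. v \<in> verts Q \<longrightarrow> (idm (\<alpha> v) * g' v = g' v \<and> g' v * idm (\<alpha> v) = g' v \<and> g v * g' v = N v \<and> g' v * g v = N v)"
      by (rule exE)
    hence g': "corner_fam (verts Q) \<alpha> \<alpha> g'" "\<forall>v\<in>verts Q. g v * g' v = N v \<and> g' v * g v = N v"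
      by (simp_all add: corner_fam_def)
    have "g (head Q e) * (V0 e + (\<Sum>\<kappa>\<in>K. (t * z \<kappa>) *\<^sub>C XM (M \<kappa>) e)) = (V0 e + t *\<^sub>C Y e) * g (tail Q e)" if e: "e \<in> arcs Q" for e
    proof -
      have X: "(\<Sum>\<kappa>\<in>K. (t * z \<kappa>) *\<^sub>C XM (M \<kappa>) e) = t *\<^sub>C Xz e" by (simp add: Xz_def csc_sum_right)
      have eq': "hz (head Q e) * V0 e + Xz e = V0 e * hz (tail Q e) + Y e + t *\<^sub>C (Y e * hz (tail Q e) - hz (head Q e) * Xz e)"
        using eq[OF e] by (simp add: algebra_simps)
      have "g (head Q e) * (V0 e + t *\<^sub>C Xz e) = V0 e + t *\<^sub>C (hz (head Q e) * V0 e + Xz e) + (t * t) *\<^sub>C (hz (head Q e) * Xz e)"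
        by (simp add: g_def distrib_left distrib_right V0_corner Xzc e csc_add_right)
      also have "\<dots> = V0 e + t *\<^sub>C (V0 e * hz (tail Q e)) + t *\<^sub>C Y e + (t * t) *\<^sub>C (Y e * hz (tail Q e))"
        unfolding eq' by (simp add: csc_add_right csc_diff_right algebra_simps)
      also have "\<dots> = (V0 e + t *\<^sub>C Y e) * g (tail Q e)"
        by (simp add: g_def distrib_left distrib_right V0_corner Yc e csc_add_right)
      finally show ?thesis unfolding X .
    qed
    hence eqs: "\<forall>e\<in>arcs Q. g (head Q e) * (V0 e + (\<Sum>\<kappa>\<in>K. (t * z \<kappa>) *\<^sub>C XM (M \<kappa>) e)) = (V0 e + t *\<^sub>C Y e) * g (tail Q e)"
      by (rule ballI)
    have "corner_fam (verts Q) \<alpha> \<alpha> g" using gc by (simp add: corner_fam_def)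
    from conjI[OF this conjI[OF g'(1) conjI[OF g'(2) eqs]]] show ?thesis
      by (intro exI[of _ "\<lambda>\<kappa>. t * z \<kappa>"] exI[of _ g] exI[of _ g'])
  qed
  show ?thesis
    by (rule that[OF fK, of M \<delta>]) (use M \<open>\<delta> > 0\<close> main in auto)
qed

text \<open>
  On the line through \<open>V0\<close> and \<open>S\<close> there is a stable point at some generic \<open>t1\<close> near \<open>1\<close>, and the point at a
  generic small \<open>t0\<close> is isomorphic to \<open>V0 + XM M\<close> for some \<open>M\<close>. A field embedding that fixes the line and
  moves \<open>t0\<close> to \<open>t1\<close> transports this isomorphism.
\<close>

theorem stable_imp_deform_stable:
  assumes S: "fm_rep Q N S" and st: "fm_stable Q \<theta> N S"
  obtains M where "repM M" "fm_stable Q \<theta> N (\<lambda>e. V0 e + XM M e)"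
proof -
  define Y where "Y e = S e - V0 e" for e
  have Y: "corner_fam (arcs Q) (\<lambda>e. \<alpha> (head Q e)) (\<lambda>e. \<alpha> (tail Q e)) Y"
    using S rep_deform(2) by (simp add: corner_fam_def Y_def fm_rep_def left_diff_distrib right_diff_distrib)
  obtain K and M :: "'e \<times> nat \<times> nat \<Rightarrow> 'f \<Rightarrow> fmat" and \<delta> where K: "finite K" and M: "\<forall>\<kappa>\<in>K. repM (M \<kappa>)" and \<delta>: "\<delta> > 0"
    and slice: "\<forall>t. cmod t < \<delta> \<longrightarrow> (\<exists>\<mu> g g'. corner_fam (verts Q) \<alpha> \<alpha> g \<and> corner_fam (verts Q) \<alpha> \<alpha> g' \<and>
      (\<forall>v\<in>verts Q. g v * g' v = N v \<and> g' v * g v = N v) \<and>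
      (\<forall>e\<in>arcs Q. g (head Q e) * (V0 e + (\<Sum>\<kappa>\<in>K. \<mu> \<kappa> *\<^sub>C XM (M \<kappa>) e)) = (V0 e + t *\<^sub>C Y e) * g (tail Q e)))"
    by (rule local_slice[OF Y])
  \<comment> \<open>The entries that the field embedding has to fix; they do not depend on \<open>t0\<close>.\<close>
  define A where "A = (\<Union>e\<in>arcs Q. ents (V0 e) \<union> ents (Y e) \<union> (\<Union>\<kappa>\<in>K. ents (XM (M \<kappa>) e)))"
  have fA: "finite A" using K fins by (auto simp: A_def finite_ents)
  obtain Bad where Bad: "countable Bad"
    and gen: "\<forall>t0 t1 B. t0 \<notin> Bad \<longrightarrow> t1 \<notin> Bad \<longrightarrow> finite B \<longrightarrow>
      (\<exists>F h. subfld F \<and> fhom F h \<and> A \<subseteq> F \<and> B \<subseteq> F \<and> t0 \<in> F \<and> (\<forall>x\<in>A. h x = x) \<and> h t0 = t1)"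
    by (rule generic_transfer[OF fA])
  have "\<exists>t1. t1 \<notin> Bad \<and> fm_stable Q \<theta> N (\<lambda>e. V0 e + t1 *\<^sub>C Y e)"
  proof (rule ccontr)
    assume neg: "\<not> (\<exists>t1. t1 \<notin> Bad \<and> fm_stable Q \<theta> N (\<lambda>e. V0 e + t1 *\<^sub>C Y e))"
    have "\<forall>n. \<exists>x. 1 < x \<and> x < 1 + 1 / real (Suc n) \<and> complex_of_real x \<notin> Bad"
    proof
      fix n
      obtain x where "1 < x" "x < 1 + 1 / real (Suc n)" "complex_of_real x \<notin> Bad"
        by (rule avoid_countable[OF Bad, of "1 / real (Suc n)" 1]) auto
      thus "\<exists>x. 1 < x \<and> x < 1 + 1 / real (Suc n) \<and> complex_of_real x \<notin> Bad" by blast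
    qed
    then obtain x where x: "\<And>n. 1 < x n" "\<And>n. x n < 1 + 1 / real (Suc n)" "\<And>n. complex_of_real (x n) \<notin> Bad"
      by metis
    have "x \<longlonglongrightarrow> 1"
    proof (rule tendsto_sandwich[of "\<lambda>n. 1" _ _ "\<lambda>n. 1 + 1 / real (Suc n)"])
      have "(\<lambda>n. 1 + inverse (real (Suc n))) \<longlonglongrightarrow> 1 + 0" by (intro tendsto_add tendsto_const LIMSEQ_inverse_real_of_nat)
      thus "(\<lambda>n. 1 + 1 / real (Suc n)) \<longlonglongrightarrow> 1" by (simp add: inverse_eq_divide)
    qed (use x in \<open>auto simp: less_imp_le\<close>)
    from tendsto_of_real[OF this, where 'a = complex]
    have x1: "(\<lambda>n. complex_of_real (x n)) \<longlonglongrightarrow> 1" by simp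
    have lim: "(\<lambda>n. V0 e + complex_of_real (x n) *\<^sub>C Y e) \<longlonglongrightarrow> S e" for e
    proof -
      have "(\<lambda>n. V0 e + complex_of_real (x n) *\<^sub>C Y e) \<longlonglongrightarrow> V0 e + 1 *\<^sub>C Y e" by (intro tendsto_intros x1)
      thus ?thesis by (simp add: Y_def)
    qed
    have nz: "\<exists>v\<in>verts Q. \<alpha> v \<noteq> 0" using st by (auto simp: fm_stable_def)
    have ns: "\<not> fm_stable Q \<theta> N (\<lambda>e. V0 e + complex_of_real (x n) *\<^sub>C Y e)" for n using neg x(3) by blast
    obtain r P Pn where "strict_mono r" "\<forall>n. fm_sub Q N (\<lambda>e. V0 e + complex_of_real (x (r n)) *\<^sub>C Y e) (Pn n)"
      "\<forall>v\<in>verts Q. (\<lambda>n. Pn n v) \<longlonglongrightarrow> P v" and P: "fm_sub Q N S P" "fm_weight Q \<theta> P \<le> 0"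
      "\<exists>v\<in>verts Q. P v \<noteq> 0" "\<exists>v\<in>verts Q. P v \<noteq> idm (\<alpha> v)"
      by (rule not_stable_limit[OF Q lim nz fm_weight_N ns])
    thus False using st unfolding fm_stable_def by (meson linorder_not_less)
  qed
  then obtain t1 where t1: "t1 \<notin> Bad" "fm_stable Q \<theta> N (\<lambda>e. V0 e + t1 *\<^sub>C Y e)" by blast
  obtain t0 where t0: "0 < t0" "t0 < 0 + \<delta>" "complex_of_real t0 \<notin> Bad" by (rule avoid_countable[OF Bad \<delta>])
  hence "cmod (complex_of_real t0) < \<delta>" by simp
  with slice obtain \<mu> g g' where g: "corner_fam (verts Q) \<alpha> \<alpha> g" and g': "corner_fam (verts Q) \<alpha> \<alpha> g'"
    and gg': "\<forall>v\<in>verts Q. g v * g' v = N v \<and> g' v * g v = N v"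
    and eq: "\<forall>e\<in>arcs Q. g (head Q e) * (V0 e + (\<Sum>\<kappa>\<in>K. \<mu> \<kappa> *\<^sub>C XM (M \<kappa>) e)) = (V0 e + complex_of_real t0 *\<^sub>C Y e) * g (tail Q e)"
    by blast
  \<comment> \<open>The entries of the isomorphism at \<open>t0\<close>, which the embedding may move.\<close>
  define B where "B = \<mu> ` K \<union> (\<Union>v\<in>verts Q. ents (g v) \<union> ents (g' v))"
  have fB: "finite B" using K fins by (auto simp: B_def finite_ents)
  obtain F h where F: "subfld F" and h: "fhom F h" and AF: "A \<subseteq> F" and BF: "B \<subseteq> F" and t0F: "complex_of_real t0 \<in> F"
    and hA: "\<forall>x\<in>A. h x = x" and ht: "h (complex_of_real t0) = t1"
    using gen t0(3) t1(1) fB by blast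
  have inF: "ents_in F (V0 e)" "ents_in F (Y e)" "\<And>\<kappa>. \<kappa> \<in> K \<Longrightarrow> ents_in F (XM (M \<kappa>) e)"
    and fixed: "emap h (V0 e) = V0 e" "emap h (Y e) = Y e" "\<And>\<kappa>. \<kappa> \<in> K \<Longrightarrow> emap h (XM (M \<kappa>) e) = XM (M \<kappa>) e"
    if e: "e \<in> arcs Q" for e
  proof -
    show "ents_in F (V0 e)" "ents_in F (Y e)" "\<And>\<kappa>. \<kappa> \<in> K \<Longrightarrow> ents_in F (XM (M \<kappa>) e)"
      using AF e unfolding ents_in_iff A_def by blast+
    show "emap h (V0 e) = V0 e" "emap h (Y e) = Y e" "\<And>\<kappa>. \<kappa> \<in> K \<Longrightarrow> emap h (XM (M \<kappa>) e) = XM (M \<kappa>) e"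
      by (rule emap_fixed[OF F h], use hA e in \<open>auto simp: A_def\<close>)+
  qed
  have gF: "ents_in F (g v)" "ents_in F (g' v)" if "v \<in> verts Q" for v
    using BF that unfolding ents_in_iff B_def by blast+
  have \<mu>F: "\<mu> \<kappa> \<in> F" if "\<kappa> \<in> K" for \<kappa> using BF that unfolding B_def by blast
  define G G' where "G v = emap h (g v)" and "G' v = emap h (g' v)" for v
  have GG': "G v * G' v = N v" "G' v * G v = N v" if v: "v \<in> verts Q" for v
  proof -
    have c: "g v * g' v = N v" "g' v * g v = N v" using gg' v by auto
    show "G v * G' v = N v" "G' v * G v = N v"
      using arg_cong[OF c(1), of "emap h"] arg_cong[OF c(2), of "emap h"]
      by (simp_all add: G_def G'_def emap_times[OF F h] gF v emap_idm[OF F h])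
  qed
  have corner: "idm (\<alpha> v) * emap h A = emap h A" "emap h A * idm (\<alpha> v) = emap h A"
    if A: "idm (\<alpha> v) * A = A" "A * idm (\<alpha> v) = A" for v A
    using A by (simp_all add: idm_times_iff times_idm_iff ent_emap[OF F h] fhomD(2)[OF h F])
  have Gc: "N v * G v = G v" "G v * N v = G v" "N v * G' v = G' v" "G' v * N v = G' v" if "v \<in> verts Q" for v
    using g g' that unfolding G_def G'_def by (simp_all add: corner corner_fam_def)
  define M1 where "M1 a = (\<Sum>\<kappa>\<in>K. h (\<mu> \<kappa>) *\<^sub>C M \<kappa> a)" for a
  have M1: "repM M1"
    unfolding repM_def
  proof (intro ballI conjI)
    fix a assume a: "a \<in> arcs Q'"
    have c: "idm (m (head Q' a)) * M \<kappa> a = M \<kappa> a" "M \<kappa> a * idm (m (tail Q' a)) = M \<kappa> a" if "\<kappa> \<in> K" for \<kappa>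
      using M a that by (auto simp: repM_def)
    show "idm (m (head Q' a)) * M1 a = M1 a" "M1 a * idm (m (tail Q' a)) = M1 a"
      by (simp_all add: M1_def sum_distrib_left sum_distrib_right c)
  qed
  have "fm_stable Q \<theta> N (\<lambda>e. V0 e + XM M1 e)"
  proof (rule fm_stable_iso[where g = G and g' = G', OF wf rep_deform(1) t1(2)])
    show "fm_hom Q N (\<lambda>e. V0 e + XM M1 e) N (\<lambda>e. V0 e + t1 *\<^sub>C Y e) G"
      unfolding fm_hom_def
    proof (intro conjI ballI)
      fix e assume e: "e \<in> arcs Q"
      note hd = ends(1)[OF e] and tl = ends(2)[OF e]
      have i1: "ents_in F (\<Sum>\<kappa>\<in>K. \<mu> \<kappa> *\<^sub>C XM (M \<kappa>) e)"
        by (intro ents_in_sum[OF F h] ents_in_csc[OF F h] \<mu>F inF(3)[OF e])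
      have "emap h (\<Sum>\<kappa>\<in>K. \<mu> \<kappa> *\<^sub>C XM (M \<kappa>) e) = (\<Sum>\<kappa>\<in>K. emap h (\<mu> \<kappa> *\<^sub>C XM (M \<kappa>) e))"
        by (intro emap_sum[OF F h] ents_in_csc[OF F h] \<mu>F inF(3)[OF e])
      also have "\<dots> = XM M1 e"
        unfolding M1_def XM_sum
        by (intro sum.cong refl) (simp add: emap_csc[OF F h] \<mu>F inF(3)[OF e] fixed(3)[OF e])
      finally have X: "emap h (\<Sum>\<kappa>\<in>K. \<mu> \<kappa> *\<^sub>C XM (M \<kappa>) e) = XM M1 e" .
      have i2: "ents_in F (complex_of_real t0 *\<^sub>C Y e)" by (intro ents_in_csc[OF F h] t0F inF(2)[OF e])
      have "emap h (g (head Q e) * (V0 e + (\<Sum>\<kappa>\<in>K. \<mu> \<kappa> *\<^sub>C XM (M \<kappa>) e))) = emap h ((V0 e + complex_of_real t0 *\<^sub>C Y e) * g (tail Q e))"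
        using eq e by simp
      thus "G (head Q e) * (V0 e + XM M1 e) = (V0 e + t1 *\<^sub>C Y e) * G (tail Q e)"
        using emap_times[OF F h gF(1)[OF hd] ents_in_add[OF F h inF(1)[OF e] i1]]
          emap_times[OF F h ents_in_add[OF F h inF(1)[OF e] i2] gF(1)[OF tl]]
        by (simp add: emap_add[OF F h] inF[OF e] i1 i2 X fixed[OF e] emap_csc[OF F h] t0F ht G_def)
    qed (use Gc in auto)
  qed (use Gc GG' in auto)
  thus ?thesis using that M1 by blast
qed

theorem stable_iff_simple:
  "(\<exists>S. fm_rep Q N S \<and> fm_stable Q \<theta> N S) \<longleftrightarrow>
    (\<exists>M. fm_rep Q' (\<lambda>i. idm (m i)) M \<and> fm_stable Q' (\<lambda>_. 0) (\<lambda>i. idm (m i)) M)"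
proof
  assume "\<exists>S. fm_rep Q N S \<and> fm_stable Q \<theta> N S"
  then obtain S where S: "fm_rep Q N S" "fm_stable Q \<theta> N S" by blast
  obtain M where "repM M" "fm_stable Q \<theta> N (\<lambda>e. V0 e + XM M e)" by (rule stable_imp_deform_stable[OF S])
  thus "\<exists>M. fm_rep Q' (\<lambda>i. idm (m i)) M \<and> fm_stable Q' (\<lambda>_. 0) (\<lambda>i. idm (m i)) M"
    using deform_stable_imp_simple repM_iff by blast
next
  assume "\<exists>M. fm_rep Q' (\<lambda>i. idm (m i)) M \<and> fm_stable Q' (\<lambda>_. 0) (\<lambda>i. idm (m i)) M"
  then obtain M where M: "repM M" "fm_stable Q' (\<lambda>_. 0) (\<lambda>i. idm (m i)) M" unfolding repM_iff by blast
  obtain M' where "fm_stable Q \<theta> N (\<lambda>e. V0 e + XM M' e)" by (rule simple_imp_deform_stable[OF M])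
  thus "\<exists>S. fm_rep Q N S \<and> fm_stable Q \<theta> N S" using rep_deform(1) by blast
qed

end


section \<open>Complex matrices and subspaces as finitary matrices\<close>

definition fm :: "complex mat \<Rightarrow> fmat" where
  "fm A = mat_fun (dim_row A) (dim_col A) (\<lambda>i j. A $$ (i, j))"

definition fvec :: "complex vec \<Rightarrow> fmat" where
  "fvec x = mat_fun (dim_vec x) 1 (\<lambda>i j. x $ i)"

definition tomat :: "nat \<Rightarrow> nat \<Rightarrow> fmat \<Rightarrow> complex mat" where
  "tomat n m A = mat n m (\<lambda>(i, j). ent A i j)"

text \<open>
  For an idempotent \<open>P\<close> the fixed vectors form the image.
\<close>

definition image_of :: "nat \<Rightarrow> fmat \<Rightarrow> complex vec set" where
  "image_of n P = {x \<in> carrier_vec n. P * fvec x = fvec x}"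

lemma fm_corner: "A \<in> carrier_mat n m \<Longrightarrow> idm n * fm A = fm A" "A \<in> carrier_mat n m \<Longrightarrow> fm A * idm m = fm A"
  by (auto simp: idm_times_iff times_idm_iff fm_def ent_mat_fun)

lemma tomat_carrier [simp]: "tomat n m A \<in> carrier_mat n m" by (simp add: tomat_def)

lemma fm_tomat: "idm n * A = A \<Longrightarrow> A * idm m = A \<Longrightarrow> fm (tomat n m A) = A"
  by (rule fmat_eqI) (auto simp: fm_def tomat_def ent_mat_fun idm_times_iff times_idm_iff)

lemma fm_inj: "A \<in> carrier_mat n m \<Longrightarrow> B \<in> carrier_mat n m \<Longrightarrow> fm A = fm B \<Longrightarrow> A = B"
proof (rule eq_matI)
  fix i j assume A: "A \<in> carrier_mat n m" "B \<in> carrier_mat n m" "fm A = fm B" and ij: "i < dim_row B" "j < dim_col B"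
  have "ent (fm A) i j = ent (fm B) i j" using A by simp
  thus "A $$ (i, j) = B $$ (i, j)" using A ij by (simp add: fm_def ent_mat_fun)
qed auto

lemma fm_mult:
  assumes "A \<in> carrier_mat n m" "B \<in> carrier_mat m k" shows "fm (A * B) = fm A * fm B"
proof (rule fmat_eqI)
  fix i j
  have E: "ent (fm A * fm B) i j = (\<Sum>z<m. ent (fm A) i z * ent (fm B) z j)"
    by (rule ent_times) (use assms in \<open>auto simp: fm_def ent_mat_fun\<close>)
  show "ent (fm (A * B)) i j = ent (fm A * fm B) i j"
    unfolding E using assms by (auto simp: fm_def ent_mat_fun scalar_prod_def lessThan_atLeast0)
qed

lemma fm_one: "fm (1\<^sub>m n) = idm n"
  by (rule fmat_eqI) (auto simp: fm_def ent_mat_fun ent_idm)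

lemma fvec_corner: "x \<in> carrier_vec n \<Longrightarrow> idm n * fvec x = fvec x"
  by (simp add: idm_times_iff fvec_def ent_mat_fun)

lemma fvec_inj: "x \<in> carrier_vec n \<Longrightarrow> y \<in> carrier_vec n \<Longrightarrow> fvec x = fvec y \<Longrightarrow> x = y"
proof (rule eq_vecI)
  fix i assume h: "x \<in> carrier_vec n" "y \<in> carrier_vec n" "fvec x = fvec y" "i < dim_vec y"
  have "ent (fvec x) i 0 = ent (fvec y) i 0" using h by simp
  thus "x $ i = y $ i" using h by (simp add: fvec_def ent_mat_fun)
qed auto

lemma fm_fvec:
  assumes "A \<in> carrier_mat n m" "x \<in> carrier_vec m" shows "fm A * fvec x = fvec (A *\<^sub>v x)"
proof (rule fmat_eqI)
  fix i j
  have E: "ent (fm A * fvec x) i j = (\<Sum>z<m. ent (fm A) i z * ent (fvec x) z j)"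
    by (rule ent_times) (use assms in \<open>auto simp: fm_def fvec_def ent_mat_fun\<close>)
  show "ent (fm A * fvec x) i j = ent (fvec (A *\<^sub>v x)) i j"
    unfolding E using assms by (auto simp: fm_def fvec_def ent_mat_fun scalar_prod_def lessThan_atLeast0)
qed

lemma fvec_add: "x \<in> carrier_vec n \<Longrightarrow> y \<in> carrier_vec n \<Longrightarrow> fvec (x + y) = fvec x + fvec y"
  by (rule fmat_eqI) (auto simp: fvec_def ent_mat_fun)
lemma fvec_smult: "fvec (c \<cdot>\<^sub>v x) = c *\<^sub>C fvec x"
  by (rule fmat_eqI) (auto simp: fvec_def ent_mat_fun)
lemma fvec_zero: "fvec (0\<^sub>v n) = 0"
  by (rule fmat_eqI) (auto simp: fvec_def ent_mat_fun)

definition colv :: "nat \<Rightarrow> fmat \<Rightarrow> nat \<Rightarrow> complex vec" where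
  "colv n A j = vec n (\<lambda>i. ent A i j)"

lemma colv_carrier [simp]: "colv n A j \<in> carrier_vec n" by (simp add: colv_def)

lemma fvec_colv: "idm n * A = A \<Longrightarrow> fvec (colv n A j) = A * unit_at j 0"
  by (rule fmat_eqI) (auto simp: fvec_def colv_def ent_mat_fun ent_times_unit idm_times_iff)

lemma columns_eqI: assumes "\<And>j. A * unit_at j 0 = B * unit_at j 0" shows "A = B"
proof (rule fmat_eqI)
  fix i j
  have "ent (A * unit_at j 0) i 0 = ent (B * unit_at j 0) i 0" by (simp only: assms)
  thus "ent A i j = ent B i j" by (simp add: ent_times_unit)
qed

lemma image_of_columns: "idm n * P = P \<Longrightarrow> P * A = A \<Longrightarrow> colv n A j \<in> image_of n P"
proof -
  assume n: "idm n * P = P" and PA: "P * A = A"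
  have "idm n * A = A" using times_right[OF n, of A] by (simp add: mult.assoc PA)
  thus ?thesis using times_right[OF PA, of "unit_at j 0"]
    by (simp add: image_of_def fvec_colv mult.assoc)
qed

lemma mult_eq_if_image_le:
  assumes "idm n * P = P" "P * A = A" "\<And>x. x \<in> image_of n P \<Longrightarrow> B * fvec x = C * fvec x"
  shows "B * A = C * A"
proof (rule columns_eqI)
  fix j
  have nA: "idm n * A = A" using times_right[OF assms(1), of A] by (simp add: mult.assoc assms(2))
  show "B * A * unit_at j 0 = C * A * unit_at j 0"
    using assms(3)[OF image_of_columns[OF assms(1,2), of j]] by (simp add: fvec_colv[OF nA] mult.assoc)
qed

lemma image_of_subspace:
  assumes "idm n * P = P"
  shows "VectorSpace.subspace class_ring (image_of n P) (module_vec TYPE(complex) n)"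
proof -
  interpret vec_space "TYPE(complex)" n .
  have "submodule class_ring (image_of n P) (module_vec TYPE(complex) n)"
    by (rule submodule.intro[OF vec_module])
       (auto simp: image_of_def module_vec_simps fvec_add[of _ n] fvec_smult fvec_zero distrib_left)
  thus ?thesis using vec_vs by (simp add: VectorSpace.subspace_def)
qed

text \<open>
  Among the idempotents with image inside \<open>U\<close> take one, \<open>P\<close>, of maximal trace. If some \<open>x \<in> U\<close> were not in its
  image, then the projection to the line spanned by \<open>y = x - P x\<close> along a complement containing the
  image of \<open>P\<close> could be added to \<open>P\<close>, which raises the trace by one.
\<close>

lemma subspace_image_of:
  assumes U: "VectorSpace.subspace class_ring U (module_vec TYPE(complex) n)"
  obtains P where "P * P = P" "idm n * P = P" "P * idm n = P" "U = image_of n P"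
proof -
  have sub: "submodule class_ring U (module_vec TYPE(complex) n)" using U by (simp add: VectorSpace.subspace_def)
  have Un: "U \<subseteq> carrier_vec n" using submodule.subset[OF sub] by (simp add: module_vec_simps)
  have Uadd: "x + y \<in> U" if "x \<in> U" "y \<in> U" for x y
    using submodule.m_closed[OF sub that] by (simp add: module_vec_simps)
  have Usm: "c \<cdot>\<^sub>v x \<in> U" if "x \<in> U" for x c
    using submodule.smult_closed[OF sub _ that, of c] by (simp add: module_vec_simps)
  have U0: "0\<^sub>v n \<in> U" using submodule.zero_closed[OF sub] by (simp add: module_vec_simps)
  define ok where "ok P \<longleftrightarrow> P * P = P \<and> idm n * P = P \<and> P * idm n = P \<and> image_of n P \<subseteq> U" for P
  have ok0: "ok 0"
  proof -
    have "x = 0\<^sub>v n" if "x \<in> carrier_vec n" "fvec x = 0" for x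
      using fvec_inj[OF that(1), of "0\<^sub>v n"] that(2) by (simp add: fvec_zero)
    thus ?thesis using U0 by (auto simp: ok_def image_of_def)
  qed
  define tr where "tr P = nat \<lfloor>Re (trc P)\<rfloor>" for P
  have tr_nat: "trc P = of_nat (tr P)" if P: "P * P = P" for P
  proof -
    obtain c where "trc P = of_nat c" by (rule trc_idempotent_nat[OF P])
    thus ?thesis by (simp add: tr_def)
  qed
  have tr_le: "tr P \<le> n" if "ok P" for P
  proof -
    have P: "P * P = P" "idm n * P = P" "P * idm n = P" using that by (auto simp: ok_def)
    have "(idm n - P) * (idm n - P) = idm n - P" by (simp add: algebra_simps P)
    from idempotent_trc_ge_0[OF this] show ?thesis by (simp add: trc_diff tr_nat[OF P(1)])
  qed
  have "\<forall>R. ok R \<longrightarrow> tr R < Suc n" using tr_le by (auto simp: less_Suc_eq_le)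
  then obtain P where P: "ok P" and max: "\<And>R. ok R \<Longrightarrow> tr R \<le> tr P"
    using ex_has_greatest_nat[of ok 0 tr "Suc n"] ok0 by blast
  have PP: "P * P = P" and Pn: "idm n * P = P" "P * idm n = P" and PU: "image_of n P \<subseteq> U"
    using P by (auto simp: ok_def)
  have "U \<subseteq> image_of n P"
  proof
    fix x assume x: "x \<in> U"
    hence xn: "x \<in> carrier_vec n" using Un by blast
    show "x \<in> image_of n P"
    proof (rule ccontr)
      assume nx: "x \<notin> image_of n P"
      define y where "y = fvec x - P * fvec x"
      have "y \<noteq> 0" using nx xn by (simp add: image_of_def y_def)
      then obtain i j where "ent y i j \<noteq> 0" using fmat_eqI[of y 0] by auto
      moreover have "y * idm 1 = y"
      proof -
        have "fvec x * idm 1 = fvec x" by (simp add: times_idm_iff fvec_def ent_mat_fun)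
        thus ?thesis by (simp add: y_def left_diff_distrib mult.assoc)
      qed
      ultimately have yi: "ent y i 0 \<noteq> 0" by (cases "j = 0") (auto simp: times_idm_iff)
      define a where "a = inverse (ent y i 0)"
      \<comment> \<open>A linear form \<open>\<rho>\<close> with \<open>\<rho> y = 1\<close>; composed with \<open>1 - P\<close> it also kills the image of \<open>P\<close>.\<close>
      define \<rho> where "\<rho> = a *\<^sub>C unit_at 0 i"
      have y1: "y * unit_at 0 0 = y"
      proof -
        have "idm 1 = unit_at 0 0" by (rule fmat_eqI) (auto simp: ent_idm ent_unit_at)
        thus ?thesis using \<open>y * idm 1 = y\<close> by simp
      qed
      have "unit_at 0 i * y = ent y i 0 *\<^sub>C unit_at 0 0"
        using unit_times_unit[of 0 i y 0 0] by (simp add: mult.assoc y1)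
      hence \<rho>y: "\<rho> * y = unit_at 0 0" using yi by (simp add: \<rho>_def a_def)
      have Py: "P * y = 0" by (simp add: y_def right_diff_distrib mult.assoc[symmetric] PP)
      have ny: "idm n * y = y"
        using times_right[OF Pn(1), of "fvec x"] by (simp add: y_def right_diff_distrib mult.assoc fvec_corner[OF xn])
      define D where "D = \<rho> * (idm n - P)"
      have Dy: "D * y = unit_at 0 0"
        by (simp add: D_def right_diff_distrib left_diff_distrib mult.assoc ny Py \<rho>y)
      have DP: "D * P = 0" by (simp add: D_def mult.assoc left_diff_distrib Pn PP)
      have Dn: "D * idm n = D" by (simp add: D_def mult.assoc left_diff_distrib Pn)
      define R where "R = P + y * D"
      have RR: "R * R = R"
        using times_right[OF Dy, of D] times_right[OF Py, of D] times_right[OF y1, of D]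
        by (simp add: R_def distrib_left distrib_right mult.assoc PP DP)
      have Rn: "idm n * R = R" "R * idm n = R"
        using times_right[OF ny, of D] by (simp_all add: R_def distrib_left distrib_right mult.assoc Pn Dn)
      have "image_of n R \<subseteq> U"
      proof
        fix w assume w: "w \<in> image_of n R"
        hence wn: "w \<in> carrier_vec n" and Rw: "R * fvec w = fvec w" by (auto simp: image_of_def)
        define c where "c = ent (D * fvec w) 0 0"
        have "D * fvec w = c *\<^sub>C unit_at 0 0"
        proof -
          have "\<rho> = unit_at 0 0 * \<rho>" by (simp add: \<rho>_def unit_unit)
          hence "D * fvec w = unit_at 0 0 * (D * fvec w)" by (simp add: D_def mult.assoc[symmetric])
          moreover have "fvec w = fvec w * unit_at 0 0"
            by (rule fmat_eqI) (simp add: ent_times_unit fvec_def ent_mat_fun)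
          ultimately have "D * fvec w = unit_at 0 0 * (D * fvec w) * unit_at 0 0" by (metis mult.assoc)
          thus ?thesis by (simp add: unit_times_unit c_def)
        qed
        hence yD: "y * (D * fvec w) = c *\<^sub>C y" by (simp add: y1)
        define u where "u = colv n (P * (fvec w - c *\<^sub>C fvec x)) 0"
        have un: "fvec u = P * (fvec w - c *\<^sub>C fvec x)"
        proof -
          have "idm n * (P * (fvec w - c *\<^sub>C fvec x)) = P * (fvec w - c *\<^sub>C fvec x)"
            by (simp add: mult.assoc[symmetric] Pn)
          moreover have "(fvec w - c *\<^sub>C fvec x) * unit_at 0 0 = fvec w - c *\<^sub>C fvec x"
            by (rule fmat_eqI) (simp add: ent_times_unit fvec_def ent_mat_fun)
          ultimately show ?thesis by (simp add: u_def fvec_colv mult.assoc)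
        qed
        have "P * fvec u = fvec u" by (simp add: un mult.assoc[symmetric] PP)
        hence "u \<in> image_of n P" by (simp add: image_of_def u_def)
        hence uU: "u \<in> U" using PU by blast
        have "fvec w = P * fvec w + c *\<^sub>C y" using Rw by (simp add: R_def distrib_right mult.assoc yD)
        also have "\<dots> = fvec u + c *\<^sub>C fvec x" by (simp add: un y_def right_diff_distrib csc_diff_right)
        also have "\<dots> = fvec (u + c \<cdot>\<^sub>v x)" using xn by (simp add: fvec_add[of _ n] fvec_smult u_def)
        finally have "w = u + c \<cdot>\<^sub>v x" using fvec_inj[OF wn] xn by (simp add: u_def)
        thus "w \<in> U" using uU Usm[OF x] Uadd by simp
      qed
      hence "ok R" using RR Rn by (simp add: ok_def)
      hence "tr R \<le> tr P" by (rule max)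
      moreover have "trc R = trc P + 1"
      proof -
        have "trc (unit_at 0 0) = 1" by (subst trc_eq[of 1]) (auto simp: ent_unit_at)
        thus ?thesis by (simp add: R_def trc_add trc_commute[of y] Dy)
      qed
      ultimately have "of_nat (tr R) = (of_nat (Suc (tr P)) :: complex)" using tr_nat[OF RR] tr_nat[OF PP] by simp
      hence "tr R = Suc (tr P)" by (simp only: of_nat_eq_iff)
      thus False using \<open>tr R \<le> tr P\<close> by simp
    qed
  qed
  thus ?thesis using that[OF PP Pn] PU by blast
qed

text \<open>
  Write \<open>P = Z * Z'\<close> with \<open>Z' * Z = idm c\<close>, so that \<open>trc P = c\<close>. The \<open>c\<close> columns of \<open>Z\<close> generate the image. If \<open>q\<close>
  vectors generate it, then \<open>idm c\<close> factors as \<open>S * T\<close> through size \<open>q\<close>, and \<open>c = trc (T * S) \<le> q\<close> since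
  \<open>T * S\<close> is an idempotent of size \<open>q\<close>. The dimension is the least size of a generating set.
\<close>

lemma dim_image_of:
  assumes PP: "P * P = P" and Pn: "idm n * P = P" "P * idm n = P"
  shows "trc P = of_nat (vectorspace.dim class_ring ((module_vec TYPE(complex) n)\<lparr>carrier := image_of n P\<rparr>))"
proof -
  interpret V: vec_space "TYPE(complex)" n .
  let ?U = "image_of n P"
  have sub: "VectorSpace.subspace class_ring ?U V.V" by (rule image_of_subspace[OF Pn(1)])
  have submod: "submodule class_ring ?U V.V" using sub by (simp add: VectorSpace.subspace_def)
  interpret W: vectorspace class_ring "V.V\<lparr>carrier := ?U\<rparr>" by (rule vectorspace.subspace_is_vs[OF vec_vs sub])
  have Un: "?U \<subseteq> carrier_vec n" by (auto simp: image_of_def)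
  obtain c Z Z' where Z: "P = Z * Z'" "Z' * Z = idm c" "Z * idm c = Z" "idm c * Z' = Z'" "trc P = of_nat c"
    by (rule idempotent_split[OF PP])
  have PZ: "P * Z = Z" by (simp add: Z mult.assoc)
  have nZ: "idm n * Z = Z" using times_right[OF Pn(1), of Z] by (simp add: mult.assoc PZ)
  have Z'n: "Z' * idm n = Z'"
  proof -
    have "Z' * P = Z'" by (simp add: Z(1) mult.assoc[symmetric] Z)
    thus ?thesis using Pn(2) by (metis mult.assoc)
  qed
  have span: "W.span A = {y. \<exists>x\<in>carrier_vec (length xs). mat_of_cols n xs *\<^sub>v x = y}"
    if "A \<subseteq> ?U" "set xs = A" for A xs
  proof -
    have c: "set xs \<subseteq> carrier_vec n" using that Un by auto
    have "W.span A = V.span A" by (rule module.span_li_not_depend(1)[OF vec_module that(1) submod])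
    also have "\<dots> = V.col_space (mat_of_cols n xs)" using c that(2) by (simp add: V.col_space_def)
    also have "\<dots> = {y\<in>carrier_vec n. \<exists>x\<in>carrier_vec (length xs). mat_of_cols n xs *\<^sub>v x = y}"
      by (subst V.col_space_eq[of _ "length xs"]) auto
    finally show ?thesis by (auto intro!: mult_mat_vec_carrier[of _ n "length xs"])
  qed
  have lower: "c \<le> length xs" if "set xs \<subseteq> ?U" "W.span (set xs) = ?U" for xs
  proof -
    define q where "q = length xs"
    define M where "M = mat_of_cols n xs"
    have M: "M \<in> carrier_mat n q" by (simp add: M_def q_def)
    have "\<forall>j. \<exists>x\<in>carrier_vec q. M *\<^sub>v x = colv n Z j"
    proof
      fix j
      have "colv n Z j \<in> W.span (set xs)" using image_of_columns[OF Pn(1) PZ, of j] that(2) by simp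
      thus "\<exists>x\<in>carrier_vec q. M *\<^sub>v x = colv n Z j" using span[OF that(1) refl] by (simp add: M_def q_def)
    qed
    then obtain X where X: "\<And>j. X j \<in> carrier_vec q" "\<And>j. M *\<^sub>v X j = colv n Z j" by metis
    define T where "T = mat_fun q c (\<lambda>i j. X j $ i)"
    have Tcol: "T * unit_at j 0 = (if j < c then fvec (X j) else 0)" for j
      by (rule fmat_eqI) (use X(1)[of j] in \<open>auto simp: T_def ent_times_unit ent_mat_fun fvec_def\<close>)
    have "fm M * T = Z"
    proof (rule columns_eqI)
      fix j
      show "fm M * T * unit_at j 0 = Z * unit_at j 0"
      proof (cases "j < c")
        case True
        thus ?thesis using fm_fvec[OF M X(1)[of j]] X(2)[of j] by (simp add: mult.assoc Tcol fvec_colv[OF nZ])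
      next
        case False
        have "Z * unit_at j 0 = 0"
          using Z(3) False by (intro fmat_eqI) (auto simp: ent_times_unit times_idm_iff)
        thus ?thesis using False by (simp add: mult.assoc Tcol)
      qed
    qed
    define S where "S = Z' * fm M"
    have ST: "S * T = idm c" using \<open>fm M * T = Z\<close> Z(2) by (simp add: S_def mult.assoc)
    have Sq: "S * idm q = S" unfolding S_def mult.assoc fm_corner(2)[OF M] ..
    have qT: "idm q * T = T" and cT: "T * idm c = T"
      by (simp_all add: idm_times_iff times_idm_iff T_def ent_mat_fun)
    have TT: "T * S * (T * S) = T * S"
      using times_right[OF ST, of S] times_right[OF cT, of S] by (simp add: mult.assoc)
    have "(idm q - T * S) * (idm q - T * S) = idm q - T * S"
      using times_right[OF qT, of S] TT by (simp add: algebra_simps mult.assoc Sq)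
    from idempotent_trc_ge_0[OF this] have "0 \<le> Re (of_nat q - trc (S * T))" by (simp add: trc_diff trc_commute[of T])
    thus ?thesis by (simp add: ST q_def)
  qed
  define xs where "xs = map (colv n Z) [0..<c]"
  have lx: "length xs = c" by (simp add: xs_def)
  have xsU: "set xs \<subseteq> ?U" using image_of_columns[OF Pn(1) PZ] by (auto simp: xs_def)
  have Mx: "fm (mat_of_cols n xs) = Z"
  proof (rule fmat_eqI)
    fix i j
    show "ent (fm (mat_of_cols n xs)) i j = ent Z i j"
      using nZ Z(3) by (auto simp: fm_def ent_mat_fun mat_of_cols_index lx xs_def colv_def idm_times_iff times_idm_iff)
  qed
  have MC: "mat_of_cols n xs \<in> carrier_mat n c" using mat_of_cols_carrier(1)[of n xs] by (simp add: lx)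
  have gen: "W.span (set xs) = ?U"
    unfolding span[OF xsU refl] lx
  proof (intro equalityI subsetI)
    fix y assume "y \<in> {y. \<exists>x\<in>carrier_vec c. mat_of_cols n xs *\<^sub>v x = y}"
    then obtain x where x: "x \<in> carrier_vec c" "mat_of_cols n xs *\<^sub>v x = y" by blast
    have "fvec y = Z * fvec x" using fm_fvec[OF MC x(1)] x(2) by (simp add: Mx)
    hence "P * fvec y = fvec y" using times_right[OF PZ, of "fvec x"] by (simp add: mult.assoc)
    moreover have "y \<in> carrier_vec n" using x(2) mult_mat_vec_carrier[OF MC x(1)] by simp
    ultimately show "y \<in> ?U" by (simp add: image_of_def)
  next
    fix y assume "y \<in> ?U"
    hence y: "y \<in> carrier_vec n" "P * fvec y = fvec y" by (auto simp: image_of_def)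
    define x where "x = colv c (Z' * fvec y) 0"
    have "fvec x = Z' * fvec y"
    proof -
      have "idm c * (Z' * fvec y) = Z' * fvec y" by (simp add: mult.assoc[symmetric] Z(4))
      moreover have "fvec y * unit_at 0 0 = fvec y"
        by (rule fmat_eqI) (simp add: ent_times_unit fvec_def ent_mat_fun)
      ultimately show ?thesis by (simp add: x_def fvec_colv mult.assoc)
    qed
    hence "fvec (mat_of_cols n xs *\<^sub>v x) = fvec y"
      using fm_fvec[OF MC, of x] y(2) by (simp add: Mx x_def Z(1) mult.assoc)
    hence "mat_of_cols n xs *\<^sub>v x = y" using y(1) mult_mat_vec_carrier[OF MC, of x] by (intro fvec_inj[of _ n]) (auto simp: x_def)
    thus "y \<in> {y. \<exists>x\<in>carrier_vec c. mat_of_cols n xs *\<^sub>v x = y}" by (auto simp: x_def)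
  qed
  have "W.dim = c"
    unfolding W.dim_def
  proof (rule Least_equality)
    have "card (set xs) = c"
    proof (rule antisym)
      show "card (set xs) \<le> c" using card_length[of xs] by (simp add: lx)
      obtain ys where ys: "set ys = set xs" "distinct ys" using finite_distinct_list[of "set xs"] by auto
      have "c \<le> length ys" by (rule lower) (use ys xsU gen in auto)
      thus "c \<le> card (set xs)" using ys distinct_card[of ys] by simp
    qed
    thus "\<exists>A. finite A \<and> card A = c \<and> A \<subseteq> carrier (V.V\<lparr>carrier := ?U\<rparr>) \<and> W.span A = carrier (V.V\<lparr>carrier := ?U\<rparr>)"
      using xsU gen by (intro exI[of _ "set xs"]) simp
  next
    fix k assume "\<exists>A. finite A \<and> card A = k \<and> A \<subseteq> carrier (V.V\<lparr>carrier := ?U\<rparr>) \<and> W.span A = carrier (V.V\<lparr>carrier := ?U\<rparr>)"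
    then obtain A where A: "finite A" "card A = k" "A \<subseteq> ?U" "W.span A = ?U" by auto
    obtain ys where ys: "set ys = A" "distinct ys" using finite_distinct_list[OF A(1)] by auto
    have "c \<le> length ys" by (rule lower) (use ys A in auto)
    thus "c \<le> k" using ys distinct_card[of ys] A by simp
  qed
  thus ?thesis using Z(5) by simp
qed


section \<open>Stable representations as finitary matrices\<close>

lemma image_of_eq_carrier:
  assumes "P * idm n = P" "image_of n P = carrier_vec n" shows "P = idm n"
proof -
  have "P * idm n = idm n * idm n"
  proof (rule mult_eq_if_image_le[of n])
    show "idm n * idm n = idm n" "idm n * idm n = idm n" by simp_all
    fix x assume "x \<in> image_of n (idm n)"
    hence "x \<in> carrier_vec n" by (simp add: image_of_def)
    thus "P * fvec x = idm n * fvec x" using assms(2) by (auto simp: image_of_def fvec_corner)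
  qed
  thus ?thesis using assms(1) by simp
qed

lemma image_of_eq_zero:
  assumes "idm n * P = P" "P * P = P" "image_of n P = {0\<^sub>v n}" shows "P = 0"
proof -
  have "idm n * P = 0 * P"
    by (rule mult_eq_if_image_le[of n, OF assms(1,2)]) (simp add: assms(3) fvec_zero)
  thus ?thesis using assms(1) by simp
qed

lemma image_of_0: "image_of n 0 = {0\<^sub>v n}"
proof -
  have "x = 0\<^sub>v n" if "x \<in> carrier_vec n" "fvec x = 0" for x
    using fvec_inj[OF that(1), of "0\<^sub>v n"] that(2) by (simp add: fvec_zero)
  thus ?thesis by (auto simp: image_of_def fvec_zero)
qed

lemma image_of_idm: "image_of n (idm n) = carrier_vec n"
  by (auto simp: image_of_def fvec_corner)

lemma fm_rep_fm:
  assumes "V \<in> rep_space Q \<alpha>" shows "fm_rep Q (\<lambda>v. idm (\<alpha> v)) (\<lambda>e. fm (V e))"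
  using assms by (auto simp: fm_rep_def rep_space_def PiE_iff intro!: fm_corner)

lemma subrep_iff_fm_sub:
  assumes V: "V \<in> rep_space Q \<alpha>" and wf: "wf_digraph Q"
    and P: "\<forall>v\<in>verts Q. P v * P v = P v \<and> idm (\<alpha> v) * P v = P v \<and> P v * idm (\<alpha> v) = P v"
    and U: "\<forall>v\<in>verts Q. U v = image_of (\<alpha> v) (P v)"
  shows "subrep Q \<alpha> V U \<longleftrightarrow> fm_sub Q (\<lambda>v. idm (\<alpha> v)) (\<lambda>e. fm (V e)) P"
proof -
  have PP: "P v * P v = P v" and nP: "idm (\<alpha> v) * P v = P v" if "v \<in> verts Q" for v using P that by auto
  have s: "VectorSpace.subspace class_ring (U v) (module_vec TYPE(complex) (\<alpha> v))" if "v \<in> verts Q" for v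
    using image_of_subspace[OF nP[OF that]] U that by simp
  have e: "(\<forall>x\<in>U (tail Q e). V e *\<^sub>v x \<in> U (head Q e)) \<longleftrightarrow>
      P (head Q e) * (fm (V e) * P (tail Q e)) = fm (V e) * P (tail Q e)" if e: "e \<in> arcs Q" for e
  proof -
    note t = wf_ends(2)[OF wf e] and h = wf_ends(1)[OF wf e]
    have Ve: "V e \<in> carrier_mat (\<alpha> (head Q e)) (\<alpha> (tail Q e))" using V e by (auto simp: rep_space_def)
    have Vx: "V e *\<^sub>v x \<in> image_of (\<alpha> (head Q e)) (P (head Q e)) \<longleftrightarrow>
        P (head Q e) * (fm (V e) * fvec x) = fm (V e) * fvec x" if "x \<in> image_of (\<alpha> (tail Q e)) (P (tail Q e))" for x
      using that mult_mat_vec_carrier[OF Ve, of x] by (auto simp: image_of_def fm_fvec[OF Ve])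
    show ?thesis unfolding U[rule_format, OF t] U[rule_format, OF h]
    proof
      assume a: "\<forall>x\<in>image_of (\<alpha> (tail Q e)) (P (tail Q e)). V e *\<^sub>v x \<in> image_of (\<alpha> (head Q e)) (P (head Q e))"
      have "(P (head Q e) * fm (V e)) * P (tail Q e) = fm (V e) * P (tail Q e)"
        by (rule mult_eq_if_image_le[OF nP[OF t] PP[OF t]]) (use a Vx in \<open>simp add: mult.assoc\<close>)
      thus "P (head Q e) * (fm (V e) * P (tail Q e)) = fm (V e) * P (tail Q e)" by (simp add: mult.assoc)
    next
      assume a: "P (head Q e) * (fm (V e) * P (tail Q e)) = fm (V e) * P (tail Q e)"
      show "\<forall>x\<in>image_of (\<alpha> (tail Q e)) (P (tail Q e)). V e *\<^sub>v x \<in> image_of (\<alpha> (head Q e)) (P (head Q e))"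
      proof
        fix x assume x: "x \<in> image_of (\<alpha> (tail Q e)) (P (tail Q e))"
        hence Px: "P (tail Q e) * fvec x = fvec x" by (simp add: image_of_def)
        have "P (head Q e) * (fm (V e) * (P (tail Q e) * fvec x)) = fm (V e) * (P (tail Q e) * fvec x)"
          using arg_cong[OF a, of "\<lambda>A. A * fvec x"] by (simp only: mult.assoc)
        thus "V e *\<^sub>v x \<in> image_of (\<alpha> (head Q e)) (P (head Q e))" unfolding Px using Vx[OF x] by simp
      qed
    qed
  qed
  have "subrep Q \<alpha> V U \<longleftrightarrow> (\<forall>e\<in>arcs Q. \<forall>x\<in>U (tail Q e). V e *\<^sub>v x \<in> U (head Q e))"
    using s by (auto simp: subrep_def)
  also have "\<dots> \<longleftrightarrow> (\<forall>e\<in>arcs Q. P (head Q e) * (fm (V e) * P (tail Q e)) = fm (V e) * P (tail Q e))"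
    by (rule ball_cong[OF refl e])
  also have "\<dots> \<longleftrightarrow> fm_sub Q (\<lambda>v. idm (\<alpha> v)) (\<lambda>e. fm (V e)) P" using P by (simp add: fm_sub_def)
  finally show ?thesis .
qed

lemma weight_image_of:
  assumes P: "\<forall>v\<in>verts Q. P v * P v = P v \<and> idm (\<alpha> v) * P v = P v \<and> P v * idm (\<alpha> v) = P v"
    and U: "\<forall>v\<in>verts Q. U v = image_of (\<alpha> v) (P v)"
  shows "fm_weight Q \<theta> P = of_int (weight Q \<theta> (sub_dim \<alpha> U))"
proof -
  have "trc (P v) = of_nat (sub_dim \<alpha> U v)" if "v \<in> verts Q" for v
    using dim_image_of[of "P v" "\<alpha> v"] P U that by (simp add: sub_dim_def)
  thus ?thesis by (simp add: fm_weight_def weight_def)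
qed

lemma weight_idm: "fm_weight Q \<theta> (\<lambda>v. idm (\<alpha> v)) = of_int (weight Q \<theta> \<alpha>)"
  by (simp add: fm_weight_def weight_def)

text \<open>
  Subrepresentations correspond to families of projections by \<open>subspace_image_of\<close>, and their dimensions to
  traces by \<open>dim_image_of\<close>.
\<close>

lemma theta_stable_iff:
  assumes V: "V \<in> rep_space Q \<alpha>" and wf: "wf_digraph Q"
  shows "theta_stable Q \<theta> \<alpha> V \<longleftrightarrow> fm_stable Q \<theta> (\<lambda>v. idm (\<alpha> v)) (\<lambda>e. fm (V e))"
proof
  assume st: "theta_stable Q \<theta> \<alpha> V"
  show "fm_stable Q \<theta> (\<lambda>v. idm (\<alpha> v)) (\<lambda>e. fm (V e))"
    unfolding fm_stable_def
  proof (intro conjI allI impI)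
    show "\<exists>v\<in>verts Q. idm (\<alpha> v) \<noteq> 0" using st by (simp add: theta_stable_def nonzero_dim_def)
    show "fm_weight Q \<theta> (\<lambda>v. idm (\<alpha> v)) = 0" using st by (simp add: weight_idm theta_stable_def theta_semistable_def)
    fix P assume P: "fm_sub Q (\<lambda>v. idm (\<alpha> v)) (\<lambda>e. fm (V e)) P"
    hence P': "\<forall>v\<in>verts Q. P v * P v = P v \<and> idm (\<alpha> v) * P v = P v \<and> P v * idm (\<alpha> v) = P v"
      by (simp add: fm_sub_def)
    define U where "U v = image_of (\<alpha> v) (P v)" for v
    have U: "\<forall>v\<in>verts Q. U v = image_of (\<alpha> v) (P v)" by (simp add: U_def)
    have sub: "subrep Q \<alpha> V U" using subrep_iff_fm_sub[OF V wf P' U] P by simp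
    have w: "fm_weight Q \<theta> P = of_int (weight Q \<theta> (sub_dim \<alpha> U))" by (rule weight_image_of[OF P' U])
    have ge: "weight Q \<theta> (sub_dim \<alpha> U) \<ge> 0" using st sub by (simp add: theta_stable_def theta_semistable_def)
    show "(\<forall>v\<in>verts Q. P v = 0) \<or> (\<forall>v\<in>verts Q. P v = idm (\<alpha> v)) \<or> 0 < fm_weight Q \<theta> P"
    proof (cases "weight Q \<theta> (sub_dim \<alpha> U) = 0")
      case True
      hence "zero_sub Q \<alpha> U \<or> full_sub Q \<alpha> U" using st sub by (simp add: theta_stable_def)
      thus ?thesis
      proof
        assume "zero_sub Q \<alpha> U"
        hence "\<forall>v\<in>verts Q. P v = 0" using P' image_of_eq_zero by (auto simp: zero_sub_def U_def)
        thus ?thesis by simp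
      next
        assume "full_sub Q \<alpha> U"
        hence "\<forall>v\<in>verts Q. P v = idm (\<alpha> v)" using P' image_of_eq_carrier by (auto simp: full_sub_def U_def)
        thus ?thesis by simp
      qed
    qed (use ge w in simp)
  qed
next
  assume st: "fm_stable Q \<theta> (\<lambda>v. idm (\<alpha> v)) (\<lambda>e. fm (V e))"
  have key: "weight Q \<theta> (sub_dim \<alpha> U) \<ge> 0 \<and> (weight Q \<theta> (sub_dim \<alpha> U) = 0 \<longrightarrow> zero_sub Q \<alpha> U \<or> full_sub Q \<alpha> U)"
    if sub: "subrep Q \<alpha> V U" for U
  proof -
    have "\<forall>v\<in>verts Q. \<exists>P. P * P = P \<and> idm (\<alpha> v) * P = P \<and> P * idm (\<alpha> v) = P \<and> U v = image_of (\<alpha> v) P"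
    proof
      fix v assume "v \<in> verts Q"
      hence "VectorSpace.subspace class_ring (U v) (module_vec TYPE(complex) (\<alpha> v))"
        using sub by (simp add: subrep_def)
      thus "\<exists>P. P * P = P \<and> idm (\<alpha> v) * P = P \<and> P * idm (\<alpha> v) = P \<and> U v = image_of (\<alpha> v) P"
        by (rule subspace_image_of) blast
    qed
    from bchoice[OF this] obtain P where P: "\<forall>v\<in>verts Q. P v * P v = P v \<and> idm (\<alpha> v) * P v = P v \<and>
        P v * idm (\<alpha> v) = P v \<and> U v = image_of (\<alpha> v) (P v)" by blast
    hence P': "\<forall>v\<in>verts Q. P v * P v = P v \<and> idm (\<alpha> v) * P v = P v \<and> P v * idm (\<alpha> v) = P v"
      and U: "\<forall>v\<in>verts Q. U v = image_of (\<alpha> v) (P v)" by auto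
    have fs: "fm_sub Q (\<lambda>v. idm (\<alpha> v)) (\<lambda>e. fm (V e)) P" using subrep_iff_fm_sub[OF V wf P' U] sub by simp
    have w: "fm_weight Q \<theta> P = of_int (weight Q \<theta> (sub_dim \<alpha> U))" by (rule weight_image_of[OF P' U])
    have "zero_sub Q \<alpha> U \<or> full_sub Q \<alpha> U" if w0: "weight Q \<theta> (sub_dim \<alpha> U) = 0"
    proof -
      have "fm_weight Q \<theta> P = 0" using w0 w by simp
      from fm_stable_sub_cases(2)[OF st fs this] show ?thesis
      proof
        assume "\<forall>v\<in>verts Q. P v = 0"
        hence "zero_sub Q \<alpha> U" using U by (simp add: zero_sub_def image_of_0)
        thus ?thesis ..
      next
        assume "\<forall>v\<in>verts Q. P v = idm (\<alpha> v)"
        hence "full_sub Q \<alpha> U" using U by (simp add: full_sub_def image_of_idm)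
        thus ?thesis ..
      qed
    qed
    thus ?thesis using fm_stable_sub_cases(1)[OF st fs] w by simp
  qed
  have "nonzero_dim Q \<alpha>" "weight Q \<theta> \<alpha> = 0"
    using st weight_idm[of Q \<theta> \<alpha>] by (auto simp: fm_stable_def nonzero_dim_def)
  thus "theta_stable Q \<theta> \<alpha> V" using key by (simp add: theta_stable_def theta_semistable_def)
qed

lemma simple_rep_iff_theta_stable: "simple_rep Q \<alpha> V \<longleftrightarrow> theta_stable Q (\<lambda>_. 0) \<alpha> V"
  by (auto simp: simple_rep_def theta_stable_def theta_semistable_def weight_def)

lemma ex_theta_stable_iff:
  assumes wf: "wf_digraph Q"
  shows "(\<exists>V\<in>rep_space Q \<alpha>. theta_stable Q \<theta> \<alpha> V) \<longleftrightarrow>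
    (\<exists>S. fm_rep Q (\<lambda>v. idm (\<alpha> v)) S \<and> fm_stable Q \<theta> (\<lambda>v. idm (\<alpha> v)) S)"
proof
  assume "\<exists>V\<in>rep_space Q \<alpha>. theta_stable Q \<theta> \<alpha> V"
  then obtain V where V: "V \<in> rep_space Q \<alpha>" "theta_stable Q \<theta> \<alpha> V" by blast
  show "\<exists>S. fm_rep Q (\<lambda>v. idm (\<alpha> v)) S \<and> fm_stable Q \<theta> (\<lambda>v. idm (\<alpha> v)) S"
    using fm_rep_fm[OF V(1)] theta_stable_iff[OF V(1) wf] V(2) by (intro exI[of _ "\<lambda>e. fm (V e)"]) simp
next
  assume "\<exists>S. fm_rep Q (\<lambda>v. idm (\<alpha> v)) S \<and> fm_stable Q \<theta> (\<lambda>v. idm (\<alpha> v)) S"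
  then obtain S where S: "fm_rep Q (\<lambda>v. idm (\<alpha> v)) S" "fm_stable Q \<theta> (\<lambda>v. idm (\<alpha> v)) S" by blast
  define V where "V = (\<lambda>e\<in>arcs Q. tomat (\<alpha> (head Q e)) (\<alpha> (tail Q e)) (S e))"
  have V: "V \<in> rep_space Q \<alpha>" by (auto simp: V_def rep_space_def)
  have eq: "fm (V e) = S e" if "e \<in> arcs Q" for e using S(1) that by (simp add: V_def fm_rep_def fm_tomat)
  have "fm_sub Q (\<lambda>v. idm (\<alpha> v)) (\<lambda>e. fm (V e)) P \<longleftrightarrow> fm_sub Q (\<lambda>v. idm (\<alpha> v)) S P" for P
    by (simp add: fm_sub_def eq)
  hence "fm_stable Q \<theta> (\<lambda>v. idm (\<alpha> v)) (\<lambda>e. fm (V e))" using S(2) by (simp add: fm_stable_def)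
  thus "\<exists>V\<in>rep_space Q \<alpha>. theta_stable Q \<theta> \<alpha> V" using theta_stable_iff[OF V wf] V by blast
qed

lemma rep_iso_fm:
  assumes V: "V \<in> rep_space Q \<alpha>" and W: "W \<in> rep_space Q \<beta>" and wf: "wf_digraph Q"
    and f: "fm_hom Q (\<lambda>v. idm (\<alpha> v)) (\<lambda>e. fm (V e)) (\<lambda>v. idm (\<beta> v)) (\<lambda>e. fm (W e)) f"
    and g: "fm_hom Q (\<lambda>v. idm (\<beta> v)) (\<lambda>e. fm (W e)) (\<lambda>v. idm (\<alpha> v)) (\<lambda>e. fm (V e)) g"
    and fg: "\<forall>v\<in>verts Q. g v * f v = idm (\<alpha> v) \<and> f v * g v = idm (\<beta> v)"
  shows "rep_iso Q \<alpha> V \<beta> W"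
proof -
  define F where "F v = tomat (\<beta> v) (\<alpha> v) (f v)" for v
  define G where "G v = tomat (\<alpha> v) (\<beta> v) (g v)" for v
  have F: "fm (F v) = f v" if "v \<in> verts Q" for v using f that by (simp add: F_def fm_hom_def fm_tomat)
  have G: "fm (G v) = g v" if "v \<in> verts Q" for v using g that by (simp add: G_def fm_hom_def fm_tomat)
  have cF: "F v \<in> carrier_mat (\<beta> v) (\<alpha> v)" and cG: "G v \<in> carrier_mat (\<alpha> v) (\<beta> v)" for v
    by (simp_all add: F_def G_def)
  have inv: "invertible_mat (F v)" if v: "v \<in> verts Q" for v
  proof -
    have "of_nat (\<alpha> v) = trc (g v * f v)" using fg v by simp
    also have "\<dots> = trc (f v * g v)" by (rule trc_commute)
    also have "\<dots> = of_nat (\<beta> v)" using fg v by simp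
    finally have ab: "\<alpha> v = \<beta> v" by (simp only: of_nat_eq_iff)
    have "F v * G v = 1\<^sub>m (\<beta> v)"
      by (rule fm_inj[of _ "\<beta> v" "\<beta> v"])
        (use cF[of v] cG[of v] v fg in \<open>auto simp: fm_mult[OF cF cG] fm_one F G\<close>)
    moreover have "G v * F v = 1\<^sub>m (\<alpha> v)"
      by (rule fm_inj[of _ "\<alpha> v" "\<alpha> v"])
        (use cF[of v] cG[of v] v fg in \<open>auto simp: fm_mult[OF cG cF] fm_one F G\<close>)
    ultimately show ?thesis using cF[of v] cG[of v] ab
      by (auto simp: invertible_mat_def inverts_mat_def intro!: exI[of _ "G v"])
  qed
  have "F (head Q e) * V e = W e * F (tail Q e)" if e: "e \<in> arcs Q" for e
  proof (rule fm_inj[of _ "\<beta> (head Q e)" "\<alpha> (tail Q e)"])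
    have Ve: "V e \<in> carrier_mat (\<alpha> (head Q e)) (\<alpha> (tail Q e))"
      and We: "W e \<in> carrier_mat (\<beta> (head Q e)) (\<beta> (tail Q e))" using V W e by (auto simp: rep_space_def)
    show "F (head Q e) * V e \<in> carrier_mat (\<beta> (head Q e)) (\<alpha> (tail Q e))"
      "W e * F (tail Q e) \<in> carrier_mat (\<beta> (head Q e)) (\<alpha> (tail Q e))"
      using cF Ve We by (auto intro: mult_carrier_mat)
    show "fm (F (head Q e) * V e) = fm (W e * F (tail Q e))"
      unfolding fm_mult[OF cF Ve] fm_mult[OF We cF] F[OF wf_ends(1)[OF wf e]] F[OF wf_ends(2)[OF wf e]]
      using f e by (simp add: fm_hom_def)
  qed
  thus ?thesis using cF inv unfolding rep_iso_def by (intro exI[of _ F]) blast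
qed


section \<open>Coordinates on a direct sum\<close>

text \<open>
  The copies of the \<open>\<beta> i\<close>-dimensional spaces are placed in the \<open>n\<close>-dimensional one by an arbitrary bijection
  \<open>b\<close> between the disjoint union of their coordinates and \<open>{..<n}\<close>.
\<close>

lemma block_coordinates:
  fixes n :: nat and \<beta> m :: "nat \<Rightarrow> nat"
  assumes n: "n = (\<Sum>i<l. m i * \<beta> i)"
  obtains s s' :: "nat \<times> nat \<Rightarrow> fmat" where
    "\<forall>i<l. \<forall>k<m i. idm n * s (i, k) = s (i, k) \<and> s (i, k) * idm (\<beta> i) = s (i, k) \<and>
      idm (\<beta> i) * s' (i, k) = s' (i, k) \<and> s' (i, k) * idm n = s' (i, k)"
    "\<forall>i<l. \<forall>k<m i. \<forall>j<l. \<forall>k'<m j. s' (i, k) * s (j, k') = (if i = j \<and> k = k' then idm (\<beta> i) else 0)"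
    "(\<Sum>i<l. \<Sum>k<m i. s (i, k) * s' (i, k)) = idm n"
proof -
  define T where "T = (SIGMA i:{..<l}. {..<m i} \<times> {..<\<beta> i})"
  have "card T = n" "finite T" by (auto simp: T_def n card_SigmaI)
  then obtain b where "bij_betw b T {0..<n}" using ex_bij_betw_finite_nat[of T] by auto
  hence b: "bij_betw b T {..<n}" by (simp add: lessThan_atLeast0)
  define s where "s = (\<lambda>(i, k). mat_fun n (\<beta> i) (\<lambda>y x. if y = b (i, k, x) then 1 else 0))"
  define s' where "s' = (\<lambda>(i, k). mat_fun (\<beta> i) n (\<lambda>x y. if y = b (i, k, x) then 1 else 0))"
  have bn: "b (i, k, x) < n" if "i < l" "k < m i" "x < \<beta> i" for i k x
    using bij_betwE[OF b] that by (auto simp: T_def)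
  have inj: "b (i, k, x) = b (j, k', x') \<longleftrightarrow> (i = j \<and> k = k' \<and> x = x')"
    if "i < l" "k < m i" "x < \<beta> i" "j < l" "k' < m j" "x' < \<beta> j" for i k x j k' x'
    using inj_onD[OF bij_betw_imp_inj_on[OF b], of "(i, k, x)" "(j, k', x')"] that by (auto simp: T_def)
  have 1: "\<forall>i<l. \<forall>k<m i. idm n * s (i, k) = s (i, k) \<and> s (i, k) * idm (\<beta> i) = s (i, k) \<and>
      idm (\<beta> i) * s' (i, k) = s' (i, k) \<and> s' (i, k) * idm n = s' (i, k)"
    by (simp add: s_def s'_def idm_times_iff times_idm_iff ent_mat_fun)
  have 2: "s' (i, k) * s (j, k') = (if i = j \<and> k = k' then idm (\<beta> i) else 0)"
    if h: "i < l" "k < m i" "j < l" "k' < m j" for i k j k'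
  proof (rule fmat_eqI)
    fix x x'
    have "ent (s' (i, k) * s (j, k')) x x' = (\<Sum>y<n. ent (s' (i, k)) x y * ent (s (j, k')) y x')"
      by (rule ent_times) (auto simp: s'_def ent_mat_fun)
    also have "\<dots> = (\<Sum>y<n. if y = b (i, k, x) then (if x < \<beta> i \<and> x' < \<beta> j \<and> y = b (j, k', x') then 1 else 0) else 0)"
      by (rule sum.cong) (auto simp: s_def s'_def ent_mat_fun)
    also have "\<dots> = (if b (i, k, x) < n \<and> x < \<beta> i \<and> x' < \<beta> j \<and> b (i, k, x) = b (j, k', x') then 1 else 0)"
      by (subst sum.delta) auto
    also have "\<dots> = ent (if i = j \<and> k = k' then idm (\<beta> i) else 0) x x'"
      using bn[OF h(1,2)] inj[OF h(1,2) _ h(3,4)] by (auto simp: ent_idm)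
    finally show "ent (s' (i, k) * s (j, k')) x x' = ent (if i = j \<and> k = k' then idm (\<beta> i) else 0) x x'" .
  qed
  have 3: "(\<Sum>i<l. \<Sum>k<m i. s (i, k) * s' (i, k)) = idm n"
  proof (rule fmat_eqI)
    fix y y'
    have E: "ent (s (i, k) * s' (i, k)) y y' =
        (\<Sum>x<\<beta> i. if b (i, k, x) = y then (if y < n \<and> y = y' then 1 else 0) else 0)" for i k
    proof -
      have "ent (s (i, k) * s' (i, k)) y y' = (\<Sum>x<\<beta> i. ent (s (i, k)) y x * ent (s' (i, k)) x y')"
        by (rule ent_times) (auto simp: s_def ent_mat_fun)
      also have "\<dots> = (\<Sum>x<\<beta> i. if b (i, k, x) = y then (if y < n \<and> y = y' then 1 else 0) else 0)"
        by (rule sum.cong) (auto simp: s_def s'_def ent_mat_fun)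
      finally show ?thesis .
    qed
    have "ent (\<Sum>i<l. \<Sum>k<m i. s (i, k) * s' (i, k)) y y' =
        (\<Sum>t\<in>T. if b t = y then (if y < n \<and> y = y' then 1 else 0) else 0)"
      by (simp add: ent_sum E T_def sum.cartesian_product) (simp add: sum.Sigma split_def)
    also have "\<dots> = (\<Sum>z<n. if z = y then (if y < n \<and> y = y' then 1 else 0) else 0)"
      by (rule sum.reindex_bij_betw[OF b])
    also have "\<dots> = ent (idm n) y y'" by (simp add: ent_idm)
    finally show "ent (\<Sum>i<l. \<Sum>k<m i. s (i, k) * s' (i, k)) y y' = ent (idm n) y y'" .
  qed
  show thesis by (rule that[of s s']) (use 1 2 3 in auto)
qed


section \<open>The local quiver theorem\<close>

text \<open>
  The conclusion of \<open>ext_basis\<close> with the basis labelled by a set \<open>A\<close>, for the arrows of \<open>Q'\<close>.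
\<close>

definition ext_data where
  "ext_data Q \<beta> W \<beta>' W' A Z \<zeta> \<longleftrightarrow>
    (\<forall>a\<in>A. corner_fam (arcs Q) (\<lambda>e. \<beta>' (head Q e)) (\<lambda>e. \<beta> (tail Q e)) (Z a)) \<and>
    (\<forall>h. corner_fam (verts Q) \<beta>' \<beta> h \<longrightarrow>
       (\<forall>a\<in>A. (\<Sum>e\<in>arcs Q. trc (\<zeta> a e * (h (head Q e) * W e - W' e * h (tail Q e)))) = 0)) \<and>
    (\<forall>a\<in>A. \<forall>b\<in>A. (\<Sum>e\<in>arcs Q. trc (\<zeta> a e * Z b e)) = (if a = b then 1 else 0)) \<and>
    (\<forall>Y. corner_fam (arcs Q) (\<lambda>e. \<beta>' (head Q e)) (\<lambda>e. \<beta> (tail Q e)) Y \<longrightarrow>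
       (\<exists>h t. corner_fam (verts Q) \<beta>' \<beta> h \<and>
         (\<forall>e\<in>arcs Q. Y e = h (head Q e) * W e - W' e * h (tail Q e) + (\<Sum>a\<in>A. t a *\<^sub>C Z a e))))"

lemma ext_data_exists:
  fixes Q :: "('v, 'e) pre_digraph"
  assumes Q: "fin_digraph Q"
    and W: "fm_rep Q (\<lambda>v. idm (\<beta> v)) W" and W': "fm_rep Q (\<lambda>v. idm (\<beta>' v)) W'"
    and hom: "(\<kappa> = 0 \<and> (\<forall>h. fm_hom Q (\<lambda>v. idm (\<beta> v)) W (\<lambda>v. idm (\<beta>' v)) W' h \<longrightarrow> (\<forall>v\<in>verts Q. h v = 0))) \<or>
      (\<kappa> = 1 \<and> (\<exists>h0. fm_hom Q (\<lambda>v. idm (\<beta> v)) W (\<lambda>v. idm (\<beta>' v)) W' h0 \<and> (\<exists>v\<in>verts Q. h0 v \<noteq> 0) \<and>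
        (\<forall>h. fm_hom Q (\<lambda>v. idm (\<beta> v)) W (\<lambda>v. idm (\<beta>' v)) W' h \<longrightarrow> (\<exists>c. \<forall>v\<in>verts Q. h v = c *\<^sub>C h0 v))))"
    and A: "finite A" "int (card A) = int \<kappa> - euler_form Q (\<lambda>v. int (\<beta> v)) (\<lambda>v. int (\<beta>' v))"
  shows "\<exists>Z \<zeta>. ext_data Q \<beta> W \<beta>' W' A Z \<zeta>"
proof -
  obtain c Z \<zeta> where E: "int c = int \<kappa> - euler_form Q (\<lambda>v. int (\<beta> v)) (\<lambda>v. int (\<beta>' v))"
    "\<forall>k<c. corner_fam (arcs Q) (\<lambda>e. \<beta>' (head Q e)) (\<lambda>e. \<beta> (tail Q e)) (Z k)"
    "\<forall>h. corner_fam (verts Q) \<beta>' \<beta> h \<longrightarrow>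
       (\<forall>k<c. (\<Sum>e\<in>arcs Q. trc (\<zeta> k e * (h (head Q e) * W e - W' e * h (tail Q e)))) = 0)"
    "\<forall>k<c. \<forall>j<c. (\<Sum>e\<in>arcs Q. trc (\<zeta> k e * Z j e)) = (if k = j then 1 else 0)"
    "\<forall>Y. corner_fam (arcs Q) (\<lambda>e. \<beta>' (head Q e)) (\<lambda>e. \<beta> (tail Q e)) Y \<longrightarrow>
       (\<exists>h t. corner_fam (verts Q) \<beta>' \<beta> h \<and>
         (\<forall>e\<in>arcs Q. Y e = h (head Q e) * W e - W' e * h (tail Q e) + (\<Sum>k<c. t k *\<^sub>C Z k e)))"
    by (rule ext_basis[OF Q W W' hom])
  have "card A = c" using A(2) E(1) by simp
  then obtain r where r: "bij_betw r A {..<c}"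
    using ex_bij_betw_finite_nat[OF A(1)] by (auto simp: lessThan_atLeast0)
  have rc: "r a < c" if "a \<in> A" for a using bij_betwE[OF r] that by auto
  have ri: "r a = r b \<longleftrightarrow> a = b" if "a \<in> A" "b \<in> A" for a b
    using inj_on_eq_iff[OF bij_betw_imp_inj_on[OF r]] that by blast
  have "ext_data Q \<beta> W \<beta>' W' A (\<lambda>a. Z (r a)) (\<lambda>a. \<zeta> (r a))"
    unfolding ext_data_def
  proof (intro conjI ballI allI impI)
    fix a assume "a \<in> A"
    thus "corner_fam (arcs Q) (\<lambda>e. \<beta>' (head Q e)) (\<lambda>e. \<beta> (tail Q e)) (Z (r a))" using E(2) rc by blast
  next
    fix h a assume "corner_fam (verts Q) \<beta>' \<beta> h" "a \<in> A"
    thus "(\<Sum>e\<in>arcs Q. trc (\<zeta> (r a) e * (h (head Q e) * W e - W' e * h (tail Q e)))) = 0"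
      using E(3) rc by blast
  next
    fix a b assume ab: "a \<in> A" "b \<in> A"
    show "(\<Sum>e\<in>arcs Q. trc (\<zeta> (r a) e * Z (r b) e)) = (if a = b then 1 else 0)"
      using E(4)[rule_format, OF rc rc, OF ab] by (simp add: ri[OF ab])
  next
    fix Y assume "corner_fam (arcs Q) (\<lambda>e. \<beta>' (head Q e)) (\<lambda>e. \<beta> (tail Q e)) Y"
    then obtain h t where ht: "corner_fam (verts Q) \<beta>' \<beta> h"
      "\<forall>e\<in>arcs Q. Y e = h (head Q e) * W e - W' e * h (tail Q e) + (\<Sum>k<c. t k *\<^sub>C Z k e)"
      using E(5) by blast
    have "(\<Sum>k<c. t k *\<^sub>C Z k e) = (\<Sum>a\<in>A. t (r a) *\<^sub>C Z (r a) e)" for e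
      by (rule sum.reindex_bij_betw[OF r, symmetric])
    thus "\<exists>h t. corner_fam (verts Q) \<beta>' \<beta> h \<and>
         (\<forall>e\<in>arcs Q. Y e = h (head Q e) * W e - W' e * h (tail Q e) + (\<Sum>a\<in>A. t a *\<^sub>C Z (r a) e))"
      using ht by (intro exI[of _ h] exI[of _ "\<lambda>a. t (r a)"]) simp
  qed
  thus ?thesis by blast
qed

theorem theorem1p2:
  fixes Q :: "('v, 'e) pre_digraph" and \<alpha> :: "'v \<Rightarrow> nat" and \<theta> :: "'v \<Rightarrow> int"
    and \<xi> :: "nat \<Rightarrow> ('e rep \<Rightarrow> complex) set"
    and l :: nat and m :: "nat \<Rightarrow> nat" and \<beta> :: "nat \<Rightarrow> 'v \<Rightarrow> nat" and W :: "nat \<Rightarrow> 'e rep"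
    and Q' :: "(nat, 'f) pre_digraph"
  assumes "fin_digraph Q"
    and "\<not> (\<exists>p. pre_digraph.cycle Q p)"
    and "\<xi> \<in> moduli_space Q \<alpha> \<theta>"
    and "\<And>i. i < l \<Longrightarrow> W i \<in> rep_space Q (\<beta> i)"
    and "\<And>i. i < l \<Longrightarrow> theta_stable Q \<theta> (\<beta> i) (W i)"
    and "\<And>i j. i < l \<Longrightarrow> j < l \<Longrightarrow> i \<noteq> j \<Longrightarrow> \<not> rep_iso Q (\<beta> i) (W i) (\<beta> j) (W j)"
    and "\<And>i. i < l \<Longrightarrow> m i \<ge> 1"
    and "\<And>v. v \<in> verts Q \<Longrightarrow> \<alpha> v = (\<Sum>i<l. m i * \<beta> i v)"
    and "\<xi> = moduli_point Q \<alpha> \<theta> (rep_direct_sum Q l m W)"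
    and "fin_digraph Q'"
    and "verts Q' = {..<l}"
    and "\<And>i j. i < l \<Longrightarrow> j < l \<Longrightarrow> int (arrow_count Q' i j) =
           (if i = j then 1 else 0) - euler_form Q (\<lambda>v. int (\<beta> i v)) (\<lambda>v. int (\<beta> j v))"
  shows "(\<exists>V \<in> rep_space Q \<alpha>. theta_stable Q \<theta> \<alpha> V) \<longleftrightarrow>
         (\<exists>V' \<in> rep_space Q' m. simple_rep Q' m V')"
proof -
  interpret Q: fin_digraph Q by (rule assms(1))
  interpret Q': fin_digraph Q' by (rule assms(10))
  have wf: "wf_digraph Q" and wf': "wf_digraph Q'" by unfold_locales
  define w where "w i e = fm (W i e)" for i e
  have w: "fm_rep Q (\<lambda>v. idm (\<beta> i v)) (w i)" if "i < l" for i
    using fm_rep_fm[OF assms(4)[OF that]] by (simp add: w_def[abs_def])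
  have st: "fm_stable Q \<theta> (\<lambda>v. idm (\<beta> i v)) (w i)" if "i < l" for i
    using theta_stable_iff[OF assms(4)[OF that] wf] assms(5)[OF that] by (simp add: w_def[abs_def])
  have homw: "\<forall>v\<in>verts Q. f v = 0"
    if ij: "i < l" "j < l" "i \<noteq> j" and f: "fm_hom Q (\<lambda>v. idm (\<beta> i v)) (w i) (\<lambda>v. idm (\<beta> j v)) (w j) f" for i j f
  proof (rule ccontr)
    assume "\<not> (\<forall>v\<in>verts Q. f v = 0)"
    hence nz: "\<exists>v\<in>verts Q. f v \<noteq> 0" by blast
    obtain g where g: "fm_hom Q (\<lambda>v. idm (\<beta> j v)) (w j) (\<lambda>v. idm (\<beta> i v)) (w i) g"
        "\<forall>v\<in>verts Q. g v * f v = idm (\<beta> i v) \<and> f v * g v = idm (\<beta> j v)"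
      by (rule schur_iso[OF wf w[OF ij(1)] w[OF ij(2)] f st[OF ij(1)] st[OF ij(2)] nz])
    have "rep_iso Q (\<beta> i) (W i) (\<beta> j) (W j)"
      by (rule rep_iso_fm[OF assms(4)[OF ij(1)] assms(4)[OF ij(2)] wf _ _ g(2)])
        (use f g(1) in \<open>simp_all add: w_def[abs_def]\<close>)
    thus False using assms(6)[OF ij] by simp
  qed
  define B where "B i j = {a \<in> arcs Q'. tail Q' a = i \<and> head Q' a = j}" for i j
  have "\<exists>Z \<zeta>. ext_data Q (\<beta> i) (w i) (\<beta> j) (w j) (B i j) Z \<zeta>" if ij: "i < l" "j < l" for i j
  proof (rule ext_data_exists[OF assms(1) w[OF ij(1)] w[OF ij(2)], of "if i = j then 1 else 0"])
    show "finite (B i j)" by (simp add: B_def)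
    show "int (card (B i j)) = int (if i = j then 1 else 0) - euler_form Q (\<lambda>v. int (\<beta> i v)) (\<lambda>v. int (\<beta> j v))"
      using assms(12)[OF ij] by (simp add: B_def arrow_count_def)
    show "((if i = j then 1 else 0) = (0::nat) \<and>
          (\<forall>h. fm_hom Q (\<lambda>v. idm (\<beta> i v)) (w i) (\<lambda>v. idm (\<beta> j v)) (w j) h \<longrightarrow> (\<forall>v\<in>verts Q. h v = 0))) \<or>
      ((if i = j then 1 else 0) = (1::nat) \<and> (\<exists>h0. fm_hom Q (\<lambda>v. idm (\<beta> i v)) (w i) (\<lambda>v. idm (\<beta> j v)) (w j) h0 \<and>
          (\<exists>v\<in>verts Q. h0 v \<noteq> 0) \<and>
          (\<forall>h. fm_hom Q (\<lambda>v. idm (\<beta> i v)) (w i) (\<lambda>v. idm (\<beta> j v)) (w j) h \<longrightarrow>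
            (\<exists>c. \<forall>v\<in>verts Q. h v = c *\<^sub>C h0 v))))"
    proof (cases "i = j")
      case False
      thus ?thesis using homw[OF ij] by simp
    next
      case True
      have 1: "fm_hom Q (\<lambda>v. idm (\<beta> i v)) (w i) (\<lambda>v. idm (\<beta> i v)) (w i) (\<lambda>v. idm (\<beta> i v))"
        using w[OF ij(1)] by (simp add: fm_hom_def fm_rep_def)
      have 2: "\<exists>v\<in>verts Q. idm (\<beta> i v) \<noteq> 0" using st[OF ij(1)] by (simp add: fm_stable_def)
      have 3: "\<exists>c. \<forall>v\<in>verts Q. h v = c *\<^sub>C idm (\<beta> i v)"
        if h: "fm_hom Q (\<lambda>v. idm (\<beta> i v)) (w i) (\<lambda>v. idm (\<beta> i v)) (w i) h" for h
        by (rule schur_scalar[OF wf w[OF ij(1)] st[OF ij(1)] h]) blast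
      show ?thesis unfolding True[symmetric] if_P[OF refl]
        by (intro disjI2 conjI refl exI[of _ "\<lambda>v. idm (\<beta> i v)"] 1 2 allI impI 3)
    qed
  qed
  hence "\<forall>i j. \<exists>Z \<zeta>. i < l \<longrightarrow> j < l \<longrightarrow> ext_data Q (\<beta> i) (w i) (\<beta> j) (w j) (B i j) Z \<zeta>" by blast
  then obtain Z0 \<zeta>0 where "\<forall>i j. i < l \<longrightarrow> j < l \<longrightarrow>
      ext_data Q (\<beta> i) (w i) (\<beta> j) (w j) (B i j) (Z0 i j) (\<zeta>0 i j)"
    by (metis (no_types))
  hence D: "ext_data Q (\<beta> i) (w i) (\<beta> j) (w j) (B i j) (Z0 i j) (\<zeta>0 i j)" if "i < l" "j < l" for i j
    using that by blast
  define Z where "Z a = Z0 (tail Q' a) (head Q' a) a" for a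
  define \<zeta> where "\<zeta> a = \<zeta>0 (tail Q' a) (head Q' a) a" for a
  have ends: "tail Q' a < l" "head Q' a < l" "a \<in> B (tail Q' a) (head Q' a)" if "a \<in> arcs Q'" for a
    using wf_ends[OF wf' that] that by (auto simp: assms(11) B_def)
  have "\<exists>s s'. v \<in> verts Q \<longrightarrow>
    (\<forall>i<l. \<forall>k<m i. idm (\<alpha> v) * s (i, k) = s (i, k) \<and> s (i, k) * idm (\<beta> i v) = s (i, k) \<and>
      idm (\<beta> i v) * s' (i, k) = s' (i, k) \<and> s' (i, k) * idm (\<alpha> v) = s' (i, k)) \<and>
    (\<forall>i<l. \<forall>k<m i. \<forall>j<l. \<forall>k'<m j. s' (i, k) * s (j, k') = (if i = j \<and> k = k' then idm (\<beta> i v) else 0)) \<and>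
    (\<Sum>i<l. \<Sum>k<m i. s (i, k) * s' (i, k)) = idm (\<alpha> v)" for v
  proof (cases "v \<in> verts Q")
    case True
    show ?thesis by (rule block_coordinates[OF assms(8)[OF True]]) blast
  qed simp
  hence "\<forall>v. \<exists>S. v \<in> verts Q \<longrightarrow>
    (\<forall>i<l. \<forall>k<m i. idm (\<alpha> v) * fst S (i, k) = fst S (i, k) \<and> fst S (i, k) * idm (\<beta> i v) = fst S (i, k) \<and>
      idm (\<beta> i v) * snd S (i, k) = snd S (i, k) \<and> snd S (i, k) * idm (\<alpha> v) = snd S (i, k)) \<and>
    (\<forall>i<l. \<forall>k<m i. \<forall>j<l. \<forall>k'<m j. snd S (i, k) * fst S (j, k') = (if i = j \<and> k = k' then idm (\<beta> i v) else 0)) \<and>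
    (\<Sum>i<l. \<Sum>k<m i. fst S (i, k) * snd S (i, k)) = idm (\<alpha> v)"
    by (simp only: split_paired_Ex fst_conv snd_conv) blast
  from choice[OF this] obtain S where S: "\<forall>v\<in>verts Q.
    (\<forall>i<l. \<forall>k<m i. idm (\<alpha> v) * fst (S v) (i, k) = fst (S v) (i, k) \<and>
      fst (S v) (i, k) * idm (\<beta> i v) = fst (S v) (i, k) \<and>
      idm (\<beta> i v) * snd (S v) (i, k) = snd (S v) (i, k) \<and> snd (S v) (i, k) * idm (\<alpha> v) = snd (S v) (i, k)) \<and>
    (\<forall>i<l. \<forall>k<m i. \<forall>j<l. \<forall>k'<m j. snd (S v) (i, k) * fst (S v) (j, k') =
      (if i = j \<and> k = k' then idm (\<beta> i v) else 0)) \<and>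
    (\<Sum>i<l. \<Sum>k<m i. fst (S v) (i, k) * snd (S v) (i, k)) = idm (\<alpha> v)" by blast
  define s where "s p v = fst (S v) p" for p v
  define s' where "s' p v = snd (S v) p" for p v
  have "local_quiver Q \<theta> \<alpha> l m \<beta> w Q' Z \<zeta> s s'"
  proof (rule local_quiver.intro)
    show "fin_digraph Q" "fin_digraph Q'" "verts Q' = {..<l}" by (rule assms)+
  next
    fix i assume "i < l"
    thus "fm_rep Q (\<lambda>v. idm (\<beta> i v)) (w i)" "fm_stable Q \<theta> (\<lambda>v. idm (\<beta> i v)) (w i)" by (rule w, rule st)
  next
    fix i j f v assume "i < l" "j < l" "i \<noteq> j"
      "fm_hom Q (\<lambda>v. idm (\<beta> i v)) (w i) (\<lambda>v. idm (\<beta> j v)) (w j) f" "v \<in> verts Q"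
    thus "f v = 0" using homw by blast
  next
    fix a assume a: "a \<in> arcs Q'"
    show "corner_fam (arcs Q) (\<lambda>e. \<beta> (head Q' a) (head Q e)) (\<lambda>e. \<beta> (tail Q' a) (tail Q e)) (Z a)"
      using D[OF ends(1,2)[OF a]] ends(3)[OF a] unfolding ext_data_def Z_def by blast
    fix h assume "corner_fam (verts Q) (\<beta> (head Q' a)) (\<beta> (tail Q' a)) h"
    thus "(\<Sum>e\<in>arcs Q. trc (\<zeta> a e * (h (head Q e) * w (tail Q' a) e - w (head Q' a) e * h (tail Q e)))) = 0"
      using D[OF ends(1,2)[OF a]] ends(3)[OF a] unfolding ext_data_def \<zeta>_def by blast
  next
    fix a b assume a: "a \<in> arcs Q'" and b: "b \<in> arcs Q'" and ab: "head Q' a = head Q' b" "tail Q' a = tail Q' b"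
    show "(\<Sum>e\<in>arcs Q. trc (\<zeta> a e * Z b e)) = (if a = b then 1 else 0)"
      using D[OF ends(1,2)[OF a]] ends(3)[OF a] ends(3)[OF b] unfolding ext_data_def \<zeta>_def Z_def ab by blast
  next
    fix i j Y assume ij: "i < l" "j < l" "corner_fam (arcs Q) (\<lambda>e. \<beta> j (head Q e)) (\<lambda>e. \<beta> i (tail Q e)) Y"
    have "\<exists>h t. corner_fam (verts Q) (\<beta> j) (\<beta> i) h \<and>
        (\<forall>e\<in>arcs Q. Y e = h (head Q e) * w i e - w j e * h (tail Q e) + (\<Sum>a\<in>B i j. t a *\<^sub>C Z0 i j a e))"
      using D[OF ij(1,2)] ij(3) unfolding ext_data_def by blast
    moreover have "(\<Sum>a\<in>B i j. t a *\<^sub>C Z0 i j a e) = (\<Sum>a\<in>{a\<in>arcs Q'. tail Q' a = i \<and> head Q' a = j}. t a *\<^sub>C Z a e)" for t e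
      by (rule sum.cong) (auto simp: B_def Z_def)
    ultimately show "\<exists>h t. corner_fam (verts Q) (\<beta> j) (\<beta> i) h \<and>
        (\<forall>e\<in>arcs Q. Y e = h (head Q e) * w i e - w j e * h (tail Q e) +
          (\<Sum>a\<in>{a\<in>arcs Q'. tail Q' a = i \<and> head Q' a = j}. t a *\<^sub>C Z a e))" by simp
  next
    fix i k v assume "i < l" "k < m i" "v \<in> verts Q"
    thus "idm (\<alpha> v) * s (i, k) v = s (i, k) v \<and> s (i, k) v * idm (\<beta> i v) = s (i, k) v"
      "idm (\<beta> i v) * s' (i, k) v = s' (i, k) v \<and> s' (i, k) v * idm (\<alpha> v) = s' (i, k) v"
      using S unfolding s_def s'_def by blast+
  next
    fix i k j k' v assume "i < l" "k < m i" "j < l" "k' < m j" "v \<in> verts Q"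
    thus "s' (i, k) v * s (j, k') v = (if i = j \<and> k = k' then idm (\<beta> i v) else 0)"
      using S unfolding s_def s'_def by blast
  next
    fix v assume "v \<in> verts Q"
    thus "(\<Sum>i<l. \<Sum>k<m i. s (i, k) v * s' (i, k) v) = idm (\<alpha> v)" using S unfolding s_def s'_def by blast
  qed
  then interpret L: local_quiver Q \<theta> \<alpha> l m \<beta> w Q' Z \<zeta> s s' .
  show ?thesis
    unfolding simple_rep_iff_theta_stable ex_theta_stable_iff[OF wf] ex_theta_stable_iff[OF wf']
    using L.stable_iff_simple .
qed

end
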